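(* Let $n\ge 1$, let $\varphi:\mathbb{C}^n\to\mathbb{R}^+$ be a plurisubharmonic $\mathcal{C}^2$ weight function with Levi matrix $M_\varphi=\left(\frac{\partial^2\varphi}{\partial z_j\partial\overline z_k}\right)_{jk}$, and let $1\le q\le n$. For $z\in\mathbb{C}^n$ let $s_q(z)$ denote the sum of the $q$ smallest eigenvalues (counted with multiplicity) of the Hermitian matrix $M_\varphi(z)$. Suppose that $$\liminf_{|z|\to\infty}s_q(z)>0.$$ Then there exists a uniquely determined bounded linear operator $$N_{\varphi,q}:L^2_{(0,q)}(\mathbb{C}^n,\varphi)\longrightarrow L^2_{(0,q)}(\mathbb{C}^n,\varphi)$$ such that $\square_\varphi\circ N_{\varphi,q}\,u=u$ for every $u\in L^2_{(0,q)}(\mathbb{C}^n,\varphi)$.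
   Context: $L^2(\mathbb{C}^n,\varphi)$ is the space of measurable $f:\mathbb{C}^n\to\mathbb{C}$ with $\int_{\mathbb{C}^n}|f|^2e^{-\varphi}\,d\lambda<\infty$ ($\lambda$ is Lebesgue measure), with inner product $(f,g)_\varphi=\int_{\mathbb{C}^n}f\,\overline g\,e^{-\varphi}\,d\lambda$ and norm $\|f\|_\varphi$. $L^2_{(0,q)}(\mathbb{C}^n,\varphi)$ is the space of $(0,q)$-forms $u=\sum'_{|J|=q}u_J\,d\overline z_J$ with coefficients $u_J\in L^2(\mathbb{C}^n,\varphi)$, with the inner product obtained by summing over the coefficients; the prime means summation over strictly increasing multi-indices. The weighted $\overline\partial$-complex is formed by the operators $\overline\partial:L^2_{(0,q)}(\mathbb{C}^n,\varphi)\to L^2_{(0,q+1)}(\mathbb{C}^n,\varphi)$, given on forms with $\mathcal{C}_0^\infty$ coefficients by $\overline\partial u=\sum'_{|J|=q}\sum_{j=1}^n\frac{\partial u_J}{\partial\overline z_j}\,d\overline z_j\wedge d\overline z_J$ and in general taken in the sense of distributions on the domain of those $u\in L^2_{(0,q)}(\mathbb{C}^n,\varphi)$ with $\overline\partial u\in L^2_{(0,q+1)}(\mathbb{C}^n,\varphi)$, and by their Hilbert space adjoints $\overline\partial_\varphi^*$ with respect to $(\cdot,\cdot)_\varphi$. On forms with $\mathcal{C}_0^\infty$ coefficients, $\overline\partial_\varphi^*u=-\sum'_{|K|=q-1}\sum_{k=1}^n\delta_k u_{kK}\,d\overline z_K$ with $\delta_k=\frac{\partial}{\partial z_k}-\frac{\partial\varphi}{\partial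 z_k}$, where $u_{kK}$ is extended antisymmetrically in its indices. The complex Laplacian on $(0,q)$-forms is $\square_\varphi=\overline\partial\,\overline\partial_\varphi^*+\overline\partial_\varphi^*\,\overline\partial$, understood as the maximal closure of the operator initially defined on forms with $\mathcal{C}_0^\infty$ coefficients. It is a positive selfadjoint operator on $L^2_{(0,q)}(\mathbb{C}^n,\varphi)$ whose associated Dirichlet form is $Q_\varphi(f,g)=(\overline\partial f,\overline\partial g)_\varphi+(\overline\partial_\varphi^*f,\overline\partial_\varphi^*g)_\varphi$ for $f,g\in\mathrm{dom}(\overline\partial)\cap\mathrm{dom}(\overline\partial_\varphi^* )$. *)

theory Defs
  imports "HOL-Analysis.Analysis" "HOL-Computational_Algebra.Computational_Algebra"
begin

text \<open>
  Complex n-space is \<^typ>\<open>complex ^ 'n\<close> with \<^typ>\<open>'n\<close> finite and linearly ordered, so that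
  n = \<open>CARD('n) \<ge> 1\<close>.  The order on the index type is needed for strictly increasing multi-indices.
\<close>

section \<open>Smoothness and Wirtinger derivatives\<close>

text \<open>Real differentiability of class \<open>C\<^sup>k\<close> on the whole space.\<close>

fun Ck :: "nat \<Rightarrow> ('a::euclidean_space \<Rightarrow> 'b::real_normed_vector) \<Rightarrow> bool" where
  "Ck 0 f \<longleftrightarrow> continuous_on UNIV f"
| "Ck (Suc k) f \<longleftrightarrow> f differentiable_on UNIV \<and>
     (\<forall>b\<in>Basis. Ck k (\<lambda>x. frechet_derivative f (at x) b))"

definition test_fun :: "(complex ^ 'n \<Rightarrow> complex) \<Rightarrow> bool" where
  "test_fun f \<longleftrightarrow> (\<forall>k. Ck k f) \<and> compact (closure {z. f z \<noteq> 0})"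

text \<open>\<open>axis j 1\<close> and \<open>axis j \<i>\<close> are the directions of the real coordinates \<open>x\<^sub>j\<close> and \<open>y\<^sub>j\<close>.\<close>

definition d_z :: "'n \<Rightarrow> (complex ^ 'n \<Rightarrow> complex) \<Rightarrow> complex ^ 'n \<Rightarrow> complex" where
  "d_z j f z = (frechet_derivative f (at z) (axis j 1)
                 - \<i> * frechet_derivative f (at z) (axis j \<i>)) / 2"

definition d_zbar :: "'n \<Rightarrow> (complex ^ 'n \<Rightarrow> complex) \<Rightarrow> complex ^ 'n \<Rightarrow> complex" where
  "d_zbar j f z = (frechet_derivative f (at z) (axis j 1)
                    + \<i> * frechet_derivative f (at z) (axis j \<i>)) / 2"


section \<open>Plurisubharmonicity and the Levi matrix\<close>

text \<open>
  Finite-valued plurisubharmonic functions: upper semicontinuous, with the sub-mean value property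
  on every circle in every complex line (the radius is absorbed into \<open>w\<close>).  For an upper
  semicontinuous real-valued function the mean value exists in \<open>[-\<infinity>, \<infinity>)\<close>; the inequality rules out
  \<open>-\<infinity>\<close>, which is why integrability is part of the condition.
\<close>

definition plurisubharmonic :: "(complex ^ 'n \<Rightarrow> real) \<Rightarrow> bool" where
  "plurisubharmonic \<phi> \<longleftrightarrow>
     (\<forall>c. open {z. \<phi> z < c}) \<and>
     (\<forall>z w. (\<lambda>t. \<phi> (z + cis t *s w)) absolutely_integrable_on {0..2*pi} \<and>
            \<phi> z \<le> integral {0..2*pi} (\<lambda>t. \<phi> (z + cis t *s w)) / (2*pi))"

definition levi_matrix :: "(complex ^ 'n \<Rightarrow> real) \<Rightarrow> complex ^ 'n \<Rightarrow> complex ^ 'n ^ 'n" where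
  "levi_matrix \<phi> z = (\<chi> j k. d_z j (d_zbar k (\<lambda>w. complex_of_real (\<phi> w))) z)"

definition charpoly :: "complex ^ 'n ^ 'n \<Rightarrow> complex poly" where
  "charpoly A = det (\<chi> i j. (if i = j then [:0, 1:] else 0) - [:A $ i $ j:])"

text \<open>Eigenvalues of a matrix, repeated according to multiplicity.\<close>

definition eigenvalues :: "complex ^ 'n ^ 'n \<Rightarrow> complex multiset" where
  "eigenvalues A = proots (charpoly A)"

text \<open>Meant for Hermitian matrices, whose eigenvalues are real, so that \<open>Re\<close> loses nothing.\<close>

definition sum_smallest_eigenvalues :: "nat \<Rightarrow> complex ^ 'n ^ 'n \<Rightarrow> real" where
  "sum_smallest_eigenvalues q A =
     sum_list (take q (sorted_list_of_multiset (image_mset Re (eigenvalues A))))"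


section \<open>Weighted spaces of forms\<close>

definition L2_weight :: "(complex ^ 'n::finite \<Rightarrow> real) \<Rightarrow> (complex ^ 'n \<Rightarrow> complex) set" where
  "L2_weight \<phi> = {f. f \<in> borel_measurable lebesgue \<and>
                      integrable lebesgue (\<lambda>z. (cmod (f z))\<^sup>2 * exp (- \<phi> z))}"

text \<open>
  A (0,q)-form is represented by its coefficient functions.  The strictly increasing multi-index
  \<open>j\<^sub>1 < \<dots> < j\<^sub>q\<close> is encoded by the set \<open>{j\<^sub>1, \<dots>, j\<^sub>q}\<close>; only the coefficients at sets of
  cardinality q are meaningful, all others are ignored.  Elements of the Hilbert spaces are
  represented by functions, with \<open>form_eq\<close> as the equality of the Hilbert space.
\<close>

type_synonym 'n form = "'n set \<Rightarrow> complex ^ 'n \<Rightarrow> complex"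

definition L2_forms :: "(complex ^ 'n::finite \<Rightarrow> real) \<Rightarrow> nat \<Rightarrow> 'n form set" where
  "L2_forms \<phi> q = {u. \<forall>J. card J = q \<longrightarrow> u J \<in> L2_weight \<phi>}"

definition form_eq :: "nat \<Rightarrow> 'n::finite form \<Rightarrow> 'n form \<Rightarrow> bool" where
  "form_eq q u v \<longleftrightarrow> (\<forall>J. card J = q \<longrightarrow> (AE z in lebesgue. u J z = v J z))"

definition form_add :: "'n::finite form \<Rightarrow> 'n form \<Rightarrow> 'n form" where
  "form_add u v = (\<lambda>J z. u J z + v J z)"

definition form_scale :: "complex \<Rightarrow> 'n::finite form \<Rightarrow> 'n form" where
  "form_scale c u = (\<lambda>J z. c * u J z)"

definition form_inner :: "(complex ^ 'n::finite \<Rightarrow> real) \<Rightarrow> nat \<Rightarrow> 'n form \<Rightarrow> 'n form \<Rightarrow> complex" where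
  "form_inner \<phi> q u v =
     (\<Sum>J | card J = q. (LINT z|lebesgue. u J z * cnj (v J z) * complex_of_real (exp (- \<phi> z))))"

definition form_norm :: "(complex ^ 'n::finite \<Rightarrow> real) \<Rightarrow> nat \<Rightarrow> 'n form \<Rightarrow> real" where
  "form_norm \<phi> q u = sqrt (Re (form_inner \<phi> q u u))"

text \<open>Bounded linear operators on the space of (0,q)-forms, acting on almost-everywhere classes.\<close>

definition bounded_operator ::
  "(complex ^ 'n::finite \<Rightarrow> real) \<Rightarrow> nat \<Rightarrow> ('n form \<Rightarrow> 'n form) \<Rightarrow> bool" where
  "bounded_operator \<phi> q N \<longleftrightarrow>
     (\<forall>u\<in>L2_forms \<phi> q. N u \<in> L2_forms \<phi> q) \<and>
     (\<forall>u\<in>L2_forms \<phi> q. \<forall>v\<in>L2_forms \<phi> q. form_eq q u v \<longrightarrow> form_eq q (N u) (N v)) \<and>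
     (\<forall>u\<in>L2_forms \<phi> q. \<forall>v\<in>L2_forms \<phi> q.
        form_eq q (N (form_add u v)) (form_add (N u) (N v))) \<and>
     (\<forall>c. \<forall>u\<in>L2_forms \<phi> q. form_eq q (N (form_scale c u)) (form_scale c (N u))) \<and>
     (\<exists>C. \<forall>u\<in>L2_forms \<phi> q. form_norm \<phi> q (N u) \<le> C * form_norm \<phi> q u)"


section \<open>The weighted dbar-complex and the complex Laplacian\<close>

text \<open>
  The coefficient of \<open>d\<zeta>\<^sub>K\<close>, \<open>K = insert j J\<close>, in \<open>d\<zeta>\<^sub>j \<and> d\<zeta>\<^sub>J\<close> for \<open>j \<notin> J\<close>, where
  \<open>\<zeta>\<close> is the conjugate of \<open>z\<close>: moving \<open>d\<zeta>\<^sub>j\<close> into place passes the factors with smaller index.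
\<close>

definition wedge_sign :: "'n::linorder \<Rightarrow> 'n set \<Rightarrow> complex" where
  "wedge_sign j J = (- 1) ^ card {i \<in> J. i < j}"

text \<open>
  The unbounded operators are given by their graphs, as relations invariant under almost-everywhere
  equality.  \<open>is_dbar \<phi> q u v\<close>: u lies in the domain of dbar on (0,q)-forms and dbar u = v,
  where the coefficient of dbar u at K, namely the sum over j in K of
  \<open>wedge_sign j (K - {j})\<close> times \<open>d_zbar j (u (K - {j}))\<close>, is taken in the sense of
  distributions.
\<close>

definition is_dbar ::
  "(complex ^ 'n::{finite,linorder} \<Rightarrow> real) \<Rightarrow> nat \<Rightarrow> 'n form \<Rightarrow> 'n form \<Rightarrow> bool" where
  "is_dbar \<phi> q u v \<longleftrightarrow>
     u \<in> L2_forms \<phi> q \<and> v \<in> L2_forms \<phi> (Suc q) \<and>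
     (\<forall>K \<eta>. card K = Suc q \<and> test_fun \<eta> \<longrightarrow>
        (LINT z|lebesgue. v K z * \<eta> z) =
        - (\<Sum>j\<in>K. wedge_sign j (K - {j}) * (LINT z|lebesgue. u (K - {j}) z * d_zbar j \<eta> z)))"

text \<open>
  The Hilbert space adjoint of dbar from (0,q)-forms to (0,q+1)-forms: v is a (0,q+1)-form in the
  domain of the adjoint and w is its image, a (0,q)-form.
\<close>

definition is_dbar_adj ::
  "(complex ^ 'n::{finite,linorder} \<Rightarrow> real) \<Rightarrow> nat \<Rightarrow> 'n form \<Rightarrow> 'n form \<Rightarrow> bool" where
  "is_dbar_adj \<phi> q v w \<longleftrightarrow>
     v \<in> L2_forms \<phi> (Suc q) \<and> w \<in> L2_forms \<phi> q \<and>
     (\<forall>u u'. is_dbar \<phi> q u u' \<longrightarrow> form_inner \<phi> (Suc q) u' v = form_inner \<phi> q u w)"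

text \<open>
  The complex Laplacian on (0,q)-forms, for \<open>q \<ge> 1\<close>, as the sum of the two compositions of
  unbounded operators on its natural domain: u and g are related iff u lies in the domains of
  dbar and its adjoint, dbar u = v and the adjoint image w of u lie in the domains of the adjoint
  and of dbar respectively, and g is the sum of their images.  This is the selfadjoint operator of
  the Dirichlet form Q, and being selfadjoint it is a maximal closed symmetric extension of the
  operator on forms with test function coefficients.
\<close>

definition is_laplacian ::
  "(complex ^ 'n::{finite,linorder} \<Rightarrow> real) \<Rightarrow> nat \<Rightarrow> 'n form \<Rightarrow> 'n form \<Rightarrow> bool" where
  "is_laplacian \<phi> q u g \<longleftrightarrow>
     (\<exists>v w a b. is_dbar_adj \<phi> (q - 1) u w \<and> is_dbar \<phi> (q - 1) w a \<and>
                is_dbar \<phi> q u v \<and> is_dbar_adj \<phi> q v b \<and>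
                form_eq q g (form_add a b))"

end

theory Submission
  imports Defs
begin

text \<open>
  In degree \<open>q\<close> the weighted complex is a pair of closed operators \<open>T\<close> and \<open>S\<close>, namely dbar into and out
  of the \<open>(0,q)\<close>-forms, with \<open>S T = 0\<close>, and the complex Laplacian is \<open>T T\<^sup>* + S\<^sup>* S\<close>.  For such a pair everything
  follows from one estimate, \<open>\<parallel>x\<parallel>\<^sup>2 \<le> C (\<parallel>S x\<parallel>\<^sup>2 + \<parallel>T\<^sup>* x\<parallel>\<^sup>2)\<close> on the intersection of the domains.  Pairing the
  equation with its solution turns the estimate into injectivity and a bound (\<open>laplace_rel_bound\<close>), and
  Riesz' representation theorem turns it into solvability (\<open>laplace_rel_solvable\<close>).

  For twice continuously differentiable forms with compact support the estimate comes from the formula of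
  Kohn and Morrey (\<open>Kohn_Morrey\<close>),
  \<open>\<parallel>S u\<parallel>\<^sup>2 + \<parallel>T\<^sup>* u\<parallel>\<^sup>2 = \<Sum>\<^sub>j \<parallel>d_zbar j u\<parallel>\<^sup>2 + \<integral> L(u) e\<^bsup>-\<phi>\<^esup>\<close>,
  where \<open>L\<close> is the Levi form of \<open>\<phi>\<close> acting on forms.  At each point \<open>L(u)\<close> is nonnegative, because \<open>\<phi>\<close> is
  plurisubharmonic (\<open>plurisubharmonic_levi_nonneg\<close>), and at least the sum of the \<open>q\<close> smallest eigenvalues
  times \<open>\<bar>u\<bar>\<^sup>2\<close> (\<open>levi_form_lower_bound\<close>).  By the hypothesis at infinity the second bound controls \<open>u\<close> outside
  a ball.  On the ball \<open>u\<close> is controlled by a single derivative \<open>d_zbar j u\<close>, by means of a cut-off and a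
  Poincare inequality for functions with compact support (\<open>dbar_Poincare\<close>).  The result is \<open>basic_estimate\<close>.

  The estimate extends to the domains of the weakly defined operators (\<open>weak_estimate\<close>): first the form is cut
  off, then it is mollified.  Cutting off is harmless because the space is complete: there are cut-off functions
  that are equal to one on arbitrarily large balls and have bounded derivatives.  Mollification is harmless because
  dbar has constant coefficients, and its adjoint has variable coefficients only in the term of order zero.

  Hilbert space elements are classes of functions in the real Hilbert space \<open>L2\<close>, with the weight absorbed by the
  factor \<open>e\<^bsup>-\<phi>/2\<^esup>\<close>.  The operators become closed linear relations there (\<open>dbar_rel\<close>), and the Laplacian of the
  abstract theorems becomes the complex Laplacian on forms (\<open>is_laplacian_iff\<close>).
\<close>

section \<open>Closed linear relations between Hilbert spaces\<close>

text \<open>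
  The first variation at a minimum: for small \<open>t\<close> the linear term would dominate the quadratic one.
\<close>

lemma quadratic_nonneg_linear_zero:
  fixes a b :: real
  assumes "\<And>t. 0 \<le> t\<^sup>2 * a + 2 * t * b" and "0 \<le> a"
  shows "b = 0"
proof (rule ccontr)
  assume b: "b \<noteq> 0"
  have a: "a + 1 > 0" using assms(2) by simp
  \<comment> \<open>the minimiser with \<open>a + 1\<close> in place of \<open>a\<close>, which may vanish\<close>
  define t where "t = - b / (a + 1)"
  have t: "t \<noteq> 0" and bt: "b = - t * (a + 1)" using a b by (auto simp: t_def)
  have "0 \<le> t\<^sup>2 * a + 2 * t * b" by (rule assms(1))
  also have "\<dots> = t\<^sup>2 * (- a - 2)" by (simp add: bt algebra_simps power2_eq_square)
  also have "\<dots> < 0"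
    using t assms(2) by (intro mult_pos_neg) auto
  finally show False by simp
qed

text \<open>
  The representing vector minimises \<open>\<parallel>m\<parallel>\<^sup>2 - 2 f m\<close> over \<open>M\<close>.  By the parallelogram law minimising sequences are
  Cauchy, and the first variation at the minimum is the representation.  The functional is assumed to be
  linear and bounded on \<open>M\<close> alone, because it will be known only there.
\<close>

lemma riesz_subspace:
  fixes M :: "'a::{real_inner,complete_space} set" and f :: "'a \<Rightarrow> real"
  assumes M: "subspace M" "closed M"
    and add: "\<And>x y. x \<in> M \<Longrightarrow> y \<in> M \<Longrightarrow> f (x + y) = f x + f y"
    and scale: "\<And>c x. x \<in> M \<Longrightarrow> f (c *\<^sub>R x) = c * f x"
    and bd: "\<And>x. x \<in> M \<Longrightarrow> \<bar>f x\<bar> \<le> C * norm x"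
  shows "\<exists>m\<in>M. \<forall>x\<in>M. f x = x \<bullet> m"
proof -
  define g where "g m = (norm m)\<^sup>2 - 2 * f m" for m
  have f0: "f 0 = 0" using scale[of 0 0] M(1) by (simp add: subspace_0)
  have g_low: "g m \<ge> - C\<^sup>2" if "m \<in> M" for m
  proof -
    have "0 \<le> (norm m - C)\<^sup>2" by simp
    then show ?thesis using bd[OF that] unfolding g_def
      by (auto simp: power2_eq_square algebra_simps abs_le_iff)
  qed
  define I where "I = Inf (g ` M)"
  have bdd: "bdd_below (g ` M)" using g_low by (auto intro!: bdd_belowI)
  have ne: "g ` M \<noteq> {}" using M(1) subspace_0 by auto
  have I_le: "I \<le> g m" if "m \<in> M" for m
    unfolding I_def using bdd that by (auto intro: cInf_lower)
  have "\<exists>m\<in>M. g m < I + 1 / real (Suc n)" for n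
  proof -
    have "Inf (g ` M) < I + 1 / real (Suc n)" unfolding I_def by simp
    then obtain y where "y \<in> g ` M" "y < I + 1 / real (Suc n)"
      using cInf_less_iff[OF ne bdd] by blast
    then show ?thesis by auto
  qed
  then obtain X where X: "\<And>n. X n \<in> M" "\<And>n. g (X n) < I + 1 / real (Suc n)" by metis
  have par: "(norm (x - y))\<^sup>2 \<le> 2 * (g x - I) + 2 * (g y - I)" if "x \<in> M" "y \<in> M" for x y
  proof -
    have h: "(1/2) *\<^sub>R (x + y) \<in> M" using that M(1) by (simp add: subspace_add subspace_mul)
    have "f ((1/2) *\<^sub>R (x + y)) = (f x + f y) / 2"
      using scale[of "x + y" "1/2"] add[OF that] M(1) that by (simp add: subspace_add)
    moreover have "(norm ((1/2) *\<^sub>R (x + y)))\<^sup>2 = (norm (x + y))\<^sup>2 / 4"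
      by (simp add: power2_eq_square)
    ultimately have "g ((1/2) *\<^sub>R (x + y)) = (norm (x + y))\<^sup>2 / 4 - (f x + f y)"
      by (simp add: g_def)
    moreover have "(norm (x - y))\<^sup>2 + (norm (x + y))\<^sup>2 = 2 * (norm x)\<^sup>2 + 2 * (norm y)\<^sup>2"
      by (simp add: power2_norm_eq_inner inner_diff inner_add inner_commute)
    ultimately show ?thesis using I_le[OF h] unfolding g_def by simp
  qed
  have "Cauchy X"
  proof (rule metric_CauchyI)
    fix e :: real assume e: "e > 0"
    define d where "d = e\<^sup>2 / 4"
    have "d > 0" and ed: "e\<^sup>2 = 4 * d" using e by (auto simp: d_def)
    then obtain N where N: "N \<noteq> 0" "1 / real N < d"
      by (metis real_arch_inverse inverse_eq_divide gr0_implies_Suc zero_less_iff_neq_zero)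
    have small: "g (X n) - I < d" if "n \<ge> N" for n
    proof -
      have "1 / real (Suc n) \<le> 1 / real N" using N that by (intro divide_left_mono) auto
      with X(2)[of n] N show ?thesis by linarith
    qed
    have "dist (X m) (X n) < e" if "m \<ge> N" "n \<ge> N" for m n
    proof -
      have "(norm (X m - X n))\<^sup>2 \<le> 2 * (g (X m) - I) + 2 * (g (X n) - I)"
        by (rule par[OF X(1) X(1)])
      also have "\<dots> < 2 * d + 2 * d"
        using small[OF that(1)] small[OF that(2)] by (intro add_strict_mono) simp_all
      also have "\<dots> = e\<^sup>2" by (simp add: ed)
      finally have "(norm (X m - X n))\<^sup>2 < e\<^sup>2" .
      then show ?thesis using e by (simp add: dist_norm power_less_imp_less_base)
    qed
    then show "\<exists>N. \<forall>m\<ge>N. \<forall>n\<ge>N. dist (X m) (X n) < e" by blast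
  qed
  then obtain m where lim: "X \<longlonglongrightarrow> m" using Cauchy_convergent convergent_def by blast
  have mM: "m \<in> M" using closed_sequentially[OF M(2)] X(1) lim by blast
  have flim: "(\<lambda>n. f (X n)) \<longlonglongrightarrow> f m"
  proof -
    have "norm (f (X n) - f m) \<le> C * norm (X n - m)" for n
    proof -
      have "f (X n - m) + f m = f (X n)"
        using add[of "X n - m" m] X(1) mM M(1) by (simp add: subspace_diff)
      then show ?thesis using bd[of "X n - m"] X(1) mM M(1) by (simp add: subspace_diff)
    qed
    then have bound: "\<forall>\<^sub>F n in sequentially. norm (f (X n) - f m) \<le> C * norm (X n - m)"
      by (rule always_eventually[OF allI])
    have "(\<lambda>n. C * norm (X n - m)) \<longlonglongrightarrow> C * norm (m - m)"
      by (intro tendsto_intros lim)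
    then have "(\<lambda>n. C * norm (X n - m)) \<longlonglongrightarrow> 0" by simp
    from Lim_null_comparison[OF bound this] show ?thesis by (rule LIM_zero_cancel)
  qed
  have "(\<lambda>n. g (X n)) \<longlonglongrightarrow> g m"
    unfolding g_def by (intro tendsto_intros lim flim)
  moreover have "(\<lambda>n. I + 1 / real (Suc n)) \<longlonglongrightarrow> I + 0"
    by (intro tendsto_intros LIMSEQ_Suc lim_inverse_n[unfolded inverse_eq_divide])
  ultimately have gm: "g m \<le> I"
    using X(2) by (intro LIMSEQ_le[of "\<lambda>n. g (X n)" _ "\<lambda>n. I + 1 / real (Suc n)"]) (auto intro: less_imp_le)
  have "f x = x \<bullet> m" if x: "x \<in> M" for x
  proof -
    have "0 \<le> t\<^sup>2 * (norm x)\<^sup>2 + 2 * t * (x \<bullet> m - f x)" for t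
    proof -
      have tx: "t *\<^sub>R x \<in> M" using x M(1) by (simp add: subspace_mul)
      have "g m \<le> g (m + t *\<^sub>R x)"
        using gm I_le[of "m + t *\<^sub>R x"] tx mM M(1) by (simp add: subspace_add)
      moreover have "f (m + t *\<^sub>R x) = f m + t * f x" using add[OF mM tx] scale[OF x] by simp
      moreover have "(norm (m + t *\<^sub>R x))\<^sup>2 = (norm m)\<^sup>2 + 2 * t * (x \<bullet> m) + t\<^sup>2 * (norm x)\<^sup>2"
        unfolding power2_norm_eq_inner inner_add_left inner_add_right
        by (simp add: power2_eq_square inner_commute[of m x])
      moreover have "2 * t * (x \<bullet> m - f x) = 2 * t * (x \<bullet> m) - 2 * (t * f x)"
        by (simp add: right_diff_distrib)
      ultimately show ?thesis unfolding g_def by linarith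
    qed
    then have "x \<bullet> m - f x = 0" by (rule quadratic_nonneg_linear_zero) simp
    then show ?thesis by simp
  qed
  with mM show ?thesis by blast
qed

lemma orthogonal_projection:
  fixes M :: "'a::{real_inner,complete_space} set"
  assumes "subspace M" "closed M"
  shows "\<exists>m\<in>M. \<forall>x\<in>M. x \<bullet> (u - m) = 0"
proof -
  have "\<exists>m\<in>M. \<forall>x\<in>M. x \<bullet> u = x \<bullet> m"
  proof (rule riesz_subspace[OF assms, where C = "norm u"])
    show "\<bar>x \<bullet> u\<bar> \<le> norm u * norm x" for x
      using Cauchy_Schwarz_ineq2[of x u] by (simp only: mult.commute)
  qed (simp_all add: inner_add_left)
  then show ?thesis by (simp add: inner_diff_right)
qed

text \<open>
  Operators are treated as linear relations.  The adjoint of a relation is a closed subspace whether or not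
  the relation is single-valued or has a dense domain.
\<close>

definition adjoint_rel :: "('a::real_inner \<times> 'b::real_inner) set \<Rightarrow> ('b \<times> 'a) set" where
  "adjoint_rel T = {(v, w). \<forall>(u, u')\<in>T. u' \<bullet> v = u \<bullet> w}"

lemma adjoint_relD: "(v, w) \<in> adjoint_rel T \<Longrightarrow> (u, u') \<in> T \<Longrightarrow> u' \<bullet> v = u \<bullet> w"
  by (auto simp: adjoint_rel_def)

lemma subspace_adjoint_rel: "subspace (adjoint_rel T)"
  by (fastforce simp: adjoint_rel_def subspace_def inner_add_right zero_prod_def)

lemma closed_adjoint_rel: "closed (adjoint_rel T)"
proof -
  have eq: "adjoint_rel T = (\<Inter>p\<in>T. {z. snd p \<bullet> fst z = fst p \<bullet> snd z})"
    by (fastforce simp: adjoint_rel_def)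
  show ?thesis unfolding eq
    by (intro closed_INT ballI closed_Collect_eq continuous_intros)
qed

text \<open>
  The part \<open>(p, q)\<close> of \<open>(w, a)\<close> that is orthogonal to the closed subspace \<open>T\<close> satisfies \<open>(q, - p) \<in> adjoint_rel T\<close>.
  The hypothesis, applied to this pair, says that \<open>(w, a)\<close> is orthogonal to \<open>(p, q)\<close>, which therefore vanishes.
\<close>

lemma adjoint_adjoint_rel:
  fixes T :: "('a::{real_inner,complete_space} \<times> 'b::{real_inner,complete_space}) set"
  assumes T: "subspace T" "closed T"
    and eq: "\<And>g g'. (g, g') \<in> adjoint_rel T \<Longrightarrow> g' \<bullet> w = g \<bullet> a"
  shows "(w, a) \<in> T"
proof -
  obtain m where m: "m \<in> T" "\<And>x. x \<in> T \<Longrightarrow> x \<bullet> ((w, a) - m) = 0"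
    using orthogonal_projection[OF T, of "(w, a)"] by blast
  obtain p q where pq: "(w, a) - m = (p, q)" by fastforce
  have orth: "u \<bullet> p + u' \<bullet> q = 0" if "(u, u') \<in> T" for u u'
    using m(2)[OF that] by (simp add: pq inner_prod_def)
  have "(q, - p) \<in> adjoint_rel T"
    unfolding adjoint_rel_def
  proof (clarsimp)
    fix u u' assume "(u, u') \<in> T"
    from orth[OF this] show "u' \<bullet> q = - (u \<bullet> p)" by linarith
  qed
  from eq[OF this] have 1: "(w, a) \<bullet> (p, q) = 0"
    by (simp add: inner_prod_def inner_commute)
  have "m \<bullet> (p, q) = 0" using m pq by simp
  with 1 have "((w, a) - m) \<bullet> (p, q) = 0" by (simp add: inner_diff_left)
  then have "(w, a) - m = 0" unfolding pq by (simp only: inner_eq_zero_iff)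
  then show ?thesis using m(1) by simp
qed

text \<open>
  The relation \<open>T T\<^sup>* + S\<^sup>* S\<close>, with \<open>w = T\<^sup>* x\<close>, \<open>a = T w\<close>, \<open>v = S x\<close> and \<open>b = S\<^sup>* v\<close>.
\<close>

definition laplace_rel ::
  "('a::real_inner \<times> 'b::real_inner) set \<Rightarrow> ('b \<times> 'c::real_inner) set \<Rightarrow> 'b \<Rightarrow> 'b \<Rightarrow> bool" where
  "laplace_rel T S x u \<longleftrightarrow> (\<exists>v w a b. (x, w) \<in> adjoint_rel T \<and> (w, a) \<in> T \<and>
      (x, v) \<in> S \<and> (v, b) \<in> adjoint_rel S \<and> u = a + b)"

text \<open>
  Pairing the equation with \<open>x\<close> gives \<open>\<parallel>v\<parallel>\<^sup>2 + \<parallel>w\<parallel>\<^sup>2 = x \<bullet> u \<le> \<parallel>x\<parallel> \<parallel>u\<parallel>\<close>, and the estimate bounds \<open>\<parallel>x\<parallel>\<^sup>2\<close> by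
  \<open>C\<close> times the left-hand side.
\<close>

theorem laplace_rel_bound:
  assumes est: "\<And>x v w. (x, v) \<in> S \<Longrightarrow> (x, w) \<in> adjoint_rel T \<Longrightarrow> (norm x)\<^sup>2 \<le> C * ((norm v)\<^sup>2 + (norm w)\<^sup>2)"
    and "0 \<le> C" and "laplace_rel T S x u"
  shows "norm x \<le> C * norm u"
proof -
  obtain v w a b where h: "(x, w) \<in> adjoint_rel T" "(w, a) \<in> T" "(x, v) \<in> S" "(v, b) \<in> adjoint_rel S" "u = a + b"
    using assms(3) by (auto simp: laplace_rel_def)
  have "(norm v)\<^sup>2 + (norm w)\<^sup>2 = x \<bullet> u"
    using adjoint_relD[OF h(1,2)] adjoint_relD[OF h(4,3)] h(5)
    by (simp add: power2_norm_eq_inner inner_add_right inner_commute)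
  also have "\<dots> \<le> norm x * norm u" using Cauchy_Schwarz_ineq2[of x u] by linarith
  finally have "C * ((norm v)\<^sup>2 + (norm w)\<^sup>2) \<le> C * (norm x * norm u)" using \<open>0 \<le> C\<close> by (rule mult_left_mono)
  with est[OF h(3,1)] have *: "norm x * norm x \<le> norm x * (C * norm u)"
    by (simp add: power2_eq_square algebra_simps)
  show ?thesis
  proof (cases "norm x = 0")
    case True then show ?thesis using \<open>0 \<le> C\<close> by simp
  next
    case False then show ?thesis using * by (simp add: mult_le_cancel_left_pos)
  qed
qed

text \<open>
  By the estimate \<open>x\<close> is a continuous function of the pair \<open>(S x, T\<^sup>* x)\<close>, and these pairs form a closed subspace
  \<open>M\<close>.  Riesz' theorem on \<open>M\<close> yields \<open>x0\<close> with the weak equation \<open>f \<bullet> u = S f \<bullet> v0 + T\<^sup>* f \<bullet> w0\<close>, where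
  \<open>v0 = S x0\<close> and \<open>w0 = T\<^sup>* x0\<close>.

  The weak equation couples the two terms, while \<open>v0\<close> has to lie in the domain of \<open>S\<^sup>*\<close> and \<open>w0\<close> in that of \<open>T\<close>.
  They are separated by splitting test elements along the kernel of \<open>S\<close>: on the kernel the first term vanishes, and
  its orthogonal complement lies in the kernel of \<open>T\<^sup>*\<close>, because the range of \<open>T\<close> is contained in the kernel of \<open>S\<close>.
  Accordingly \<open>a\<close> is the projection of \<open>u\<close> to the kernel, and \<open>b = u - a\<close>.
\<close>

theorem laplace_rel_solvable:
  fixes T :: "('a::{real_inner,complete_space} \<times> 'b::{real_inner,complete_space}) set"
    and S :: "('b \<times> 'c::{real_inner,complete_space}) set"
  assumes T: "subspace T" "closed T" and S: "subspace S" "closed S"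
    and compl: "\<And>w a. (w, a) \<in> T \<Longrightarrow> (a, 0) \<in> S"
    and est: "\<And>x v w. (x, v) \<in> S \<Longrightarrow> (x, w) \<in> adjoint_rel T \<Longrightarrow> (norm x)\<^sup>2 \<le> C * ((norm v)\<^sup>2 + (norm w)\<^sup>2)"
    and C: "0 \<le> C"
  shows "\<exists>x. laplace_rel T S x u"
proof -
  define D where "D = {(v, w, x). (x, v) \<in> S \<and> (x, w) \<in> adjoint_rel T}"
  define M where "M = {(v, w). \<exists>x. (v, w, x) \<in> D}"
  have D_lin: "(v + v', w + w', x + x') \<in> D" if "(v, w, x) \<in> D" "(v', w', x') \<in> D" for v w x v' w' x'
    using that subspace_add[OF S(1), of "(x, v)" "(x', v')"]
      subspace_add[OF subspace_adjoint_rel, of "(x, w)" T "(x', w')"] by (auto simp: D_def)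
  have D_scale: "(c *\<^sub>R v, c *\<^sub>R w, c *\<^sub>R x) \<in> D" if "(v, w, x) \<in> D" for c v w x
    using that subspace_mul[OF S(1), of "(x, v)" c]
      subspace_mul[OF subspace_adjoint_rel, of "(x, w)" T c] by (auto simp: D_def)
  have D_diff: "(v - v', w - w', x - x') \<in> D" if "(v, w, x) \<in> D" "(v', w', x') \<in> D" for v w x v' w' x'
    using D_lin[OF that(1) D_scale[OF that(2), of "-1"]] by simp
  have D_est: "norm x \<le> sqrt C * norm (v, w)" if "(v, w, x) \<in> D" for v w x
  proof -
    have "(norm x)\<^sup>2 \<le> C * (norm (v, w))\<^sup>2"
      using that est by (auto simp: D_def norm_prod_def)
    from real_le_rsqrt[OF this] show ?thesis by (simp add: real_sqrt_mult)
  qed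
  have D_unique: "x = x'" if "(v, w, x) \<in> D" "(v, w, x') \<in> D" for v w x x'
    using D_est[OF D_diff[OF that]] by simp
  define R where "R p = (THE x. (fst p, snd p, x) \<in> D)" for p
  have R: "R (v, w) = x" if "(v, w, x) \<in> D" for v w x
    unfolding R_def using that D_unique by (auto intro!: the_equality)
  have RD: "(fst p, snd p, R p) \<in> D" if "p \<in> M" for p
    using that R by (auto simp: M_def)
  have subM: "subspace M"
  proof -
    have "(0, 0, 0) \<in> D"
      using subspace_0[OF S(1)] subspace_0[OF subspace_adjoint_rel] by (simp add: D_def zero_prod_def)
    then have "0 \<in> M" by (auto simp: M_def zero_prod_def)
    moreover have "p + p' \<in> M" if "p \<in> M" "p' \<in> M" for p p'
      using that D_lin unfolding M_def by (cases p; cases p') (simp, blast)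
    moreover have "c *\<^sub>R p \<in> M" if "p \<in> M" for c p
      using that D_scale unfolding M_def by (cases p) (simp, blast)
    ultimately show ?thesis by (intro subspaceI)
  qed
  have closedM: "closed M"
  proof (rule closed_sequential_limits[THEN iffD2], intro allI impI)
    fix p l assume p: "(\<forall>n. p n \<in> M) \<and> p \<longlonglongrightarrow> l"
    have "Cauchy (\<lambda>n. R (p n))"
    proof (rule metric_CauchyI)
      fix e :: real assume e: "e > 0"
      have "Cauchy p" using p LIMSEQ_imp_Cauchy by blast
      moreover have "e / (sqrt C + 1) > 0" using e C by (simp add: add_nonneg_pos)
      ultimately obtain N where N: "\<And>m n. m \<ge> N \<Longrightarrow> n \<ge> N \<Longrightarrow> dist (p m) (p n) < e / (sqrt C + 1)"
        unfolding Cauchy_def by meson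
      have "dist (R (p m)) (R (p n)) < e" if "m \<ge> N" "n \<ge> N" for m n
      proof -
        have "p m \<in> M" "p n \<in> M" using p by auto
        from D_est[OF D_diff[OF RD RD, OF this]]
        have "norm (R (p m) - R (p n)) \<le> sqrt C * norm (p m - p n)"
          by (simp add: minus_prod_def)
        also have "\<dots> \<le> (sqrt C + 1) * norm (p m - p n)" by (simp add: mult_right_mono)
        also have "\<dots> < e" using N[OF that] C
          by (simp add: dist_norm pos_less_divide_eq add_nonneg_pos mult.commute)
        finally show ?thesis by (simp add: dist_norm)
      qed
      then show "\<exists>N. \<forall>m\<ge>N. \<forall>n\<ge>N. dist (R (p m)) (R (p n)) < e" by blast
    qed
    then obtain x where x: "(\<lambda>n. R (p n)) \<longlonglongrightarrow> x" using Cauchy_convergent convergent_def by blast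
    have v: "(\<lambda>n. fst (p n)) \<longlonglongrightarrow> fst l" and w: "(\<lambda>n. snd (p n)) \<longlonglongrightarrow> snd l"
      using p by (auto intro: tendsto_fst tendsto_snd)
    have "(x, fst l) \<in> S"
      using closed_sequentially[OF S(2), of "\<lambda>n. (R (p n), fst (p n))"] RD p tendsto_Pair[OF x v]
      by (auto simp: D_def)
    moreover have "(x, snd l) \<in> adjoint_rel T"
      using closed_sequentially[OF closed_adjoint_rel, of "\<lambda>n. (R (p n), snd (p n))" T] RD p tendsto_Pair[OF x w]
      by (auto simp: D_def)
    ultimately show "l \<in> M" by (cases l) (auto simp: M_def D_def)
  qed
  have "\<exists>m\<in>M. \<forall>p\<in>M. R p \<bullet> u = p \<bullet> m"
  proof (rule riesz_subspace[OF subM closedM, where C = "sqrt C * norm u"])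
    show "R (p + q) \<bullet> u = R p \<bullet> u + R q \<bullet> u" if "p \<in> M" "q \<in> M" for p q
      using R[OF D_lin[OF RD[OF that(1)] RD[OF that(2)]]] by (simp add: plus_prod_def inner_add_left)
    show "R (c *\<^sub>R p) \<bullet> u = c * (R p \<bullet> u)" if "p \<in> M" for c p
      using R[OF D_scale[OF RD[OF that], of c]] by (simp add: scaleR_prod_def)
    show "\<bar>R p \<bullet> u\<bar> \<le> sqrt C * norm u * norm p" if "p \<in> M" for p
    proof -
      have "\<bar>R p \<bullet> u\<bar> \<le> norm (R p) * norm u" by (rule Cauchy_Schwarz_ineq2)
      also have "\<dots> \<le> (sqrt C * norm p) * norm u"
        using D_est[OF RD[OF that]] by (intro mult_right_mono) auto
      finally show ?thesis by (simp add: algebra_simps)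
    qed
  qed
  then obtain m where m: "m \<in> M" "\<And>p. p \<in> M \<Longrightarrow> R p \<bullet> u = p \<bullet> m" by blast
  define v0 w0 where "v0 = fst m" and "w0 = snd m"
  then have mvw: "m = (v0, w0)" by simp
  have vw: "(v0, w0) \<in> M" using m(1) by (simp only: mvw)
  have ries: "R p \<bullet> u = p \<bullet> (v0, w0)" if "p \<in> M" for p using m(2)[OF that] by (simp only: mvw)
  from vw obtain x0 where x0: "(v0, w0, x0) \<in> D" by (auto simp: M_def)
  have weak: "f \<bullet> u = g \<bullet> v0 + h \<bullet> w0" if "(f, g) \<in> S" "(f, h) \<in> adjoint_rel T" for f g h
  proof -
    have d: "(g, h, f) \<in> D" using that by (simp add: D_def)
    then have "(g, h) \<in> M" unfolding M_def by blast
    from ries[OF this] R[OF d] show ?thesis by (simp add: inner_prod_def)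
  qed
  \<comment> \<open>the splitting along the kernel of \<open>S\<close> separates the two terms\<close>
  define K where "K = {f. (f, 0) \<in> S}"
  have subK: "subspace K"
  proof -
    have "(x + y, 0) \<in> S" if "(x, 0) \<in> S" "(y, 0) \<in> S" for x y
      using subspace_add[OF S(1) that] by simp
    moreover have "(c *\<^sub>R x, 0) \<in> S" if "(x, 0) \<in> S" for x c
      using subspace_mul[OF S(1) that, of c] by simp
    moreover have "(0, 0) \<in> S" using subspace_0[OF S(1)] by (simp only: zero_prod_def)
    ultimately show ?thesis unfolding K_def by (intro subspaceI) simp_all
  qed
  have closedK: "closed K"
  proof (rule closed_sequential_limits[THEN iffD2], intro allI impI)
    fix x l assume x: "(\<forall>n. x n \<in> K) \<and> x \<longlonglongrightarrow> l"
    then have "(\<lambda>n. (x n, 0)) \<longlonglongrightarrow> (l, 0)" by (intro tendsto_intros) auto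
    with x closed_sequentially[OF S(2), of "\<lambda>n. (x n, 0)"] show "l \<in> K" by (auto simp: K_def)
  qed
  have perp: "(f, 0) \<in> adjoint_rel T" if "\<And>k. k \<in> K \<Longrightarrow> k \<bullet> f = 0" for f
    using that compl by (auto simp: adjoint_rel_def K_def)
  have proj: "\<exists>k\<in>K. \<forall>x\<in>K. x \<bullet> (f - k) = 0" for f
    by (rule orthogonal_projection[OF subK closedK])
  obtain a where a: "a \<in> K" "\<And>x. x \<in> K \<Longrightarrow> x \<bullet> (u - a) = 0" using proj[of u] by blast
  have adjS: "(v0, u - a) \<in> adjoint_rel S"
    unfolding adjoint_rel_def
  proof (clarsimp)
    fix f g assume fg: "(f, g) \<in> S"
    obtain k where k: "k \<in> K" "\<And>x. x \<in> K \<Longrightarrow> x \<bullet> (f - k) = 0" using proj[of f] by blast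
    have 1: "(f - k, g) \<in> S" using subspace_diff[OF S(1) fg, of "(k, 0)"] k(1) by (simp add: K_def)
    have "(f - k) \<bullet> u = g \<bullet> v0" using weak[OF 1 perp[OF k(2)]] by simp
    moreover have "(f - k) \<bullet> a = 0" using k(2)[OF a(1)] by (simp only: inner_commute)
    ultimately show "g \<bullet> v0 = f \<bullet> (u - a)" using a(2)[OF k(1)]
      unfolding inner_diff_left inner_diff_right by linarith
  qed
  \<comment> \<open>\<open>T\<close> is recovered as its second adjoint, since only \<open>T\<^sup>*\<close> occurs in the weak equation\<close>
  have inT: "(w0, a) \<in> T"
  proof (rule adjoint_adjoint_rel[OF T])
    fix g g' assume g: "(g, g') \<in> adjoint_rel T"
    obtain k where k: "k \<in> K" "\<And>x. x \<in> K \<Longrightarrow> x \<bullet> (g - k) = 0" using proj[of g] by blast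
    have "(k, g') \<in> adjoint_rel T"
      using subspace_diff[OF subspace_adjoint_rel g perp[OF k(2)]] by simp
    moreover have "(k, 0) \<in> S" using k(1) by (simp add: K_def)
    ultimately have "k \<bullet> u = g' \<bullet> w0" using weak[of k 0 g'] by simp
    moreover have "k \<bullet> (u - a) = 0" using a(2) k(1) by simp
    moreover have "(g - k) \<bullet> a = 0" using k(2)[OF a(1)] by (simp only: inner_commute)
    ultimately show "g' \<bullet> w0 = g \<bullet> a" unfolding inner_diff_left inner_diff_right by linarith
  qed
  have "laplace_rel T S x0 u"
    unfolding laplace_rel_def
  proof (intro exI conjI)
    show "(x0, w0) \<in> adjoint_rel T" "(x0, v0) \<in> S" using x0 by (auto simp: D_def)
    show "u = a + (u - a)" by simp
  qed (rule inT adjS)+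
  then show ?thesis ..
qed

(* in what follows $ denotes the components of vectors *)
no_notation fps_nth (infixl "$" 75)

section \<open>Exterior algebra of the coefficient vectors\<close>

text \<open>
  Contraction with \<open>d\<zeta>\<^sub>j\<close>: the value at \<open>K\<close> is the coefficient \<open>u\<^sub>j\<^sub>K\<close> of the antisymmetric extension.
\<close>

definition annih :: "'n::linorder \<Rightarrow> ('n set \<Rightarrow> complex) \<Rightarrow> 'n set \<Rightarrow> complex" where
  "annih j u K = (if j \<in> K then 0 else wedge_sign j K * u (insert j K))"

text \<open>
  Exterior multiplication by \<open>d\<zeta>\<^sub>j\<close>, the adjoint of the contraction.
\<close>

definition creat :: "'n::linorder \<Rightarrow> ('n set \<Rightarrow> complex) \<Rightarrow> 'n set \<Rightarrow> complex" where
  "creat j u K = (if j \<in> K then wedge_sign j (K - {j}) * u (K - {j}) else 0)"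

definition ext_inner :: "('n::finite set \<Rightarrow> complex) \<Rightarrow> ('n set \<Rightarrow> complex) \<Rightarrow> complex" where
  "ext_inner u v = (\<Sum>K\<in>UNIV. u K * cnj (v K))"

lemma wedge_sign_insert:
  assumes "k \<notin> J"
  shows "wedge_sign j (insert k J) = (if k < j then - 1 else 1) * wedge_sign j (J::'n::{finite,linorder} set)"
proof (cases "k < j")
  case True
  then have "{i \<in> insert k J. i < j} = insert k {i \<in> J. i < j}" by auto
  with assms True show ?thesis by (simp add: wedge_sign_def)
next
  case False
  then have "{i \<in> insert k J. i < j} = {i \<in> J. i < j}" by auto
  with False show ?thesis by (simp add: wedge_sign_def)
qed

lemma wedge_sign_squared [simp]: "wedge_sign j J * wedge_sign j J = 1"
  by (simp add: wedge_sign_def flip: power_add)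

lemma cnj_wedge_sign [simp]: "cnj (wedge_sign j J) = wedge_sign j J"
  by (simp add: wedge_sign_def)

text \<open>
  The anticommutation relations of the exterior algebra.  For \<open>j \<noteq> k\<close> the two products carry opposite signs, because
  of the two indices only the larger one has to pass the other.
\<close>

lemma annih_creat:
  fixes u :: "'n::{finite,linorder} set \<Rightarrow> complex"
  shows "annih k (creat j u) K + creat j (annih k u) K = (if j = k then u K else 0)"
proof (cases "j = k")
  case True
  then show ?thesis
    by (auto simp: annih_def creat_def insert_absorb mult.assoc[symmetric])
next
  case False
  show ?thesis
  proof (cases "j \<in> K \<and> k \<notin> K")
    case True
    define J where "J = K - {j}"
    have K: "K = insert j J" "j \<notin> J" "k \<notin> J" using True by (auto simp: J_def)
    have 1: "insert k (insert j J) - {j} = insert k J" using K False by auto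
    have "annih k (creat j u) K = wedge_sign k (insert j J) * (wedge_sign j (insert k J) * u (insert k J))"
      using K False by (simp add: annih_def creat_def 1)
    moreover have "creat j (annih k u) K = wedge_sign j J * (wedge_sign k J * u (insert k J))"
      using K False by (simp add: annih_def creat_def)
    ultimately show ?thesis using K False
      by (cases "j < k") (simp_all add: wedge_sign_insert)
  next
    case no: False
    then show ?thesis using False by (auto simp: annih_def creat_def)
  qed
qed

lemma sum_insert_notin:
  fixes f :: "'n::finite set \<Rightarrow> 'a::comm_monoid_add"
  shows "(\<Sum>K\<in>{K. j \<in> K}. f K) = (\<Sum>K\<in>{K. j \<notin> K}. f (insert j K))"
  by (rule sum.reindex_bij_witness[of _ "insert j" "\<lambda>K. K - {j}"]) (auto simp: insert_absorb)

lemma ext_inner_creat: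
  "ext_inner (creat j u) v = ext_inner u (annih j (v :: 'n::{finite,linorder} set \<Rightarrow> complex))"
proof -
  have "ext_inner (creat j u) v = (\<Sum>K\<in>{K. j \<in> K}. wedge_sign j (K - {j}) * u (K - {j}) * cnj (v K))"
    unfolding ext_inner_def creat_def by (rule sum.mono_neutral_cong_right) auto
  also have "\<dots> = (\<Sum>K\<in>{K. j \<notin> K}. u K * cnj (wedge_sign j K * v (insert j K)))"
    unfolding sum_insert_notin by (rule sum.cong) auto
  also have "\<dots> = ext_inner u (annih j v)"
    unfolding ext_inner_def annih_def by (rule sum.mono_neutral_cong_left) auto
  finally show ?thesis .
qed

lemma ext_inner_diff_right: "ext_inner u (\<lambda>K. v K - v' K) = ext_inner u v - ext_inner u v'"
  and ext_inner_scale_left: "ext_inner (\<lambda>K. c * u K) v = c * ext_inner u v"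
  and ext_inner_scale_right: "ext_inner u (\<lambda>K. c * v K) = cnj c * ext_inner u v"
  and ext_inner_sum_left: "ext_inner (\<lambda>K. \<Sum>i\<in>I. w i K) v = (\<Sum>i\<in>I. ext_inner (w i) v)"
  and ext_inner_sum_right: "ext_inner u (\<lambda>K. \<Sum>i\<in>I. w i K) = (\<Sum>i\<in>I. ext_inner u (w i))"
  unfolding ext_inner_def
  by (auto simp: algebra_simps sum.distrib sum_subtractf sum_distrib_left sum_distrib_right intro: sum.swap)

lemma cnj_ext_inner: "cnj (ext_inner u v) = ext_inner v u"
  by (simp add: ext_inner_def mult.commute)

lemma ext_inner_self: "ext_inner u u = complex_of_real (\<Sum>K\<in>UNIV. (cmod (u K))\<^sup>2)"
  by (simp add: ext_inner_def complex_norm_square del: of_real_power)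

lemma Re_ext_inner_self_nonneg: "0 \<le> Re (ext_inner u u)"
  by (simp add: ext_inner_self sum_nonneg)

lemma annih_scale: "annih j (\<lambda>K. c * u K) K = c * annih j u K"
  by (simp add: annih_def)

text \<open>
  The anticommutation relations, applied to the squared norm of \<open>\<Sum>\<^sub>j d\<zeta>\<^sub>j \<and> d\<^sub>j\<close>.  With the derivatives of a form in
  the role of the \<open>d\<^sub>j\<close> this is the norm of its image under dbar.
\<close>

lemma ext_inner_sum_creat:
  fixes d :: "'n \<Rightarrow> 'n::{finite,linorder} set \<Rightarrow> complex"
  shows "ext_inner (\<lambda>K. \<Sum>j\<in>UNIV. creat j (d j) K) (\<lambda>K. \<Sum>j\<in>UNIV. creat j (d j) K) =
    (\<Sum>j\<in>UNIV. ext_inner (d j) (d j)) - (\<Sum>j\<in>UNIV. \<Sum>k\<in>UNIV. ext_inner (annih k (d j)) (annih j (d k)))"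
proof -
  have 1: "ext_inner (creat j (d j)) (creat k (d k)) =
      (if j = k then ext_inner (d j) (d j) else 0) - ext_inner (annih k (d j)) (annih j (d k))" for j k
  proof -
    have "annih j (creat k (d k)) = (\<lambda>K. (if k = j then d k K else 0) - creat k (annih j (d k)) K)"
      by (rule ext, unfold eq_diff_eq) (rule annih_creat)
    then have "ext_inner (creat j (d j)) (creat k (d k)) =
        ext_inner (d j) (\<lambda>K. if k = j then d k K else 0) - ext_inner (d j) (creat k (annih j (d k)))"
      by (simp add: ext_inner_creat ext_inner_diff_right)
    moreover have "ext_inner (d j) (creat k (annih j (d k))) = ext_inner (annih k (d j)) (annih j (d k))"
      by (subst cnj_ext_inner[symmetric], subst ext_inner_creat, rule cnj_ext_inner)
    moreover have "ext_inner (d j) (\<lambda>K. if k = j then d k K else 0) = (if j = k then ext_inner (d j) (d j) else 0)"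
      by (simp add: ext_inner_def)
    ultimately show ?thesis by simp
  qed
  show ?thesis
    unfolding ext_inner_sum_left ext_inner_sum_right 1 sum_subtractf by simp
qed

text \<open>
  The coefficient at \<open>K\<close> reappears in exactly those contractions whose index lies in \<open>K\<close>.
\<close>

lemma sum_annih_norm:
  fixes u :: "'n::{finite,linorder} set \<Rightarrow> complex"
  shows "(\<Sum>k\<in>UNIV. ext_inner (annih k u) (annih k u)) = (\<Sum>K\<in>UNIV. of_nat (card K) * (u K * cnj (u K)))"
proof -
  have "ext_inner (annih k u) (annih k u) = (\<Sum>K\<in>UNIV. if k \<in> K then u K * cnj (u K) else 0)" for k
  proof -
    have "ext_inner (annih k u) (annih k u) = (\<Sum>K\<in>{K. k \<notin> K}. u (insert k K) * cnj (u (insert k K)))"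
      unfolding ext_inner_def
    proof (rule sum.mono_neutral_cong_right)
      show "annih k u K * cnj (annih k u K) = u (insert k K) * cnj (u (insert k K))" if "K \<in> {K. k \<notin> K}" for K
      proof -
        have "annih k u K * cnj (annih k u K) =
            (wedge_sign k K * wedge_sign k K) * (u (insert k K) * cnj (u (insert k K)))"
          using that by (simp add: annih_def del: wedge_sign_squared)
        then show ?thesis by simp
      qed
    qed (auto simp: annih_def)
    also have "\<dots> = (\<Sum>K\<in>{K. k \<in> K}. u K * cnj (u K))" by (rule sum_insert_notin[symmetric])
    also have "\<dots> = (\<Sum>K\<in>UNIV. if k \<in> K then u K * cnj (u K) else 0)"
      by (rule sum.mono_neutral_cong_left) auto
    finally show ?thesis .
  qed
  then have "(\<Sum>k\<in>UNIV. ext_inner (annih k u) (annih k u)) =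
      (\<Sum>K\<in>UNIV. \<Sum>k\<in>UNIV. if k \<in> K then u K * cnj (u K) else 0)"
    by (simp only:) (rule sum.swap)
  also have "\<dots> = (\<Sum>K\<in>UNIV. of_nat (card K) * (u K * cnj (u K)))"
  proof (rule sum.cong[OF refl])
    fix K :: "'n set"
    have "(\<Sum>k\<in>UNIV. if k \<in> K then u K * cnj (u K) else 0) = (\<Sum>k\<in>K. u K * cnj (u K))"
      by (rule sum.mono_neutral_cong_right) auto
    then show "(\<Sum>k\<in>UNIV. if k \<in> K then u K * cnj (u K) else 0) = of_nat (card K) * (u K * cnj (u K))"
      by simp
  qed
  finally show ?thesis .
qed

text \<open>
  The difference of the two sides is the squared norm of the exterior product of \<open>u\<close> with the covector of
  coefficients \<open>cnj (c j)\<close>.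
\<close>

lemma contraction_norm_le:
  fixes u :: "'n::{finite,linorder} set \<Rightarrow> complex" and c :: "'n \<Rightarrow> complex"
  defines "b \<equiv> \<lambda>K. \<Sum>k\<in>UNIV. c k * annih k u K"
  shows "Re (ext_inner b b) \<le> (\<Sum>k\<in>UNIV. (cmod (c k))\<^sup>2) * Re (ext_inner u u)"
proof -
  define d where "d j = (\<lambda>K. cnj (c j) * u K)" for j
  define w where "w = (\<lambda>K. \<Sum>j\<in>UNIV. creat j (d j) K)"
  have a: "annih k (d j) = (\<lambda>K. cnj (c j) * annih k u K)" for j k
    by (rule ext) (simp add: d_def annih_scale)
  have "ext_inner w w = (\<Sum>j\<in>UNIV. ext_inner (d j) (d j))
      - (\<Sum>j\<in>UNIV. \<Sum>k\<in>UNIV. ext_inner (annih k (d j)) (annih j (d k)))"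
    unfolding w_def by (rule ext_inner_sum_creat)
  also have "(\<Sum>j\<in>UNIV. ext_inner (d j) (d j)) = (\<Sum>k\<in>UNIV. cnj (c k) * c k) * ext_inner u u"
    by (simp add: d_def ext_inner_scale_left ext_inner_scale_right sum_distrib_right mult.assoc)
  also have "(\<Sum>j\<in>UNIV. \<Sum>k\<in>UNIV. ext_inner (annih k (d j)) (annih j (d k))) = ext_inner b b"
    unfolding a b_def ext_inner_sum_left ext_inner_sum_right ext_inner_scale_left ext_inner_scale_right
    by (subst sum.swap) (simp add: mult.left_commute)
  finally have "Re (ext_inner w w) = Re ((\<Sum>k\<in>UNIV. cnj (c k) * c k) * ext_inner u u) - Re (ext_inner b b)"
    by simp
  moreover have "(\<Sum>k\<in>UNIV. cnj (c k) * c k) = complex_of_real (\<Sum>k\<in>UNIV. (cmod (c k))\<^sup>2)"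
    by (simp add: complex_norm_square mult.commute del: of_real_power)
  ultimately have "Re (ext_inner w w) = (\<Sum>k\<in>UNIV. (cmod (c k))\<^sup>2) * Re (ext_inner u u) - Re (ext_inner b b)"
    by (simp only: times_complex.sel Re_complex_of_real Im_complex_of_real)
  then show ?thesis using Re_ext_inner_self_nonneg[of w] by simp
qed

section \<open>Hermitian matrices\<close>

definition cinner :: "complex ^ 'n \<Rightarrow> complex ^ 'n \<Rightarrow> complex" where
  "cinner x y = (\<Sum>k\<in>UNIV. x $ k * cnj (y $ k))"

definition hermitian :: "complex ^ 'n ^ 'n \<Rightarrow> bool" where
  "hermitian A \<longleftrightarrow> (\<forall>j k. A $ j $ k = cnj (A $ k $ j))"

lemma Re_cinner: "Re (cinner x y) = x \<bullet> y"
  by (simp add: cinner_def inner_vec_def inner_complex_def)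

lemma Im_cinner: "Im (cinner x y) = x \<bullet> (\<i> *s y)"
  by (simp add: cinner_def inner_vec_def inner_complex_def algebra_simps)

lemma cinner_hermitian:
  assumes "hermitian A"
  shows "cinner (A *v x) y = cinner x (A *v y)"
proof -
  have "cinner (A *v x) y = (\<Sum>j\<in>UNIV. \<Sum>k\<in>UNIV. A $ j $ k * x $ k * cnj (y $ j))"
    by (simp add: cinner_def matrix_vector_mult_def sum_distrib_right)
  also have "\<dots> = (\<Sum>k\<in>UNIV. \<Sum>j\<in>UNIV. A $ j $ k * x $ k * cnj (y $ j))" by (rule sum.swap)
  also have "\<dots> = (\<Sum>k\<in>UNIV. \<Sum>j\<in>UNIV. x $ k * cnj (A $ k $ j * y $ j))"
  proof (intro sum.cong refl)
    fix k j
    have A: "A $ j $ k = cnj (A $ k $ j)" using assms unfolding hermitian_def by blast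
    show "A $ j $ k * x $ k * cnj (y $ j) = x $ k * cnj (A $ k $ j * y $ j)"
      by (subst A) simp
  qed
  also have "\<dots> = cinner x (A *v y)"
    by (simp add: cinner_def matrix_vector_mult_def sum_distrib_left)
  finally show ?thesis .
qed

lemma cinner_scale_right: "cinner x (c *s y) = cnj c * cinner x y"
  by (simp add: cinner_def sum_distrib_left mult.left_commute)

lemma cnj_cinner: "cnj (cinner x y) = cinner y x"
  by (simp add: cinner_def mult.commute)

lemma cinner_self: "cinner x x = complex_of_real ((norm x)\<^sup>2)"
proof -
  have "Im (cinner x x) = 0" using cnj_cinner[of x x] by (simp add: complex_eq_iff)
  then show ?thesis by (simp add: complex_eq_iff Re_cinner power2_norm_eq_inner)
qed

lemma matrix_vector_mult_scaleR_complex: "A *v (t *\<^sub>R z) = t *\<^sub>R (A *v z)"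
  for A :: "complex ^ 'n ^ 'm"
  by (simp add: vec_eq_iff matrix_vector_mult_def scaleR_sum_right)

text \<open>
  A maximum of the Rayleigh quotient on the unit sphere of the orthogonal complement of the eigenvectors found so far
  is an eigenvector, by the first variation.  The complement is invariant under \<open>A\<close>, so testing the variation within
  it suffices.
\<close>

lemma hermitian_next_eigenvector:
  fixes A :: "complex ^ 'n ^ 'n"
  assumes herm: "hermitian A" and m: "m < CARD('n)"
    and eig: "\<And>i. i < m \<Longrightarrow> A *v v i = complex_of_real (l i) *s v i"
  shows "\<exists>x c. norm x = 1 \<and> (\<forall>i<m. cinner x (v i) = 0) \<and> A *v x = complex_of_real c *s x"
proof -
  define W where "W = {x. \<forall>i<m. cinner x (v i) = 0}"
  have W_alt: "W = {x. \<forall>i<m. x \<bullet> v i = 0 \<and> x \<bullet> (\<i> *s v i) = 0}"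
    unfolding W_def by (simp add: complex_eq_iff Re_cinner Im_cinner)
  have subW: "subspace W"
    unfolding W_alt by (auto simp: subspace_def inner_add_left)
  have closedW: "closed W" using closed_subspace[OF subW] .
  have AW: "A *v x \<in> W" if "x \<in> W" for x
    using that eig by (simp add: W_def cinner_hermitian[OF herm] cinner_scale_right)
  \<comment> \<open>\<open>2 m\<close> real conditions cannot exhaust a space of real dimension \<open>2 n\<close>\<close>
  define S where "S = v ` {..<m} \<union> (\<lambda>i. \<i> *s v i) ` {..<m}"
  have "dim S \<le> card S" by (rule dim_le_card') (auto simp: S_def)
  also have "card S \<le> m + m"
    unfolding S_def by (rule order_trans[OF card_Un_le]) (metis add_mono card_image_le card_lessThan finite_lessThan)
  also have "m + m < DIM(complex ^ 'n)" using m by simp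
  finally have "dim S < DIM(complex ^ 'n)" .
  then obtain y where y: "y \<noteq> 0" "\<And>z. z \<in> span S \<Longrightarrow> orthogonal y z"
    using orthogonal_to_subspace_exists by blast
  have yW: "y \<in> W" unfolding W_alt
    using y(2) by (auto simp: S_def orthogonal_def intro!: span_base)
  define K where "K = W \<inter> sphere 0 1"
  have "compact K" unfolding K_def using closedW by (intro closed_Int_compact) auto
  moreover have "(1 / norm y) *\<^sub>R y \<in> K"
    using y(1) yW subW by (simp add: K_def subspace_mul)
  then have "K \<noteq> {}" by blast
  moreover have "continuous_on K (\<lambda>z. z \<bullet> (A *v z))"
    unfolding matrix_vector_mult_def by (intro continuous_intros)
  ultimately obtain x where x: "x \<in> K" "\<And>z. z \<in> K \<Longrightarrow> z \<bullet> (A *v z) \<le> x \<bullet> (A *v x)"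
    using continuous_attains_sup[of K "\<lambda>z. z \<bullet> (A *v z)"] by blast
  define c where "c = x \<bullet> (A *v x)"
  have nx: "norm x = 1" and xW: "x \<in> W" using x(1) by (auto simp: K_def)
  have symm: "a \<bullet> (A *v b) = b \<bullet> (A *v a)" for a b
    using cinner_hermitian[OF herm, of a b] by (metis Re_cinner inner_commute)
  have low: "z \<bullet> (A *v z) \<le> c * (norm z)\<^sup>2" if "z \<in> W" for z
  proof (cases "z = 0")
    case False
    define w where "w = (1 / norm z) *\<^sub>R z"
    have "w \<in> K" using that False subW by (simp add: w_def K_def subspace_mul)
    then have "w \<bullet> (A *v w) \<le> c" using x(2) c_def by simp
    moreover have "w \<bullet> (A *v w) = (z \<bullet> (A *v z)) / (norm z)\<^sup>2"
      by (simp add: w_def matrix_vector_mult_scaleR_complex power2_eq_square)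
    ultimately show ?thesis using False by (simp add: divide_simps)
  qed simp
  have zero: "(c *\<^sub>R x - A *v x) \<bullet> z = 0" if z: "z \<in> W" for z
  proof (rule quadratic_nonneg_linear_zero)
    show "0 \<le> c * (norm z)\<^sup>2 - z \<bullet> (A *v z)" using low[OF z] by simp
    fix t
    have "x + t *\<^sub>R z \<in> W" using xW z subW by (simp add: subspace_add subspace_mul)
    from low[OF this] have "(x + t *\<^sub>R z) \<bullet> (A *v (x + t *\<^sub>R z)) \<le> c * (norm (x + t *\<^sub>R z))\<^sup>2" .
    moreover have "(norm (x + t *\<^sub>R z))\<^sup>2 = 1 + 2 * t * (x \<bullet> z) + t\<^sup>2 * (norm z)\<^sup>2"
      using nx unfolding power2_norm_eq_inner inner_add_left inner_add_right
      by (simp add: power2_eq_square inner_commute[of z x] norm_eq_1)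
    moreover have "(x + t *\<^sub>R z) \<bullet> (A *v (x + t *\<^sub>R z)) =
        c + 2 * t * ((A *v x) \<bullet> z) + t\<^sup>2 * (z \<bullet> (A *v z))"
      unfolding matrix_vector_right_distrib matrix_vector_mult_scaleR_complex inner_add_left inner_add_right c_def
      by (simp add: power2_eq_square symm[of x z] inner_commute[of "A *v x" z])
    ultimately have "0 \<le> c * (1 + 2 * t * (x \<bullet> z) + t\<^sup>2 * (norm z)\<^sup>2)
       - (c + 2 * t * ((A *v x) \<bullet> z) + t\<^sup>2 * (z \<bullet> (A *v z)))" by simp
    also have "\<dots> = t\<^sup>2 * (c * (norm z)\<^sup>2 - z \<bullet> (A *v z)) + 2 * t * ((c *\<^sub>R x - A *v x) \<bullet> z)"
      by (simp add: inner_diff_left algebra_simps)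
    finally show "0 \<le> t\<^sup>2 * (c * (norm z)\<^sup>2 - z \<bullet> (A *v z)) + 2 * t * ((c *\<^sub>R x - A *v x) \<bullet> z)" .
  qed
  have "c *\<^sub>R x - A *v x \<in> W" using xW AW subW by (simp add: subspace_diff subspace_mul)
  from zero[OF this] have "A *v x = c *\<^sub>R x" by simp
  also have "c *\<^sub>R x = complex_of_real c *s x"
    unfolding vec_eq_iff vector_scaleR_component vector_smult_component by (simp add: scaleR_conv_of_real)
  finally show ?thesis using nx xW by (auto simp: W_def)
qed

lemma hermitian_eigenvectors:
  fixes A :: "complex ^ 'n ^ 'n"
  assumes herm: "hermitian A" and "m \<le> CARD('n)"
  shows "\<exists>v l. (\<forall>i<m. A *v v i = complex_of_real (l i) *s v i) \<and>
    (\<forall>i<m. \<forall>j<m. cinner (v i) (v j) = (if i = j then 1 else 0))"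
  using assms(2)
proof (induction m)
  case 0 then show ?case by simp
next
  case (Suc m)
  then obtain v l where v: "\<And>i. i < m \<Longrightarrow> A *v v i = complex_of_real (l i) *s v i"
    "\<And>i j. i < m \<Longrightarrow> j < m \<Longrightarrow> cinner (v i) (v j) = (if i = j then 1 else 0)" by auto
  have "\<exists>x c. norm x = 1 \<and> (\<forall>i<m. cinner x (v i) = 0) \<and> A *v x = complex_of_real c *s x"
    by (rule hermitian_next_eigenvector[OF herm Suc_le_lessD[OF Suc.prems]]) (rule v(1))
  then obtain x c where x: "norm x = 1" "\<forall>i<m. cinner x (v i) = 0" "A *v x = complex_of_real c *s x"
    by blast
  have 1: "cinner (v i) x = 0" if "i < m" for i using x(2) that cnj_cinner[of x "v i"] by simp
  have 2: "cinner x x = 1" using x(1) by (simp add: cinner_self)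
  show ?case
    by (rule exI[of _ "v(m := x)"], rule exI[of _ "l(m := c)"])
      (auto simp: v x 1 2 less_Suc_eq)
qed

text \<open>
  The eigenvectors are indexed by the index type of the matrix, so that they form a unitary matrix of the same
  type.  Eigenvalues are defined as roots of the characteristic polynomial; conjugating the characteristic matrix
  with the unitary matrix over the ring of polynomials makes it diagonal and shows its roots.
\<close>

theorem hermitian_spectral:
  fixes A :: "complex ^ 'n ^ 'n"
  assumes herm: "hermitian A"
  obtains v :: "'n \<Rightarrow> complex ^ 'n" and l :: "'n \<Rightarrow> real" where
    "\<And>j k. A $ j $ k = (\<Sum>i\<in>UNIV. complex_of_real (l i) * (v i $ j * cnj (v i $ k)))"
    "\<And>j k. (\<Sum>i\<in>UNIV. v i $ j * cnj (v i $ k)) = (if j = k then 1 else 0)"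
    "\<And>i. (\<Sum>k\<in>UNIV. (cmod (v i $ k))\<^sup>2) = 1"
    "eigenvalues A = image_mset (\<lambda>i. complex_of_real (l i)) (mset_set UNIV)"
proof -
  obtain v' l' where v': "\<And>i. i < CARD('n) \<Longrightarrow> A *v v' i = complex_of_real (l' i) *s v' i"
    "\<And>i j. i < CARD('n) \<Longrightarrow> j < CARD('n) \<Longrightarrow> cinner (v' i) (v' j) = (if i = j then 1 else 0)"
    using hermitian_eigenvectors[OF herm, of "CARD('n)"] by auto
  obtain e :: "'n \<Rightarrow> nat" where "bij_betw e UNIV {0..<CARD('n)}"
    using ex_bij_betw_finite_nat[of "UNIV :: 'n set"] by auto
  then have e: "\<And>i. e i < CARD('n)" "inj e" by (auto simp: bij_betw_def)
  define v where "v i = v' (e i)" for i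
  define l where "l i = l' (e i)" for i
  have eig: "A *v v i = complex_of_real (l i) *s v i" for i using v'(1) e by (simp add: v_def l_def)
  have on: "cinner (v i) (v j) = (if i = j then 1 else 0)" for i j
    using v'(2) e by (simp add: v_def inj_eq)
  define U where "U = (\<chi> i k. v k $ i)"
  define H where "H = (\<chi> k j. cnj (v k $ j))"
  have HU: "H ** U = mat 1"
  proof -
    have "(\<Sum>k\<in>UNIV. cnj (v i $ k) * v j $ k) = cinner (v j) (v i)" for i j
      by (simp add: cinner_def mult.commute)
    then show ?thesis by (auto simp: H_def U_def matrix_matrix_mult_def mat_def vec_eq_iff on)
  qed
  then have UH: "U ** H = mat 1" using matrix_left_right_inverse by blast
  have complete: "(\<Sum>i\<in>UNIV. v i $ j * cnj (v i $ k)) = (if j = k then 1 else 0)" for j k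
  proof -
    have "(U ** H) $ j $ k = (\<Sum>i\<in>UNIV. v i $ j * cnj (v i $ k))"
      by (simp add: U_def H_def matrix_matrix_mult_def)
    then show ?thesis by (simp add: UH mat_def)
  qed
  have A_eq: "A $ j $ k = (\<Sum>i\<in>UNIV. complex_of_real (l i) * (v i $ j * cnj (v i $ k)))" for j k
  proof -
    have "A = A ** (U ** H)" by (simp add: UH)
    also have "\<dots> = (A ** U) ** H" by (simp add: matrix_mul_assoc)
    finally have "A $ j $ k = ((A ** U) ** H) $ j $ k" by simp
    also have "\<dots> = (\<Sum>i\<in>UNIV. (A *v v i) $ j * cnj (v i $ k))"
      by (simp add: matrix_matrix_mult_def matrix_vector_mult_def U_def H_def)
    also have "\<dots> = (\<Sum>i\<in>UNIV. complex_of_real (l i) * (v i $ j * cnj (v i $ k)))"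
      by (simp add: eig mult.assoc)
    finally show ?thesis .
  qed
  have unit: "(\<Sum>k\<in>UNIV. (cmod (v i $ k))\<^sup>2) = 1" for i
  proof -
    have "cinner (v i) (v i) = complex_of_real (\<Sum>k\<in>UNIV. (cmod (v i $ k))\<^sup>2)"
      by (simp add: cinner_def complex_norm_square del: of_real_power)
    then show ?thesis using on[of i i] by (metis of_real_eq_1_iff)
  qed
  define c :: "complex ^ 'n ^ 'n \<Rightarrow> complex poly ^ 'n ^ 'n" where "c B = (\<chi> i j. [:B $ i $ j:])" for B
  have const_sum: "[:\<Sum>i\<in>I. f i:] = (\<Sum>i\<in>I. [:f i:])" for f :: "'n \<Rightarrow> complex" and I
  proof (induction I rule: infinite_finite_induct)
    case (insert x F)
    have "[:sum f (insert x F):] = [:f x:] + [:sum f F:]" using insert.hyps by simp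
    then show ?case using insert by (simp del: add_pCons)
  qed auto
  define D where "D = (\<chi> i j. if i = j then [:- complex_of_real (l i), 1:] else 0)"
  have "(\<chi> i j. (if i = j then [:0, 1:] else 0) - [:A $ i $ j:]) = c U ** D ** c H"
  proof (simp only: vec_eq_iff, intro allI)
    fix i j
    have "(c U ** D ** c H) $ i $ j = (\<Sum>k\<in>UNIV. [:v k $ i:] * [:- complex_of_real (l k), 1:] * [:cnj (v k $ j):])"
      by (simp add: matrix_matrix_mult_def c_def D_def U_def H_def if_distrib[of "\<lambda>x. _ * x"] cong: if_cong)
    also have "\<dots> = (\<Sum>k\<in>UNIV. [:0, 1:] * [:v k $ i * cnj (v k $ j):] - [:complex_of_real (l k) * (v k $ i * cnj (v k $ j)):])"
      by (rule sum.cong) (auto simp: algebra_simps)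
    also have "\<dots> = [:0, 1:] * [:\<Sum>k\<in>UNIV. v k $ i * cnj (v k $ j):] - [:A $ i $ j:]"
      by (simp only: sum_subtractf A_eq const_sum sum_distrib_left)
    also have "\<dots> = (if i = j then [:0, 1:] else 0) - [:A $ i $ j:]"
      by (simp add: complete)
    finally show "(\<chi> i j. (if i = j then [:0, 1:] else 0) - [:A $ i $ j:]) $ i $ j = (c U ** D ** c H) $ i $ j"
      by simp
  qed
  then have "charpoly A = det (c U) * det D * det (c H)" by (simp add: charpoly_def det_mul)
  moreover have "det (c U) * det (c H) = 1"
  proof -
    have "c U ** c H = mat 1"
    proof (simp only: vec_eq_iff, intro allI)
      fix i j
      have "(c U ** c H) $ i $ j = [:\<Sum>k\<in>UNIV. v k $ i * cnj (v k $ j):]"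
        by (simp add: matrix_matrix_mult_def c_def U_def H_def const_sum mult.commute)
      then show "(c U ** c H) $ i $ j = (mat 1 :: complex poly ^ 'n ^ 'n) $ i $ j"
        by (simp add: complete mat_def one_pCons)
    qed
    then show ?thesis by (metis det_I det_mul)
  qed
  moreover have "det D = (\<Prod>i\<in>UNIV. [:- complex_of_real (l i), 1:])"
    by (subst det_diagonal) (auto simp: D_def)
  ultimately have "charpoly A = (\<Prod>i\<in>UNIV. [:- complex_of_real (l i), 1:])"
    by (metis mult.commute mult.left_commute mult_1)
  then have "eigenvalues A = (\<Sum>i\<in>UNIV. {#complex_of_real (l i)#})"
    by (simp add: eigenvalues_def proots_prod)
  also have "\<dots> = image_mset (\<lambda>i. complex_of_real (l i)) (mset_set UNIV)"
  proof -
    have "(\<Sum>i\<in>S. {#complex_of_real (l i)#}) = image_mset (\<lambda>i. complex_of_real (l i)) (mset_set S)"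
      if "finite S" for S using that by (induction S) auto
    then show ?thesis by simp
  qed
  finally show ?thesis using that A_eq complete unit by blast
qed

text \<open>
  The \<open>q\<close> smallest values solve a linear programme over the weights \<open>t\<close>.  Its dual variable is the \<open>q\<close>-th smallest
  value \<open>c\<close>: the sum of \<open>(c - l i) t i\<close> is at most the sum of the positive parts of \<open>c - l i\<close>, which is
  \<open>q c\<close> minus the sum of the \<open>q\<close> smallest values.
\<close>

lemma sum_smallest_le_weighted_sum:
  fixes l t :: "'n::finite \<Rightarrow> real"
  assumes t: "\<And>i. 0 \<le> t i" "\<And>i. t i \<le> 1" and q: "(\<Sum>i\<in>UNIV. t i) = real q" "q \<le> CARD('n)"
  shows "sum_list (take q (sorted_list_of_multiset (image_mset l (mset_set UNIV)))) \<le> (\<Sum>i\<in>UNIV. l i * t i)"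
proof (cases "q = 0")
  case True
  then have "t i = 0" for i using q t sum_nonneg_eq_0_iff[of UNIV t] by auto
  then show ?thesis using True by simp
next
  case False
  define xs where "xs = sorted_list_of_multiset (image_mset l (mset_set UNIV))"
  have ms: "mset xs = image_mset l (mset_set UNIV)" by (simp add: xs_def)
  have srt: "sorted xs" by (simp add: xs_def)
  have len: "length xs = CARD('n)" using ms by (metis size_mset size_image_mset size_mset_set)
  define c where "c = xs ! (q - 1)"
  have "(\<Sum>i\<in>UNIV. max 0 (c - l i)) = sum_list (map (\<lambda>x. max 0 (c - x)) xs)"
  proof -
    have "(\<Sum>i\<in>UNIV. max 0 (c - l i)) = sum_mset (image_mset (\<lambda>x. max 0 (c - x)) (mset xs))"
      by (simp add: ms sum_unfold_sum_mset image_mset.compositionality comp_def)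
    then show ?thesis by (metis mset_map sum_mset_sum_list)
  qed
  also have "\<dots> = sum_list (map (\<lambda>x. max 0 (c - x)) (take q xs)) + sum_list (map (\<lambda>x. max 0 (c - x)) (drop q xs))"
    by (metis append_take_drop_id map_append sum_list_append)
  also have "map (\<lambda>x. max 0 (c - x)) (take q xs) = map (\<lambda>x. c - x) (take q xs)"
  proof (rule map_cong[OF refl])
    fix x assume "x \<in> set (take q xs)"
    then obtain i where "i < q" "i < length xs" "x = xs ! i" by (auto simp: in_set_conv_nth)
    then have "x \<le> c" unfolding c_def using srt q(2) len by (auto intro!: sorted_nth_mono)
    then show "max 0 (c - x) = c - x" by simp
  qed
  also have "map (\<lambda>x. max 0 (c - x)) (drop q xs) = map (\<lambda>x. 0) (drop q xs)"
  proof (rule map_cong[OF refl])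
    fix x assume "x \<in> set (drop q xs)"
    then obtain i where "i < length (drop q xs)" "x = drop q xs ! i" by (metis in_set_conv_nth)
    then have "q + i < length xs" "x = xs ! (q + i)" by auto
    then have "c \<le> x" unfolding c_def using srt by (auto intro!: sorted_nth_mono)
    then show "max 0 (c - x) = 0" by simp
  qed
  also have "sum_list (map (\<lambda>x. c - x) (take q xs)) = real q * c - sum_list (take q xs)"
    using q(2) len by (simp add: sum_list_subtractf sum_list_triv)
  finally have 1: "(\<Sum>i\<in>UNIV. max 0 (c - l i)) = real q * c - sum_list (take q xs)" by simp
  have "(\<Sum>i\<in>UNIV. (c - l i) * t i) \<le> (\<Sum>i\<in>UNIV. max 0 (c - l i))"
  proof (rule sum_mono)
    fix i
    have "(c - l i) * t i \<le> max 0 (c - l i) * t i" using t by (intro mult_right_mono) auto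
    also have "\<dots> \<le> max 0 (c - l i) * 1" using t by (intro mult_left_mono) auto
    finally show "(c - l i) * t i \<le> max 0 (c - l i)" by simp
  qed
  moreover have "(\<Sum>i\<in>UNIV. (c - l i) * t i) = c * real q - (\<Sum>i\<in>UNIV. l i * t i)"
    by (simp add: left_diff_distrib sum_subtractf q(1) flip: sum_distrib_left)
  ultimately show ?thesis using 1 by (simp add: xs_def)
qed

section \<open>The Levi form acting on forms\<close>

text \<open>
  For the Levi matrix this is the term of order zero in the formula of Kohn and Morrey.
\<close>

definition levi_form ::
  "complex ^ 'n::{finite,linorder} ^ 'n::{finite,linorder} \<Rightarrow> ('n set \<Rightarrow> complex) \<Rightarrow> real" where
  "levi_form A u = Re (\<Sum>k\<in>UNIV. \<Sum>j\<in>UNIV. A $ k $ j * ext_inner (annih k u) (annih j u))"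

text \<open>
  At each \<open>K\<close> the summand is the quadratic form of \<open>A\<close> at the vector of the contractions \<open>annih k u K\<close>.
\<close>

lemma levi_form_nonneg:
  fixes A :: "complex ^ 'n::{finite,linorder} ^ 'n::{finite,linorder}"
  assumes "\<And>c. 0 \<le> Re (\<Sum>k\<in>UNIV. \<Sum>j\<in>UNIV. A $ k $ j * (c k * cnj (c j)))"
  shows "0 \<le> levi_form A u"
proof -
  have "(\<Sum>k\<in>UNIV. \<Sum>j\<in>UNIV. A $ k $ j * ext_inner (annih k u) (annih j u)) =
      (\<Sum>k\<in>UNIV. \<Sum>j\<in>UNIV. \<Sum>K\<in>UNIV. A $ k $ j * (annih k u K * cnj (annih j u K)))"
    by (simp add: ext_inner_def sum_distrib_left)
  also have "\<dots> = (\<Sum>K\<in>UNIV. \<Sum>k\<in>UNIV. \<Sum>j\<in>UNIV. A $ k $ j * (annih k u K * cnj (annih j u K)))"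
    by (rule trans[OF sum.cong[OF refl sum.swap] sum.swap])
  finally show ?thesis
    unfolding levi_form_def by (simp only: Re_sum) (rule sum_nonneg, use assms in simp)
qed

text \<open>
  In an orthonormal eigenbasis the form is a sum of eigenvalues weighted by the squared norms of
  the contractions of \<open>u\<close> with the eigenvectors.  Each of these is at most the squared norm of \<open>u\<close>, and they
  add up to \<open>q\<close> times that, so the smallest value is reached by the \<open>q\<close> smallest eigenvalues.
\<close>

theorem levi_form_lower_bound:
  fixes A :: "complex ^ 'n::{finite,linorder} ^ 'n::{finite,linorder}"
  assumes herm: "hermitian A" and q: "q \<le> CARD('n)" and u: "\<And>K. card K \<noteq> q \<Longrightarrow> u K = 0"
  shows "sum_smallest_eigenvalues q A * Re (ext_inner u u) \<le> levi_form A u"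
proof (cases "Re (ext_inner u u) = 0")
  case True
  then have "u K = 0" for K
    by (simp add: ext_inner_self sum_nonneg_eq_0_iff)
  then have "annih k u = (\<lambda>K. 0)" for k by (auto simp: annih_def)
  then show ?thesis using True by (simp add: levi_form_def ext_inner_def)
next
  case False
  define N where "N = Re (ext_inner u u)"
  have N: "N > 0" using False Re_ext_inner_self_nonneg[of u] by (simp add: N_def)
  obtain v :: "'n \<Rightarrow> _" and l where A: "\<And>j k. A $ j $ k = (\<Sum>i\<in>UNIV. complex_of_real (l i) * (v i $ j * cnj (v i $ k)))"
    and complete: "\<And>j k. (\<Sum>i\<in>UNIV. v i $ j * cnj (v i $ k)) = (if j = k then 1 else 0)"
    and unit: "\<And>i. (\<Sum>k\<in>UNIV. (cmod (v i $ k))\<^sup>2) = 1"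
    and ev: "eigenvalues A = image_mset (\<lambda>i. complex_of_real (l i)) (mset_set UNIV)"
    by (rule hermitian_spectral[OF herm], rule that, assumption+)
  define e where "e k j = ext_inner (annih k u) (annih j u)" for k j
  define b where "b i = (\<lambda>K. \<Sum>k\<in>UNIV. v i $ k * annih k u K)" for i
  have bb: "ext_inner (b i) (b i) = (\<Sum>k\<in>UNIV. \<Sum>j\<in>UNIV. v i $ k * cnj (v i $ j) * e k j)" for i
    unfolding b_def ext_inner_sum_left ext_inner_sum_right ext_inner_scale_left ext_inner_scale_right e_def
    by (simp add: mult_ac sum_distrib_left)
  have form: "levi_form A u = (\<Sum>i\<in>UNIV. l i * Re (ext_inner (b i) (b i)))"
  proof -
    have "(\<Sum>k\<in>UNIV. \<Sum>j\<in>UNIV. A $ k $ j * e k j) =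
       (\<Sum>k\<in>UNIV. \<Sum>j\<in>UNIV. \<Sum>i\<in>UNIV. complex_of_real (l i) * (v i $ k * cnj (v i $ j) * e k j))"
      by (simp add: A sum_distrib_right mult.assoc)
    also have "\<dots> = (\<Sum>k\<in>UNIV. \<Sum>i\<in>UNIV. \<Sum>j\<in>UNIV. complex_of_real (l i) * (v i $ k * cnj (v i $ j) * e k j))"
      by (rule sum.cong[OF refl], rule sum.swap)
    also have "\<dots> = (\<Sum>i\<in>UNIV. \<Sum>k\<in>UNIV. \<Sum>j\<in>UNIV. complex_of_real (l i) * (v i $ k * cnj (v i $ j) * e k j))"
      by (rule sum.swap)
    also have "\<dots> = (\<Sum>i\<in>UNIV. complex_of_real (l i) * ext_inner (b i) (b i))"
      by (simp only: bb sum_distrib_left)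
    finally show ?thesis by (simp add: levi_form_def e_def)
  qed
  have total: "(\<Sum>i\<in>UNIV. Re (ext_inner (b i) (b i))) = real q * N"
  proof -
    have "(\<Sum>i\<in>UNIV. ext_inner (b i) (b i)) = (\<Sum>k\<in>UNIV. \<Sum>i\<in>UNIV. \<Sum>j\<in>UNIV. v i $ k * cnj (v i $ j) * e k j)"
      unfolding bb by (rule sum.swap)
    also have "\<dots> = (\<Sum>k\<in>UNIV. \<Sum>j\<in>UNIV. \<Sum>i\<in>UNIV. v i $ k * cnj (v i $ j) * e k j)"
      by (rule sum.cong[OF refl], rule sum.swap)
    also have "\<dots> = (\<Sum>k\<in>UNIV. \<Sum>j\<in>UNIV. if k = j then e k j else 0)"
      by (intro sum.cong refl) (simp add: complete flip: sum_distrib_right)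
    also have "\<dots> = (\<Sum>k\<in>UNIV. e k k)" by simp
    also have "\<dots> = (\<Sum>K\<in>UNIV. of_nat (card K) * (u K * cnj (u K)))"
      unfolding e_def by (rule sum_annih_norm)
    also have "\<dots> = (\<Sum>K\<in>UNIV. of_nat q * (u K * cnj (u K)))"
    proof (rule sum.cong[OF refl])
      fix K show "of_nat (card K) * (u K * cnj (u K)) = of_nat q * (u K * cnj (u K))"
        using u[of K] by (cases "card K = q") auto
    qed
    also have "\<dots> = of_nat q * ext_inner u u" by (simp add: ext_inner_def sum_distrib_left)
    finally have "Re (\<Sum>i\<in>UNIV. ext_inner (b i) (b i)) = Re (of_nat q * ext_inner u u)" by simp
    then show ?thesis by (simp add: N_def)
  qed
  define t where "t i = Re (ext_inner (b i) (b i)) / N" for i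
  have "sum_list (take q (sorted_list_of_multiset (image_mset l (mset_set UNIV)))) \<le> (\<Sum>i\<in>UNIV. l i * t i)"
  proof (rule sum_smallest_le_weighted_sum)
    show "q \<le> CARD('n)" by (rule q)
    show "0 \<le> t i" for i
      unfolding t_def using N by (intro divide_nonneg_nonneg Re_ext_inner_self_nonneg) simp
    show "t i \<le> 1" for i
      using contraction_norm_le[of "\<lambda>k. v i $ k" u] N by (simp add: t_def b_def unit N_def)
    show "(\<Sum>i\<in>UNIV. t i) = real q" using total N by (simp add: t_def flip: sum_divide_distrib)
  qed
  moreover have "image_mset Re (eigenvalues A) = image_mset l (mset_set UNIV)"
    by (simp add: ev image_mset.compositionality comp_def)
  ultimately have "sum_smallest_eigenvalues q A \<le> (\<Sum>i\<in>UNIV. l i * t i)"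
    by (simp add: sum_smallest_eigenvalues_def)
  also have "\<dots> = levi_form A u / N" by (simp add: form t_def sum_divide_distrib)
  finally show ?thesis using N by (simp add: pos_le_divide_eq N_def)
qed

section \<open>Calculus of finitely differentiable functions\<close>

definition dird :: "'a::euclidean_space \<Rightarrow> ('a \<Rightarrow> 'b::real_normed_vector) \<Rightarrow> 'a \<Rightarrow> 'b" where
  "dird b f x = frechet_derivative f (at x) b"

lemma dird_eqI: "(f has_derivative f') (at x) \<Longrightarrow> dird b f x = f' b"
  unfolding dird_def by (metis frechet_derivative_at)

lemma Ck_Suc_iff:
  "Ck (Suc k) f \<longleftrightarrow> (\<forall>x. f differentiable (at x)) \<and> (\<forall>b\<in>Basis. Ck k (dird b f))"
  by (simp add: dird_def[abs_def] differentiable_on_def)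

declare Ck.simps(2) [simp del]

lemma Ck_differentiable: "Ck (Suc k) f \<Longrightarrow> f differentiable (at x)"
  by (simp add: Ck_Suc_iff)

lemma Ck_dird: "Ck (Suc k) f \<Longrightarrow> b \<in> Basis \<Longrightarrow> Ck k (dird b f)"
  by (simp add: Ck_Suc_iff)

lemma Ck_continuous: "Ck k f \<Longrightarrow> continuous_on UNIV f"
proof (cases k)
  case (Suc j)
  assume "Ck k f"
  then have "f differentiable_on UNIV"
    using Ck_differentiable Suc by (auto simp: differentiable_on_def)
  then show ?thesis by (rule differentiable_imp_continuous_on)
qed simp

lemma Ck_SucD: "Ck (Suc k) f \<Longrightarrow> Ck k f"
proof (induction k arbitrary: f)
  case 0
  then show ?case using Ck_continuous[of "Suc 0" f] by simp
next
  case (Suc k)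
  have d: "\<forall>x. f differentiable (at x)" and s: "\<forall>b\<in>Basis. Ck (Suc k) (dird b f)"
    using Suc.prems unfolding Ck_Suc_iff[of "Suc k"] by blast+
  have "\<forall>b\<in>Basis. Ck k (dird b f)" using s Suc.IH by blast
  with d show ?case unfolding Ck_Suc_iff[of k] by blast
qed

text \<open>
  Smoothness of the members of a family follows from its closure under directional derivatives, without computing
  any higher derivative.
\<close>

lemma Ck_coinduct:
  assumes "f \<in> S"
    and "\<And>g x. g \<in> S \<Longrightarrow> g differentiable (at x)"
    and "\<And>g b. g \<in> S \<Longrightarrow> b \<in> Basis \<Longrightarrow> dird b g \<in> S"
  shows "Ck k f"
  using assms(1)
proof (induction k arbitrary: f)
  case 0
  then show ?case using assms(2) by (simp add: continuous_at_imp_continuous_on differentiable_imp_continuous_within)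
next
  case (Suc k)
  then show ?case using assms(2,3) unfolding Ck_Suc_iff by blast
qed

lemma dird_const [simp]: "dird b (\<lambda>x. c) = (\<lambda>x. 0)"
  by (rule ext, rule dird_eqI) (auto intro!: derivative_eq_intros)

lemma dird_bounded_linear:
  assumes "bounded_linear L" "f differentiable (at x)"
  shows "dird b (\<lambda>x. L (f x)) x = L (dird b f x)"
proof -
  have "(f has_derivative frechet_derivative f (at x)) (at x)" using assms(2) frechet_derivative_works by blast
  from dird_eqI[OF bounded_linear.has_derivative[OF assms(1) this]] show ?thesis by (simp add: dird_def)
qed

lemma differentiable_bounded_linear:
  assumes "bounded_linear L" "f differentiable (at x)"
  shows "(\<lambda>x. L (f x)) differentiable (at x)"
  using bounded_linear.has_derivative[OF assms(1)] assms(2) unfolding differentiable_def by blast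

lemma dird_add:
  assumes "f differentiable (at x)" "g differentiable (at x)"
  shows "dird b (\<lambda>x. f x + g x) x = dird b f x + dird b g x"
proof -
  have "((\<lambda>x. f x + g x) has_derivative (\<lambda>h. frechet_derivative f (at x) h + frechet_derivative g (at x) h)) (at x)"
    using assms frechet_derivative_works by (blast intro: has_derivative_add)
  from dird_eqI[OF this] show ?thesis by (simp add: dird_def)
qed

lemma dird_mult:
  fixes f g :: "'a::euclidean_space \<Rightarrow> 'b::real_normed_algebra"
  assumes "f differentiable (at x)" "g differentiable (at x)"
  shows "dird b (\<lambda>x. f x * g x) x = f x * dird b g x + dird b f x * g x"
proof -
  have "((\<lambda>x. f x * g x) has_derivative
      (\<lambda>h. f x * frechet_derivative g (at x) h + frechet_derivative f (at x) h * g x)) (at x)"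
    using assms frechet_derivative_works by (blast intro: has_derivative_mult)
  from dird_eqI[OF this] show ?thesis by (simp add: dird_def)
qed

lemma dird_exp:
  fixes f :: "'a::euclidean_space \<Rightarrow> real"
  assumes "f differentiable (at x)"
  shows "dird b (\<lambda>x. exp (f x)) x = dird b f x * exp (f x)" "(\<lambda>x. exp (f x)) differentiable (at x)"
proof -
  have f: "(f has_derivative frechet_derivative f (at x)) (at x)" using assms frechet_derivative_works by blast
  have *: "((\<lambda>x. exp (f x)) has_derivative (\<lambda>h. frechet_derivative f (at x) h * exp (f x))) (at x)"
    by (rule has_derivative_eq_rhs, rule has_derivative_exp, rule f) auto
  from dird_eqI[OF this] show "dird b (\<lambda>x. exp (f x)) x = dird b f x * exp (f x)" by (simp add: dird_def)
  show "(\<lambda>x. exp (f x)) differentiable (at x)" using * unfolding differentiable_def by blast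
qed

lemma Ck_const: "Ck k (\<lambda>x. c)"
  by (induction k arbitrary: c) (simp_all add: Ck_Suc_iff)

lemma Ck_bounded_linear:
  assumes "bounded_linear L"
  shows "Ck k f \<Longrightarrow> Ck k (\<lambda>x. L (f x))"
proof (induction k arbitrary: f)
  case 0
  then show ?case using bounded_linear.continuous_on[OF assms] by simp
next
  case (Suc k)
  have d: "f differentiable (at x)" for x using Suc.prems by (rule Ck_differentiable)
  have "dird b (\<lambda>x. L (f x)) = (\<lambda>x. L (dird b f x))" for b
    using dird_bounded_linear[OF assms d] by auto
  then show ?case
    unfolding Ck_Suc_iff using differentiable_bounded_linear[OF assms d] Suc.IH[OF Ck_dird[OF Suc.prems]] by simp
qed

lemma Ck_add: "Ck k f \<Longrightarrow> Ck k g \<Longrightarrow> Ck k (\<lambda>x. f x + g x)"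
proof (induction k arbitrary: f g)
  case 0 then show ?case by (auto intro: continuous_intros)
next
  case (Suc k)
  have d: "f differentiable (at x)" "g differentiable (at x)" for x
    using Suc.prems by (auto intro: Ck_differentiable)
  have "dird b (\<lambda>x. f x + g x) = (\<lambda>x. dird b f x + dird b g x)" for b using dird_add[OF d] by auto
  then show ?case unfolding Ck_Suc_iff
    using d Suc.IH[OF Ck_dird[OF Suc.prems(1)] Ck_dird[OF Suc.prems(2)]] by simp
qed

lemma Ck_uminus: "Ck k f \<Longrightarrow> Ck k (\<lambda>x. - f x)"
  by (rule Ck_bounded_linear[OF bounded_linear_minus[OF bounded_linear_ident]])

lemma Ck_diff: "Ck k f \<Longrightarrow> Ck k g \<Longrightarrow> Ck k (\<lambda>x. f x - g x)"
  using Ck_add[of k f "\<lambda>x. - g x"] Ck_uminus[of k g] by simp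

lemma Ck_mult:
  fixes f g :: "'a::euclidean_space \<Rightarrow> 'b::real_normed_algebra"
  shows "Ck k f \<Longrightarrow> Ck k g \<Longrightarrow> Ck k (\<lambda>x. f x * g x)"
proof (induction k arbitrary: f g)
  case 0 then show ?case by (auto intro: continuous_intros)
next
  case (Suc k)
  have d: "f differentiable (at x)" "g differentiable (at x)" for x
    using Suc.prems by (auto intro: Ck_differentiable)
  have e: "dird b (\<lambda>x. f x * g x) = (\<lambda>x. f x * dird b g x + dird b f x * g x)" for b
    using dird_mult[OF d] by auto
  have "Ck k (\<lambda>x. f x * dird b g x + dird b f x * g x)" if "b \<in> Basis" for b
    using Suc.prems that by (intro Ck_add Suc.IH Ck_dird Ck_SucD[of k f] Ck_SucD[of k g])
  then show ?case unfolding Ck_Suc_iff using d e by simp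
qed

lemma Ck_exp:
  fixes f :: "'a::euclidean_space \<Rightarrow> real"
  shows "Ck k f \<Longrightarrow> Ck k (\<lambda>x. exp (f x))"
proof (induction k arbitrary: f)
  case 0 then show ?case by (simp add: continuous_on_exp)
next
  case (Suc k)
  have d: "f differentiable (at x)" for x using Suc.prems by (rule Ck_differentiable)
  have e: "dird b (\<lambda>x. exp (f x)) = (\<lambda>x. dird b f x * exp (f x))" for b using dird_exp(1)[OF d] by auto
  have "Ck k (\<lambda>x. dird b f x * exp (f x))" if "b \<in> Basis" for b
    using Suc.prems that by (intro Ck_mult Suc.IH Ck_dird Ck_SucD[of k f])
  then show ?case unfolding Ck_Suc_iff using dird_exp(2)[OF d] e by simp
qed

lemma dird_has_vector_derivative:
  assumes "f differentiable (at (x + s *\<^sub>R b))"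
  shows "((\<lambda>s. f (x + s *\<^sub>R b)) has_vector_derivative dird b f (x + s *\<^sub>R b)) (at s within S)"
proof -
  have "(f has_derivative frechet_derivative f (at (x + s *\<^sub>R b))) (at (x + s *\<^sub>R b))"
    using assms frechet_derivative_works by blast
  moreover have "((\<lambda>s. x + s *\<^sub>R b) has_derivative (\<lambda>h. h *\<^sub>R b)) (at s within S)"
    by (auto intro!: derivative_eq_intros)
  ultimately have "((\<lambda>s. f (x + s *\<^sub>R b)) has_derivative (\<lambda>h. frechet_derivative f (at (x + s *\<^sub>R b)) (h *\<^sub>R b))) (at s within S)"
    using has_derivative_in_compose[of "\<lambda>s. x + s *\<^sub>R b" _ s S f] has_derivative_at_withinI by blast
  moreover have "linear (frechet_derivative f (at (x + s *\<^sub>R b)))" using assms linear_frechet_derivative by blast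
  ultimately show ?thesis by (simp add: has_vector_derivative_def dird_def linear_cmul)
qed

lemma dird_MVT:
  fixes f :: "'a::euclidean_space \<Rightarrow> real"
  assumes d: "\<And>x. f differentiable (at x)" and t: "0 < t"
  obtains s where "0 < s" "s < t" "f (x + t *\<^sub>R b) - f x = t * dird b f (x + s *\<^sub>R b)"
proof -
  have v: "((\<lambda>s. f (x + s *\<^sub>R b)) has_real_derivative dird b f (x + s *\<^sub>R b)) (at s)" for s
    unfolding has_real_derivative_iff_has_vector_derivative by (rule dird_has_vector_derivative) (rule d)
  obtain s where "0 < s" "s < t" "f (x + t *\<^sub>R b) - f (x + 0 *\<^sub>R b) = (t - 0) * dird b f (x + s *\<^sub>R b)"
    using MVT2[OF t, of "\<lambda>s. f (x + s *\<^sub>R b)" "\<lambda>s. dird b f (x + s *\<^sub>R b)"] v by blast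
  then show ?thesis using that by simp
qed

text \<open>
  Two applications of the mean value theorem.  The left-hand side is symmetric in \<open>b\<close> and \<open>c\<close>, which makes the second
  derivatives symmetric.
\<close>

lemma second_difference:
  fixes f :: "'a::euclidean_space \<Rightarrow> real"
  assumes f: "Ck 2 f" and bc: "b \<in> Basis" "c \<in> Basis" and t: "0 < t"
  shows "\<exists>p. dist x p < 2 * t \<and>
    f (x + t *\<^sub>R b + t *\<^sub>R c) - f (x + t *\<^sub>R b) - f (x + t *\<^sub>R c) + f x = t * t * dird c (dird b f) p"
proof -
  have f2: "Ck (Suc (Suc 0)) f" using f by (simp only: numeral_2_eq_2)
  have d: "f differentiable (at x)" "dird b f differentiable (at x)" for x
    using Ck_differentiable[OF f2] Ck_differentiable[OF Ck_dird[OF f2 bc(1)]] by auto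
  define g where "g y = f (y + t *\<^sub>R c) + (- 1) * f y" for y
  have comp: "((\<lambda>y. f (y + t *\<^sub>R c)) has_derivative frechet_derivative f (at (y + t *\<^sub>R c))) (at y)" for y
  proof -
    have "((\<lambda>y. y + t *\<^sub>R c) has_derivative (\<lambda>h. h)) (at y)" by (auto intro!: derivative_eq_intros)
    from has_derivative_compose[OF this d(1)[unfolded frechet_derivative_works]] show ?thesis .
  qed
  then have dc: "(\<lambda>y. f (y + t *\<^sub>R c)) differentiable (at y)" for y unfolding differentiable_def by blast
  have dg: "g differentiable (at y)" "dird b g y = dird b f (y + t *\<^sub>R c) - dird b f y" for y
  proof -
    have "dird b g y = dird b (\<lambda>y. f (y + t *\<^sub>R c)) y + dird b (\<lambda>y. (- 1) * f y) y"
      unfolding g_def by (rule dird_add) (use dc d in auto)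
    moreover have "dird b (\<lambda>y. (- 1) * f y) y = (- 1) * dird b f y"
      using dird_mult[OF _ d(1), of "\<lambda>x. - 1"] by simp
    moreover have "dird b (\<lambda>y. f (y + t *\<^sub>R c)) y = dird b f (y + t *\<^sub>R c)"
      using dird_eqI[OF comp] by (simp add: dird_def)
    ultimately show "dird b g y = dird b f (y + t *\<^sub>R c) - dird b f y" by simp
    show "g differentiable (at y)" unfolding g_def using dc d by simp
  qed
  obtain s where s: "0 < s" "s < t" "g (x + t *\<^sub>R b) - g x = t * dird b g (x + s *\<^sub>R b)"
    using dird_MVT[OF dg(1) t] by blast
  obtain r where r: "0 < r" "r < t"
    "dird b f (x + s *\<^sub>R b + t *\<^sub>R c) - dird b f (x + s *\<^sub>R b) = t * dird c (dird b f) (x + s *\<^sub>R b + r *\<^sub>R c)"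
    using dird_MVT[OF d(2) t] by blast
  show ?thesis
  proof (intro exI conjI)
    have "dist (x + s *\<^sub>R b + r *\<^sub>R c) x = norm (s *\<^sub>R b + r *\<^sub>R c)"
      by (simp add: dist_norm add.assoc)
    then have "dist x (x + s *\<^sub>R b + r *\<^sub>R c) = norm (s *\<^sub>R b + r *\<^sub>R c)"
      by (simp only: dist_commute)
    also have "\<dots> \<le> norm (s *\<^sub>R b) + norm (r *\<^sub>R c)" by (rule norm_triangle_ineq)
    also have "\<dots> < 2 * t" using s r bc by simp
    finally show "dist x (x + s *\<^sub>R b + r *\<^sub>R c) < 2 * t" .
    show "f (x + t *\<^sub>R b + t *\<^sub>R c) - f (x + t *\<^sub>R b) - f (x + t *\<^sub>R c) + f x =
        t * t * dird c (dird b f) (x + s *\<^sub>R b + r *\<^sub>R c)"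
      using s(3) r(3) by (simp add: g_def dg(2))
  qed
qed

lemma dird_commute_real:
  fixes f :: "'a::euclidean_space \<Rightarrow> real"
  assumes f: "Ck 2 f" and bc: "b \<in> Basis" "c \<in> Basis"
  shows "dird c (dird b f) x = dird b (dird c f) x"
proof (rule ccontr)
  assume ne: "dird c (dird b f) x \<noteq> dird b (dird c f) x"
  define e where "e = \<bar>dird c (dird b f) x - dird b (dird c f) x\<bar> / 2"
  have e: "e > 0" using ne by (simp add: e_def)
  have f2: "Ck (Suc (Suc 0)) f" using f by (simp only: numeral_2_eq_2)
  have cont: "continuous_on UNIV (dird c (dird b f))" "continuous_on UNIV (dird b (dird c f))"
    using Ck_continuous[OF Ck_dird[OF Ck_dird[OF f2]]] bc by auto
  obtain d1 where d1: "d1 > 0" "\<And>p. dist p x < d1 \<Longrightarrow> dist (dird c (dird b f) p) (dird c (dird b f) x) < e"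
    using cont(1)[unfolded continuous_on_iff] e by (metis UNIV_I)
  obtain d2 where d2: "d2 > 0" "\<And>p. dist p x < d2 \<Longrightarrow> dist (dird b (dird c f) p) (dird b (dird c f) x) < e"
    using cont(2)[unfolded continuous_on_iff] e by (metis UNIV_I)
  define t where "t = min d1 d2 / 2"
  have t: "0 < t" "2 * t \<le> d1" "2 * t \<le> d2" using d1(1) d2(1) by (auto simp: t_def)
  obtain p where p: "dist x p < 2 * t"
    "f (x + t *\<^sub>R b + t *\<^sub>R c) - f (x + t *\<^sub>R b) - f (x + t *\<^sub>R c) + f x = t * t * dird c (dird b f) p"
    using second_difference[OF f bc t(1)] by blast
  obtain p' where p': "dist x p' < 2 * t"
    "f (x + t *\<^sub>R c + t *\<^sub>R b) - f (x + t *\<^sub>R c) - f (x + t *\<^sub>R b) + f x = t * t * dird b (dird c f) p'"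
    using second_difference[OF f bc(2,1) t(1)] by blast
  have "x + t *\<^sub>R b + t *\<^sub>R c = x + t *\<^sub>R c + t *\<^sub>R b" by simp
  then have swap: "f (x + t *\<^sub>R b + t *\<^sub>R c) = f (x + t *\<^sub>R c + t *\<^sub>R b)" by (rule arg_cong)
  have "t * t * dird c (dird b f) p =
      f (x + t *\<^sub>R b + t *\<^sub>R c) - f (x + t *\<^sub>R b) - f (x + t *\<^sub>R c) + f x" by (rule p(2)[symmetric])
  also have "\<dots> = f (x + t *\<^sub>R c + t *\<^sub>R b) - f (x + t *\<^sub>R c) - f (x + t *\<^sub>R b) + f x"
    unfolding swap by (simp only: diff_right_commute)
  also have "\<dots> = t * t * dird b (dird c f) p'" by (rule p'(2))
  finally have "t * t * dird c (dird b f) p = t * t * dird b (dird c f) p'" .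
  then have eq: "dird c (dird b f) p = dird b (dird c f) p'" using t(1) by simp
  have "dist (dird c (dird b f) p) (dird c (dird b f) x) < e"
    using d1(2)[of p] p(1) t(2) by (simp add: dist_commute)
  moreover have "dist (dird b (dird c f) p') (dird b (dird c f) x) < e"
    using d2(2)[of p'] p'(1) t(3) by (simp add: dist_commute)
  ultimately have "\<bar>dird c (dird b f) x - dird b (dird c f) x\<bar> < 2 * e"
    unfolding eq dist_real_def by linarith
  then show False by (simp add: e_def)
qed

lemma dird_commute:
  fixes f :: "'a::euclidean_space \<Rightarrow> complex"
  assumes f: "Ck 2 f" and bc: "b \<in> Basis" "c \<in> Basis"
  shows "dird c (dird b f) x = dird b (dird c f) x"
proof -
  have f2: "Ck (Suc (Suc 0)) f" using f by (simp only: numeral_2_eq_2)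
  have *: "L (dird c (dird b f) x) = dird c (dird b (\<lambda>x. L (f x))) x"
    if L: "bounded_linear L" and bc: "b \<in> Basis" "c \<in> Basis" for L :: "complex \<Rightarrow> real" and b c
  proof -
    have "dird b (\<lambda>x. L (f x)) = (\<lambda>x. L (dird b f x))"
      using dird_bounded_linear[OF L Ck_differentiable[OF f2]] by auto
    then show ?thesis using dird_bounded_linear[OF L Ck_differentiable[OF Ck_dird[OF f2 bc(1)]]] by simp
  qed
  have **: "L (dird c (dird b f) x) = L (dird b (dird c f) x)" if L: "bounded_linear L" for L :: "complex \<Rightarrow> real"
    unfolding *[OF L bc] *[OF L bc(2,1)] by (rule dird_commute_real[OF Ck_bounded_linear[OF L f] bc])
  show ?thesis
    using **[OF bounded_linear_Re] **[OF bounded_linear_Im] by (rule complex_eqI)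
qed

section \<open>Smooth bump functions\<close>

text \<open>
  The parameter \<open>k\<close> makes the family closed under differentiation, up to linear combinations.
\<close>

definition flat_exp :: "nat \<Rightarrow> real \<Rightarrow> real" where
  "flat_exp k t = (if t > 0 then exp (- inverse t) * inverse t ^ k else 0)"

lemma flat_exp_tendsto_0: "(flat_exp k \<longlongrightarrow> 0) (at 0)"
proof -
  have 1: "((\<lambda>t::real. (inverse t) ^ k / exp (inverse t)) \<longlongrightarrow> 0) (at_right 0)"
    by (rule filterlim_compose[OF tendsto_power_div_exp_0 filterlim_inverse_at_top_right])
  have "(flat_exp k \<longlongrightarrow> 0) (at_right 0)"
  proof (rule tendsto_cong[THEN iffD1, OF _ 1])
    show "\<forall>\<^sub>F t in at_right 0. (inverse t) ^ k / exp (inverse t) = flat_exp k t"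
      unfolding eventually_at_right_field
      by (rule exI[of _ 1]) (auto simp: flat_exp_def exp_minus field_simps)
  qed
  moreover have "(flat_exp k \<longlongrightarrow> 0) (at_left 0)"
  proof (rule tendsto_cong[THEN iffD1, OF _ tendsto_const])
    show "\<forall>\<^sub>F t in at_left 0. 0 = flat_exp k t"
      unfolding eventually_at_left_field by (rule exI[of _ "-1"]) (auto simp: flat_exp_def)
  qed
  ultimately show ?thesis by (simp add: filterlim_split_at)
qed

lemma flat_exp_deriv:
  "(flat_exp k has_real_derivative flat_exp (k + 2) t - real k * flat_exp (k + 1) t) (at t)"
proof -
  consider "t > 0" | "t < 0" | "t = 0" by linarith
  then show ?thesis
  proof cases
    case 1
    define s where "s = inverse t"
    have "((\<lambda>s. exp (- s) * s ^ k) has_real_derivative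
        (exp (- s) * (real k * s ^ (k - 1)) - exp (- s) * s ^ k)) (at s)"
      by (auto intro!: derivative_eq_intros)
    moreover have "(inverse has_real_derivative - (s\<^sup>2)) (at t)"
      using DERIV_inverse[of t UNIV] 1 by (simp add: s_def numeral_2_eq_2)
    ultimately have "((\<lambda>t. exp (- inverse t) * inverse t ^ k) has_real_derivative
        (exp (- s) * (real k * s ^ (k - 1)) - exp (- s) * s ^ k) * - (s\<^sup>2)) (at t)"
      unfolding s_def by (rule DERIV_chain2)
    moreover have "(exp (- s) * (real k * s ^ (k - 1)) - exp (- s) * s ^ k) * - (s\<^sup>2) =
        flat_exp (k + 2) t - real k * flat_exp (k + 1) t"
    proof -
      have "real k * s ^ (k - 1) * s\<^sup>2 = real k * s ^ (k + 1)"
        by (cases k) (simp_all add: power2_eq_square)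
      then have "(exp (- s) * (real k * s ^ (k - 1)) - exp (- s) * s ^ k) * - (s\<^sup>2) =
          exp (- s) * s ^ (k + 2) - exp (- s) * (real k * s ^ (k + 1))"
        by (simp only: power_add left_diff_distrib minus_mult_right[symmetric] mult.assoc)
      then show ?thesis using 1 by (simp add: flat_exp_def s_def)
    qed
    ultimately have d: "((\<lambda>t. exp (- inverse t) * inverse t ^ k) has_real_derivative
        flat_exp (k + 2) t - real k * flat_exp (k + 1) t) (at t)" by simp
    have "\<forall>\<^sub>F s in nhds t. flat_exp k s = exp (- inverse s) * inverse s ^ k"
      using eventually_nhds_in_open[of "{0<..}" t] 1 by (auto elim!: eventually_mono simp: flat_exp_def)
    from DERIV_cong_ev[OF refl this refl] d show ?thesis by blast
  next
    case 2
    have "\<forall>\<^sub>F s in nhds t. flat_exp k s = 0"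
      using eventually_nhds_in_open[of "{..<0}" t] 2 by (auto elim!: eventually_mono simp: flat_exp_def)
    from DERIV_cong_ev[OF refl this refl, of 0] have "(flat_exp k has_real_derivative 0) (at t)" by simp
    then show ?thesis using 2 by (simp add: flat_exp_def)
  next
    case 3
    \<comment> \<open>at zero the difference quotient is itself a member of the family\<close>
    have "((\<lambda>h. (flat_exp k (0 + h) - flat_exp k 0) / h) \<longlongrightarrow> 0) (at 0)"
    proof (rule tendsto_cong[THEN iffD1, OF _ flat_exp_tendsto_0[of "k + 1"]])
      show "\<forall>\<^sub>F h in at 0. flat_exp (k + 1) h = (flat_exp k (0 + h) - flat_exp k 0) / h"
        by (rule always_eventually) (simp add: flat_exp_def divide_inverse mult.commute)
    qed
    then show ?thesis using 3 by (simp add: DERIV_def flat_exp_def)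
  qed
qed

text \<open>
  An algebra of smooth functions that is closed under composition with \<open>flat_exp k\<close>; the cut-off functions and the
  mollifiers are taken from it.
\<close>

inductive_set bump_algebra :: "('a::euclidean_space \<Rightarrow> real) set" where
  const: "(\<lambda>x. c) \<in> bump_algebra"
| inner: "(\<lambda>x. x \<bullet> a) \<in> bump_algebra"
| add: "f \<in> bump_algebra \<Longrightarrow> g \<in> bump_algebra \<Longrightarrow> (\<lambda>x. f x + g x) \<in> bump_algebra"
| mult: "f \<in> bump_algebra \<Longrightarrow> g \<in> bump_algebra \<Longrightarrow> (\<lambda>x. f x * g x) \<in> bump_algebra"
| flat: "f \<in> bump_algebra \<Longrightarrow> (\<lambda>x. flat_exp k (f x)) \<in> bump_algebra"

lemma bump_algebra_derivative:
  assumes "f \<in> bump_algebra"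
  shows "(\<forall>x. f differentiable (at x)) \<and> dird b f \<in> bump_algebra"
  using assms
proof induction
  case (const c)
  then show ?case using bump_algebra.const[of 0] by simp
next
  case (inner a)
  have "((\<lambda>x. x \<bullet> a) has_derivative (\<lambda>h. h \<bullet> a)) (at x)" for x by (auto intro!: derivative_eq_intros)
  then have "dird b (\<lambda>x. x \<bullet> a) = (\<lambda>x. b \<bullet> a)" using dird_eqI by blast
  then show ?case using bump_algebra.const by simp
next
  case (add f g)
  then have "dird b (\<lambda>x. f x + g x) = (\<lambda>x. dird b f x + dird b g x)" using dird_add by blast
  then show ?case using add bump_algebra.add by auto
next
  case (mult f g)
  then have "dird b (\<lambda>x. f x * g x) = (\<lambda>x. f x * dird b g x + dird b f x * g x)" using dird_mult by blast
  then show ?case using mult by (auto intro: bump_algebra.add bump_algebra.mult)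
next
  case (flat f k)
  define g where "g x = flat_exp (k + 2) (f x) + - real k * flat_exp (k + 1) (f x)" for x
  have 1: "((\<lambda>x. flat_exp k (f x)) has_derivative (\<lambda>h. frechet_derivative f (at x) h * g x)) (at x)" for x
  proof -
    have "(f has_derivative frechet_derivative f (at x)) (at x)"
      using flat.IH frechet_derivative_works by blast
    from has_derivative_compose[OF this, of "flat_exp k" "(*) (flat_exp (k + 2) (f x) - real k * flat_exp (k + 1) (f x))"]
    show ?thesis using flat_exp_deriv[of k "f x"]
      by (simp add: has_field_derivative_def g_def mult.commute)
  qed
  then have "dird b (\<lambda>x. flat_exp k (f x)) = (\<lambda>x. dird b f x * g x)"
    using dird_eqI[OF 1] by (auto simp: dird_def)
  moreover have "g \<in> bump_algebra"
    unfolding g_def[abs_def] by (intro bump_algebra.intros flat.hyps)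
  moreover have "\<forall>x. (\<lambda>x. flat_exp k (f x)) differentiable (at x)" using 1 unfolding differentiable_def by blast
  ultimately show ?case using flat.IH bump_algebra.mult by auto
qed

lemma bump_algebra_Ck: "f \<in> bump_algebra \<Longrightarrow> Ck k f"
  by (rule Ck_coinduct[of f bump_algebra]) (use bump_algebra_derivative in blast)+

lemma bump_algebra_norm_square: "(\<lambda>x::'a::euclidean_space. x \<bullet> x) \<in> bump_algebra"
proof -
  have "(\<lambda>x::'a. \<Sum>b\<in>B. (x \<bullet> b) * (x \<bullet> b)) \<in> bump_algebra" if "finite B" for B
    using that
  proof induction
    case (insert b B)
    then show ?case by (simp, intro bump_algebra.intros)
  qed (simp add: bump_algebra.const)
  moreover have "(\<lambda>x::'a. x \<bullet> x) = (\<lambda>x. \<Sum>b\<in>Basis. (x \<bullet> b) * (x \<bullet> b))"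
    by (rule ext) (rule euclidean_inner)
  ultimately show ?thesis by simp
qed

lemma flat_exp_nonneg: "0 \<le> flat_exp k t" by (simp add: flat_exp_def)

lemma flat_exp_0_mono: "s \<le> t \<Longrightarrow> flat_exp 0 s \<le> flat_exp 0 t"
  by (auto simp: flat_exp_def divide_simps)

text \<open>
  The inner \<open>flat_exp\<close> vanishes for \<open>\<parallel>z\<parallel> \<le> R\<close>, and multiplied by \<open>exp 1\<close> it is at least 1 for \<open>\<parallel>z\<parallel>\<^sup>2 \<ge> 2 R\<^sup>2\<close>.  So the
  function is 1 on the ball of radius \<open>R\<close> and 0 outside the ball of radius \<open>2 R\<close>.
\<close>

definition cutoff :: "real \<Rightarrow> 'a::euclidean_space \<Rightarrow> real" where
  "cutoff R z = exp 1 * flat_exp 0 (1 + - exp 1 * flat_exp 0 (1 / R\<^sup>2 * (z \<bullet> z) + - 1))"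

lemma cutoff_Ck: "Ck k (cutoff R)"
  unfolding cutoff_def[abs_def]
  by (rule bump_algebra_Ck) (intro bump_algebra.intros bump_algebra_norm_square)

lemma cutoff_bounds: "0 \<le> cutoff R z" "cutoff R z \<le> 1"
proof -
  show "0 \<le> cutoff R z" by (simp add: cutoff_def flat_exp_nonneg)
  have "flat_exp 0 (1 + - exp 1 * flat_exp 0 (1 / R\<^sup>2 * (z \<bullet> z) + - 1)) \<le> flat_exp 0 1"
    by (rule flat_exp_0_mono) (simp add: flat_exp_nonneg)
  then have "cutoff R z \<le> exp 1 * flat_exp 0 1" unfolding cutoff_def by (intro mult_left_mono) auto
  then show "cutoff R z \<le> 1" by (simp add: flat_exp_def flip: exp_add)
qed

lemma cutoff_eq_1:
  assumes "0 < R" "norm z \<le> R"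
  shows "cutoff R z = 1"
proof -
  have "z \<bullet> z \<le> R\<^sup>2" using assms by (simp add: power2_norm_eq_inner[symmetric] power_mono)
  then have "1 / R\<^sup>2 * (z \<bullet> z) + - 1 \<le> 0" using assms by (simp add: divide_simps)
  then show ?thesis by (simp add: cutoff_def flat_exp_def flip: exp_add)
qed

lemma cutoff_eq_0:
  assumes "0 < R" "2 * R \<le> norm z"
  shows "cutoff R z = 0"
proof -
  have "(2 * R)\<^sup>2 \<le> z \<bullet> z" using assms by (simp only: power2_norm_eq_inner[symmetric] power_mono)
  moreover have "2 * R\<^sup>2 \<le> (2 * R)\<^sup>2" by (simp add: power_mult_distrib)
  ultimately have "2 * R\<^sup>2 \<le> z \<bullet> z" by (rule order_trans[rotated])
  then have "1 \<le> 1 / R\<^sup>2 * (z \<bullet> z) + - 1" using assms by (simp add: divide_simps)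
  then have "flat_exp 0 1 \<le> flat_exp 0 (1 / R\<^sup>2 * (z \<bullet> z) + - 1)" by (rule flat_exp_0_mono)
  then have "exp 1 * flat_exp 0 1 \<le> exp 1 * flat_exp 0 (1 / R\<^sup>2 * (z \<bullet> z) + - 1)" by simp
  then have "1 \<le> exp 1 * flat_exp 0 (1 / R\<^sup>2 * (z \<bullet> z) + - 1)" by (simp add: flat_exp_def flip: exp_add)
  then show ?thesis by (simp add: cutoff_def flat_exp_def)
qed

definition bump :: "real \<Rightarrow> 'a::euclidean_space \<Rightarrow> real" where
  "bump e z = flat_exp 0 (e\<^sup>2 + - 1 * (z \<bullet> z))"

lemma bump_Ck: "Ck k (bump e)"
  unfolding bump_def[abs_def]
  by (rule bump_algebra_Ck) (intro bump_algebra.intros bump_algebra_norm_square)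

lemma bump_nonneg: "0 \<le> bump e z" by (simp add: bump_def flat_exp_nonneg)

lemma bump_pos: "0 < e \<Longrightarrow> norm z < e \<Longrightarrow> 0 < bump e z"
  by (simp add: bump_def flat_exp_def power2_norm_eq_inner[symmetric] power_strict_mono)

lemma bump_eq_0: "0 < e \<Longrightarrow> e \<le> norm z \<Longrightarrow> bump e z = 0"
  by (simp add: bump_def flat_exp_def power2_norm_eq_inner[symmetric] power_mono not_less)

section \<open>The Hilbert space of square-integrable functions\<close>

definition sqint :: "('a::euclidean_space \<Rightarrow> complex) \<Rightarrow> bool" where
  "sqint f \<longleftrightarrow> f \<in> borel_measurable lebesgue \<and> integrable lebesgue (\<lambda>x. (cmod (f x))\<^sup>2)"

lemma sqint_measurable: "sqint f \<Longrightarrow> f \<in> borel_measurable lebesgue"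
  by (simp add: sqint_def)

lemma sqint_zero [simp]: "sqint (\<lambda>x. 0)"
  by (simp add: sqint_def)

lemma sqint_bound:
  assumes "sqint f" and g: "g \<in> borel_measurable lebesgue"
    and le: "AE x in lebesgue. cmod (g x) \<le> C * cmod (f x)"
  shows "sqint g"
proof -
  have "integrable lebesgue (\<lambda>x. C\<^sup>2 * (cmod (f x))\<^sup>2)" using assms by (simp add: sqint_def)
  then have "integrable lebesgue (\<lambda>x. (cmod (g x))\<^sup>2)"
  proof (rule Bochner_Integration.integrable_bound)
    show "AE x in lebesgue. norm ((cmod (g x))\<^sup>2) \<le> norm (C\<^sup>2 * (cmod (f x))\<^sup>2)"
      using le
    proof eventually_elim
      case (elim x)
      then have "(cmod (g x))\<^sup>2 \<le> (C * cmod (f x))\<^sup>2" by (rule power_mono) simp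
      then show ?case by (simp add: power_mult_distrib)
    qed
  qed (use g in measurable)
  then show ?thesis using g by (simp add: sqint_def)
qed

lemma sqint_scale: "sqint f \<Longrightarrow> sqint (\<lambda>x. c * f x)"
  by (rule sqint_bound[of f _ "cmod c"]) (auto simp: sqint_def norm_mult)

lemma sqint_scaleR: "sqint f \<Longrightarrow> sqint (\<lambda>x. r *\<^sub>R f x)"
  using sqint_scale[of f "of_real r"] by (simp add: scaleR_conv_of_real)

lemma sqint_uminus: "sqint f \<Longrightarrow> sqint (\<lambda>x. - f x)"
  using sqint_scale[of f "- 1"] by simp

lemma sqint_cnj: "sqint f \<Longrightarrow> sqint (\<lambda>x. cnj (f x))"
  by (rule sqint_bound[of f _ 1]) (auto simp: sqint_def intro!: borel_measurable_continuous_onI continuous_intros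
      measurable_compose[of f lebesgue borel cnj])

lemma cmod_add_square_le: "(cmod (a + b))\<^sup>2 \<le> 2 * (cmod a)\<^sup>2 + 2 * (cmod b)\<^sup>2"
proof -
  have "(cmod (a + b))\<^sup>2 \<le> (cmod a + cmod b)\<^sup>2" by (intro power_mono norm_triangle_ineq) simp
  also have "\<dots> \<le> 2 * (cmod a)\<^sup>2 + 2 * (cmod b)\<^sup>2"
    using sum_squares_bound[of "cmod a" "cmod b"] by (simp add: power2_sum)
  finally show ?thesis .
qed

lemma sqint_add:
  assumes "sqint f" "sqint g"
  shows "sqint (\<lambda>x. f x + g x)"
proof -
  have "integrable lebesgue (\<lambda>x. 2 * (cmod (f x))\<^sup>2 + 2 * (cmod (g x))\<^sup>2)"
    using assms by (simp add: sqint_def)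
  then have "integrable lebesgue (\<lambda>x. (cmod (f x + g x))\<^sup>2)"
    by (rule Bochner_Integration.integrable_bound)
      (use assms cmod_add_square_le in \<open>auto simp: sqint_def\<close>)
  then show ?thesis using assms[THEN sqint_measurable] by (simp add: sqint_def borel_measurable_add)
qed

lemma sqint_diff: "sqint f \<Longrightarrow> sqint g \<Longrightarrow> sqint (\<lambda>x. f x - g x)"
  using sqint_add[of f "\<lambda>x. - g x"] sqint_uminus[of g] by simp

lemma sqint_sum: "(\<And>i. i \<in> I \<Longrightarrow> sqint (f i)) \<Longrightarrow> sqint (\<lambda>x. \<Sum>i\<in>I. f i x)"
  by (induction I rule: infinite_finite_induct) (auto intro: sqint_add)

lemma integrable_sqint_mult:
  assumes "sqint f" "sqint g"
  shows "integrable lebesgue (\<lambda>x. f x * g x)"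
proof -
  have "integrable lebesgue (\<lambda>x. (cmod (f x))\<^sup>2 + (cmod (g x))\<^sup>2)"
    using assms by (simp add: sqint_def)
  then show ?thesis
  proof (rule Bochner_Integration.integrable_bound)
    show "AE x in lebesgue. cmod (f x * g x) \<le> norm ((cmod (f x))\<^sup>2 + (cmod (g x))\<^sup>2)"
    proof (rule AE_I2)
      fix x
      have "2 * (cmod (f x) * cmod (g x)) \<le> (cmod (f x))\<^sup>2 + (cmod (g x))\<^sup>2"
        using sum_squares_bound[of "cmod (f x)" "cmod (g x)"] by simp
      moreover have "0 \<le> cmod (f x) * cmod (g x)" by simp
      ultimately have "cmod (f x) * cmod (g x) \<le> (cmod (f x))\<^sup>2 + (cmod (g x))\<^sup>2" by linarith
      then show "cmod (f x * g x) \<le> norm ((cmod (f x))\<^sup>2 + (cmod (g x))\<^sup>2)" by (simp add: norm_mult)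
    qed
  qed (use assms in \<open>auto simp: sqint_def\<close>)
qed

lemma integrable_sqint_inner:
  assumes "sqint f" "sqint g"
  shows "integrable lebesgue (\<lambda>x. f x \<bullet> g x)"
proof -
  have eq: "(\<lambda>x. f x \<bullet> g x) = (\<lambda>x. Re (f x * cnj (g x)))" by (simp add: inner_complex_def fun_eq_iff)
  show ?thesis unfolding eq
    by (rule integrable_Re) (rule integrable_sqint_mult[OF assms(1) sqint_cnj[OF assms(2)]])
qed

text \<open>
  The inner product is the real part of the complex one.  The theory of closed relations above concerns real Hilbert
  spaces, and complex adjoints are recovered from real ones by multiplication with \<open>\<i>\<close>.
\<close>

quotient_type (overloaded) 'a L2 = "'a::euclidean_space \<Rightarrow> complex" /
  partial: "\<lambda>f g. sqint f \<and> sqint g \<and> (AE x in lebesgue. f x = g x)"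
proof (rule part_equivpI)
  show "\<exists>f::'a \<Rightarrow> complex. sqint f \<and> sqint f \<and> (AE x in lebesgue. f x = f x)"
    by (rule exI[of _ "\<lambda>x. 0"]) simp
  show "symp (\<lambda>(f::'a \<Rightarrow> complex) g. sqint f \<and> sqint g \<and> (AE x in lebesgue. f x = g x))"
    by (rule sympI) (auto elim: AE_mp)
  show "transp (\<lambda>(f::'a \<Rightarrow> complex) g. sqint f \<and> sqint g \<and> (AE x in lebesgue. f x = g x))"
  proof (rule transpI, elim conjE, intro conjI)
    fix f g h :: "'a \<Rightarrow> complex"
    assume "AE x in lebesgue. f x = g x" "AE x in lebesgue. g x = h x"
    then show "AE x in lebesgue. f x = h x" by eventually_elim simp
  qed
qed

instantiation L2 :: (euclidean_space) real_vector
begin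

lift_definition zero_L2 :: "'a L2" is "\<lambda>x. 0" by simp

lift_definition plus_L2 :: "'a L2 \<Rightarrow> 'a L2 \<Rightarrow> 'a L2" is "\<lambda>f g x. f x + g x"
proof (elim conjE, intro conjI sqint_add)
  fix f g h k :: "'a \<Rightarrow> complex"
  assume "AE x in lebesgue. f x = g x" "AE x in lebesgue. h x = k x"
  then show "AE x in lebesgue. f x + h x = g x + k x" by eventually_elim simp
qed

lift_definition uminus_L2 :: "'a L2 \<Rightarrow> 'a L2" is "\<lambda>f x. - f x"
  by (auto intro: sqint_uminus elim: AE_mp)

lift_definition minus_L2 :: "'a L2 \<Rightarrow> 'a L2 \<Rightarrow> 'a L2" is "\<lambda>f g x. f x - g x"
proof (elim conjE, intro conjI sqint_diff)
  fix f g h k :: "'a \<Rightarrow> complex"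
  assume "AE x in lebesgue. f x = g x" "AE x in lebesgue. h x = k x"
  then show "AE x in lebesgue. f x - h x = g x - k x" by eventually_elim simp
qed

lift_definition scaleR_L2 :: "real \<Rightarrow> 'a L2 \<Rightarrow> 'a L2" is "\<lambda>r f x. r *\<^sub>R f x"
  by (auto intro: sqint_scaleR elim: AE_mp)

instance
proof
  fix x y z :: "'a L2" and a b :: real
  show "x + y + z = x + (y + z)" by transfer (auto simp: add.assoc intro: sqint_add)
  show "x + y = y + x" by transfer (auto simp: add.commute intro: sqint_add)
  show "0 + x = x" by transfer auto
  show "- x + x = 0" by transfer auto
  show "x - y = x + - y" by transfer (auto intro: sqint_add sqint_diff sqint_uminus)
  show "a *\<^sub>R (x + y) = a *\<^sub>R x + a *\<^sub>R y"
    by transfer (simp add: scaleR_add_right sqint_add sqint_scaleR)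
  show "(a + b) *\<^sub>R x = a *\<^sub>R x + b *\<^sub>R x"
    by transfer (simp add: scaleR_add_left sqint_add sqint_scaleR)
  show "a *\<^sub>R b *\<^sub>R x = (a * b) *\<^sub>R x"
    by transfer (simp add: sqint_scaleR)
  show "1 *\<^sub>R x = x" by transfer simp
qed

end

instantiation L2 :: (euclidean_space) real_inner
begin

lift_definition inner_L2 :: "'a L2 \<Rightarrow> 'a L2 \<Rightarrow> real" is "\<lambda>f g. LINT x|lebesgue. f x \<bullet> g x"
proof (elim conjE)
  fix f g h k :: "'a \<Rightarrow> complex"
  assume m: "sqint f" "sqint g" "sqint h" "sqint k"
    and ae: "AE x in lebesgue. f x = g x" "AE x in lebesgue. h x = k x"
  show "(LINT x|lebesgue. f x \<bullet> h x) = (LINT x|lebesgue. g x \<bullet> k x)"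
  proof (rule integral_cong_AE)
    show "AE x in lebesgue. f x \<bullet> h x = g x \<bullet> k x" using ae by eventually_elim simp
  qed (use m integrable_sqint_inner borel_measurable_integrable in blast)+
qed

definition norm_L2 :: "'a L2 \<Rightarrow> real" where "norm_L2 x = sqrt (x \<bullet> x)"
definition dist_L2 :: "'a L2 \<Rightarrow> 'a L2 \<Rightarrow> real" where "dist_L2 x y = norm (x - y)"
definition sgn_L2 :: "'a L2 \<Rightarrow> 'a L2" where "sgn_L2 x = x /\<^sub>R norm x"
definition uniformity_L2 :: "('a L2 \<times> 'a L2) filter" where
  "uniformity_L2 = (INF e\<in>{0 <..}. principal {(x, y). dist x y < e})"
definition open_L2 :: "'a L2 set \<Rightarrow> bool" where
  "open_L2 U \<longleftrightarrow> (\<forall>x\<in>U. eventually (\<lambda>(x', y). x' = x \<longrightarrow> y \<in> U) uniformity)"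

instance
proof
  fix x y z :: "'a L2" and r :: real and U :: "'a L2 set"
  show "dist x y = norm (x - y)" by (simp add: dist_L2_def)
  show "sgn x = x /\<^sub>R norm x" by (simp add: sgn_L2_def)
  show "uniformity = (INF e\<in>{0 <..}. principal {(x :: 'a L2, y). dist x y < e})" by (rule uniformity_L2_def)
  show "open U \<longleftrightarrow> (\<forall>x\<in>U. \<forall>\<^sub>F (x', y) in uniformity. x' = x \<longrightarrow> y \<in> U)" by (rule open_L2_def)
  show "x \<bullet> y = y \<bullet> x" by transfer (simp add: inner_commute)
  show "(x + y) \<bullet> z = x \<bullet> z + y \<bullet> z"
    by transfer (simp add: inner_add_left integrable_sqint_inner)
  show "r *\<^sub>R x \<bullet> y = r * (x \<bullet> y)" by transfer simp
  show "0 \<le> x \<bullet> x" by transfer simp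
  show "(x \<bullet> x = 0) = (x = 0)"
  proof (transfer, elim conjE)
    fix f :: "'a \<Rightarrow> complex" assume f: "sqint f"
    have "((LINT x|lebesgue. f x \<bullet> f x) = 0) = (AE x in lebesgue. f x \<bullet> f x = 0)"
      by (rule integral_nonneg_eq_0_iff_AE) (use f integrable_sqint_inner in auto)
    then show "((LINT x|lebesgue. f x \<bullet> f x) = 0) = (sqint f \<and> sqint (\<lambda>x. 0) \<and> (AE x in lebesgue. f x = 0))"
      using f by simp
  qed
  show "norm x = sqrt (x \<bullet> x)" by (rule norm_L2_def)
qed

end

definition L2_class :: "('a::euclidean_space \<Rightarrow> complex) \<Rightarrow> 'a L2" where
  "L2_class f = abs_L2 f"

lemma L2_class_cases: obtains f where "sqint f" "x = L2_class f"
proof -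
  have "sqint (rep_L2 x)" using Quotient3_rep_reflp[OF Quotient3_L2, of x] by simp
  moreover have "x = L2_class (rep_L2 x)"
    unfolding L2_class_def by (rule Quotient3_abs_rep[OF Quotient3_L2, symmetric])
  ultimately show ?thesis using that by blast
qed

lemma L2_class_eq_iff:
  "sqint f \<Longrightarrow> sqint g \<Longrightarrow> L2_class f = L2_class g \<longleftrightarrow> (AE x in lebesgue. f x = g x)"
  using Quotient3_rel[OF Quotient3_L2, of f g] by (simp add: L2_class_def)

lemma L2_class_add: "sqint f \<Longrightarrow> sqint g \<Longrightarrow> L2_class f + L2_class g = L2_class (\<lambda>x. f x + g x)"
  unfolding L2_class_def by (rule plus_L2.abs_eq) auto

lemma L2_class_diff: "sqint f \<Longrightarrow> sqint g \<Longrightarrow> L2_class f - L2_class g = L2_class (\<lambda>x. f x - g x)"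
  unfolding L2_class_def by (rule minus_L2.abs_eq) auto

lemma L2_class_scaleR: "sqint f \<Longrightarrow> r *\<^sub>R L2_class f = L2_class (\<lambda>x. r *\<^sub>R f x)"
  unfolding L2_class_def by (rule scaleR_L2.abs_eq) auto

lemma L2_class_zero: "L2_class (\<lambda>x. 0) = 0"
  unfolding L2_class_def zero_L2_def by simp

lemma L2_class_inner: "sqint f \<Longrightarrow> sqint g \<Longrightarrow> L2_class f \<bullet> L2_class g = (LINT x|lebesgue. f x \<bullet> g x)"
  unfolding L2_class_def by (rule inner_L2.abs_eq) auto

lemma L2_class_norm: "sqint f \<Longrightarrow> (norm (L2_class f))\<^sup>2 = (LINT x|lebesgue. (cmod (f x))\<^sup>2)"
  by (simp add: power2_norm_eq_inner L2_class_inner)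

lemma ennreal_norm_L2_class:
  assumes "sqint f"
  shows "ennreal ((norm (L2_class f))\<^sup>2) = (\<integral>\<^sup>+x. ennreal ((cmod (f x))\<^sup>2) \<partial>lebesgue)"
  unfolding L2_class_norm[OF assms]
  by (rule nn_integral_eq_integral[symmetric]) (use assms in \<open>auto simp: sqint_def\<close>)

lemma sqint_iff_nn_integral:
  assumes "f \<in> borel_measurable lebesgue"
  shows "sqint f \<longleftrightarrow> (\<integral>\<^sup>+x. ennreal ((cmod (f x))\<^sup>2) \<partial>lebesgue) < \<infinity>"
proof -
  have m: "(\<lambda>x. (cmod (f x))\<^sup>2) \<in> borel_measurable lebesgue" using assms by measurable
  show ?thesis using assms by (simp add: sqint_def integrable_iff_bounded m)
qed

text \<open>
  The theorem of Riesz and Fischer.  Along a subsequence with summable increments the representatives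
  converge almost everywhere, because the sum of the moduli of the increments is square integrable;
  the lemma of Fatou identifies the pointwise limit as the limit in norm.
\<close>

lemma L2_fast_Cauchy_convergent:
  fixes X :: "nat \<Rightarrow> 'a::euclidean_space L2"
  assumes X: "\<And>n. norm (X (Suc n) - X n) \<le> (1/2) ^ n"
  shows "convergent X"
proof -
  have "\<exists>f. \<forall>n. sqint (f n) \<and> X n = L2_class (f n)"
    by (rule choice) (metis L2_class_cases)
  then obtain f where f: "\<And>n. sqint (f n)" "\<And>n. X n = L2_class (f n)" by blast
  have fm[measurable]: "f n \<in> borel_measurable lebesgue" for n using f(1) by (rule sqint_measurable)
  define d where "d n x = complex_of_real (cmod (f (Suc n) x - f n x))" for n x
  have d: "sqint (d n)" "norm (L2_class (d n)) \<le> (1/2) ^ n" for n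
  proof -
    have fd: "sqint (\<lambda>x. f (Suc n) x - f n x)" by (intro sqint_diff f)
    show dn: "sqint (d n)"
      by (rule sqint_bound[OF fd, of _ 1]) (auto simp: d_def[abs_def])
    have "(norm (L2_class (d n)))\<^sup>2 = (norm (X (Suc n) - X n))\<^sup>2"
      using dn fd by (simp add: L2_class_norm f L2_class_diff d_def)
    then have "norm (L2_class (d n)) = norm (X (Suc n) - X n)" by simp
    then show "norm (L2_class (d n)) \<le> (1/2) ^ n" using X by simp
  qed
  define g where "g n x = (\<Sum>k<n. cmod (f (Suc k) x - f k x))" for n x
  have g_eq: "complex_of_real (g n x) = (\<Sum>k<n. d k x)" for n x by (simp add: g_def d_def)
  have L2_sum: "sqint (\<lambda>x. \<Sum>k<n. d k x) \<and> norm (L2_class (\<lambda>x. \<Sum>k<n. d k x)) \<le> 2 - 2 * (1/2) ^ n" for n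
  proof (induction n)
    case 0
    then show ?case by (simp add: L2_class_zero)
  next
    case (Suc n)
    have "norm (L2_class (\<lambda>x. \<Sum>k<Suc n. d k x)) \<le> norm (L2_class (\<lambda>x. \<Sum>k<n. d k x)) + norm (L2_class (d n))"
      using L2_class_add[of "\<lambda>x. \<Sum>k<n. d k x" "d n"] Suc d(1)
        norm_triangle_ineq[of "L2_class (\<lambda>x. \<Sum>k<n. d k x)" "L2_class (d n)"] by simp
    also have "\<dots> \<le> (2 - 2 * (1/2) ^ n) + (1/2) ^ n" using Suc d(2) by (intro add_mono) auto
    finally show ?case using Suc d(1) by (auto intro: sqint_add)
  qed
  have g_int: "(\<integral>\<^sup>+x. ennreal ((g n x)\<^sup>2) \<partial>lebesgue) \<le> 4" for n
  proof -
    have "(\<integral>\<^sup>+x. ennreal ((g n x)\<^sup>2) \<partial>lebesgue) = ennreal ((norm (L2_class (\<lambda>x. \<Sum>k<n. d k x)))\<^sup>2)"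
      using ennreal_norm_L2_class[OF conjunct1[OF L2_sum]] by (simp flip: g_eq)
    also have "\<dots> \<le> ennreal (2\<^sup>2)"
    proof (intro ennreal_leI power_mono)
      show "norm (L2_class (\<lambda>x. \<Sum>k<n. d k x)) \<le> 2"
        using conjunct2[OF L2_sum[of n]] by (rule order_trans) simp
    qed simp
    finally show ?thesis by simp
  qed
  have gm[measurable]: "g n \<in> borel_measurable lebesgue" for n unfolding g_def[abs_def] by measurable
  have "(\<integral>\<^sup>+x. (SUP n. ennreal ((g n x)\<^sup>2)) \<partial>lebesgue) = (SUP n. \<integral>\<^sup>+x. ennreal ((g n x)\<^sup>2) \<partial>lebesgue)"
  proof (rule nn_integral_monotone_convergence_SUP)
    show "incseq (\<lambda>n x. ennreal ((g n x)\<^sup>2))"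
      by (rule incseq_SucI) (auto simp: le_fun_def g_def intro!: ennreal_leI power_mono sum_nonneg)
  qed measurable
  also have "\<dots> \<le> 4" by (rule SUP_least) (rule g_int)
  finally have "(\<integral>\<^sup>+x. (SUP n. ennreal ((g n x)\<^sup>2)) \<partial>lebesgue) \<noteq> \<infinity>"
    by (auto simp: top_unique)
  then have ae: "AE x in lebesgue. (SUP n. ennreal ((g n x)\<^sup>2)) \<noteq> \<infinity>"
    by (intro nn_integral_PInf_AE) measurable
  have conv: "convergent (\<lambda>n. f n x)" if fin: "(SUP n. ennreal ((g n x)\<^sup>2)) \<noteq> \<infinity>" for x
  proof -
    obtain B where B: "(SUP n. ennreal ((g n x)\<^sup>2)) = ennreal B" "0 \<le> B"
      using fin by (metis ennreal_cases infinity_ennreal_def)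
    have "(g n x)\<^sup>2 \<le> B" for n
      using SUP_upper[of n UNIV "\<lambda>n. ennreal ((g n x)\<^sup>2)"] B by (simp add: ennreal_le_iff)
    then have "g n x \<le> sqrt B" for n by (rule real_le_rsqrt)
    then have "summable (\<lambda>k. cmod (f (Suc k) x - f k x))"
      by (intro summableI_nonneg_bounded[where x = "sqrt B"]) (auto simp: g_def)
    then have "summable (\<lambda>k. f (Suc k) x - f k x)" by (rule summable_norm_cancel)
    then have "convergent (\<lambda>n. \<Sum>k<n. f (Suc k) x - f k x)" by (simp add: summable_iff_convergent)
    then have "convergent (\<lambda>n. f n x - f 0 x)" by (simp only: sum_lessThan_telescope[of "\<lambda>k. f k x"])
    then show ?thesis using convergent_diff_const_right_iff by blast
  qed
  define F where "F x = lim (\<lambda>n. f n x)" for x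
  have Fm[measurable]: "F \<in> borel_measurable lebesgue" unfolding F_def[abs_def] by measurable
  have F: "AE x in lebesgue. (\<lambda>n. f n x) \<longlonglongrightarrow> F x"
    using ae by eventually_elim (simp add: F_def conv convergent_LIMSEQ_iff[symmetric])
  have X_dist: "norm (X m - X n) \<le> 2 * (1/2) ^ n" if "n \<le> m" for m n
  proof -
    have "norm (X m - X n) \<le> 2 * (1/2) ^ n - 2 * (1/2) ^ m" using that
    proof (induction m rule: dec_induct)
      case (step m)
      have "norm (X (Suc m) - X n) \<le> norm (X (Suc m) - X m) + norm (X m - X n)"
        using norm_triangle_ineq[of "X (Suc m) - X m" "X m - X n"] by simp
      then show ?case using step.IH X[of m] by simp
    qed simp
    then show ?thesis by (rule order_trans) simp
  qed
  have F_dist: "(\<integral>\<^sup>+x. ennreal ((cmod (F x - f n x))\<^sup>2) \<partial>lebesgue) \<le> ennreal ((2 * (1/2) ^ n)\<^sup>2)" for n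
  proof -
    have "(\<integral>\<^sup>+x. ennreal ((cmod (F x - f n x))\<^sup>2) \<partial>lebesgue) =
        (\<integral>\<^sup>+x. liminf (\<lambda>m. ennreal ((cmod (f m x - f n x))\<^sup>2)) \<partial>lebesgue)"
    proof (rule nn_integral_cong_AE)
      show "AE x in lebesgue. ennreal ((cmod (F x - f n x))\<^sup>2) = liminf (\<lambda>m. ennreal ((cmod (f m x - f n x))\<^sup>2))"
        using F
      proof eventually_elim
        case (elim x)
        have "(\<lambda>m. ennreal ((cmod (f m x - f n x))\<^sup>2)) \<longlonglongrightarrow> ennreal ((cmod (F x - f n x))\<^sup>2)"
          by (intro tendsto_intros elim tendsto_ennrealI)
        then show ?case by (rule lim_imp_Liminf[OF trivial_limit_sequentially, symmetric])
      qed
    qed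
    also have "\<dots> \<le> liminf (\<lambda>m. \<integral>\<^sup>+x. ennreal ((cmod (f m x - f n x))\<^sup>2) \<partial>lebesgue)"
      by (rule nn_integral_liminf) measurable
    also have "\<dots> \<le> ennreal ((2 * (1/2) ^ n)\<^sup>2)"
    proof (rule Liminf_le)
      show "\<forall>\<^sub>F m in sequentially. (\<integral>\<^sup>+x. ennreal ((cmod (f m x - f n x))\<^sup>2) \<partial>lebesgue) \<le> ennreal ((2 * (1/2) ^ n)\<^sup>2)"
        using eventually_ge_at_top[of n]
      proof eventually_elim
        case (elim m)
        have "(\<integral>\<^sup>+x. ennreal ((cmod (f m x - f n x))\<^sup>2) \<partial>lebesgue) = ennreal ((norm (X m - X n))\<^sup>2)"
          using ennreal_norm_L2_class[OF sqint_diff[OF f(1) f(1)], of m n] by (simp add: f L2_class_diff)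
        also have "\<dots> \<le> ennreal ((2 * (1/2) ^ n)\<^sup>2)"
          using X_dist[OF elim] by (intro ennreal_leI power_mono) auto
        finally show ?case .
      qed
    qed simp
    finally show ?thesis .
  qed
  have sF: "sqint F"
  proof -
    have "(\<integral>\<^sup>+x. ennreal ((cmod (F x - f 0 x))\<^sup>2) \<partial>lebesgue) < \<infinity>"
      by (rule le_less_trans[OF F_dist]) simp
    moreover have "(\<lambda>x. F x - f 0 x) \<in> borel_measurable lebesgue" by measurable
    ultimately have "sqint (\<lambda>x. F x - f 0 x)" by (simp only: sqint_iff_nn_integral)
    from sqint_add[OF this f(1)[of 0]] show ?thesis by simp
  qed
  have bound: "norm (X n - L2_class F) \<le> 2 * (1/2) ^ n" for n
  proof -
    have "ennreal ((norm (L2_class F - X n))\<^sup>2) \<le> ennreal ((2 * (1/2) ^ n)\<^sup>2)"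
      using F_dist[of n] ennreal_norm_L2_class[OF sqint_diff[OF sF f(1)]] by (simp add: f L2_class_diff sF)
    then have "(norm (L2_class F - X n))\<^sup>2 \<le> (2 * (1/2) ^ n)\<^sup>2" by (simp add: ennreal_le_iff)
    then have "norm (L2_class F - X n) \<le> 2 * (1/2) ^ n" by (rule power2_le_imp_le) simp
    then show ?thesis by (simp add: norm_minus_commute)
  qed
  have "(\<lambda>n. 2 * (1/2 :: real) ^ n) \<longlonglongrightarrow> 2 * 0"
    by (intro tendsto_intros LIMSEQ_power_zero) simp
  then have "(\<lambda>n. 2 * (1/2 :: real) ^ n) \<longlonglongrightarrow> 0" by simp
  from Lim_null_comparison[OF always_eventually[OF allI] this, of "\<lambda>n. X n - L2_class F", OF bound]
  have "X \<longlonglongrightarrow> L2_class F" by (rule LIM_zero_cancel)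
  then show ?thesis by (rule convergentI)
qed

instance L2 :: (euclidean_space) complete_space
proof
  fix X :: "nat \<Rightarrow> 'a L2"
  assume C: "Cauchy X"
  have "\<exists>N. \<forall>m\<ge>N. \<forall>k\<ge>N. norm (X m - X k) < (1/2) ^ n" for n :: nat
    using CauchyD[OF C, of "(1/2) ^ n"] by simp
  then have "\<forall>n. \<exists>N. \<forall>m\<ge>N. \<forall>k\<ge>N. norm (X m - X k) < (1/2) ^ n" by blast
  from choice[OF this] obtain N
    where N: "\<And>n m k. m \<ge> N n \<Longrightarrow> k \<ge> N n \<Longrightarrow> norm (X m - X k) < (1/2) ^ n" by blast
  \<comment> \<open>the sum dominates every \<open>N k\<close>, and the summand \<open>n\<close> makes the sequence strictly increasing\<close>
  define r where "r n = (\<Sum>k\<le>n. N k) + n" for n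
  have r: "N n \<le> r n" "r n < r (Suc n)" for n
    by (simp_all add: r_def trans_le_add1 member_le_sum)
  have "strict_mono r" using r(2) by (rule strict_monoI_Suc)
  have "norm (X (r (Suc n)) - X (r n)) \<le> (1/2) ^ n" for n
    using N[of n "r (Suc n)" "r n"] r[of n] by (simp add: less_imp_le)
  then have "convergent (\<lambda>n. X (r n))" by (rule L2_fast_Cauchy_convergent)
  then obtain L where "(X \<circ> r) \<longlonglongrightarrow> L" by (auto simp: convergent_def comp_def)
  then have "X \<longlonglongrightarrow> L" using Cauchy_converges_subseq[OF C \<open>strict_mono r\<close>] by simp
  then show "convergent X" by (rule convergentI)
qed

section \<open>Integration by parts and Wirtinger derivatives\<close>

text \<open>
  For continuous functions this is compactness of the support, in a form that passes to products and derivatives.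
\<close>

definition csupp :: "('a::euclidean_space \<Rightarrow> 'b::zero) \<Rightarrow> bool" where
  "csupp f \<longleftrightarrow> (\<exists>r. \<forall>x. r < norm x \<longrightarrow> f x = 0)"

lemma csuppE:
  assumes "csupp f"
  obtains r where "0 < r" "\<And>x. r < norm x \<Longrightarrow> f x = 0"
proof -
  obtain r where "\<And>x. r < norm x \<Longrightarrow> f x = 0" using assms by (auto simp: csupp_def)
  then show ?thesis using that[of "max r 1"] by simp
qed

lemma csupp_subset: "csupp f \<Longrightarrow> (\<And>x. f x = 0 \<Longrightarrow> g x = 0) \<Longrightarrow> csupp g"
  unfolding csupp_def by blast

lemma csupp_mult1: "csupp f \<Longrightarrow> csupp (\<lambda>x. f x * g x :: 'b::mult_zero)"
  by (erule csupp_subset) simp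

lemma csupp_mult2: "csupp g \<Longrightarrow> csupp (\<lambda>x. f x * g x :: 'b::mult_zero)"
  by (erule csupp_subset) simp

lemma csupp_add: "csupp f \<Longrightarrow> csupp g \<Longrightarrow> csupp (\<lambda>x. f x + g x :: 'b::monoid_add)"
proof -
  assume "csupp f" "csupp g"
  then obtain r s where "\<And>x. r < norm x \<Longrightarrow> f x = 0" "\<And>x. s < norm x \<Longrightarrow> g x = 0"
    unfolding csupp_def by blast
  then have "\<forall>x. max r s < norm x \<longrightarrow> f x + g x = 0" by simp
  then show ?thesis unfolding csupp_def by blast
qed

lemma csupp_dird:
  assumes "csupp f"
  shows "csupp (dird b f)"
proof -
  obtain r where r: "0 < r" "\<And>x. r < norm x \<Longrightarrow> f x = 0" using csuppE[OF assms] by blast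
  have "dird b f x = 0" if "r < norm x" for x
  proof -
    have "(f has_derivative (\<lambda>h. 0)) (at x)"
    proof (rule has_derivative_transform_within_open[of "\<lambda>x. 0" "\<lambda>h. 0" x UNIV "- cball 0 r"])
      show "open (- cball (0::'a) r)" by (simp add: open_Compl)
    qed (use that r(2) in auto)
    from dird_eqI[OF this] show ?thesis by simp
  qed
  then show ?thesis unfolding csupp_def by blast
qed

lemma integrable_csupp:
  fixes f :: "'a::euclidean_space \<Rightarrow> 'b::euclidean_space"
  assumes "continuous_on UNIV f" "csupp f"
  shows "integrable lebesgue f"
proof -
  obtain r where r: "0 < r" "\<And>x. r < norm x \<Longrightarrow> f x = 0" using csuppE[OF assms(2)] by blast
  have "integrable lborel (\<lambda>x. indicator (cball 0 r) x *\<^sub>R f x)"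
    by (rule borel_integrable_compact) (use assms(1) continuous_on_subset in auto)
  moreover have "(\<lambda>x. indicator (cball 0 r) x *\<^sub>R f x) = f"
    using r(2) by (auto simp: fun_eq_iff indicator_def not_le)
  ultimately have "integrable lborel f" by simp
  then show ?thesis using integrable_completion[of f lborel] borel_measurable_integrable by blast
qed

lemma csupp_bounded:
  fixes f :: "'a::euclidean_space \<Rightarrow> 'b::real_normed_vector"
  assumes "continuous_on UNIV f" "csupp f"
  obtains B where "0 < B" "\<And>x. norm (f x) \<le> B"
proof -
  obtain r where r: "0 < r" "\<And>x. r < norm x \<Longrightarrow> f x = 0" using csuppE[OF assms(2)] by blast
  have "compact (f ` cball 0 r)"
    by (rule compact_continuous_image) (use assms(1) continuous_on_subset in auto)
  then obtain B where B: "0 < B" "\<And>y. y \<in> f ` cball 0 r \<Longrightarrow> norm y \<le> B"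
    using bounded_pos compact_imp_bounded by metis
  have "norm (f x) \<le> B" for x
    using B r(2)[of x] by (cases "norm x \<le> r") auto
  then show ?thesis using that B(1) by blast
qed

lemma LINT_translate:
  fixes f :: "'a::euclidean_space \<Rightarrow> 'b::euclidean_space"
  assumes f[measurable]: "f \<in> borel_measurable borel"
  shows "(LINT x|lebesgue. f (x + c)) = (LINT x|lebesgue. f x)"
proof -
  have "(LINT x|lebesgue. f (x + c)) = (LINT x|lborel. f (x + c))"
    by (rule integral_completion) measurable
  also have "\<dots> = (LINT x|distr lborel borel ((+) c). f x)"
    by (subst integral_distr) (auto simp: add.commute)
  also have "\<dots> = (LINT x|lborel. f x)" by (simp add: lborel_distr_plus)
  also have "\<dots> = (LINT x|lebesgue. f x)" by (rule integral_completion[symmetric]) measurable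
  finally show ?thesis .
qed

text \<open>
  By translation invariance the difference quotients of \<open>f\<close> integrate to zero, and by the mean value
  theorem they are dominated.
\<close>

lemma integral_dird_real:
  fixes f :: "'a::euclidean_space \<Rightarrow> real"
  assumes f: "Ck 1 f" "csupp f" and b: "b \<in> Basis"
  shows "(LINT x|lebesgue. dird b f x) = 0"
proof -
  have f1: "Ck (Suc 0) f" using f(1) by simp
  have d: "f differentiable (at x)" for x by (rule Ck_differentiable[OF f1])
  have cf: "continuous_on UNIV f" by (rule Ck_continuous[OF f1])
  have cd: "continuous_on UNIV (dird b f)" by (rule Ck_continuous[OF Ck_dird[OF f1 b]])
  obtain B where B: "0 < B" "\<And>x. norm (dird b f x) \<le> B" using csupp_bounded[OF cd csupp_dird[OF f(2)]] by blast
  obtain r where r: "0 < r" "\<And>x. r < norm x \<Longrightarrow> dird b f x = 0" using csuppE[OF csupp_dird[OF f(2)]] by blast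
  define t where "t n = 1 / real (Suc n)" for n
  have t: "0 < t n" "t n \<le> 1" for n by (auto simp: t_def)
  have tlim: "t \<longlonglongrightarrow> 0" unfolding t_def[abs_def] by (rule LIMSEQ_Suc[OF lim_1_over_n])
  define q where "q n x = (f (x + t n *\<^sub>R b) - f x) / t n" for n x
  have "\<exists>s. 0 < s \<and> s < t n \<and> q n x = dird b f (x + s *\<^sub>R b)" for n x
  proof -
    obtain s where "0 < s" "s < t n" "f (x + t n *\<^sub>R b) - f x = t n * dird b f (x + s *\<^sub>R b)"
      using dird_MVT[OF d t(1)] by blast
    then show ?thesis using t(1)[of n] by (auto simp: q_def intro!: exI[of _ s])
  qed
  then have "\<forall>n x. \<exists>s. 0 < s \<and> s < t n \<and> q n x = dird b f (x + s *\<^sub>R b)" by blast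
  have ex: "\<forall>p. \<exists>s. 0 < s \<and> s < t (fst p) \<and> q (fst p) (snd p) = dird b f (snd p + s *\<^sub>R b)"
    using \<open>\<forall>n x. \<exists>s. 0 < s \<and> s < t n \<and> q n x = dird b f (x + s *\<^sub>R b)\<close> by blast
  from choice[OF ex] obtain s where s0: "\<And>p. 0 < s p \<and> s p < t (fst p) \<and> q (fst p) (snd p) = dird b f (snd p + s p *\<^sub>R b)"
    by blast
  have s: "0 < s (n, x)" "s (n, x) < t n" "q n x = dird b f (x + s (n, x) *\<^sub>R b)" for n x
    using s0[of "(n, x)"] by simp_all
  have "(\<lambda>n. LINT x|lebesgue. q n x) \<longlonglongrightarrow> (LINT x|lebesgue. dird b f x)"
  proof (rule integral_dominated_convergence[where w = "\<lambda>x. B * indicator (cball 0 (r + 1)) x"])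
    show "dird b f \<in> borel_measurable lebesgue"
      using borel_measurable_continuous_onI[OF cd] by (simp add: measurable_completion)
    have "continuous_on UNIV (q n)" for n
    proof -
      have "continuous_on UNIV (\<lambda>x. f (x + t n *\<^sub>R b))"
        by (rule continuous_on_compose2[OF cf]) (auto intro: continuous_intros)
      then show ?thesis unfolding q_def[abs_def] using t(1)[of n] by (intro continuous_intros cf) auto
    qed
    from borel_measurable_continuous_onI[OF this] show "q n \<in> borel_measurable lebesgue" for n
      by (simp add: measurable_completion)
    show "integrable lebesgue (\<lambda>x. B * indicator (cball 0 (r + 1)) x :: real)"
      using lmeasurable_cball[of 0 "r + 1"] by (auto intro!: integrable_mult_right simp: fmeasurable_def)
    show "AE x in lebesgue. (\<lambda>n. q n x) \<longlonglongrightarrow> dird b f x"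
    proof (rule AE_I2)
      fix x
      have "(\<lambda>n. s (n, x)) \<longlonglongrightarrow> 0"
        by (rule tendsto_sandwich[OF _ _ tendsto_const tlim])
          (intro always_eventually allI less_imp_le s)+
      then have "(\<lambda>n. x + s (n, x) *\<^sub>R b) \<longlonglongrightarrow> x + 0 *\<^sub>R b" by (intro tendsto_intros)
      then have lim: "(\<lambda>n. x + s (n, x) *\<^sub>R b) \<longlonglongrightarrow> x" by simp
      have "isCont (dird b f) x" using cd by (simp add: continuous_on_eq_continuous_at)
      from isCont_tendsto_compose[OF this lim] show "(\<lambda>n. q n x) \<longlonglongrightarrow> dird b f x" unfolding s(3) .
    qed
    show "AE x in lebesgue. norm (q n x) \<le> B * indicator (cball 0 (r + 1)) x" for n
    proof (rule AE_I2)
      fix x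
      show "norm (q n x) \<le> B * indicator (cball 0 (r + 1)) x"
      proof (cases "norm x \<le> r + 1")
        case True
        then show ?thesis unfolding s(3) using B(2) by simp
      next
        case False
        have "norm x \<le> norm (x + s (n, x) *\<^sub>R b) + norm (s (n, x) *\<^sub>R b)"
          using norm_triangle_ineq4[of "x + s (n, x) *\<^sub>R b" "s (n, x) *\<^sub>R b"] by simp
        moreover have "norm (s (n, x) *\<^sub>R b) \<le> 1" using s(1,2)[of n x] t(2)[of n] b by simp
        ultimately have "r < norm (x + s (n, x) *\<^sub>R b)" using False by linarith
        then show ?thesis unfolding s(3) using r(2) B(1) by simp
      qed
    qed
  qed
  moreover have "(LINT x|lebesgue. q n x) = 0" for n
  proof -
    have fb: "f \<in> borel_measurable borel" by (rule borel_measurable_continuous_onI[OF cf])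
    have i1: "integrable lebesgue f" by (rule integrable_csupp[OF cf f(2)])
    have i2: "integrable lebesgue (\<lambda>x. f (x + t n *\<^sub>R b))"
    proof (rule integrable_csupp)
      show "continuous_on UNIV (\<lambda>x. f (x + t n *\<^sub>R b))"
        by (rule continuous_on_compose2[OF cf]) (auto intro: continuous_intros)
      obtain r' where r': "0 < r'" "\<And>x. r' < norm x \<Longrightarrow> f x = 0" using csuppE[OF f(2)] by blast
      have "f (x + t n *\<^sub>R b) = 0" if "r' + 1 < norm x" for x
      proof (rule r'(2))
        have "norm x \<le> norm (x + t n *\<^sub>R b) + norm (t n *\<^sub>R b)"
          using norm_triangle_ineq4[of "x + t n *\<^sub>R b" "t n *\<^sub>R b"] by simp
        moreover have "norm (t n *\<^sub>R b) \<le> 1" using t[of n] b by simp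
        ultimately show "r' < norm (x + t n *\<^sub>R b)" using that by linarith
      qed
      then show "csupp (\<lambda>x. f (x + t n *\<^sub>R b))" unfolding csupp_def by blast
    qed
    have "(LINT x|lebesgue. q n x) = ((LINT x|lebesgue. f (x + t n *\<^sub>R b)) - (LINT x|lebesgue. f x)) / t n"
      unfolding q_def by (simp add: Bochner_Integration.integral_diff[OF i2 i1])
    then show ?thesis using LINT_translate[OF fb] by simp
  qed
  ultimately have "(\<lambda>n. 0) \<longlonglongrightarrow> (LINT x|lebesgue. dird b f x)" by simp
  then show ?thesis by (simp add: LIMSEQ_const_iff)
qed

lemma integral_dird:
  fixes f :: "'a::euclidean_space \<Rightarrow> complex"
  assumes f: "Ck 1 f" "csupp f" and b: "b \<in> Basis"
  shows "(LINT x|lebesgue. dird b f x) = 0"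
proof -
  have f1: "Ck (Suc 0) f" using f(1) by simp
  have d: "f differentiable (at x)" for x by (rule Ck_differentiable[OF f1])
  have i: "integrable lebesgue (dird b f)"
    by (rule integrable_csupp[OF Ck_continuous[OF Ck_dird[OF f1 b]] csupp_dird[OF f(2)]])
  have *: "(LINT x|lebesgue. L (dird b f x)) = 0" if L: "bounded_linear L" for L :: "complex \<Rightarrow> real"
  proof -
    have "(LINT x|lebesgue. dird b (\<lambda>x. L (f x)) x) = 0"
    proof (rule integral_dird_real[OF Ck_bounded_linear[OF L f(1)] _ b])
      show "csupp (\<lambda>x. L (f x))"
        by (rule csupp_subset[OF f(2)]) (simp add: linear_0 bounded_linear.linear[OF L])
    qed
    then show ?thesis by (simp add: dird_bounded_linear[OF L d])
  qed
  show ?thesis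
    using *[OF bounded_linear_Re] *[OF bounded_linear_Im] integral_Re[OF i] integral_Im[OF i]
    by (simp add: complex_eq_iff)
qed

text \<open>
  The values \<open>s = \<i>\<close> and \<open>s = - \<i>\<close> give \<open>d_zbar\<close> and \<open>d_z\<close>; conjugation exchanges them.
\<close>

definition wirt :: "complex \<Rightarrow> 'n::finite \<Rightarrow> (complex ^ 'n \<Rightarrow> complex) \<Rightarrow> complex ^ 'n \<Rightarrow> complex" where
  "wirt s j f z = (dird (axis j 1) f z + s * dird (axis j \<i>) f z) / 2"

lemma d_z_wirt: "d_z j f = wirt (- \<i>) j f"
  by (rule ext) (simp add: d_z_def wirt_def dird_def)

lemma d_zbar_wirt: "d_zbar j f = wirt \<i> j f"
  by (rule ext) (simp add: d_zbar_def wirt_def dird_def)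

lemma axis_Basis: "axis j 1 \<in> (Basis :: (complex ^ 'n) set)" "axis j \<i> \<in> (Basis :: (complex ^ 'n) set)"
  by (auto simp: Basis_vec_def Basis_complex_def)

lemma wirt_add: "f differentiable (at z) \<Longrightarrow> g differentiable (at z) \<Longrightarrow> wirt s j (\<lambda>z. f z + g z) z = wirt s j f z + wirt s j g z"
  by (simp add: wirt_def dird_add algebra_simps add_divide_distrib)

lemma wirt_mult:
  "f differentiable (at z) \<Longrightarrow> g differentiable (at z) \<Longrightarrow> wirt s j (\<lambda>z. f z * g z) z = f z * wirt s j g z + wirt s j f z * g z"
  by (simp add: wirt_def dird_mult algebra_simps add_divide_distrib)

lemma wirt_const [simp]: "wirt s j (\<lambda>z. c) = (\<lambda>z. 0)"
  by (rule ext) (simp add: wirt_def)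

lemma wirt_uminus: "f differentiable (at z) \<Longrightarrow> wirt s j (\<lambda>z. - f z) z = - wirt s j f z"
  using wirt_mult[of "\<lambda>z. - 1" z f s j] by simp

lemma wirt_diff: "f differentiable (at z) \<Longrightarrow> g differentiable (at z) \<Longrightarrow> wirt s j (\<lambda>z. f z - g z) z = wirt s j f z - wirt s j g z"
  using wirt_add[of f z "\<lambda>z. - g z" s j] wirt_uminus[of g z s j] by simp

lemma wirt_cnj:
  assumes "f differentiable (at z)"
  shows "wirt s j (\<lambda>z. cnj (f z)) z = cnj (wirt (cnj s) j f z)"
  by (simp add: wirt_def dird_bounded_linear[OF bounded_linear_cnj assms])

lemma Ck_wirt:
  assumes "Ck (Suc k) f"
  shows "Ck k (wirt s j f)"
proof -
  have "Ck k (\<lambda>z. (1 / 2) * (dird (axis j 1) f z + s * dird (axis j \<i>) f z))"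
    by (intro Ck_mult Ck_add Ck_const Ck_dird[OF assms] axis_Basis)
  then show ?thesis by (simp add: wirt_def[abs_def])
qed

lemma csupp_wirt:
  assumes "csupp f"
  shows "csupp (wirt s j f)"
proof -
  have "csupp (\<lambda>z. dird (axis j 1) f z + s * dird (axis j \<i>) f z)"
    by (intro csupp_add csupp_mult2 csupp_dird assms)
  then show ?thesis by (rule csupp_subset) (simp add: wirt_def)
qed

lemma wirt_commute:
  assumes "Ck 2 f"
  shows "wirt s j (wirt t k f) z = wirt t k (wirt s j f) z"
proof -
  have f2: "Ck (Suc (Suc 0)) f" using assms by (simp only: numeral_2_eq_2)
  have d: "dird b f differentiable (at z)" if "b \<in> Basis" for b z
    by (rule Ck_differentiable[OF Ck_dird[OF f2 that]])
  have expand: "dird b (wirt t k f) z = (dird b (dird (axis k 1) f) z + t * dird b (dird (axis k \<i>) f) z) / 2" for b t k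
  proof -
    have 1: "(\<lambda>z. t * dird (axis k \<i>) f z) differentiable (at z)"
      using d[OF axis_Basis(2)] by (intro differentiable_mult) auto
    have "dird b (wirt t k f) z = dird b (\<lambda>z. (1 / 2) * (dird (axis k 1) f z + t * dird (axis k \<i>) f z)) z"
      by (simp add: wirt_def[abs_def])
    also have "\<dots> = (1 / 2) * dird b (\<lambda>z. dird (axis k 1) f z + t * dird (axis k \<i>) f z) z"
      by (subst dird_mult) (use d[OF axis_Basis(1)] 1 in auto)
    also have "dird b (\<lambda>z. dird (axis k 1) f z + t * dird (axis k \<i>) f z) z =
        dird b (dird (axis k 1) f) z + dird b (\<lambda>z. t * dird (axis k \<i>) f z) z"
      by (rule dird_add[OF d[OF axis_Basis(1)] 1])
    also have "dird b (\<lambda>z. t * dird (axis k \<i>) f z) z = t * dird b (dird (axis k \<i>) f) z"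
      by (subst dird_mult) (use d[OF axis_Basis(2)] in auto)
    finally show ?thesis by simp
  qed
  show ?thesis
    unfolding wirt_def[of s j "wirt t k f"] wirt_def[of t k "wirt s j f"] expand
    by (simp add: dird_commute[OF assms axis_Basis(1) axis_Basis(1), of k j]
        dird_commute[OF assms axis_Basis(2) axis_Basis(1), of k j]
        dird_commute[OF assms axis_Basis(1) axis_Basis(2), of k j]
        dird_commute[OF assms axis_Basis(2) axis_Basis(2), of k j] algebra_simps add_divide_distrib)
qed

lemma integral_wirt:
  assumes f: "Ck 1 f" "csupp f"
  shows "(LINT z|lebesgue. wirt s j f z) = 0"
proof -
  have f1: "Ck (Suc 0) f" using f(1) by simp
  have i: "integrable lebesgue (dird b f)" if "b \<in> Basis" for b
    by (rule integrable_csupp[OF Ck_continuous[OF Ck_dird[OF f1 that]] csupp_dird[OF f(2)]])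
  have "(LINT z|lebesgue. wirt s j f z) =
      ((LINT z|lebesgue. dird (axis j 1) f z) + s * (LINT z|lebesgue. dird (axis j \<i>) f z)) / 2"
    unfolding wirt_def using i[OF axis_Basis(1)[of j]] i[OF axis_Basis(2)[of j]] by simp
  then show ?thesis by (simp add: integral_dird[OF f axis_Basis(1)] integral_dird[OF f axis_Basis(2)])
qed

lemma integral_wirt_parts:
  assumes f: "Ck 1 f" and g: "Ck 1 g" and c: "csupp f \<or> csupp g"
  shows "(LINT z|lebesgue. f z * wirt s j g z) = - (LINT z|lebesgue. wirt s j f z * g z)"
proof -
  have f1: "Ck (Suc 0) f" "Ck (Suc 0) g" using f g by simp_all
  have d: "f differentiable (at z)" "g differentiable (at z)" for z
    using f1 Ck_differentiable by blast+
  have c1: "csupp (\<lambda>z. f z * g z)" using c by (auto intro: csupp_mult1 csupp_mult2)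
  have c2: "csupp (\<lambda>z. f z * wirt s j g z)" "csupp (\<lambda>z. wirt s j f z * g z)"
    using c by (auto intro: csupp_mult1 csupp_mult2 csupp_wirt)
  have i: "integrable lebesgue (\<lambda>z. f z * wirt s j g z)" "integrable lebesgue (\<lambda>z. wirt s j f z * g z)"
    by (intro integrable_csupp c2 continuous_intros Ck_continuous[OF f] Ck_continuous[OF g]
        Ck_continuous[OF Ck_wirt[OF f1(1)]] Ck_continuous[OF Ck_wirt[OF f1(2)]])+
  have "0 = (LINT z|lebesgue. wirt s j (\<lambda>z. f z * g z) z)"
    by (rule integral_wirt[OF Ck_mult[OF f g] c1, symmetric])
  also have "\<dots> = (LINT z|lebesgue. f z * wirt s j g z + wirt s j f z * g z)" by (simp add: wirt_mult d)
  also have "\<dots> = (LINT z|lebesgue. f z * wirt s j g z) + (LINT z|lebesgue. wirt s j f z * g z)"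
    by (rule Bochner_Integration.integral_add[OF i])
  finally show ?thesis by (simp add: eq_neg_iff_add_eq_0)
qed

section \<open>The weighted commutator identity\<close>

text \<open>
  The operator \<open>\<delta>\<^sub>k\<close>, whose negative is the adjoint of \<open>d_zbar k\<close> for the weight \<open>exp (- \<psi>)\<close>.
\<close>

definition dstar :: "(complex ^ 'n \<Rightarrow> real) \<Rightarrow> 'n::finite \<Rightarrow> (complex ^ 'n \<Rightarrow> complex) \<Rightarrow> complex ^ 'n \<Rightarrow> complex" where
  "dstar \<psi> k f z = d_z k f z - d_z k (\<lambda>w. complex_of_real (\<psi> w)) z * f z"

definition wt :: "(complex ^ 'n::finite \<Rightarrow> real) \<Rightarrow> complex ^ 'n \<Rightarrow> complex" where
  "wt \<psi> z = complex_of_real (exp (- \<psi> z))"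

lemma Ck_of_real: "Ck k \<psi> \<Longrightarrow> Ck k (\<lambda>w. complex_of_real (\<psi> w))"
  by (rule Ck_bounded_linear[OF bounded_linear_of_real])

lemma Ck_wt: "Ck k \<psi> \<Longrightarrow> Ck k (wt \<psi>)"
  unfolding wt_def[abs_def] by (intro Ck_of_real Ck_exp Ck_uminus)

lemma wirt_wt:
  assumes "\<psi> differentiable (at z)"
  shows "wirt s k (wt \<psi>) z = - wirt s k (\<lambda>w. complex_of_real (\<psi> w)) z * wt \<psi> z"
proof -
  have d: "(\<lambda>w. - \<psi> w) differentiable (at z)" using assms by simp
  have m: "dird b (\<lambda>w. - \<psi> w) z = - dird b \<psi> z" for b
    by (rule dird_bounded_linear[OF bounded_linear_minus[OF bounded_linear_ident] assms])
  have "dird b (wt \<psi>) z = - complex_of_real (dird b \<psi> z) * wt \<psi> z" for b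
    unfolding wt_def[abs_def]
    by (subst dird_bounded_linear[OF bounded_linear_of_real dird_exp(2)[OF d]]) (simp add: dird_exp(1)[OF d] m)
  moreover have "dird b (\<lambda>w. complex_of_real (\<psi> w)) z = complex_of_real (dird b \<psi> z)" for b
    by (rule dird_bounded_linear[OF bounded_linear_of_real assms])
  ultimately show ?thesis by (simp add: wirt_def algebra_simps)
qed

lemma dstar_adjoint:
  assumes \<psi>: "Ck 1 \<psi>" and f: "Ck 1 f" and h: "Ck 1 h" and c: "csupp f \<or> csupp h"
  shows "(LINT z|lebesgue. dstar \<psi> k f z * cnj (h z) * wt \<psi> z) =
     - (LINT z|lebesgue. f z * cnj (d_zbar k h z) * wt \<psi> z)"
proof -
  have s: "Ck (Suc 0) \<psi>" "Ck (Suc 0) f" "Ck (Suc 0) h" using assms by simp_all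
  have d: "\<psi> differentiable (at z)" "f differentiable (at z)" "h differentiable (at z)" "wt \<psi> differentiable (at z)" for z
    using s Ck_differentiable Ck_wt[OF s(1)] by blast+
  have "dstar \<psi> k f z * cnj (h z) * wt \<psi> z = wirt (- \<i>) k (\<lambda>z. f z * wt \<psi> z) z * cnj (h z)" for z
    by (simp add: wirt_mult d wirt_wt dstar_def d_z_wirt algebra_simps)
  then have "(LINT z|lebesgue. dstar \<psi> k f z * cnj (h z) * wt \<psi> z) =
      (LINT z|lebesgue. wirt (- \<i>) k (\<lambda>z. f z * wt \<psi> z) z * cnj (h z))" by (simp only:)
  also have "\<dots> = - (LINT z|lebesgue. (f z * wt \<psi> z) * wirt (- \<i>) k (\<lambda>z. cnj (h z)) z)"
  proof -
    have "csupp (\<lambda>z. f z * wt \<psi> z) \<or> csupp (\<lambda>z. cnj (h z))"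
      using c csupp_mult1[of f "wt \<psi>"] csupp_subset[of h "\<lambda>z. cnj (h z)"] by auto
    then show ?thesis
      using integral_wirt_parts[OF Ck_mult[OF f Ck_wt[OF \<psi>]] Ck_bounded_linear[OF bounded_linear_cnj h], of "- \<i>" k]
      by simp
  qed
  also have "(\<lambda>z. (f z * wt \<psi> z) * wirt (- \<i>) k (\<lambda>z. cnj (h z)) z) = (\<lambda>z. f z * cnj (d_zbar k h z) * wt \<psi> z)"
    by (rule ext) (simp add: wirt_cnj d d_zbar_wirt)
  finally show ?thesis .
qed

lemma cnj_levi_matrix:
  fixes \<psi> :: "complex ^ 'n::finite \<Rightarrow> real"
  assumes "Ck 2 \<psi>"
  shows "cnj (levi_matrix \<psi> z $ k $ j) = wirt \<i> k (wirt (- \<i>) j (\<lambda>w. complex_of_real (\<psi> w))) z"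
proof -
  define p where "p = (\<lambda>w. complex_of_real (\<psi> w))"
  have "Ck (Suc (Suc 0)) \<psi>" using assms by (simp only: numeral_2_eq_2)
  then have p: "Ck (Suc (Suc 0)) p" unfolding p_def by (rule Ck_of_real)
  have "wirt (- \<i>) j p = (\<lambda>z. cnj (wirt \<i> j p z))"
  proof
    fix z show "wirt (- \<i>) j p z = cnj (wirt \<i> j p z)"
      using wirt_cnj[OF Ck_differentiable[OF p], of "- \<i>" j z] by (simp add: p_def)
  qed
  then have "wirt \<i> k (wirt (- \<i>) j p) z = wirt \<i> k (\<lambda>z. cnj (wirt \<i> j p z)) z" by simp
  also have "\<dots> = cnj (wirt (- \<i>) k (wirt \<i> j p) z)"
    by (simp add: wirt_cnj Ck_differentiable[OF Ck_wirt[OF p]])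
  finally show ?thesis by (simp add: levi_matrix_def d_z_wirt d_zbar_wirt p_def)
qed

lemma levi_matrix_hermitian:
  assumes "Ck 2 \<psi>"
  shows "hermitian (levi_matrix \<psi> z)"
proof -
  have "levi_matrix \<psi> z $ j $ k = cnj (levi_matrix \<psi> z $ k $ j)" for j k
    unfolding cnj_levi_matrix[OF assms] wirt_commute[OF Ck_of_real[OF assms], of \<i>]
    by (simp add: levi_matrix_def d_z_wirt d_zbar_wirt)
  then show ?thesis unfolding hermitian_def by blast
qed

text \<open>
  Moving both adjoint operators to the other side produces the operators \<open>d_zbar k\<close> and \<open>\<delta>\<^sub>j\<close> in the wrong order, and
  their commutator is multiplication by an entry of the Levi matrix.
\<close>

theorem weighted_commutator:
  fixes \<psi> :: "complex ^ 'n::finite \<Rightarrow> real"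
  assumes \<psi>: "Ck 2 \<psi>" and f: "Ck 2 f" "csupp f" and g: "Ck 2 g" "csupp g"
  shows "(LINT z|lebesgue. dstar \<psi> k f z * cnj (dstar \<psi> j g z) * wt \<psi> z) =
    (LINT z|lebesgue. d_zbar j f z * cnj (d_zbar k g z) * wt \<psi> z) +
    (LINT z|lebesgue. levi_matrix \<psi> z $ k $ j * (f z * cnj (g z)) * wt \<psi> z)"
proof -
  have s: "Ck (Suc (Suc 0)) \<psi>" "Ck (Suc (Suc 0)) f" "Ck (Suc (Suc 0)) g"
    using assms by (simp_all only: numeral_2_eq_2)
  have one: "Ck 1 \<psi>" "Ck 1 f" "Ck 1 g" using Ck_SucD[OF s(1)] Ck_SucD[OF s(2)] Ck_SucD[OF s(3)] by simp_all
  define p where "p = (\<lambda>w. complex_of_real (\<psi> w))"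
  have p: "Ck (Suc (Suc 0)) p" unfolding p_def by (rule Ck_of_real[OF s(1)])
  have k1: "Ck 1 (wirt t i h)" if "Ck (Suc (Suc 0)) h" for t i h
    using Ck_wirt[OF that, of t i] by simp
  have d0: "h differentiable (at z)" if "Ck (Suc (Suc 0)) h" for h :: "complex ^ 'n \<Rightarrow> complex" and z
    by (rule Ck_differentiable[OF that])
  have d1: "wirt t i h differentiable (at z)" if "Ck (Suc (Suc 0)) h" for t i h z
    by (rule Ck_differentiable[OF Ck_wirt[OF that]])
  have ds: "dstar \<psi> j g = (\<lambda>z. wirt (- \<i>) j g z - wirt (- \<i>) j p z * g z)"
    by (rule ext) (simp add: dstar_def d_z_wirt p_def)
  have ck: "Ck 1 (dstar \<psi> j g)" unfolding ds by (intro Ck_diff Ck_mult k1 s p one)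
  have comm: "d_zbar k (dstar \<psi> j g) z = dstar \<psi> j (d_zbar k g) z - cnj (levi_matrix \<psi> z $ k $ j) * g z" for z
  proof -
    have "d_zbar k (dstar \<psi> j g) z = wirt \<i> k (wirt (- \<i>) j g) z
        - (wirt (- \<i>) j p z * wirt \<i> k g z + wirt \<i> k (wirt (- \<i>) j p) z * g z)"
    proof -
      have "(\<lambda>z. wirt (- \<i>) j p z * g z) differentiable (at z)"
        using d1[OF p] d0[OF s(3)] by (rule differentiable_mult)
      then show ?thesis unfolding d_zbar_wirt ds
        by (simp add: wirt_diff wirt_mult d0[OF s(3)] d1[OF p] d1[OF s(3)])
    qed
    moreover have "cnj (levi_matrix \<psi> z $ k $ j) = wirt \<i> k (wirt (- \<i>) j p) z"
      unfolding p_def by (rule cnj_levi_matrix[OF \<psi>])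
    moreover have "wirt \<i> k (wirt (- \<i>) j g) z = wirt (- \<i>) j (wirt \<i> k g) z" by (rule wirt_commute[OF g(1)])
    ultimately show ?thesis by (simp add: dstar_def d_z_wirt d_zbar_wirt p_def)
  qed
  have cW: "continuous_on UNIV (wt \<psi>)" by (rule Ck_continuous[OF Ck_wt[OF \<psi>]])
  have cf: "continuous_on UNIV f" "continuous_on UNIV g" using f g Ck_continuous by blast+
  have cL: "continuous_on UNIV (\<lambda>z. levi_matrix \<psi> z $ k $ j)"
    using Ck_continuous[OF Ck_wirt[OF Ck_wirt[OF p]], of "- \<i>" k \<i> j]
    by (simp add: levi_matrix_def d_z_wirt d_zbar_wirt p_def)
  have ckg: "Ck (Suc 0) (d_zbar k g)" using k1[OF s(3)] by (simp add: d_zbar_wirt)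
  have cD: "continuous_on UNIV (dstar \<psi> j (d_zbar k g))"
    unfolding dstar_def[abs_def] d_z_wirt
    using Ck_continuous[OF Ck_wirt[OF ckg]] Ck_continuous[OF k1[OF p]] Ck_continuous[OF ckg]
    by (intro continuous_intros) (auto simp: p_def)
  have "(LINT z|lebesgue. dstar \<psi> k f z * cnj (dstar \<psi> j g z) * wt \<psi> z) =
      - (LINT z|lebesgue. f z * cnj (d_zbar k (dstar \<psi> j g) z) * wt \<psi> z)"
    by (rule dstar_adjoint[OF one(1,2) ck]) (use f in simp)
  also have "\<dots> = - (LINT z|lebesgue. f z * cnj (dstar \<psi> j (d_zbar k g) z) * wt \<psi> z
      - levi_matrix \<psi> z $ k $ j * (f z * cnj (g z)) * wt \<psi> z)"
    unfolding comm by (simp add: algebra_simps)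
  also have "\<dots> = - (LINT z|lebesgue. f z * cnj (dstar \<psi> j (d_zbar k g) z) * wt \<psi> z)
      + (LINT z|lebesgue. levi_matrix \<psi> z $ k $ j * (f z * cnj (g z)) * wt \<psi> z)"
  proof (subst Bochner_Integration.integral_diff)
    show "integrable lebesgue (\<lambda>z. f z * cnj (dstar \<psi> j (d_zbar k g) z) * wt \<psi> z)"
      by (intro integrable_csupp csupp_mult1 f continuous_intros cf cD cW)
    show "integrable lebesgue (\<lambda>z. levi_matrix \<psi> z $ k $ j * (f z * cnj (g z)) * wt \<psi> z)"
      by (intro integrable_csupp csupp_mult1[of "\<lambda>z. levi_matrix \<psi> z $ k $ j * (f z * cnj (g z))"]
          csupp_mult2[of "\<lambda>z. f z * cnj (g z)"] csupp_mult1[of f] f continuous_intros cf cL cW)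
  qed simp
  also have "- (LINT z|lebesgue. f z * cnj (dstar \<psi> j (d_zbar k g) z) * wt \<psi> z) =
      (LINT z|lebesgue. d_zbar j f z * cnj (d_zbar k g z) * wt \<psi> z)"
  proof -
    have a: "(LINT z|lebesgue. dstar \<psi> j (d_zbar k g) z * cnj (f z) * wt \<psi> z) =
        - (LINT z|lebesgue. d_zbar k g z * cnj (d_zbar j f z) * wt \<psi> z)"
      by (rule dstar_adjoint[OF one(1) _ one(2)]) (use ckg f in auto)
    have "f z * cnj (dstar \<psi> j (d_zbar k g) z) * wt \<psi> z = cnj (dstar \<psi> j (d_zbar k g) z * cnj (f z) * wt \<psi> z)" for z
      by (simp add: wt_def)
    then have "(LINT z|lebesgue. f z * cnj (dstar \<psi> j (d_zbar k g) z) * wt \<psi> z) =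
        cnj (LINT z|lebesgue. dstar \<psi> j (d_zbar k g) z * cnj (f z) * wt \<psi> z)"
      by (simp only: Bochner_Integration.integral_cnj)
    also have "\<dots> = - (LINT z|lebesgue. cnj (d_zbar k g z * cnj (d_zbar j f z) * wt \<psi> z))"
      unfolding a by (simp only: complex_cnj_minus Bochner_Integration.integral_cnj)
    finally show ?thesis by (simp add: wt_def mult_ac)
  qed
  finally show ?thesis .
qed

section \<open>The Levi form of a plurisubharmonic function\<close>

lemma vec_complex_expand: "h = (\<Sum>k\<in>UNIV. Re (h $ k) *\<^sub>R axis k 1 + Im (h $ k) *\<^sub>R axis k \<i>)"
  for h :: "complex ^ 'n"
proof -
  have "h $ i = (\<Sum>k\<in>UNIV. Re (h $ k) *\<^sub>R axis k 1 + Im (h $ k) *\<^sub>R axis k \<i>) $ i" for i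
  proof -
    have "(Re (h $ k) *\<^sub>R axis k 1 + Im (h $ k) *\<^sub>R axis k \<i>) $ i = (if k = i then h $ i else 0)" for k
      by (auto simp: axis_def complex_eq_iff)
    then show ?thesis by (simp only: sum_component) simp
  qed
  then show ?thesis unfolding vec_eq_iff by blast
qed

lemma dird_expand:
  fixes f :: "complex ^ 'n \<Rightarrow> 'b::real_normed_vector"
  assumes "f differentiable (at x)"
  shows "dird h f x = (\<Sum>k\<in>UNIV. Re (h $ k) *\<^sub>R dird (axis k 1) f x + Im (h $ k) *\<^sub>R dird (axis k \<i>) f x)"
proof -
  have lin: "linear (frechet_derivative f (at x))" using assms by (rule linear_frechet_derivative)
  have "dird h f x = frechet_derivative f (at x) (\<Sum>k\<in>UNIV. Re (h $ k) *\<^sub>R axis k 1 + Im (h $ k) *\<^sub>R axis k \<i>)"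
    unfolding dird_def using vec_complex_expand[of h] by simp
  then show ?thesis by (simp add: dird_def linear_sum[OF lin] linear_add[OF lin] linear_cmul[OF lin])
qed

text \<open>
  The second derivative in the direction \<open>h\<close>, written in the real coordinates, which shows its joint continuity in
  the point and the direction.
\<close>

definition hess :: "(complex ^ 'n \<Rightarrow> real) \<Rightarrow> complex ^ 'n::finite \<Rightarrow> complex ^ 'n \<Rightarrow> real" where
  "hess \<phi> x h = (\<Sum>k\<in>UNIV. \<Sum>j\<in>UNIV.
      Re (h $ k) * Re (h $ j) * dird (axis k 1) (dird (axis j 1) \<phi>) x
    + Re (h $ k) * Im (h $ j) * dird (axis k 1) (dird (axis j \<i>) \<phi>) x
    + Im (h $ k) * Re (h $ j) * dird (axis k \<i>) (dird (axis j 1) \<phi>) x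
    + Im (h $ k) * Im (h $ j) * dird (axis k \<i>) (dird (axis j \<i>) \<phi>) x)"

lemma dird_sum:
  assumes "\<And>i. i \<in> I \<Longrightarrow> f i differentiable (at x)"
  shows "dird b (\<lambda>x. \<Sum>i\<in>I. f i x) x = (\<Sum>i\<in>I. dird b (f i) x) \<and> (\<lambda>x. \<Sum>i\<in>I. f i x) differentiable (at x)"
  using assms
proof (induction I rule: infinite_finite_induct)
  case (insert i F)
  then have "f i differentiable (at x)" "(\<lambda>x. \<Sum>i\<in>F. f i x) differentiable (at x)" by auto
  then show ?case using insert by (simp add: dird_add)
qed auto

lemma dird_dird_hess:
  fixes \<phi> :: "complex ^ 'n::finite \<Rightarrow> real"
  assumes "Ck 2 \<phi>"
  shows "dird h (dird h \<phi>) x = hess \<phi> x h" "dird h \<phi> differentiable (at x)"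
proof -
  have c: "Ck (Suc (Suc 0)) \<phi>" using assms by (simp only: numeral_2_eq_2)
  have d0: "\<phi> differentiable (at x)" for x by (rule Ck_differentiable[OF c])
  have d1: "dird (axis k 1) \<phi> differentiable (at x)" "dird (axis k \<i>) \<phi> differentiable (at x)" for k x
    by (rule Ck_differentiable[OF Ck_dird[OF c axis_Basis(1)]])
      (rule Ck_differentiable[OF Ck_dird[OF c axis_Basis(2)]])
  have e: "dird h \<phi> = (\<lambda>x. \<Sum>j\<in>UNIV. Re (h $ j) * dird (axis j 1) \<phi> x + Im (h $ j) * dird (axis j \<i>) \<phi> x)"
    by (rule ext, subst dird_expand[OF d0]) simp
  have t: "(\<lambda>x. Re (h $ j) * dird (axis j 1) \<phi> x + Im (h $ j) * dird (axis j \<i>) \<phi> x) differentiable (at x)"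
    "dird b (\<lambda>x. Re (h $ j) * dird (axis j 1) \<phi> x + Im (h $ j) * dird (axis j \<i>) \<phi> x) x =
      Re (h $ j) * dird b (dird (axis j 1) \<phi>) x + Im (h $ j) * dird b (dird (axis j \<i>) \<phi>) x" for b j x
  proof -
    have m: "(\<lambda>x. Re (h $ j) * dird (axis j 1) \<phi> x) differentiable (at x)"
      "(\<lambda>x. Im (h $ j) * dird (axis j \<i>) \<phi> x) differentiable (at x)"
      by (intro differentiable_mult d1 differentiable_const)+
    show "(\<lambda>x. Re (h $ j) * dird (axis j 1) \<phi> x + Im (h $ j) * dird (axis j \<i>) \<phi> x) differentiable (at x)"
      by (rule differentiable_add[OF m])
    show "dird b (\<lambda>x. Re (h $ j) * dird (axis j 1) \<phi> x + Im (h $ j) * dird (axis j \<i>) \<phi> x) x =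
      Re (h $ j) * dird b (dird (axis j 1) \<phi>) x + Im (h $ j) * dird b (dird (axis j \<i>) \<phi>) x"
      unfolding dird_add[OF m] by (simp add: dird_mult d1)
  qed
  show d2: "dird h \<phi> differentiable (at x)" unfolding e by (rule conjunct2[OF dird_sum]) (rule t(1))
  have s: "dird b (dird h \<phi>) x = (\<Sum>j\<in>UNIV. Re (h $ j) * dird b (dird (axis j 1) \<phi>) x + Im (h $ j) * dird b (dird (axis j \<i>) \<phi>) x)" for b
    unfolding e by (rule trans[OF conjunct1[OF dird_sum]], rule t(1), rule sum.cong[OF refl], rule t(2))
  show "dird h (dird h \<phi>) x = hess \<phi> x h"
    by (rule trans[OF dird_expand[OF d2]], unfold s hess_def real_scaleR_def sum_distrib_left sum.distrib[symmetric])
      (intro sum.cong refl, simp add: algebra_simps)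
qed

lemma continuous_hess:
  fixes \<phi> :: "complex ^ 'n::finite \<Rightarrow> real"
  assumes "Ck 2 \<phi>"
  shows "continuous_on UNIV (\<lambda>p. hess \<phi> (fst p) (snd p))"
proof -
  have c: "Ck (Suc (Suc 0)) \<phi>" using assms by (simp only: numeral_2_eq_2)
  have cc: "continuous_on UNIV (\<lambda>p. dird a (dird b \<phi>) (fst p))" if "a \<in> Basis" "b \<in> Basis"
    for a b
    by (rule continuous_on_compose2[OF Ck_continuous[OF Ck_dird[OF Ck_dird[OF c that(2)] that(1)]]]) (auto intro: continuous_intros)
  show ?thesis unfolding hess_def by (intro continuous_intros cc axis_Basis)
qed

text \<open>
  Replacing \<open>w\<close> by \<open>\<i> w\<close> changes the sign of the holomorphic and the antiholomorphic part of the second derivative and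
  preserves the mixed part, which is the Levi form.
\<close>

lemma Re_levi_sum:
  fixes \<phi> :: "complex ^ 'n::finite \<Rightarrow> real"
  assumes "Ck 2 \<phi>"
  shows "4 * Re (\<Sum>k\<in>UNIV. \<Sum>j\<in>UNIV. levi_matrix \<phi> z $ k $ j * (w $ k * cnj (w $ j))) = hess \<phi> z w + hess \<phi> z (\<i> *s w)"
proof -
  have c: "Ck (Suc (Suc 0)) \<phi>" using assms by (simp only: numeral_2_eq_2)
  have d0: "\<phi> differentiable (at x)" for x by (rule Ck_differentiable[OF c])
  have p: "dird b (\<lambda>w. complex_of_real (\<phi> w)) = (\<lambda>x. complex_of_real (dird b \<phi> x))" for b
    using dird_bounded_linear[OF bounded_linear_of_real d0] by auto
  have d1: "dird b \<phi> differentiable (at x)" if "b \<in> Basis" for b x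
    by (rule Ck_differentiable[OF Ck_dird[OF c that]])
  have zb: "d_zbar j (\<lambda>w. complex_of_real (\<phi> w)) =
      (\<lambda>x. (1 / 2) * (complex_of_real (dird (axis j 1) \<phi> x) + \<i> * complex_of_real (dird (axis j \<i>) \<phi> x)))" for j
    by (rule ext) (simp add: d_zbar_wirt wirt_def p)
  have dd: "dird b (d_zbar j (\<lambda>w. complex_of_real (\<phi> w))) x =
      (1 / 2) * (complex_of_real (dird b (dird (axis j 1) \<phi>) x) + \<i> * complex_of_real (dird b (dird (axis j \<i>) \<phi>) x))" for b j x
  proof -
    have m: "(\<lambda>x. complex_of_real (dird (axis j 1) \<phi> x)) differentiable (at x)"
      "(\<lambda>x. complex_of_real (dird (axis j \<i>) \<phi> x)) differentiable (at x)"
      by (intro differentiable_bounded_linear[OF bounded_linear_of_real] d1 axis_Basis)+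
    have m2: "(\<lambda>x. \<i> * complex_of_real (dird (axis j \<i>) \<phi> x)) differentiable (at x)"
      by (intro differentiable_mult m differentiable_const)
    have "dird b (d_zbar j (\<lambda>w. complex_of_real (\<phi> w))) x =
        (1 / 2) * dird b (\<lambda>x. complex_of_real (dird (axis j 1) \<phi> x) + \<i> * complex_of_real (dird (axis j \<i>) \<phi> x)) x"
      unfolding zb by (subst dird_mult) (use m m2 in auto)
    also have "dird b (\<lambda>x. complex_of_real (dird (axis j 1) \<phi> x) + \<i> * complex_of_real (dird (axis j \<i>) \<phi> x)) x =
        dird b (\<lambda>x. complex_of_real (dird (axis j 1) \<phi> x)) x + dird b (\<lambda>x. \<i> * complex_of_real (dird (axis j \<i>) \<phi> x)) x"
      by (rule dird_add[OF m(1) m2])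
    also have "dird b (\<lambda>x. \<i> * complex_of_real (dird (axis j \<i>) \<phi> x)) x =
        \<i> * dird b (\<lambda>x. complex_of_real (dird (axis j \<i>) \<phi> x)) x"
      by (subst dird_mult) (use m in auto)
    finally show ?thesis
      by (simp only: dird_bounded_linear[OF bounded_linear_of_real d1[OF axis_Basis(1)]]
          dird_bounded_linear[OF bounded_linear_of_real d1[OF axis_Basis(2)]])
  qed
  have lv: "4 * levi_matrix \<phi> z $ k $ j =
     (complex_of_real (dird (axis k 1) (dird (axis j 1) \<phi>) z) + complex_of_real (dird (axis k \<i>) (dird (axis j \<i>) \<phi>) z)
      + \<i> * (complex_of_real (dird (axis k 1) (dird (axis j \<i>) \<phi>) z) - complex_of_real (dird (axis k \<i>) (dird (axis j 1) \<phi>) z)))" for k j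
    unfolding levi_matrix_def by (simp add: d_z_wirt wirt_def dd) (simp add: complex_eq_iff)
  have "4 * Re (\<Sum>k\<in>UNIV. \<Sum>j\<in>UNIV. levi_matrix \<phi> z $ k $ j * (w $ k * cnj (w $ j))) =
      (\<Sum>k\<in>UNIV. \<Sum>j\<in>UNIV. Re ((4 * levi_matrix \<phi> z $ k $ j) * (w $ k * cnj (w $ j))))"
    by (simp add: sum_distrib_left mult.assoc algebra_simps)
  also have "\<dots> = hess \<phi> z w + hess \<phi> z (\<i> *s w)"
    unfolding hess_def sum.distrib[symmetric] lv
    by (intro sum.cong refl) (simp add: algebra_simps)
  finally show ?thesis .
qed

text \<open>
  If the Levi form were negative in some direction, then the sum of \<open>\<phi>\<close> over the four points
  \<open>z + \<i>\<^sup>m h\<close>, with \<open>h\<close> on a small circle in that direction, would stay below \<open>4 \<phi>(z)\<close> uniformly,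
  against the submean value property.  Summing over the four points removes the first derivatives
  and leaves exactly the Levi form among the second ones.
\<close>

theorem plurisubharmonic_levi_nonneg:
  fixes \<phi> :: "complex ^ 'n::finite \<Rightarrow> real"
  assumes \<phi>: "Ck 2 \<phi>" and psh: "plurisubharmonic \<phi>"
  shows "0 \<le> Re (\<Sum>k\<in>UNIV. \<Sum>j\<in>UNIV. levi_matrix \<phi> z $ k $ j * (w $ k * cnj (w $ j)))"
proof (rule ccontr)
  define L where "L v = Re (\<Sum>k\<in>UNIV. \<Sum>j\<in>UNIV. levi_matrix \<phi> z $ k $ j * (v $ k * cnj (v $ j)))" for v
  assume "\<not> ?thesis"
  then have neg: "L w < 0" by (simp add: L_def)
  have Lrot: "L (c *s w) = L w" if "cmod c = 1" for c
  proof -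
    have c: "c * cnj c = 1" using that by (simp add: complex_norm_square[symmetric])
    have "(c *s w) $ k * cnj ((c *s w) $ j) = (c * cnj c) * (w $ k * cnj (w $ j))" for k j
      by (simp add: mult_ac)
    then have "(c *s w) $ k * cnj ((c *s w) $ j) = w $ k * cnj (w $ j)" for k j unfolding c by simp
    then show ?thesis unfolding L_def by (simp only:)
  qed
  define h where "h m t = (\<i> ^ m * cis t) *s w" for m :: nat and t
  define \<Psi> where "\<Psi> p = (\<Sum>m<4. hess \<phi> (z + fst p *\<^sub>R h m (snd p)) (h m (snd p)))" for p :: "real \<times> real"
  have hc: "continuous_on S (\<lambda>p. h m (snd p))" for m and S :: "(real \<times> real) set"
    unfolding h_def vector_scalar_mult_def by (intro continuous_intros)
  have \<Psi>c: "continuous_on ({0..1} \<times> {0..2*pi}) \<Psi>"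
    unfolding \<Psi>_def[abs_def]
  proof (intro continuous_on_sum)
    fix m
    show "continuous_on ({0..1} \<times> {0..2*pi}) (\<lambda>p. hess \<phi> (z + fst p *\<^sub>R h m (snd p)) (h m (snd p)))"
      using continuous_on_compose2[OF continuous_hess[OF \<phi>],
          of "{0..1} \<times> {0..2*pi}" "\<lambda>p. (z + fst p *\<^sub>R h m (snd p), h m (snd p))"]
      by (simp add: continuous_intros hc)
  qed
  \<comment> \<open>the four points form two pairs, each of which contributes \<open>4 * L w\<close>\<close>
  have \<Psi>0: "\<Psi> (0, t) = 8 * L w" for t
  proof -
    have a: "h 1 t = \<i> *s h 0 t" "h 3 t = \<i> *s h 2 t"
      by (simp_all add: h_def vec_eq_iff numeral_3_eq_3 power2_eq_square numeral_2_eq_2)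
    have "\<Psi> (0, t) = hess \<phi> z (h 0 t) + hess \<phi> z (h 1 t) + (hess \<phi> z (h 2 t) + hess \<phi> z (h 3 t))"
      by (simp add: \<Psi>_def eval_nat_numeral)
    also have "\<dots> = 4 * L (h 0 t) + 4 * L (h 2 t)"
      unfolding a using Re_levi_sum[OF \<phi>, of z "h 0 t"] Re_levi_sum[OF \<phi>, of z "h 2 t"] by (simp add: L_def)
    also have "\<dots> = 8 * L w"
      using Lrot[of "\<i> ^ 0 * cis t"] Lrot[of "\<i> ^ 2 * cis t"] by (simp add: h_def norm_mult norm_power)
    finally show ?thesis .
  qed
  have "uniformly_continuous_on ({0..1} \<times> {0..2*pi}) \<Psi>"
    by (rule compact_uniformly_continuous[OF \<Psi>c]) (intro compact_Times compact_Icc)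
  then obtain d where d: "0 < d" "\<And>p p'. p \<in> {0..1} \<times> {0..2*pi} \<Longrightarrow> p' \<in> {0..1} \<times> {0..2*pi} \<Longrightarrow>
      dist p' p < d \<Longrightarrow> dist (\<Psi> p') (\<Psi> p) < - 4 * L w"
    unfolding uniformly_continuous_on_def using neg by (metis mult_neg_neg neg_less_0_iff_less zero_less_numeral)
  define r where "r = min 1 (d / 2)"
  have r: "0 < r" "r \<le> 1" "r < d" using d(1) by (auto simp: r_def)
  \<comment> \<open>half of the negative value at the centre survives on a small disc\<close>
  have below: "\<Psi> (s, t) \<le> 4 * L w" if "0 \<le> s" "s \<le> r" "t \<in> {0..2*pi}" for s t
  proof -
    have "dist (\<Psi> (s, t)) (\<Psi> (0, t)) < - 4 * L w"
      by (rule d(2)) (use that r in \<open>auto simp: dist_Pair_Pair dist_real_def\<close>)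
    then show ?thesis unfolding \<Psi>0 dist_real_def by linarith
  qed
  have d0: "\<phi> differentiable (at x)" for x
    using Ck_differentiable[of "Suc 0" \<phi>] \<phi> by (simp only: numeral_2_eq_2)
  have drop: "(\<Sum>m<4. \<phi> (z + r *\<^sub>R h m t)) \<le> 4 * \<phi> z + 2 * L w * r\<^sup>2" if t: "t \<in> {0..2*pi}" for t
  proof -
    define G where "G i s = (if i = 0 then (\<Sum>m<4. \<phi> (z + s *\<^sub>R h m t))
      else if i = 1 then (\<Sum>m<4. dird (h m t) \<phi> (z + s *\<^sub>R h m t)) else \<Psi> (s, t))" for i :: nat and s
    have "\<exists>s>0. s < r \<and> G 0 r = (\<Sum>i<2. G i 0 / fact i * r ^ i) + G 2 s / fact 2 * r ^ 2"
    proof (rule Maclaurin)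
      show "\<forall>i s. i < 2 \<and> 0 \<le> s \<and> s \<le> r \<longrightarrow> (G i has_real_derivative G (Suc i) s) (at s)"
      proof (intro allI impI, elim conjE)
        fix i :: nat and s assume i: "i < 2"
        have 0: "((\<lambda>s. \<phi> (z + s *\<^sub>R h m t)) has_real_derivative dird (h m t) \<phi> (z + s *\<^sub>R h m t)) (at s)" for m
          unfolding has_real_derivative_iff_has_vector_derivative by (rule dird_has_vector_derivative[OF d0])
        have 1: "((\<lambda>s. dird (h m t) \<phi> (z + s *\<^sub>R h m t)) has_real_derivative hess \<phi> (z + s *\<^sub>R h m t) (h m t)) (at s)" for m
          unfolding has_real_derivative_iff_has_vector_derivative dird_dird_hess(1)[OF \<phi>, symmetric]
          by (rule dird_has_vector_derivative[OF dird_dird_hess(2)[OF \<phi>]])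
        from i consider "i = 0" | "i = 1" by linarith
        then show "(G i has_real_derivative G (Suc i) s) (at s)"
        proof cases
          case 1
          have "G 0 = (\<lambda>s. \<Sum>m<4. \<phi> (z + s *\<^sub>R h m t))" by (simp add: G_def fun_eq_iff)
          moreover have "G (Suc 0) s = (\<Sum>m<4. dird (h m t) \<phi> (z + s *\<^sub>R h m t))" by (simp add: G_def)
          ultimately show ?thesis unfolding \<open>i = 0\<close>
            by (simp only:) (intro DERIV_sum 0)
        next
          case 2
          have "G 1 = (\<lambda>s. \<Sum>m<4. dird (h m t) \<phi> (z + s *\<^sub>R h m t))" by (simp add: G_def fun_eq_iff)
          moreover have "G (Suc 1) s = (\<Sum>m<4. hess \<phi> (z + s *\<^sub>R h m t) (h m t))" by (simp add: G_def \<Psi>_def)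
          ultimately show ?thesis unfolding \<open>i = 1\<close>
            by (simp only:) (intro DERIV_sum 1)
        qed
      qed
    qed (use r(1) in auto)
    then obtain s where s: "0 < s" "s < r" "G 0 r = (\<Sum>i<2. G i 0 / fact i * r ^ i) + G 2 s / fact 2 * r ^ 2" by blast
    \<comment> \<open>the first derivatives at opposite points cancel\<close>
    have "G 1 0 = 0"
    proof -
      have lin: "linear (frechet_derivative \<phi> (at z))" using d0 by (rule linear_frechet_derivative)
      have "h 2 t = - h 0 t" "h 3 t = - h 1 t" by (simp_all add: h_def vec_eq_iff numeral_3_eq_3)
      then have "dird (h 2 t) \<phi> z = - dird (h 0 t) \<phi> z" "dird (h 3 t) \<phi> z = - dird (h 1 t) \<phi> z"
        by (simp_all add: dird_def linear_neg[OF lin])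
      moreover have "G 1 0 = dird (h 0 t) \<phi> z + dird (h 1 t) \<phi> z + dird (h 2 t) \<phi> z + dird (h 3 t) \<phi> z"
        by (simp add: G_def eval_nat_numeral)
      ultimately show ?thesis by simp
    qed
    moreover have "G 0 0 = 4 * \<phi> z" by (simp add: G_def)
    moreover have "G 2 s \<le> 4 * L w" using below[of s t] s t by (simp add: G_def)
    then have "G 2 s / fact 2 * r ^ 2 \<le> 4 * L w / 2 * r ^ 2" by (intro mult_right_mono) auto
    ultimately have "G 0 r \<le> 4 * \<phi> z + 2 * L w * r\<^sup>2" using s(3) by (simp add: eval_nat_numeral)
    then show ?thesis by (simp add: G_def)
  qed
  have rot: "z + cis t *s (r *\<^sub>R ((\<i> ^ m) *s w)) = z + r *\<^sub>R h m t" for t m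
    by (simp add: h_def vec_eq_iff algebra_simps scaleR_conv_of_real)
  have int: "(\<lambda>t. \<phi> (z + r *\<^sub>R h m t)) integrable_on {0..2*pi}"
    and mean: "2 * pi * \<phi> z \<le> integral {0..2*pi} (\<lambda>t. \<phi> (z + r *\<^sub>R h m t))" for m
  proof -
    have "(\<lambda>t. \<phi> (z + cis t *s (r *\<^sub>R ((\<i> ^ m) *s w)))) absolutely_integrable_on {0..2*pi} \<and>
        \<phi> z \<le> integral {0..2*pi} (\<lambda>t. \<phi> (z + cis t *s (r *\<^sub>R ((\<i> ^ m) *s w)))) / (2*pi)"
      using psh unfolding plurisubharmonic_def by blast
    then have *: "(\<lambda>t. \<phi> (z + r *\<^sub>R h m t)) absolutely_integrable_on {0..2*pi}"
      "\<phi> z \<le> integral {0..2*pi} (\<lambda>t. \<phi> (z + r *\<^sub>R h m t)) / (2*pi)"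
      by (simp_all only: rot)
    show "(\<lambda>t. \<phi> (z + r *\<^sub>R h m t)) integrable_on {0..2*pi}"
      using *(1) by (rule absolutely_integrable_on_def[THEN iffD1, THEN conjunct1])
    show "2 * pi * \<phi> z \<le> integral {0..2*pi} (\<lambda>t. \<phi> (z + r *\<^sub>R h m t))"
      using *(2) by (simp add: pos_le_divide_eq mult.commute)
  qed
  have "4 * (2 * pi * \<phi> z) = (\<Sum>m<4::nat. 2 * pi * \<phi> z)" by simp
  also have "\<dots> \<le> (\<Sum>m<4. integral {0..2*pi} (\<lambda>t. \<phi> (z + r *\<^sub>R h m t)))" by (rule sum_mono) (rule mean)
  also have "\<dots> = integral {0..2*pi} (\<lambda>t. \<Sum>m<4. \<phi> (z + r *\<^sub>R h m t))"
    by (rule integral_sum[symmetric]) (auto intro: int)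
  also have "\<dots> \<le> integral {0..2*pi} (\<lambda>t. 4 * \<phi> z + 2 * L w * r\<^sup>2)"
    by (rule integral_le) (auto intro!: integrable_sum int drop)
  also have "\<dots> = 4 * (2 * pi * \<phi> z) + 2 * pi * (2 * L w * r\<^sup>2)" by (simp add: algebra_simps)
  finally have "0 \<le> 2 * pi * (2 * L w * r\<^sup>2)" by linarith
  moreover have "2 * L w * r\<^sup>2 < 0"
  proof (rule mult_neg_pos)
    show "2 * L w < 0" "0 < r\<^sup>2" using neg r(1) by simp_all
  qed
  then have "2 * pi * (2 * L w * r\<^sup>2) < 0" by (rule mult_pos_neg[rotated]) simp
  ultimately show False by linarith
qed

section \<open>The a priori estimate\<close>

text \<open>
  All components are counted, in every degree; forms of degree \<open>q\<close> are singled out by the vanishing of the other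
  components.
\<close>

definition wnorm2 :: "(complex ^ 'n::finite \<Rightarrow> real) \<Rightarrow> 'n form \<Rightarrow> real" where
  "wnorm2 \<phi> v = (LINT z|lebesgue. Re (ext_inner (\<lambda>J. v J z) (\<lambda>J. v J z)) * exp (- \<phi> z))"

text \<open>
  The operators in the classical sense, for forms with continuously differentiable coefficients.
\<close>

definition dbar_form :: "'n::{finite,linorder} form \<Rightarrow> 'n form" where
  "dbar_form u K z = (\<Sum>j\<in>UNIV. creat j (\<lambda>J. d_zbar j (u J) z) K)"

definition dbar_adj_form :: "(complex ^ 'n::{finite,linorder} \<Rightarrow> real) \<Rightarrow> 'n form \<Rightarrow> 'n form" where
  "dbar_adj_form \<phi> u L z = - (\<Sum>k\<in>UNIV. annih k (\<lambda>J. dstar \<phi> k (u J) z) L)"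

definition cc0 :: "('a::euclidean_space \<Rightarrow> 'b::real_normed_vector) \<Rightarrow> bool" where
  "cc0 f \<longleftrightarrow> continuous_on UNIV f \<and> csupp f"

lemma cc0_integrable: "cc0 f \<Longrightarrow> integrable lebesgue f"
  for f :: "'a::euclidean_space \<Rightarrow> 'b::euclidean_space"
  unfolding cc0_def using integrable_csupp by blast

lemma cc0_zero: "cc0 (\<lambda>x. 0)"
  by (simp add: cc0_def csupp_def)

lemma cc0_add: "cc0 f \<Longrightarrow> cc0 g \<Longrightarrow> cc0 (\<lambda>x. f x + g x)"
  unfolding cc0_def by (auto intro: continuous_on_add csupp_add)

lemma cc0_mult1: "cc0 f \<Longrightarrow> continuous_on UNIV g \<Longrightarrow> cc0 (\<lambda>x. f x * g x :: 'b::real_normed_algebra)"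
  unfolding cc0_def by (auto intro: continuous_on_mult csupp_mult1)

lemma cc0_mult2: "cc0 g \<Longrightarrow> continuous_on UNIV f \<Longrightarrow> cc0 (\<lambda>x. f x * g x :: 'b::real_normed_algebra)"
  unfolding cc0_def by (auto intro: continuous_on_mult csupp_mult2)

lemma cc0_bounded_linear:
  assumes "bounded_linear L" "cc0 f"
  shows "cc0 (\<lambda>x. L (f x))"
proof -
  have "csupp (\<lambda>x. L (f x))"
    using assms(2) by (auto simp: cc0_def linear_0 bounded_linear.linear[OF assms(1)] elim!: csupp_subset)
  then show ?thesis using assms bounded_linear.continuous_on[OF assms(1)] by (auto simp: cc0_def)
qed

lemma cc0_scale: "cc0 f \<Longrightarrow> cc0 (\<lambda>x. c * f x :: 'b::real_normed_algebra)"
  by (rule cc0_mult2) (auto intro: continuous_intros)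

lemma cc0_uminus: "cc0 f \<Longrightarrow> cc0 (\<lambda>x. - f x)"
  by (rule cc0_bounded_linear[OF bounded_linear_minus[OF bounded_linear_ident]])

lemma cc0_sum: "(\<And>i. i \<in> I \<Longrightarrow> cc0 (f i)) \<Longrightarrow> cc0 (\<lambda>x. \<Sum>i\<in>I. f i x)"
  by (induction I rule: infinite_finite_induct) (auto intro: cc0_zero cc0_add)

lemma cc0_cnj: "cc0 f \<Longrightarrow> cc0 (\<lambda>x. cnj (f x))"
  by (rule cc0_bounded_linear[OF bounded_linear_cnj])

lemma cc0_mult: "cc0 f \<Longrightarrow> cc0 g \<Longrightarrow> cc0 (\<lambda>x. f x * g x :: 'b::real_normed_algebra)"
  using cc0_mult1 by (auto simp: cc0_def)

lemma cc0_annih: "(\<And>J. cc0 (F J)) \<Longrightarrow> cc0 (\<lambda>z. annih k (\<lambda>J. F J z) L)"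
  by (cases "k \<in> L") (simp_all add: annih_def cc0_zero cc0_scale)

lemma cc0_creat: "(\<And>J. cc0 (F J)) \<Longrightarrow> cc0 (\<lambda>z. creat k (\<lambda>J. F J z) L)"
  by (cases "k \<in> L") (simp_all add: creat_def cc0_zero cc0_scale)

lemma cc0_ext_inner:
  assumes "\<And>J. cc0 (F J)" "\<And>J. cc0 (G J)"
  shows "cc0 (\<lambda>z. ext_inner (\<lambda>J. F J z) (\<lambda>J. G J z))"
  unfolding ext_inner_def by (intro cc0_sum cc0_mult cc0_cnj assms)

lemma wnorm2_complex:
  assumes "continuous_on UNIV \<phi>" "\<And>J. cc0 (v J)"
  shows "complex_of_real (wnorm2 \<phi> v) = (LINT z|lebesgue. ext_inner (\<lambda>J. v J z) (\<lambda>J. v J z) * wt \<phi> z)"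
proof -
  have "ext_inner (\<lambda>J. v J z) (\<lambda>J. v J z) * wt \<phi> z =
      complex_of_real (Re (ext_inner (\<lambda>J. v J z) (\<lambda>J. v J z)) * exp (- \<phi> z))" for z
    by (simp add: ext_inner_self wt_def)
  then show ?thesis unfolding wnorm2_def by (simp only: integral_complex_of_real)
qed

context
  fixes \<phi> :: "complex ^ 'n::{finite,linorder} \<Rightarrow> real" and u :: "'n form"
  assumes \<phi>: "Ck 2 \<phi>" and u: "\<And>J. Ck 2 (u J)" "\<And>J. csupp (u J)"
begin

lemma smooth_form_cc0:
  "cc0 (u J)" "cc0 (d_zbar j (u J))" "cc0 (dstar \<phi> j (u J))" "continuous_on UNIV (\<lambda>z. levi_matrix \<phi> z $ k $ j)"
  "continuous_on UNIV (wt \<phi>)" "continuous_on UNIV \<phi>"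
proof -
  have s: "Ck (Suc (Suc 0)) \<phi>" "Ck (Suc (Suc 0)) (u J)" using \<phi> u(1) by (simp_all only: numeral_2_eq_2)
  have p: "Ck (Suc (Suc 0)) (\<lambda>w. complex_of_real (\<phi> w))" by (rule Ck_of_real[OF s(1)])
  show "continuous_on UNIV \<phi>" by (rule Ck_continuous[OF \<phi>])
  show "continuous_on UNIV (wt \<phi>)" by (rule Ck_continuous[OF Ck_wt[OF \<phi>]])
  show uc: "cc0 (u J)" using Ck_continuous[OF u(1)] u(2) by (simp add: cc0_def)
  have w: "cc0 (wirt t j (u J))" for t
    using Ck_continuous[OF Ck_wirt[OF s(2)]] csupp_wirt[OF u(2)] by (simp add: cc0_def)
  then show "cc0 (d_zbar j (u J))" by (simp add: d_zbar_wirt)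
  have "cc0 (\<lambda>z. wirt (- \<i>) j (u J) z + - (wirt (- \<i>) j (\<lambda>w. complex_of_real (\<phi> w)) z * u J z))"
    by (intro cc0_add cc0_uminus w cc0_mult2 uc Ck_continuous[OF Ck_wirt[OF p]])
  then show "cc0 (dstar \<phi> j (u J))" by (simp add: dstar_def[abs_def] d_z_wirt)
  show "continuous_on UNIV (\<lambda>z. levi_matrix \<phi> z $ k $ j)"
    using Ck_continuous[OF Ck_wirt[OF Ck_wirt[OF p]], of "- \<i>" k \<i> j]
    by (simp add: levi_matrix_def d_z_wirt d_zbar_wirt)
qed

text \<open>
  By \<open>ext_inner_sum_creat\<close> the first norm is the sum of the norms of the derivatives minus mixed terms.  The second
  norm is a sum of products of adjoint derivatives, which \<open>weighted_commutator\<close> turns into the same mixed terms plus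
  the Levi form.
\<close>

theorem Kohn_Morrey:
  "wnorm2 \<phi> (dbar_form u) + wnorm2 \<phi> (dbar_adj_form \<phi> u) =
    (\<Sum>j\<in>UNIV. wnorm2 \<phi> (\<lambda>J. d_zbar j (u J))) +
    (LINT z|lebesgue. levi_form (levi_matrix \<phi> z) (\<lambda>J. u J z) * exp (- \<phi> z))"
proof -
  note c = smooth_form_cc0
  define d where "d j z = (\<lambda>J. d_zbar j (u J) z)" for j z
  define e where "e j z = (\<lambda>J. dstar \<phi> j (u J) z)" for j z
  have ad: "cc0 (\<lambda>z. annih k (d j z) L)" and ae: "cc0 (\<lambda>z. annih k (e j z) L)"
    and au: "cc0 (\<lambda>z. annih k (\<lambda>J. u J z) L)" for k j L
    unfolding d_def e_def by (intro cc0_annih c)+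
  have id: "integrable lebesgue (\<lambda>z. ext_inner (annih k (d j z)) (annih j (d k z)) * wt \<phi> z)" for k j
    by (intro cc0_integrable cc0_mult1 cc0_ext_inner ad c)
  have ie: "integrable lebesgue (\<lambda>z. ext_inner (annih k (e k z)) (annih j (e j z)) * wt \<phi> z)" for k j
    by (intro cc0_integrable cc0_mult1 cc0_ext_inner ae c)
  have iu: "integrable lebesgue (\<lambda>z. (levi_matrix \<phi> z $ k $ j * ext_inner (annih k (\<lambda>J. u J z)) (annih j (\<lambda>J. u J z))) * wt \<phi> z)" for k j
    by (intro cc0_integrable cc0_mult1 cc0_mult2 cc0_ext_inner au c)
  have idd: "integrable lebesgue (\<lambda>z. ext_inner (d j z) (d j z) * wt \<phi> z)" for j
    unfolding d_def by (intro cc0_integrable cc0_mult1 cc0_ext_inner c)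
  have db: "cc0 (dbar_form u K)" for K
    unfolding dbar_form_def[abs_def] by (intro cc0_sum cc0_creat c)
  have da: "cc0 (dbar_adj_form \<phi> u K)" for K
    unfolding dbar_adj_form_def[abs_def] by (intro cc0_uminus cc0_sum cc0_annih c)
  have comm: "(LINT z|lebesgue. ext_inner (annih k (e k z)) (annih j (e j z)) * wt \<phi> z) =
      (LINT z|lebesgue. ext_inner (annih k (d j z)) (annih j (d k z)) * wt \<phi> z) +
      (LINT z|lebesgue. (levi_matrix \<phi> z $ k $ j * ext_inner (annih k (\<lambda>J. u J z)) (annih j (\<lambda>J. u J z))) * wt \<phi> z)" for k j
  proof -
    have L: "(LINT z|lebesgue. (annih k (e k z) L * cnj (annih j (e j z) L)) * wt \<phi> z) =
      (LINT z|lebesgue. (annih k (d j z) L * cnj (annih j (d k z) L)) * wt \<phi> z) +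
      (LINT z|lebesgue. (levi_matrix \<phi> z $ k $ j * (annih k (\<lambda>J. u J z) L * cnj (annih j (\<lambda>J. u J z) L))) * wt \<phi> z)" for L
    proof (cases "k \<in> L \<or> j \<in> L")
      case True
      then show ?thesis by (auto simp: annih_def)
    next
      case False
      define s where "s = wedge_sign k L * wedge_sign j L"
      define f where "f = u (insert k L)"
      define g where "g = u (insert j L)"
      have "(\<lambda>z. (annih k (e k z) L * cnj (annih j (e j z) L)) * wt \<phi> z) =
          (\<lambda>z. s * (dstar \<phi> k f z * cnj (dstar \<phi> j g z) * wt \<phi> z))"
        using False by (simp add: annih_def e_def s_def f_def g_def fun_eq_iff)
      moreover have "(\<lambda>z. (annih k (d j z) L * cnj (annih j (d k z) L)) * wt \<phi> z) =
          (\<lambda>z. s * (d_zbar j f z * cnj (d_zbar k g z) * wt \<phi> z))"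
        using False by (simp add: annih_def d_def s_def f_def g_def fun_eq_iff)
      moreover have "(\<lambda>z. (levi_matrix \<phi> z $ k $ j * (annih k (\<lambda>J. u J z) L * cnj (annih j (\<lambda>J. u J z) L))) * wt \<phi> z) =
          (\<lambda>z. s * (levi_matrix \<phi> z $ k $ j * (f z * cnj (g z)) * wt \<phi> z))"
        using False by (simp add: annih_def s_def f_def g_def fun_eq_iff)
      moreover have "(LINT z|lebesgue. dstar \<phi> k f z * cnj (dstar \<phi> j g z) * wt \<phi> z) =
          (LINT z|lebesgue. d_zbar j f z * cnj (d_zbar k g z) * wt \<phi> z) +
          (LINT z|lebesgue. levi_matrix \<phi> z $ k $ j * (f z * cnj (g z)) * wt \<phi> z)"
        unfolding f_def g_def by (rule weighted_commutator[OF \<phi> u u])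
      ultimately show ?thesis by (simp only: integral_mult_right_zero distrib_left)
    qed
    have i1: "integrable lebesgue (\<lambda>z. (annih k (e k z) L * cnj (annih j (e j z) L)) * wt \<phi> z)"
      and i2: "integrable lebesgue (\<lambda>z. (annih k (d j z) L * cnj (annih j (d k z) L)) * wt \<phi> z)"
      and i3: "integrable lebesgue (\<lambda>z. (levi_matrix \<phi> z $ k $ j * (annih k (\<lambda>J. u J z) L * cnj (annih j (\<lambda>J. u J z) L))) * wt \<phi> z)" for L
      by (intro cc0_integrable cc0_mult1[OF _ c(5)] cc0_mult2[OF _ c(4)] cc0_mult cc0_cnj ad ae au)+
    show ?thesis
      unfolding ext_inner_def sum_distrib_left sum_distrib_right
      by (simp only: Bochner_Integration.integral_sum[OF i1] Bochner_Integration.integral_sum[OF i2]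
          Bochner_Integration.integral_sum[OF i3] L sum.distrib)
  qed
  have "complex_of_real (wnorm2 \<phi> (dbar_form u)) =
      (LINT z|lebesgue. ((\<Sum>j\<in>UNIV. ext_inner (d j z) (d j z)) -
        (\<Sum>k\<in>UNIV. \<Sum>j\<in>UNIV. ext_inner (annih k (d j z)) (annih j (d k z)))) * wt \<phi> z)"
    unfolding wnorm2_complex[OF c(6) db] dbar_form_def
    by (subst ext_inner_sum_creat, subst sum.swap) (simp add: d_def)
  also have "\<dots> = (\<Sum>j\<in>UNIV. LINT z|lebesgue. ext_inner (d j z) (d j z) * wt \<phi> z) -
      (\<Sum>k\<in>UNIV. \<Sum>j\<in>UNIV. LINT z|lebesgue. ext_inner (annih k (d j z)) (annih j (d k z)) * wt \<phi> z)"
    by (simp add: left_diff_distrib sum_distrib_right idd id)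
  finally have A: "complex_of_real (wnorm2 \<phi> (dbar_form u)) = \<dots>" .
  have "complex_of_real (wnorm2 \<phi> (dbar_adj_form \<phi> u)) =
      (LINT z|lebesgue. (\<Sum>k\<in>UNIV. \<Sum>j\<in>UNIV. ext_inner (annih k (e k z)) (annih j (e j z))) * wt \<phi> z)"
  proof -
    have "ext_inner (\<lambda>L. dbar_adj_form \<phi> u L z) (\<lambda>L. dbar_adj_form \<phi> u L z) =
        ext_inner (\<lambda>L. \<Sum>k\<in>UNIV. annih k (e k z) L) (\<lambda>L. \<Sum>k\<in>UNIV. annih k (e k z) L)" for z
      by (simp add: dbar_adj_form_def ext_inner_def e_def)
    then show ?thesis unfolding wnorm2_complex[OF c(6) da]
      by (simp only: ext_inner_sum_left ext_inner_sum_right)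
  qed
  also have "\<dots> = (\<Sum>k\<in>UNIV. \<Sum>j\<in>UNIV. LINT z|lebesgue. ext_inner (annih k (e k z)) (annih j (e j z)) * wt \<phi> z)"
    by (simp add: sum_distrib_right ie)
  finally have B: "complex_of_real (wnorm2 \<phi> (dbar_adj_form \<phi> u)) = \<dots>" .
  have C: "complex_of_real (wnorm2 \<phi> (\<lambda>J. d_zbar j (u J))) = (LINT z|lebesgue. ext_inner (d j z) (d j z) * wt \<phi> z)" for j
    unfolding d_def by (rule wnorm2_complex[OF c(6) c(2)])
  define S where "S = (\<Sum>k\<in>UNIV. \<Sum>j\<in>UNIV. LINT z|lebesgue.
      (levi_matrix \<phi> z $ k $ j * ext_inner (annih k (\<lambda>J. u J z)) (annih j (\<lambda>J. u J z))) * wt \<phi> z)"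
  have S: "S = (LINT z|lebesgue. (\<Sum>k\<in>UNIV. \<Sum>j\<in>UNIV.
      levi_matrix \<phi> z $ k $ j * ext_inner (annih k (\<lambda>J. u J z)) (annih j (\<lambda>J. u J z))) * wt \<phi> z)"
    unfolding S_def sum_distrib_right by (simp add: iu)
  have iS: "integrable lebesgue (\<lambda>z. (\<Sum>k\<in>UNIV. \<Sum>j\<in>UNIV.
      levi_matrix \<phi> z $ k $ j * ext_inner (annih k (\<lambda>J. u J z)) (annih j (\<lambda>J. u J z))) * wt \<phi> z)"
    unfolding sum_distrib_right by (simp add: iu)
  have "Re S = (LINT z|lebesgue. levi_form (levi_matrix \<phi> z) (\<lambda>J. u J z) * exp (- \<phi> z))"
    unfolding S integral_Re[OF iS, symmetric] by (simp add: levi_form_def wt_def)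
  moreover have "complex_of_real (wnorm2 \<phi> (dbar_form u) + wnorm2 \<phi> (dbar_adj_form \<phi> u)) =
      (\<Sum>j\<in>UNIV. complex_of_real (wnorm2 \<phi> (\<lambda>J. d_zbar j (u J)))) + S"
    unfolding of_real_add A B C S_def comm by (simp add: sum.distrib)
  then have "Re (complex_of_real (wnorm2 \<phi> (dbar_form u) + wnorm2 \<phi> (dbar_adj_form \<phi> u))) =
      Re (complex_of_real (\<Sum>j\<in>UNIV. wnorm2 \<phi> (\<lambda>J. d_zbar j (u J)))) + Re S"
    by (simp only: of_real_sum plus_complex.sel)
  ultimately show ?thesis by (simp only: Re_complex_of_real)
qed

end

text \<open>
  For the weight \<open>- \<bar>z\<^sub>j\<bar>\<^sup>2\<close>, whose Levi form is \<open>-1\<close> in the direction of \<open>z\<^sub>j\<close>, the commutator identity says that the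
  right-hand side minus the left-hand side is the squared norm of \<open>\<delta>\<^sub>j g\<close>.
\<close>

lemma dbar_Poincare:
  fixes g :: "complex ^ 'n::finite \<Rightarrow> complex"
  assumes g: "Ck 2 g" "csupp g"
  shows "(LINT z|lebesgue. (cmod (g z))\<^sup>2 * exp ((cmod (z $ j))\<^sup>2)) \<le>
    (LINT z|lebesgue. (cmod (d_zbar j g z))\<^sup>2 * exp ((cmod (z $ j))\<^sup>2))"
proof -
  define \<psi> where "\<psi> = (\<lambda>z :: complex ^ 'n. (- 1) * ((z \<bullet> axis j 1) * (z \<bullet> axis j 1) + (z \<bullet> axis j \<i>) * (z \<bullet> axis j \<i>)))"
  have \<psi>: "Ck 2 \<psi>" unfolding \<psi>_def by (rule bump_algebra_Ck) (intro bump_algebra.intros)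
  have \<psi>_eq: "\<psi> z = - (cmod (z $ j))\<^sup>2" for z
    unfolding cmod_power2 by (simp add: \<psi>_def inner_axis inner_complex_def power2_eq_square)
  define p where "p = (\<lambda>w. complex_of_real (\<psi> w))"
  have dp: "(p has_derivative (\<lambda>h. complex_of_real (- 2 * (Re (z $ j) * Re (h $ j) + Im (z $ j) * Im (h $ j))))) (at z)" for z
  proof -
    have "(\<psi> has_derivative (\<lambda>h. - 2 * ((z \<bullet> axis j 1) * (h \<bullet> axis j 1) + (z \<bullet> axis j \<i>) * (h \<bullet> axis j \<i>)))) (at z)"
      unfolding \<psi>_def by (rule has_derivative_eq_rhs, (rule derivative_intros)+) (simp add: fun_eq_iff algebra_simps)
    from bounded_linear.has_derivative[OF bounded_linear_of_real this] show ?thesis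
      by (simp add: p_def inner_axis inner_complex_def)
  qed
  have zb: "d_zbar j p = (\<lambda>z. - (z $ j))"
    by (rule ext) (simp add: d_zbar_wirt wirt_def dird_eqI[OF dp] complex_eq_iff)
  have "((\<lambda>z. - (z $ j)) has_derivative (\<lambda>h. - (h $ j))) (at z)" for z :: "complex ^ 'n"
    by (auto intro!: derivative_eq_intros bounded_linear.has_derivative[OF bounded_linear_vec_nth])
  note dzj = this
  have lv: "levi_matrix \<psi> z $ j $ j = - 1" for z
    unfolding levi_matrix_def using zb by (simp add: p_def d_z_wirt wirt_def dird_eqI[OF dzj])
  have cs: "cc0 (\<lambda>z. dstar \<psi> j g z)" "cc0 g" "cc0 (d_zbar j g)" "continuous_on UNIV (\<lambda>z. exp (- \<psi> z))"
  proof -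
    have g2: "Ck (Suc (Suc 0)) g" "Ck (Suc (Suc 0)) \<psi>" using g \<psi> by (simp_all only: numeral_2_eq_2)
    show gc: "cc0 g" using Ck_continuous[OF g(1)] g(2) by (simp add: cc0_def)
    have w: "cc0 (wirt t j g)" for t
      using Ck_continuous[OF Ck_wirt[OF g2(1)]] csupp_wirt[OF g(2)] by (simp add: cc0_def)
    then show "cc0 (d_zbar j g)" by (simp add: d_zbar_wirt)
    have "cc0 (\<lambda>z. wirt (- \<i>) j g z + - (wirt (- \<i>) j p z * g z))"
      unfolding p_def by (intro cc0_add cc0_uminus w cc0_mult2 gc Ck_continuous[OF Ck_wirt[OF Ck_of_real[OF g2(2)]]])
    then show "cc0 (\<lambda>z. dstar \<psi> j g z)" by (simp add: dstar_def[abs_def] d_z_wirt p_def)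
    show "continuous_on UNIV (\<lambda>z. exp (- \<psi> z))" by (intro continuous_intros Ck_continuous[OF \<psi>])
  qed
  have re: "complex_of_real (LINT z|lebesgue. (cmod (f z))\<^sup>2 * exp (- \<psi> z)) =
      (LINT z|lebesgue. f z * cnj (f z) * wt \<psi> z)" for f
  proof -
    have "f z * cnj (f z) * wt \<psi> z = complex_of_real ((cmod (f z))\<^sup>2 * exp (- \<psi> z))" for z
      by (simp add: wt_def complex_norm_square del: of_real_power)
    then show ?thesis by (simp only: integral_complex_of_real)
  qed
  have "complex_of_real (LINT z|lebesgue. (cmod (dstar \<psi> j g z))\<^sup>2 * exp (- \<psi> z)) =
     complex_of_real ((LINT z|lebesgue. (cmod (d_zbar j g z))\<^sup>2 * exp (- \<psi> z)) - (LINT z|lebesgue. (cmod (g z))\<^sup>2 * exp (- \<psi> z)))"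
    unfolding of_real_diff re weighted_commutator[OF \<psi> g g] lv by simp
  then have "(LINT z|lebesgue. (cmod (dstar \<psi> j g z))\<^sup>2 * exp (- \<psi> z)) =
     (LINT z|lebesgue. (cmod (d_zbar j g z))\<^sup>2 * exp (- \<psi> z)) - (LINT z|lebesgue. (cmod (g z))\<^sup>2 * exp (- \<psi> z))"
    by (simp only: of_real_eq_iff)
  moreover have "0 \<le> (LINT z|lebesgue. (cmod (dstar \<psi> j g z))\<^sup>2 * exp (- \<psi> z))" by simp
  ultimately show ?thesis by (simp add: \<psi>_eq)
qed

lemma dird_local:
  assumes "open S" "z \<in> S" "\<And>x. x \<in> S \<Longrightarrow> f x = g x"
  shows "dird b f z = dird b g z"
proof -
  have "(f has_derivative f') (at z) \<longleftrightarrow> (g has_derivative f') (at z)" for f'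
  proof
    assume "(f has_derivative f') (at z)"
    then show "(g has_derivative f') (at z)"
      by (rule has_derivative_transform_within_open[OF _ assms(1,2)]) (rule assms(3))
  next
    assume "(g has_derivative f') (at z)"
    then show "(f has_derivative f') (at z)"
      by (rule has_derivative_transform_within_open[OF _ assms(1,2)]) (rule assms(3)[symmetric])
  qed
  then show ?thesis by (simp add: dird_def frechet_derivative_def)
qed

lemma wirt_local:
  assumes "open S" "z \<in> S" "\<And>x. x \<in> S \<Longrightarrow> f x = g x"
  shows "wirt s j f z = wirt s j g z"
  by (simp only: wirt_def dird_local[OF assms])

lemma csupp_cutoff: "0 < R \<Longrightarrow> csupp (cutoff R)"
  unfolding csupp_def by (intro exI[of _ "2 * R"] allI impI cutoff_eq_0) auto

lemma wnorm2_nonneg: "0 \<le> wnorm2 \<phi> v"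
  unfolding wnorm2_def by (simp add: Re_ext_inner_self_nonneg)

text \<open>
  Where the sum of the \<open>q\<close> smallest eigenvalues is bounded below, outside a ball, the Levi form controls
  \<open>u\<close>.  Inside the ball the Levi form is only nonnegative, and a compactly supported cut-off of \<open>u\<close> is
  controlled by its derivatives; the error made by the cut-off lives outside the ball again.
\<close>

theorem basic_estimate:
  fixes \<phi> :: "complex ^ 'n::{finite,linorder} \<Rightarrow> real"
  assumes nonneg: "\<And>z. 0 \<le> \<phi> z" and \<phi>: "Ck 2 \<phi>" and psh: "plurisubharmonic \<phi>" and q: "q \<le> CARD('n)"
    and liminf: "Liminf at_infinity (\<lambda>z. ereal (sum_smallest_eigenvalues q (levi_matrix \<phi> z))) > 0"
  shows "\<exists>C\<ge>0. \<forall>u. (\<forall>J. Ck 2 (u J) \<and> csupp (u J)) \<longrightarrow> (\<forall>J z. card J \<noteq> q \<longrightarrow> u J z = 0) \<longrightarrow>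
    wnorm2 \<phi> u \<le> C * (wnorm2 \<phi> (dbar_form u) + wnorm2 \<phi> (dbar_adj_form \<phi> u))"
proof -
  obtain \<epsilon> where e: "0 < \<epsilon>" "ereal \<epsilon> < Liminf at_infinity (\<lambda>z. ereal (sum_smallest_eigenvalues q (levi_matrix \<phi> z)))"
    using ereal_dense2[OF liminf] by auto
  from less_LiminfD[OF e(2)]
  have "\<forall>\<^sub>F z in at_infinity. \<epsilon> < sum_smallest_eigenvalues q (levi_matrix \<phi> z)" by simp
  then obtain R0 where R0: "\<And>z. R0 \<le> norm z \<Longrightarrow> \<epsilon> < sum_smallest_eigenvalues q (levi_matrix \<phi> z)"
    unfolding eventually_at_infinity by blast
  define R where "R = max 1 R0"
  have R: "0 < R" "\<And>z. R \<le> norm z \<Longrightarrow> \<epsilon> < sum_smallest_eigenvalues q (levi_matrix \<phi> z)"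
    using R0 by (auto simp: R_def)
  have c\<phi>: "continuous_on UNIV \<phi>" by (rule Ck_continuous[OF \<phi>])
  have "compact (\<phi> ` cball 0 (2 * R))"
    by (rule compact_continuous_image) (use c\<phi> continuous_on_subset in auto)
  then have "bdd_above (\<phi> ` cball 0 (2 * R))" by (intro bounded_imp_bdd_above compact_imp_bounded)
  then obtain M where M': "\<And>y. y \<in> \<phi> ` cball 0 (2 * R) \<Longrightarrow> y \<le> M" unfolding bdd_above_def by blast
  have M: "\<phi> z \<le> M" if "norm z \<le> 2 * R" for z by (rule M') (use that in auto)
  define X where "X = (\<lambda>z :: (complex, 'n) vec. complex_of_real (cutoff R z))"
  have X: "Ck k X" for k unfolding X_def by (rule Ck_of_real[OF cutoff_Ck])
  have Xs: "csupp X" by (rule csupp_subset[OF csupp_cutoff[OF R(1)]]) (simp add: X_def)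
  have X1: "cmod (X z) \<le> 1" for z using cutoff_bounds[of R z] by (simp add: X_def)
  \<comment> \<open>one derivative is enough for the Poincare inequality, and any coordinate will do\<close>
  define j :: 'n where "j = undefined"
  define dX where "dX = d_zbar j X"
  have "continuous_on UNIV dX" unfolding dX_def d_zbar_wirt by (rule Ck_continuous[OF Ck_wirt[OF X[of "Suc 0"]]])
  then obtain D where D: "0 < D" "\<And>z. norm (dX z) \<le> D"
    using csupp_bounded[of dX] csupp_wirt[OF Xs] by (auto simp: dX_def d_zbar_wirt)
  have dX_in: "dX z = 0" if "norm z < R" for z
  proof -
    have "wirt \<i> j X z = wirt \<i> j (\<lambda>z. 1) z"
      by (rule wirt_local[of "ball 0 R"]) (use that in \<open>auto simp: X_def cutoff_eq_1[OF R(1)]\<close>)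
    then show ?thesis by (simp add: dX_def d_zbar_wirt)
  qed
  have dX_out: "dX z = 0" if "2 * R < norm z" for z
  proof -
    have "wirt \<i> j X z = wirt \<i> j (\<lambda>z. 0) z"
      by (rule wirt_local[of "- cball 0 (2 * R)"]) (use that in \<open>auto simp: X_def cutoff_eq_0[OF R(1)]\<close>)
    then show ?thesis by (simp add: dX_def d_zbar_wirt)
  qed
  \<comment> \<open>\<open>K\<close> compares the weight \<open>E\<close> of the Poincare inequality with \<open>exp (- \<phi>)\<close> on the support of the cut-off\<close>
  define K where "K = exp ((2 * R)\<^sup>2 + M)"
  define E where "E z = exp ((cmod (z $ j))\<^sup>2)" for z :: "(complex, 'n) vec"
  have E1: "1 \<le> E z" for z by (simp add: E_def)
  have EK: "E z \<le> K * exp (- \<phi> z)" if "norm z \<le> 2 * R" for z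
  proof -
    have "cmod (z $ j) \<le> 2 * R" using Finite_Cartesian_Product.norm_nth_le[of z j] that by (rule order_trans)
    then have "(cmod (z $ j))\<^sup>2 \<le> (2 * R)\<^sup>2" by (rule power_mono) simp
    then have "(cmod (z $ j))\<^sup>2 \<le> (2 * R)\<^sup>2 + M + - \<phi> z" using M[OF that] by linarith
    then show ?thesis by (simp add: E_def K_def flip: exp_add)
  qed
  \<comment> \<open>dominates both coefficients in the inequality \<open>main\<close> below\<close>
  define C where "C = 2 * K + (2 * D\<^sup>2 * K + 1) / \<epsilon>"
  have K0: "0 < K" by (simp add: K_def)
  have C0: "0 \<le> C" using e(1) K0 by (simp add: C_def)
  have "wnorm2 \<phi> u \<le> C * (wnorm2 \<phi> (dbar_form u) + wnorm2 \<phi> (dbar_adj_form \<phi> u))"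
    if u: "\<And>J. Ck 2 (u J)" "\<And>J. csupp (u J)" and uq: "\<And>J z. card J \<noteq> q \<Longrightarrow> u J z = 0" for u :: "'n form"
  proof -
    note c = smooth_form_cc0[OF \<phi> u]
    define F where "F z = Re (ext_inner (\<lambda>J. u J z) (\<lambda>J. u J z))" for z
    define G where "G z = Re (ext_inner (\<lambda>J. d_zbar j (u J) z) (\<lambda>J. d_zbar j (u J) z))" for z
    define lev where "lev z = levi_form (levi_matrix \<phi> z) (\<lambda>J. u J z)" for z
    define g where "g J = (\<lambda>z. X z * u J z)" for J
    have F: "F z = (\<Sum>J\<in>UNIV. (cmod (u J z))\<^sup>2)" for z by (simp add: F_def ext_inner_self)
    have G: "G z = (\<Sum>J\<in>UNIV. (cmod (d_zbar j (u J) z))\<^sup>2)" for z by (simp add: G_def ext_inner_self)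
    have F0: "0 \<le> F z" and G0: "0 \<le> G z" for z by (simp_all add: F G sum_nonneg)
    have lev0: "0 \<le> lev z" for z
      unfolding lev_def
    proof (rule levi_form_nonneg)
      fix c :: "'n \<Rightarrow> complex"
      show "0 \<le> Re (\<Sum>k\<in>UNIV. \<Sum>j\<in>UNIV. levi_matrix \<phi> z $ k $ j * (c k * cnj (c j)))"
        using plurisubharmonic_levi_nonneg[OF \<phi> psh, of z "\<chi> k. c k"] by simp
    qed
    have levF: "F z \<le> lev z / \<epsilon>" if "R \<le> norm z" for z
    proof -
      have "\<epsilon> * F z \<le> sum_smallest_eigenvalues q (levi_matrix \<phi> z) * F z"
        using R(2)[OF that] F0 by (intro mult_right_mono) auto
      also have "\<dots> \<le> lev z"
        unfolding F_def lev_def by (rule levi_form_lower_bound[OF levi_matrix_hermitian[OF \<phi>] q uq])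
      finally show ?thesis using e(1) by (simp add: pos_le_divide_eq mult.commute)
    qed
    have gC: "Ck 2 (g J)" "csupp (g J)" for J
      unfolding g_def by (intro Ck_mult X u) (rule csupp_mult2[OF u(2)])
    have u1: "u J differentiable (at z)" for J z
      using Ck_differentiable[of "Suc 0" "u J"] u(1) by (simp only: numeral_2_eq_2)
    have dg: "d_zbar j (g J) z = X z * d_zbar j (u J) z + dX z * u J z" for J z
      unfolding g_def dX_def d_zbar_wirt by (rule wirt_mult[OF Ck_differentiable[OF X[of "Suc 0"]] u1])
    \<comment> \<open>inside the ball the cut-off is one, outside the Levi form controls \<open>u\<close>\<close>
    have point1: "F z * exp (- \<phi> z) \<le> (\<Sum>J\<in>UNIV. (cmod (g J z))\<^sup>2 * E z) + 1 / \<epsilon> * (lev z * exp (- \<phi> z))" for z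
    proof (cases "norm z \<le> R")
      case True
      then have "X z = 1" using cutoff_eq_1[OF R(1) True] by (simp add: X_def)
      then have "(\<Sum>J\<in>UNIV. (cmod (g J z))\<^sup>2 * E z) = F z * E z" by (simp add: g_def F sum_distrib_right)
      moreover have "exp (- \<phi> z) \<le> E z" by (rule order_trans[OF _ E1]) (simp add: nonneg)
      then have "F z * exp (- \<phi> z) \<le> F z * E z" using F0 by (rule mult_left_mono)
      moreover have "0 \<le> 1 / \<epsilon> * (lev z * exp (- \<phi> z))" using lev0[of z] e(1) by simp
      ultimately show ?thesis by linarith
    next
      case False
      then have "F z * exp (- \<phi> z) \<le> lev z / \<epsilon> * exp (- \<phi> z)" by (intro mult_right_mono levF) auto
      moreover have "0 \<le> (\<Sum>J\<in>UNIV. (cmod (g J z))\<^sup>2 * E z)" using E1[of z] by (intro sum_nonneg) simp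
      ultimately show ?thesis by simp
    qed
    \<comment> \<open>the derivative of the cut-off vanishes inside the ball, so its term is controlled by the Levi form\<close>
    have point2: "(\<Sum>J\<in>UNIV. (cmod (d_zbar j (g J) z))\<^sup>2 * E z) \<le>
        2 * K * (G z * exp (- \<phi> z)) + 2 * D\<^sup>2 * K / \<epsilon> * (lev z * exp (- \<phi> z))" for z
    proof (cases "norm z \<le> 2 * R")
      case True
      have XF: "(cmod (dX z))\<^sup>2 * F z \<le> D\<^sup>2 / \<epsilon> * lev z"
      proof (cases "norm z < R")
        case True
        then show ?thesis using dX_in lev0[of z] e(1) by simp
      next
        case False
        have "(cmod (dX z))\<^sup>2 * F z \<le> D\<^sup>2 * (lev z / \<epsilon>)"
          using D False levF[of z] F0 by (intro mult_mono power_mono) auto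
        then show ?thesis by simp
      qed
      have "(cmod (d_zbar j (g J) z))\<^sup>2 \<le> 2 * (cmod (d_zbar j (u J) z))\<^sup>2 + 2 * (cmod (dX z))\<^sup>2 * (cmod (u J z))\<^sup>2" for J
      proof -
        have "(cmod (d_zbar j (g J) z))\<^sup>2 \<le> 2 * (cmod (X z * d_zbar j (u J) z))\<^sup>2 + 2 * (cmod (dX z * u J z))\<^sup>2"
          unfolding dg by (rule cmod_add_square_le)
        moreover have "cmod (X z * d_zbar j (u J) z) \<le> 1 * cmod (d_zbar j (u J) z)"
          unfolding norm_mult by (rule mult_right_mono[OF X1]) simp
        then have "(cmod (X z * d_zbar j (u J) z))\<^sup>2 \<le> (cmod (d_zbar j (u J) z))\<^sup>2" by (intro power_mono) auto
        moreover have "(cmod (dX z * u J z))\<^sup>2 = (cmod (dX z))\<^sup>2 * (cmod (u J z))\<^sup>2"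
          by (simp add: norm_mult power_mult_distrib)
        ultimately show ?thesis by linarith
      qed
      then have "(\<Sum>J\<in>UNIV. (cmod (d_zbar j (g J) z))\<^sup>2) \<le>
          (\<Sum>J\<in>UNIV. 2 * (cmod (d_zbar j (u J) z))\<^sup>2 + 2 * (cmod (dX z))\<^sup>2 * (cmod (u J z))\<^sup>2)"
        by (rule sum_mono)
      also have "\<dots> = 2 * G z + 2 * ((cmod (dX z))\<^sup>2 * F z)"
        by (simp add: G F sum.distrib sum_distrib_left mult.assoc)
      also have "\<dots> \<le> 2 * G z + 2 * (D\<^sup>2 / \<epsilon> * lev z)" using XF by linarith
      finally have "(\<Sum>J\<in>UNIV. (cmod (d_zbar j (g J) z))\<^sup>2) * E z \<le> (2 * G z + 2 * (D\<^sup>2 / \<epsilon> * lev z)) * (K * exp (- \<phi> z))"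
        using EK[OF True] E1[of z] G0[of z] lev0[of z] e(1) by (intro mult_mono) auto
      then show ?thesis unfolding sum_distrib_right[symmetric] by (simp add: algebra_simps)
    next
      case False
      then have "X z = 0" "dX z = 0" using cutoff_eq_0[OF R(1), of z] dX_out[of z] by (auto simp: X_def)
      then have "(\<Sum>J\<in>UNIV. (cmod (d_zbar j (g J) z))\<^sup>2 * E z) = 0" by (simp add: dg)
      then show ?thesis using G0[of z] lev0[of z] e(1) K0 by simp
    qed
    have cE: "continuous_on UNIV E" unfolding E_def by (intro continuous_intros)
    have cexp: "continuous_on UNIV (\<lambda>z. exp (- \<phi> z))" by (intro continuous_intros c\<phi>)
    have iF: "integrable lebesgue (\<lambda>z. F z * exp (- \<phi> z))"
      unfolding F_def by (intro cc0_integrable cc0_mult1 cc0_bounded_linear[OF bounded_linear_Re] cc0_ext_inner c cexp)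
    have iG: "integrable lebesgue (\<lambda>z. G z * exp (- \<phi> z))"
      unfolding G_def by (intro cc0_integrable cc0_mult1 cc0_bounded_linear[OF bounded_linear_Re] cc0_ext_inner c cexp)
    have iL: "integrable lebesgue (\<lambda>z. lev z * exp (- \<phi> z))"
      unfolding lev_def levi_form_def
      by (intro cc0_integrable cc0_mult1[OF _ cexp] cc0_bounded_linear[OF bounded_linear_Re] cc0_sum cc0_mult2[OF _ c(4)]
          cc0_ext_inner cc0_annih c)
    have sq: "cc0 h \<Longrightarrow> integrable lebesgue (\<lambda>z. (cmod (h z))\<^sup>2 * E z)" for h :: "(complex, 'n) vec \<Rightarrow> complex"
    proof -
      assume h: "cc0 h"
      have "integrable lebesgue (\<lambda>z. Re (h z * cnj (h z)) * E z)"
        by (intro cc0_integrable cc0_mult1[OF _ cE] cc0_bounded_linear[OF bounded_linear_Re] cc0_mult cc0_cnj h)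
      moreover have "Re (x * cnj x) = (cmod x)\<^sup>2" for x unfolding cmod_power2 by (simp add: power2_eq_square)
      ultimately show ?thesis by simp
    qed
    have ig: "integrable lebesgue (\<lambda>z. (cmod (g J z))\<^sup>2 * E z)" "integrable lebesgue (\<lambda>z. (cmod (d_zbar j (g J) z))\<^sup>2 * E z)" for J
      by (intro sq smooth_form_cc0[OF \<phi> gC])+
    define BL where "BL = (LINT z|lebesgue. lev z * exp (- \<phi> z))"
    define WG where "WG = (LINT z|lebesgue. G z * exp (- \<phi> z))"
    define S1 where "S1 = (\<Sum>J\<in>UNIV. (LINT z|lebesgue. (cmod (g J z))\<^sup>2 * E z))"
    define S2 where "S2 = (\<Sum>J\<in>UNIV. (LINT z|lebesgue. (cmod (d_zbar j (g J) z))\<^sup>2 * E z))"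
    have "(LINT z|lebesgue. F z * exp (- \<phi> z)) \<le>
        (LINT z|lebesgue. (\<Sum>J\<in>UNIV. (cmod (g J z))\<^sup>2 * E z) + 1 / \<epsilon> * (lev z * exp (- \<phi> z)))"
      by (rule integral_mono[OF iF _ point1])
        (intro Bochner_Integration.integrable_add Bochner_Integration.integrable_sum ig integrable_mult_right iL)
    also have "\<dots> = S1 + 1 / \<epsilon> * BL"
      unfolding S1_def BL_def
      by (subst Bochner_Integration.integral_add)
        (simp_all add: ig iL Bochner_Integration.integrable_sum Bochner_Integration.integral_sum)
    finally have a1: "wnorm2 \<phi> u \<le> S1 + 1 / \<epsilon> * BL" by (simp add: wnorm2_def F_def)
    have a2: "S1 \<le> S2"
      unfolding S1_def S2_def E_def by (intro sum_mono dbar_Poincare gC)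
    have "S2 = (LINT z|lebesgue. (\<Sum>J\<in>UNIV. (cmod (d_zbar j (g J) z))\<^sup>2 * E z))"
      unfolding S2_def by (rule Bochner_Integration.integral_sum[symmetric]) (rule ig)
    also have "\<dots> \<le> (LINT z|lebesgue. 2 * K * (G z * exp (- \<phi> z)) + 2 * D\<^sup>2 * K / \<epsilon> * (lev z * exp (- \<phi> z)))"
      by (rule integral_mono[OF _ _ point2])
        (intro Bochner_Integration.integrable_add Bochner_Integration.integrable_sum ig integrable_mult_right iL iG)+
    also have "\<dots> = 2 * K * WG + 2 * D\<^sup>2 * K / \<epsilon> * BL"
      unfolding WG_def BL_def
      by (subst Bochner_Integration.integral_add) (simp_all add: iG iL)
    finally have a3: "S2 \<le> 2 * K * WG + 2 * D\<^sup>2 * K / \<epsilon> * BL" .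
    have WG: "WG = wnorm2 \<phi> (\<lambda>J. d_zbar j (u J))" by (simp add: wnorm2_def G_def WG_def)
    have main: "wnorm2 \<phi> u \<le> 2 * K * wnorm2 \<phi> (\<lambda>J. d_zbar j (u J)) + (2 * D\<^sup>2 * K / \<epsilon> + 1 / \<epsilon>) * BL"
      unfolding distrib_right WG[symmetric] using a1 a2 a3 by linarith
    have B0: "0 \<le> BL" unfolding BL_def by (rule integral_nonneg_AE) (simp add: lev0)
    have "wnorm2 \<phi> (\<lambda>J. d_zbar j (u J)) \<le> (\<Sum>j\<in>UNIV. wnorm2 \<phi> (\<lambda>J. d_zbar j (u J)))"
      by (rule member_le_sum) (auto simp: wnorm2_nonneg)
    then have A: "wnorm2 \<phi> (\<lambda>J. d_zbar j (u J)) + BL \<le>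
        wnorm2 \<phi> (dbar_form u) + wnorm2 \<phi> (dbar_adj_form \<phi> u)"
      using Kohn_Morrey[OF \<phi> u] by (simp add: lev_def BL_def)
    have "wnorm2 \<phi> u \<le> C * wnorm2 \<phi> (\<lambda>J. d_zbar j (u J)) + C * BL"
    proof (rule order_trans[OF main], rule add_mono; rule mult_right_mono)
      show "2 * K \<le> C" using e(1) K0 by (simp add: C_def)
      show "2 * D\<^sup>2 * K / \<epsilon> + 1 / \<epsilon> \<le> C" using e(1) K0 by (simp add: C_def add_divide_distrib)
    qed (use wnorm2_nonneg B0 in auto)
    also have "\<dots> \<le> C * (wnorm2 \<phi> (dbar_form u) + wnorm2 \<phi> (dbar_adj_form \<phi> u))"
      unfolding distrib_left[symmetric] by (rule mult_left_mono[OF A C0])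
    finally show ?thesis .
  qed
  with C0 show ?thesis by blast
qed

section \<open>Regularisation by convolution\<close>

lemma csupp_uniformly_continuous:
  fixes f :: "'a::euclidean_space \<Rightarrow> 'b::real_normed_vector"
  assumes f: "continuous_on UNIV f" "csupp f" and e: "0 < e"
  shows "\<exists>d>0. \<forall>x y. dist x y < d \<longrightarrow> dist (f x) (f y) < e"
proof -
  obtain r where r: "0 < r" "\<And>x. r < norm x \<Longrightarrow> f x = 0" using csuppE[OF f(2)] by blast
  have "uniformly_continuous_on (cball 0 (r + 1)) f"
    by (rule compact_uniformly_continuous) (use f(1) continuous_on_subset in auto)
  then obtain d where d: "0 < d" "\<And>x y. x \<in> cball 0 (r + 1) \<Longrightarrow> y \<in> cball 0 (r + 1) \<Longrightarrow> dist y x < d \<Longrightarrow> dist (f y) (f x) < e"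
    unfolding uniformly_continuous_on_def using e by blast
  have "dist (f x) (f y) < e" if xy: "dist x y < min d 1" for x y
  proof (cases "norm x \<le> r + 1 \<and> norm y \<le> r + 1")
    case True
    then show ?thesis using d(2)[of y x] xy by simp
  next
    case False
    have "\<bar>norm x - norm y\<bar> \<le> dist x y" by (simp add: dist_norm norm_triangle_ineq3)
    then have "r < norm x" "r < norm y" using False xy by auto
    then show ?thesis using r(2) e by simp
  qed
  then show ?thesis using d(1) by (intro exI[of _ "min d 1"]) auto
qed

lemma dird_expand_Basis:
  assumes "f differentiable (at x)"
  shows "dird h f x = (\<Sum>b\<in>Basis. (h \<bullet> b) *\<^sub>R dird b f x)"
proof -
  have lin: "linear (frechet_derivative f (at x))" using assms by (rule linear_frechet_derivative)
  have "dird h f x = frechet_derivative f (at x) (\<Sum>b\<in>Basis. (h \<bullet> b) *\<^sub>R b)"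
    by (simp add: dird_def euclidean_representation)
  then show ?thesis by (simp add: dird_def linear_sum[OF lin] linear_cmul[OF lin])
qed

text \<open>
  The derivatives have compact support, hence are uniformly continuous, and the mean value theorem makes the remainder
  of the first-order expansion uniformly small.  This is what allows differentiation under the convolution integral.
\<close>

lemma uniform_differentiability:
  fixes \<rho> :: "'a::euclidean_space \<Rightarrow> real"
  assumes \<rho>: "Ck 1 \<rho>" "csupp \<rho>" and e: "0 < e"
  shows "\<exists>d>0. \<forall>x h. norm h < d \<longrightarrow> \<bar>\<rho> (x + h) - \<rho> x - dird h \<rho> x\<bar> \<le> e * norm h"
proof -
  have \<rho>1: "Ck (Suc 0) \<rho>" using \<rho>(1) by simp
  have d0: "\<rho> differentiable (at x)" for x by (rule Ck_differentiable[OF \<rho>1])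
  define e' where "e' = e / real DIM('a)"
  have e': "0 < e'" using e by (simp add: e'_def)
  have "\<forall>b\<in>Basis. \<exists>d>0. \<forall>x y. dist x y < d \<longrightarrow> dist (dird b \<rho> x) (dird b \<rho> y) < e'"
    using csupp_uniformly_continuous[OF Ck_continuous[OF Ck_dird[OF \<rho>1]] csupp_dird[OF \<rho>(2)] e'] by blast
  then obtain \<delta> where \<delta>: "\<And>b. b \<in> Basis \<Longrightarrow> 0 < \<delta> b"
    "\<And>b x y. b \<in> Basis \<Longrightarrow> dist x y < \<delta> b \<Longrightarrow> dist (dird b \<rho> x) (dird b \<rho> y) < e'" by metis
  define d where "d = Min (\<delta> ` Basis)"
  have d: "0 < d" "\<And>b. b \<in> Basis \<Longrightarrow> d \<le> \<delta> b" using \<delta>(1) by (auto simp: d_def)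
  have "\<bar>\<rho> (x + h) - \<rho> x - dird h \<rho> x\<bar> \<le> e * norm h" if h: "norm h < d" for x h
  proof -
    obtain s where s: "0 < s" "s < 1" "\<rho> (x + 1 *\<^sub>R h) - \<rho> x = 1 * dird h \<rho> (x + s *\<^sub>R h)"
      using dird_MVT[OF d0 zero_less_one] by blast
    have small: "dist (x + s *\<^sub>R h) x < d"
    proof -
      have "s * norm h \<le> 1 * norm h" using s by (intro mult_right_mono) auto
      then show ?thesis using h s by (simp add: dist_norm)
    qed
    have "\<rho> (x + h) - \<rho> x - dird h \<rho> x = dird h \<rho> (x + s *\<^sub>R h) - dird h \<rho> x" using s(3) by simp
    also have "\<dots> = (\<Sum>b\<in>Basis. (h \<bullet> b) * (dird b \<rho> (x + s *\<^sub>R h) - dird b \<rho> x))"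
      unfolding dird_expand_Basis[OF d0, of h] by (simp add: sum_subtractf right_diff_distrib)
    also have "\<bar>\<dots>\<bar> \<le> (\<Sum>b\<in>(Basis :: 'a set). norm h * e')"
    proof (rule order_trans[OF sum_abs], rule sum_mono)
      fix b :: 'a assume b: "b \<in> Basis"
      have "\<bar>dird b \<rho> (x + s *\<^sub>R h) - dird b \<rho> x\<bar> \<le> e'"
        using \<delta>(2)[OF b, of "x + s *\<^sub>R h" x] small d(2)[OF b] by (simp add: dist_real_def)
      then show "\<bar>(h \<bullet> b) * (dird b \<rho> (x + s *\<^sub>R h) - dird b \<rho> x)\<bar> \<le> norm h * e'"
        unfolding abs_mult using Basis_le_norm[OF b, of h] by (intro mult_mono) auto
    qed
    also have "\<dots> = e * norm h" by (simp add: e'_def)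
    finally show ?thesis .
  qed
  then show ?thesis using d(1) by blast
qed

definition conv :: "('a::euclidean_space \<Rightarrow> real) \<Rightarrow> ('a \<Rightarrow> complex) \<Rightarrow> 'a \<Rightarrow> complex" where
  "conv \<rho> f z = (LINT y|lebesgue. f y * complex_of_real (\<rho> (z - y)))"

lemma integrable_conv:
  assumes f: "integrable lebesgue f" and \<rho>: "continuous_on UNIV \<rho>" "\<And>x. \<bar>\<rho> x\<bar> \<le> B"
  shows "integrable lebesgue (\<lambda>y. f y * complex_of_real (\<rho> (z - y)))"
proof (rule Bochner_Integration.integrable_bound[of lebesgue "\<lambda>y. complex_of_real B * f y"])
  have "continuous_on UNIV (\<lambda>y. complex_of_real (\<rho> (z - y)))"
    by (intro continuous_intros continuous_on_compose2[OF \<rho>(1)]) auto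
  from borel_measurable_continuous_onI[OF this]
  have "(\<lambda>y. complex_of_real (\<rho> (z - y))) \<in> borel_measurable lebesgue" by (simp add: measurable_completion)
  then show "(\<lambda>y. f y * complex_of_real (\<rho> (z - y))) \<in> borel_measurable lebesgue"
    using borel_measurable_integrable[OF f] by simp
  show "AE y in lebesgue. norm (f y * complex_of_real (\<rho> (z - y))) \<le> norm (complex_of_real B * f y)"
  proof (rule AE_I2)
    fix y
    have "cmod (f y) * \<bar>\<rho> (z - y)\<bar> \<le> cmod (f y) * \<bar>B\<bar>"
      using \<rho>(2)[of "z - y"] by (intro mult_left_mono) auto
    then show "norm (f y * complex_of_real (\<rho> (z - y))) \<le> norm (complex_of_real B * f y)"
      by (simp add: norm_mult mult.commute)
  qed
qed (use f in simp)

text \<open>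
  The remainder of the convolution is at most the uniform remainder of \<open>\<rho>\<close> times the integral of \<open>\<bar>f\<bar>\<close>.
\<close>

lemma conv_has_derivative:
  fixes \<rho> :: "'a::euclidean_space \<Rightarrow> real"
  assumes f: "integrable lebesgue f" and \<rho>: "Ck 1 \<rho>" "csupp \<rho>"
  shows "(conv \<rho> f has_derivative (\<lambda>h. \<Sum>b\<in>Basis. (h \<bullet> b) *\<^sub>R conv (dird b \<rho>) f z)) (at z)"
proof -
  have \<rho>1: "Ck (Suc 0) \<rho>" using \<rho>(1) by simp
  have d0: "\<rho> differentiable (at x)" for x by (rule Ck_differentiable[OF \<rho>1])
  have c\<rho>: "continuous_on UNIV \<rho>" by (rule Ck_continuous[OF \<rho>1])
  have i0: "integrable lebesgue (\<lambda>y. f y * complex_of_real (\<rho> (z - y)))" for z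
  proof -
    obtain B where "0 < B" "\<And>x. norm (\<rho> x) \<le> B" using csupp_bounded[OF c\<rho> \<rho>(2)] by blast
    then show ?thesis by (intro integrable_conv[OF f c\<rho>]) auto
  qed
  have i1: "integrable lebesgue (\<lambda>y. f y * complex_of_real (dird b \<rho> (z - y)))" if "b \<in> Basis" for b z
  proof -
    have c: "continuous_on UNIV (dird b \<rho>)" by (rule Ck_continuous[OF Ck_dird[OF \<rho>1 that]])
    obtain B where "0 < B" "\<And>x. norm (dird b \<rho> x) \<le> B" using csupp_bounded[OF c csupp_dird[OF \<rho>(2)]] by blast
    then show ?thesis by (intro integrable_conv[OF f c]) auto
  qed
  define A where "A = (LINT y|lebesgue. cmod (f y))"
  have A: "0 \<le> A" by (simp add: A_def)
  have inorm: "integrable lebesgue (\<lambda>y. cmod (f y))" using f by simp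
  define D where "D h = (\<Sum>b\<in>Basis. (h \<bullet> b) *\<^sub>R conv (dird b \<rho>) f z)" for h
  have blD: "bounded_linear D"
    unfolding D_def by (intro bounded_linear_sum bounded_linear_compose[OF bounded_linear_scaleR_left] bounded_linear_inner_left)
  show ?thesis
    unfolding D_def[symmetric]
  proof (rule has_derivativeI_sandwich[OF zero_less_one blD[unfolded D_def, folded D_def]])
    show "norm (conv \<rho> f y - conv \<rho> f z - D (y - z)) / norm (y - z) \<le>
        norm (conv \<rho> f y - conv \<rho> f z - D (y - z)) / norm (y - z)" for y by simp
    show "((\<lambda>y. norm (conv \<rho> f y - conv \<rho> f z - D (y - z)) / norm (y - z)) \<longlongrightarrow> 0) (at z)"
    proof (rule tendstoI)
      fix e :: real assume e: "0 < e"
      define e' where "e' = e / 2 / (A + 1)"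
      have e': "0 < e'" using e A by (simp add: e'_def)
      obtain d where d: "0 < d" "\<And>x h. norm h < d \<Longrightarrow> \<bar>\<rho> (x + h) - \<rho> x - dird h \<rho> x\<bar> \<le> e' * norm h"
        using uniform_differentiability[OF \<rho> e'] by blast
      have "dist (norm (conv \<rho> f y - conv \<rho> f z - D (y - z)) / norm (y - z)) 0 < e"
        if y: "y \<noteq> z" "dist y z < d" for y
      proof -
        define h where "h = y - z"
        have h: "h \<noteq> 0" "norm h < d" "y = z + h" using y by (auto simp: h_def dist_norm)
        have idird: "integrable lebesgue (\<lambda>x. f x * complex_of_real (dird h \<rho> (z - x)))"
          and Dh: "D h = (LINT x|lebesgue. f x * complex_of_real (dird h \<rho> (z - x)))"
        proof -
          have e: "(\<lambda>x. f x * complex_of_real (dird h \<rho> (z - x))) =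
              (\<lambda>x. \<Sum>b\<in>Basis. (h \<bullet> b) *\<^sub>R (f x * complex_of_real (dird b \<rho> (z - x))))"
            by (rule ext) (simp add: dird_expand_Basis[OF d0, of h] scaleR_conv_of_real sum_distrib_left mult.left_commute)
          have i: "integrable lebesgue (\<lambda>x. (h \<bullet> b) *\<^sub>R (f x * complex_of_real (dird b \<rho> (z - x))))" if "b \<in> Basis" for b
            by (intro integrable_scaleR_right i1 that)
          show "integrable lebesgue (\<lambda>x. f x * complex_of_real (dird h \<rho> (z - x)))"
            unfolding e by (rule Bochner_Integration.integrable_sum) (rule i)
          show "D h = (LINT x|lebesgue. f x * complex_of_real (dird h \<rho> (z - x)))"
            unfolding e D_def conv_def
            by (subst Bochner_Integration.integral_sum[OF i]) (simp_all add: i1)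
        qed
        have "conv \<rho> f y - conv \<rho> f z - D h =
            (LINT x|lebesgue. f x * complex_of_real (\<rho> (z + h - x)) - f x * complex_of_real (\<rho> (z - x)) - f x * complex_of_real (dird h \<rho> (z - x)))"
          unfolding conv_def Dh h(3) by (simp add: Bochner_Integration.integral_diff i0 idird)
        also have "\<dots> = (LINT x|lebesgue. f x * complex_of_real (\<rho> (z - x + h) - \<rho> (z - x) - dird h \<rho> (z - x)))"
          by (simp add: algebra_simps)
        also have "norm \<dots> \<le> (LINT x|lebesgue. cmod (f x) * (e' * norm h))"
        proof (rule Bochner_Integration.integral_norm_bound_integral)
          show "integrable lebesgue (\<lambda>x. f x * complex_of_real (\<rho> (z - x + h) - \<rho> (z - x) - dird h \<rho> (z - x)))"
            using Bochner_Integration.integrable_diff[OF Bochner_Integration.integrable_diff[OF i0[of "z + h"] i0[of z]] idird]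
            by (simp add: algebra_simps)
          show "integrable lebesgue (\<lambda>x. cmod (f x) * (e' * norm h))" by (intro integrable_mult_left inorm)
          show "norm (f x * complex_of_real (\<rho> (z - x + h) - \<rho> (z - x) - dird h \<rho> (z - x))) \<le> cmod (f x) * (e' * norm h)" for x
            unfolding norm_mult norm_of_real by (intro mult_left_mono d(2) h) simp
        qed
        also have "\<dots> = A * e' * norm h" by (simp add: A_def)
        finally have "norm (conv \<rho> f y - conv \<rho> f z - D h) / norm h \<le> A * e'"
          using h(1) by (simp add: pos_divide_le_eq)
        also have "A * e' < e"
        proof -
          have "A * e' \<le> (A + 1) * e'" using e' by simp
          also have "\<dots> = e / 2"
          proof -
            have "A + 1 \<noteq> 0" using A by simp
            from nonzero_eq_divide_eq[THEN iffD1, OF this e'_def] show ?thesis by (simp only: mult.commute)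
          qed
          also have "\<dots> < e" using e by simp
          finally show ?thesis .
        qed
        finally show ?thesis by (simp add: h_def)
      qed
      then show "\<forall>\<^sub>F y in at z. dist (norm (conv \<rho> f y - conv \<rho> f z - D (y - z)) / norm (y - z)) 0 < e"
        unfolding eventually_at using d(1) by blast
    qed
  qed
qed

lemma dird_conv:
  assumes "integrable lebesgue f" "Ck 1 \<rho>" "csupp \<rho>" "b \<in> Basis"
  shows "dird b (conv \<rho> f) z = conv (dird b \<rho>) f z"
  using dird_eqI[OF conv_has_derivative[OF assms(1-3)], of b z] assms(4)
  by (simp add: inner_Basis if_distrib[of "\<lambda>x. x *\<^sub>R _"] cong: if_cong)

lemma Ck_conv:
  fixes \<rho> :: "'a::euclidean_space \<Rightarrow> real"
  assumes f: "integrable lebesgue f" and \<rho>: "\<And>k. Ck k \<rho>" "csupp \<rho>"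
  shows "Ck k (conv \<rho> f)"
proof (rule Ck_coinduct[of _ "{conv \<rho> f |\<rho>. (\<forall>k. Ck k \<rho>) \<and> csupp \<rho>}"])
  show "conv \<rho> f \<in> {conv \<rho> f |\<rho>. (\<forall>k. Ck k \<rho>) \<and> csupp \<rho>}" using \<rho> by blast
next
  fix g x assume "g \<in> {conv \<rho> f |\<rho>. (\<forall>k. Ck k \<rho>) \<and> csupp \<rho>}"
  then obtain \<rho> where "g = conv \<rho> f" "\<forall>k. Ck k \<rho>" "csupp \<rho>" by blast
  then show "g differentiable (at x)"
    using conv_has_derivative[OF f, of \<rho>] unfolding differentiable_def by blast
next
  fix g :: "'a \<Rightarrow> complex" and b :: 'a
  assume "g \<in> {conv \<rho> f |\<rho>. (\<forall>k. Ck k \<rho>) \<and> csupp \<rho>}" and b: "b \<in> Basis"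
  then obtain \<rho> where g: "g = conv \<rho> f" "\<forall>k. Ck k \<rho>" "csupp \<rho>" by blast
  have "dird b g = conv (dird b \<rho>) f" unfolding g(1) using dird_conv[OF f _ g(3) b] g(2) by blast
  moreover have "\<forall>k. Ck k (dird b \<rho>)" using g(2) Ck_dird[OF _ b] by blast
  ultimately show "dird b g \<in> {conv \<rho> f |\<rho>. (\<forall>k. Ck k \<rho>) \<and> csupp \<rho>}" using csupp_dird[OF g(3)] by blast
qed

lemma csupp_conv:
  assumes "csupp f" "csupp \<rho>"
  shows "csupp (conv \<rho> f)"
proof -
  obtain r where r: "0 < r" "\<And>x. r < norm x \<Longrightarrow> f x = 0" using csuppE[OF assms(1)] by blast
  obtain s where s: "0 < s" "\<And>x. s < norm x \<Longrightarrow> \<rho> x = 0" using csuppE[OF assms(2)] by blast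
  have "conv \<rho> f z = 0" if z: "r + s < norm z" for z
  proof -
    have "f y * complex_of_real (\<rho> (z - y)) = 0" for y
    proof (cases "r < norm y")
      case False
      have "norm z \<le> norm (z - y) + norm y" using norm_triangle_ineq[of "z - y" y] by simp
      then have "s < norm (z - y)" using z False by linarith
      then show ?thesis using s(2) by simp
    qed (simp add: r(2))
    then show ?thesis by (simp only: conv_def Bochner_Integration.integral_zero)
  qed
  then show ?thesis unfolding csupp_def by blast
qed

lemma sqint_indicator_cball: "sqint (\<lambda>x::'a::euclidean_space. complex_of_real (indicator (cball 0 r) x))"
proof -
  have i: "integrable lebesgue (indicator (cball 0 r) :: 'a \<Rightarrow> real)"
    using lmeasurable_cball[of 0 r] by (auto simp: fmeasurable_def)
  have "(\<lambda>x::'a. complex_of_real (indicator (cball 0 r) x)) \<in> borel_measurable lebesgue"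
    by (rule borel_measurable_integrable[OF integrable_of_real[OF i]])
  moreover have "(\<lambda>x. (cmod (complex_of_real (indicator (cball 0 r) x)))\<^sup>2) = (indicator (cball 0 r) :: 'a \<Rightarrow> real)"
    by (auto simp: fun_eq_iff indicator_def)
  ultimately show ?thesis using i unfolding sqint_def by (simp only: simp_thms)
qed

lemma sqint_csupp_integrable:
  assumes f: "sqint f" "csupp f"
  shows "integrable lebesgue f"
proof -
  obtain r where r: "0 < r" "\<And>x. r < norm x \<Longrightarrow> f x = 0" using csuppE[OF f(2)] by blast
  from integrable_sqint_mult[OF f(1) sqint_indicator_cball[of r]]
  have "integrable lebesgue (\<lambda>x. f x * complex_of_real (indicator (cball 0 r) x))" .
  moreover have "(\<lambda>x. f x * complex_of_real (indicator (cball 0 r) x)) = f"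
    using r(2) by (auto simp: fun_eq_iff indicator_def not_le)
  ultimately show ?thesis by simp
qed

lemma sqint_cc:
  fixes f :: "'a::euclidean_space \<Rightarrow> complex"
  assumes "continuous_on UNIV f" "csupp f"
  shows "sqint f"
proof -
  have "integrable lebesgue (\<lambda>x. Re (f x * cnj (f x)))"
  proof (rule integrable_csupp)
    show "continuous_on UNIV (\<lambda>x. Re (f x * cnj (f x)))" by (intro continuous_intros assms)
    show "csupp (\<lambda>x. Re (f x * cnj (f x)))" by (rule csupp_subset[OF assms(2)]) simp
  qed
  moreover have "Re (x * cnj x) = (cmod x)\<^sup>2" for x unfolding cmod_power2 by (simp add: power2_eq_square)
  ultimately show ?thesis
    using borel_measurable_continuous_onI[OF assms(1)] by (simp add: sqint_def measurable_completion)
qed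

section \<open>Mollification in the mean\<close>

lemma L2_dominated_convergence:
  fixes f :: "nat \<Rightarrow> 'a::euclidean_space \<Rightarrow> complex"
  assumes W: "sqint W" and f: "\<And>n. f n \<in> borel_measurable lebesgue"
    and bd: "\<And>n x. cmod (f n x) \<le> cmod (W x)" and F: "F \<in> borel_measurable lebesgue"
    and lim: "AE x in lebesgue. (\<lambda>n. f n x) \<longlonglongrightarrow> F x"
  shows "sqint F" "\<And>n. sqint (f n)" "(\<lambda>n. L2_class (f n)) \<longlonglongrightarrow> L2_class F"
proof -
  show sf: "sqint (f n)" for n
    by (rule sqint_bound[OF W f, of _ 1]) (simp add: bd)
  have bF: "AE x in lebesgue. cmod (F x) \<le> cmod (W x)"
    using lim
  proof eventually_elim
    case (elim x)
    show ?case by (rule LIMSEQ_le_const2[OF tendsto_norm[OF elim]]) (use bd in blast)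
  qed
  show sF: "sqint F" by (rule sqint_bound[OF W F, of 1]) (use bF in simp)
  have "(\<lambda>n. LINT x|lebesgue. (cmod (f n x - F x))\<^sup>2) \<longlonglongrightarrow> (LINT x|(lebesgue :: 'a measure). 0 :: real)"
  proof (rule integral_dominated_convergence[where w = "\<lambda>x. 4 * (cmod (W x))\<^sup>2"])
    show "integrable lebesgue (\<lambda>x. 4 * (cmod (W x))\<^sup>2)" using W by (simp add: sqint_def)
    show "AE x in lebesgue. (\<lambda>n. (cmod (f n x - F x))\<^sup>2) \<longlonglongrightarrow> 0"
      using lim
    proof eventually_elim
      case (elim x)
      have "(\<lambda>n. (cmod (f n x - F x))\<^sup>2) \<longlonglongrightarrow> (cmod (F x - F x))\<^sup>2" by (intro tendsto_intros elim)
      then show ?case by simp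
    qed
    show "AE x in lebesgue. norm ((cmod (f n x - F x))\<^sup>2) \<le> 4 * (cmod (W x))\<^sup>2" for n
      using bF
    proof eventually_elim
      case (elim x)
      have "cmod (f n x - F x) \<le> cmod (W x) + cmod (W x)"
        using norm_triangle_ineq4[of "f n x" "F x"] bd[of n x] elim by linarith
      then have "(cmod (f n x - F x))\<^sup>2 \<le> (2 * cmod (W x))\<^sup>2" by (intro power_mono) auto
      then show ?case by (simp add: power_mult_distrib)
    qed
    show "(\<lambda>x. (cmod (f n x - F x))\<^sup>2) \<in> borel_measurable lebesgue" for n
      using f[of n] F by measurable
  qed simp
  then have "(\<lambda>n. (norm (L2_class (f n) - L2_class F))\<^sup>2) \<longlonglongrightarrow> 0"
    by (simp add: L2_class_diff sf sF L2_class_norm sqint_diff)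
  from tendsto_real_sqrt[OF this] have "(\<lambda>n. norm (L2_class (f n) - L2_class F)) \<longlonglongrightarrow> 0" by simp
  then show "(\<lambda>n. L2_class (f n)) \<longlonglongrightarrow> L2_class F"
    by (simp add: tendsto_norm_zero_iff LIM_zero_iff)
qed

text \<open>
  The radial retraction to the disc of radius \<open>m\<close>; being continuous, it keeps approximations continuous.
\<close>

definition clamp :: "real \<Rightarrow> complex \<Rightarrow> complex" where
  "clamp m y = (m / max m (cmod y)) *\<^sub>R y"

lemma clamp_bound: "0 < m \<Longrightarrow> cmod (clamp m y) \<le> m"
  by (auto simp: clamp_def max_def divide_simps mult_left_mono)

lemma clamp_id: "0 < m \<Longrightarrow> cmod y \<le> m \<Longrightarrow> clamp m y = y"
  by (simp add: clamp_def max_absorb1)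

lemma continuous_clamp: "0 < m \<Longrightarrow> continuous_on UNIV (clamp m)"
  unfolding clamp_def by (intro continuous_intros) (auto simp: max_def)

text \<open>
  A measurable function is the almost everywhere limit of continuous functions.  Retracting their values and cutting
  off their supports keeps the limit, because \<open>h\<close> is bounded with bounded support, and gives a dominating function.
\<close>

lemma cc_dense_bounded:
  fixes h :: "'a::euclidean_space \<Rightarrow> complex"
  assumes h: "h \<in> borel_measurable lebesgue" and m: "0 < m" "\<And>x. cmod (h x) \<le> m" and s: "csupp h" and e: "0 < e"
  shows "sqint h \<and> (\<exists>g. continuous_on UNIV g \<and> csupp g \<and> norm (L2_class h - L2_class g) < e)"
proof -
  obtain r where r: "0 < r" "\<And>x. r < norm x \<Longrightarrow> h x = 0" using csuppE[OF s] by blast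
  have "h measurable_on UNIV"
    by (rule lebesgue_measurable_imp_measurable_on) (use h in auto)
  then obtain N G where N: "negligible N" and G: "\<And>n. continuous_on UNIV (G n)"
    "\<And>x. x \<notin> N \<Longrightarrow> (\<lambda>n. G n x) \<longlonglongrightarrow> h x"
    unfolding measurable_on_def by auto
  define k where "k n x = complex_of_real (cutoff r x) * clamp m (G n x)" for n x
  have kc: "continuous_on UNIV (k n)" for n
    unfolding k_def
    by (intro continuous_intros Ck_continuous[OF Ck_of_real[OF cutoff_Ck[of 0]]] continuous_on_compose2[OF continuous_clamp[OF m(1)] G(1)]) auto
  have ks: "k n x = 0" if "2 * r < norm x" for n x
    using cutoff_eq_0[OF r(1), of x] that by (simp add: k_def)
  have kcs: "csupp (k n)" for n unfolding csupp_def using ks by blast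
  define W where "W x = complex_of_real m * complex_of_real (indicator (cball 0 (2 * r)) x)" for x :: 'a
  have W: "sqint W" unfolding W_def by (intro sqint_scale sqint_indicator_cball)
  have kb: "cmod (k n x) \<le> cmod (W x)" for n x
  proof (cases "norm x \<le> 2 * r")
    case True
    have "cmod (k n x) \<le> 1 * m"
      unfolding k_def norm_mult using cutoff_bounds[of r x] clamp_bound[OF m(1)] by (intro mult_mono) auto
    then show ?thesis using True m(1) by (simp add: W_def norm_mult)
  qed (simp add: ks)
  have lim: "AE x in lebesgue. (\<lambda>n. k n x) \<longlonglongrightarrow> h x"
  proof -
    have "AE x in lebesgue. x \<notin> N"
      by (rule AE_not_in) (use N in \<open>simp add: negligible_iff_null_sets\<close>)
    then show ?thesis
    proof eventually_elim
      case (elim x)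
      have "isCont (clamp m) (h x)" using continuous_clamp[OF m(1)] by (simp add: continuous_on_eq_continuous_at)
      then have "(\<lambda>n. clamp m (G n x)) \<longlonglongrightarrow> clamp m (h x)" using G(2)[OF elim] by (rule isCont_tendsto_compose)
      then have "(\<lambda>n. k n x) \<longlonglongrightarrow> complex_of_real (cutoff r x) * clamp m (h x)"
        unfolding k_def by (intro tendsto_intros)
      moreover have "complex_of_real (cutoff r x) * clamp m (h x) = h x"
        using clamp_id[OF m(1) m(2)[of x]] r(2)[of x] cutoff_eq_1[OF r(1), of x] by (cases "norm x \<le> r") auto
      ultimately show ?case by simp
    qed
  qed
  have km: "k n \<in> borel_measurable lebesgue" for n
    using borel_measurable_continuous_onI[OF kc] by (simp add: measurable_completion)
  note D = L2_dominated_convergence[OF W km kb h lim]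
  from LIMSEQ_D[OF D(3) e] obtain n where "norm (L2_class (k n) - L2_class h) < e" by blast
  then have "norm (L2_class h - L2_class (k n)) < e" by (simp only: norm_minus_commute)
  then show ?thesis using D(1) kc kcs by blast
qed

lemma cc_dense:
  fixes f :: "'a::euclidean_space \<Rightarrow> complex"
  assumes f: "sqint f" "csupp f" and e: "0 < e"
  shows "\<exists>g. continuous_on UNIV g \<and> csupp g \<and> norm (L2_class f - L2_class g) < e"
proof -
  define h where "h n x = (if cmod (f x) \<le> real (Suc n) then f x else 0)" for n x
  have fm[measurable]: "f \<in> borel_measurable lebesgue" using f(1) by (rule sqint_measurable)
  have hm: "h n \<in> borel_measurable lebesgue" for n unfolding h_def[abs_def] by measurable
  have hb: "cmod (h n x) \<le> cmod (f x)" for n x by (simp add: h_def)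
  have lim: "(\<lambda>n. h n x) \<longlonglongrightarrow> f x" for x
  proof (rule tendsto_eventually)
    obtain N where N: "cmod (f x) \<le> real N" using real_arch_simple by blast
    show "\<forall>\<^sub>F n in sequentially. h n x = f x"
      using eventually_ge_at_top[of N] by eventually_elim (use N in \<open>auto simp: h_def\<close>)
  qed
  note D = L2_dominated_convergence[OF f(1) hm hb fm AE_I2[OF lim]]
  have e2: "0 < e / 2" using e by simp
  from LIMSEQ_D[OF D(3) e2] obtain n where n: "norm (L2_class (h n) - L2_class f) < e / 2" by blast
  have "csupp (h n)" by (rule csupp_subset[OF f(2)]) (simp add: h_def)
  moreover have "cmod (h n x) \<le> real (Suc n)" for x by (simp add: h_def)
  ultimately have "\<exists>g. continuous_on UNIV g \<and> csupp g \<and> norm (L2_class (h n) - L2_class g) < e / 2"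
    using cc_dense_bounded[OF hm[of n], of "real (Suc n)" "e / 2"] e2 by simp
  then obtain g where g: "continuous_on UNIV g" "csupp g" "norm (L2_class (h n) - L2_class g) < e / 2" by blast
  have "norm (L2_class f - L2_class g) \<le> norm (L2_class f - L2_class (h n)) + norm (L2_class (h n) - L2_class g)"
    using norm_triangle_ineq[of "L2_class f - L2_class (h n)" "L2_class (h n) - L2_class g"] by simp
  then have "norm (L2_class f - L2_class g) < e" using n g(3) by (simp add: norm_minus_commute)
  then show ?thesis using g by blast
qed

lemma nn_integral_translate:
  fixes h :: "'a::euclidean_space \<Rightarrow> ennreal"
  assumes [measurable]: "h \<in> borel_measurable borel"
  shows "(\<integral>\<^sup>+z. h (z - y) \<partial>lborel) = (\<integral>\<^sup>+z. h z \<partial>lborel)"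
proof -
  have "(\<integral>\<^sup>+z. h z \<partial>lborel) = (\<integral>\<^sup>+z. h z \<partial>(distr lborel borel ((+) (- y))))" by (simp add: lborel_distr_plus)
  also have "\<dots> = (\<integral>\<^sup>+z. h (- y + z) \<partial>lborel)" by (subst nn_integral_distr) auto
  finally show ?thesis by simp
qed

text \<open>
  With a Borel representative \<open>g\<close> the integrand \<open>(z, y) \<mapsto> \<bar>g y\<bar>\<^sup>2 \<rho> (y - z)\<close> is jointly measurable, as Fubini's theorem
  requires.
\<close>

lemma complex_borel_representative:
  fixes f :: "'a::euclidean_space \<Rightarrow> complex"
  assumes f: "f \<in> borel_measurable lebesgue"
  shows "\<exists>g\<in>borel_measurable borel. AE x in lebesgue. f x = g x"
proof -
  have "\<exists>g\<in>borel_measurable lborel. AE x in lborel. Re (f x) = g x"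
    by (rule completion_ex_borel_measurable_real) (use f in measurable)
  then obtain a where a: "a \<in> borel_measurable lborel" "AE x in lborel. Re (f x) = a x" by blast
  have "\<exists>g\<in>borel_measurable lborel. AE x in lborel. Im (f x) = g x"
    by (rule completion_ex_borel_measurable_real) (use f in measurable)
  then obtain b where b: "b \<in> borel_measurable lborel" "AE x in lborel. Im (f x) = b x" by blast
  have [measurable]: "a \<in> borel_measurable borel" "b \<in> borel_measurable borel" using a b by simp_all
  have "(\<lambda>x. complex_of_real (a x) + \<i> * complex_of_real (b x)) \<in> borel_measurable borel" by measurable
  moreover have "AE x in lborel. f x = complex_of_real (a x) + \<i> * complex_of_real (b x)"
    using a(2) b(2) by eventually_elim (simp add: complex_eq_iff)
  then have "AE x in lebesgue. f x = complex_of_real (a x) + \<i> * complex_of_real (b x)"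
    by (rule AE_completion)
  ultimately show ?thesis
    by (intro bexI[where x = "\<lambda>x. complex_of_real (a x) + \<i> * complex_of_real (b x)"])
qed

locale mollifier =
  fixes \<rho> :: "'a::euclidean_space \<Rightarrow> real" and d :: real
  assumes smooth: "\<And>k. Ck k \<rho>" and nonneg: "\<And>x. 0 \<le> \<rho> x" and even: "\<And>x. \<rho> (- x) = \<rho> x"
    and support: "0 < d" "\<And>x. d \<le> norm x \<Longrightarrow> \<rho> x = 0" and total: "(LINT x|lebesgue. \<rho> x) = 1"
begin

lemma compact_support: "csupp \<rho>"
  unfolding csupp_def using support(2) by (intro exI[of _ d]) auto

lemma cont: "continuous_on UNIV \<rho>"
  by (rule Ck_continuous[OF smooth])

lemma borel[measurable]: "\<rho> \<in> borel_measurable borel"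
  by (rule borel_measurable_continuous_onI[OF cont])

lemma flip: "\<rho> (z - y) = \<rho> (y - z)"
  using even[of "y - z"] by simp

lemma nn_total: "(\<integral>\<^sup>+y. ennreal (\<rho> (y - z)) \<partial>lborel) = 1"
proof -
  have "(\<integral>\<^sup>+y. ennreal (\<rho> (y - z)) \<partial>lborel) = (\<integral>\<^sup>+y. ennreal (\<rho> y) \<partial>lborel)"
    by (rule nn_integral_translate) measurable
  also have "\<dots> = (\<integral>\<^sup>+y. ennreal (\<rho> y) \<partial>lebesgue)" by (rule nn_integral_completion[symmetric])
  also have "\<dots> = ennreal (LINT x|lebesgue. \<rho> x)"
    by (rule nn_integral_eq_integral[OF integrable_csupp[OF cont compact_support]]) (simp add: nonneg)
  finally show ?thesis by (simp add: total)
qed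

text \<open>By the Cauchy-Schwarz inequality and Fubini's theorem, convolution with a probability density is a contraction.\<close>

lemma conv_contraction:
  assumes f: "sqint f" "csupp f"
  shows "sqint (conv \<rho> f) \<and> norm (L2_class (conv \<rho> f)) \<le> norm (L2_class f)"
proof -
  have fm: "f \<in> borel_measurable lebesgue" using f(1) by (rule sqint_measurable)
  have fi: "integrable lebesgue f" by (rule sqint_csupp_integrable[OF f])
  obtain g where g[measurable]: "g \<in> borel_measurable borel" and fg: "AE x in lebesgue. f x = g x"
    using complex_borel_representative[OF fm] by blast
  obtain B where B: "0 < B" "\<And>x. norm (\<rho> x) \<le> B" using csupp_bounded[OF cont compact_support] by blast
  \<comment> \<open>Cauchy-Schwarz with the density written as the square of its root\<close>
  have pt: "ennreal ((cmod (conv \<rho> f z))\<^sup>2) \<le> (\<integral>\<^sup>+y. ennreal ((cmod (g y))\<^sup>2 * \<rho> (y - z)) \<partial>lborel)" for z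
  proof -
    have i: "integrable lebesgue (\<lambda>y. f y * complex_of_real (\<rho> (z - y)))"
      by (rule integrable_conv[OF fi cont, of B]) (use B in auto)
    have "ennreal (cmod (conv \<rho> f z)) \<le> (\<integral>\<^sup>+y. ennreal (cmod (f y * complex_of_real (\<rho> (z - y)))) \<partial>lebesgue)"
      unfolding conv_def by (rule integral_norm_bound_ennreal[OF i])
    also have "\<dots> = (\<integral>\<^sup>+y. ennreal (cmod (g y) * \<rho> (y - z)) \<partial>lebesgue)"
    proof (rule nn_integral_cong_AE)
      show "AE y in lebesgue. ennreal (cmod (f y * complex_of_real (\<rho> (z - y)))) = ennreal (cmod (g y) * \<rho> (y - z))"
        using fg by eventually_elim (simp add: norm_mult flip[of z] nonneg)
    qed
    also have "\<dots> = (\<integral>\<^sup>+y. ennreal (cmod (g y) * \<rho> (y - z)) \<partial>lborel)" by (rule nn_integral_completion)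
    also have "\<dots> = (\<integral>\<^sup>+y. ennreal (cmod (g y) * sqrt (\<rho> (y - z))) * ennreal (sqrt (\<rho> (y - z))) \<partial>lborel)"
      by (rule nn_integral_cong) (simp add: ennreal_mult[symmetric] nonneg mult.assoc)
    finally have 1: "ennreal (cmod (conv \<rho> f z)) \<le> \<dots>" .
    have "ennreal ((cmod (conv \<rho> f z))\<^sup>2) = (ennreal (cmod (conv \<rho> f z)))\<^sup>2" by (simp add: ennreal_power)
    also have "\<dots> \<le> (\<integral>\<^sup>+y. ennreal (cmod (g y) * sqrt (\<rho> (y - z))) * ennreal (sqrt (\<rho> (y - z))) \<partial>lborel)\<^sup>2"
      using 1 by (rule power_mono) simp
    also have "\<dots> \<le> (\<integral>\<^sup>+y. (ennreal (cmod (g y) * sqrt (\<rho> (y - z))))\<^sup>2 \<partial>lborel) * (\<integral>\<^sup>+y. (ennreal (sqrt (\<rho> (y - z))))\<^sup>2 \<partial>lborel)"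
      by (rule Cauchy_Schwarz_nn_integral) measurable
    also have "(\<integral>\<^sup>+y. (ennreal (sqrt (\<rho> (y - z))))\<^sup>2 \<partial>lborel) = 1"
      by (simp add: ennreal_power nonneg nn_total)
    also have "(\<integral>\<^sup>+y. (ennreal (cmod (g y) * sqrt (\<rho> (y - z))))\<^sup>2 \<partial>lborel) = (\<integral>\<^sup>+y. ennreal ((cmod (g y))\<^sup>2 * \<rho> (y - z)) \<partial>lborel)"
      by (rule nn_integral_cong) (simp add: ennreal_power nonneg power_mult_distrib)
    finally show ?thesis by simp
  qed
  have "(\<integral>\<^sup>+z. ennreal ((cmod (conv \<rho> f z))\<^sup>2) \<partial>lborel) \<le> (\<integral>\<^sup>+z. (\<integral>\<^sup>+y. ennreal ((cmod (g y))\<^sup>2 * \<rho> (y - z)) \<partial>lborel) \<partial>lborel)"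
    by (rule nn_integral_mono) (rule pt)
  also have "\<dots> = (\<integral>\<^sup>+y. (\<integral>\<^sup>+z. ennreal ((cmod (g y))\<^sup>2 * \<rho> (y - z)) \<partial>lborel) \<partial>lborel)"
    by (rule lborel_pair.Fubini') measurable
  also have "\<dots> = (\<integral>\<^sup>+y. ennreal ((cmod (g y))\<^sup>2) \<partial>lborel)"
  proof (rule nn_integral_cong)
    fix y
    have "(\<integral>\<^sup>+z. ennreal ((cmod (g y))\<^sup>2 * \<rho> (y - z)) \<partial>lborel) = (\<integral>\<^sup>+z. ennreal ((cmod (g y))\<^sup>2) * ennreal (\<rho> (z - y)) \<partial>lborel)"
      by (rule nn_integral_cong) (simp add: ennreal_mult nonneg flip[of y])
    also have "\<dots> = ennreal ((cmod (g y))\<^sup>2) * (\<integral>\<^sup>+z. ennreal (\<rho> (z - y)) \<partial>lborel)"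
      by (rule nn_integral_cmult) measurable
    finally show "(\<integral>\<^sup>+z. ennreal ((cmod (g y))\<^sup>2 * \<rho> (y - z)) \<partial>lborel) = ennreal ((cmod (g y))\<^sup>2)"
      by (simp add: nn_total)
  qed
  also have "\<dots> = (\<integral>\<^sup>+y. ennreal ((cmod (g y))\<^sup>2) \<partial>lebesgue)" by (rule nn_integral_completion[symmetric])
  also have "\<dots> = (\<integral>\<^sup>+y. ennreal ((cmod (f y))\<^sup>2) \<partial>lebesgue)"
    by (rule nn_integral_cong_AE) (use fg in eventually_elim, simp)
  also have "\<dots> = ennreal ((norm (L2_class f))\<^sup>2)" by (rule ennreal_norm_L2_class[OF f(1), symmetric])
  finally have le: "(\<integral>\<^sup>+z. ennreal ((cmod (conv \<rho> f z))\<^sup>2) \<partial>lebesgue) \<le> ennreal ((norm (L2_class f))\<^sup>2)"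
    by (simp add: nn_integral_completion)
  have s: "sqint (conv \<rho> f)"
    by (rule sqint_cc[OF Ck_continuous[OF Ck_conv[OF fi smooth compact_support]] csupp_conv[OF f(2) compact_support]])
  then have "(norm (L2_class (conv \<rho> f)))\<^sup>2 \<le> (norm (L2_class f))\<^sup>2"
    using le by (simp add: ennreal_norm_L2_class[symmetric] ennreal_le_iff)
  then have "norm (L2_class (conv \<rho> f)) \<le> norm (L2_class f)" by (rule power2_le_imp_le) simp
  with s show ?thesis by blast
qed

lemma conv_close:
  assumes g: "continuous_on UNIV g" "csupp g" and e: "\<And>x y. dist x y < d \<Longrightarrow> dist (g x) (g y) \<le> e"
  shows "cmod (conv \<rho> g z - g z) \<le> e"
proof -
  have gi: "integrable lebesgue g" by (rule integrable_csupp[OF g])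
  obtain B where B: "0 < B" "\<And>x. norm (\<rho> x) \<le> B" using csupp_bounded[OF cont compact_support] by blast
  have i: "integrable lebesgue (\<lambda>y. g y * complex_of_real (\<rho> (z - y)))"
    by (rule integrable_conv[OF gi cont, of B]) (use B in auto)
  have r: "continuous_on UNIV (\<lambda>y. \<rho> (z - y))" "csupp (\<lambda>y. \<rho> (z - y))"
  proof -
    show "continuous_on UNIV (\<lambda>y. \<rho> (z - y))" by (rule continuous_on_compose2[OF cont]) (auto intro: continuous_intros)
    have "\<rho> (z - y) = 0" if "norm z + d < norm y" for y
    proof (rule support(2))
      show "d \<le> norm (z - y)" using norm_triangle_ineq2[of y z] that by (simp add: norm_minus_commute)
    qed
    then show "csupp (\<lambda>y. \<rho> (z - y))" unfolding csupp_def by blast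
  qed
  have ir: "integrable lebesgue (\<lambda>y. \<rho> (z - y))" by (rule integrable_csupp[OF r])
  have one: "(LINT y|lebesgue. \<rho> (z - y)) = 1"
    using LINT_translate[OF borel, of "- z"] total by (simp add: flip[of z])
  have "conv \<rho> g z - g z = (LINT y|lebesgue. g y * complex_of_real (\<rho> (z - y)) - g z * complex_of_real (\<rho> (z - y)))"
    unfolding conv_def using one
    by (subst Bochner_Integration.integral_diff[OF i]) (simp_all add: ir)
  also have "cmod \<dots> \<le> (LINT y|lebesgue. e * \<rho> (z - y))"
  proof (rule Bochner_Integration.integral_norm_bound_integral)
    show "integrable lebesgue (\<lambda>y. g y * complex_of_real (\<rho> (z - y)) - g z * complex_of_real (\<rho> (z - y)))"
      by (intro Bochner_Integration.integrable_diff i integrable_mult_right integrable_of_real ir)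
    show "integrable lebesgue (\<lambda>y. e * \<rho> (z - y))" by (intro integrable_mult_right ir)
    fix y
    show "cmod (g y * complex_of_real (\<rho> (z - y)) - g z * complex_of_real (\<rho> (z - y))) \<le> e * \<rho> (z - y)"
    proof (cases "norm (z - y) < d")
      case True
      then have "cmod (g y - g z) \<le> e" using e[of y z] by (simp add: dist_norm norm_minus_commute)
      then show ?thesis
        using nonneg[of "z - y"] by (simp add: norm_mult mult_right_mono flip: left_diff_distrib)
    next
      case False
      then show ?thesis using support(2)[of "z - y"] by simp
    qed
  qed
  also have "\<dots> = e" using one by simp
  finally show ?thesis .
qed

end

definition moll :: "nat \<Rightarrow> 'a::euclidean_space \<Rightarrow> real" where
  "moll n x = bump (1 / real (Suc n)) x * (1 / (LINT x|lebesgue. bump (1 / real (Suc n)) (x :: 'a)))"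

lemma mollifier_moll: "mollifier (moll n :: 'a::euclidean_space \<Rightarrow> real) (1 / real (Suc n))"
proof
  define d where "d = 1 / real (Suc n)"
  have d: "0 < d" by (simp add: d_def)
  define I where "I = (LINT x|lebesgue. bump d (x :: 'a))"
  have m: "moll n = (\<lambda>x :: 'a. bump d x * (1 / I))" by (rule ext) (simp add: moll_def I_def d_def)
  have c: "continuous_on UNIV (bump d :: 'a \<Rightarrow> real)" by (rule Ck_continuous[OF bump_Ck])
  have s: "csupp (bump d :: 'a \<Rightarrow> real)"
    unfolding csupp_def by (intro exI[of _ d] allI impI bump_eq_0[OF d]) simp
  have i: "integrable lebesgue (bump d :: 'a \<Rightarrow> real)" by (rule integrable_csupp[OF c s])
  have I: "0 < I"
  proof -
    have "0 \<le> I" unfolding I_def by (rule integral_nonneg_AE) (simp add: bump_nonneg)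
    moreover have "I \<noteq> 0"
    proof
      assume "I = 0"
      then have "AE x in lebesgue. bump d (x :: 'a) = 0"
        unfolding I_def using integral_nonneg_eq_0_iff_AE[OF i] by (simp add: bump_nonneg)
      then have "AE x in lebesgue. x \<notin> ball (0 :: 'a) d"
        by eventually_elim (use bump_pos[OF d] in \<open>force simp: dist_norm\<close>)
      then have "ball (0 :: 'a) d \<in> null_sets lebesgue"
        by (subst (asm) AE_iff_null_sets[symmetric]) auto
      then have "negligible (ball (0 :: 'a) d)" by (simp add: negligible_iff_null_sets)
      then show False using open_not_negligible[of "ball (0 :: 'a) d"] d by simp
    qed
    ultimately show ?thesis by simp
  qed
  show "Ck k (moll n :: 'a \<Rightarrow> real)" for k unfolding m by (intro Ck_mult bump_Ck Ck_const)
  show "0 \<le> moll n x" for x :: 'a using I by (simp add: m bump_nonneg)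
  show "moll n (- x) = moll n x" for x :: 'a by (simp add: m bump_def)
  show "0 < 1 / real (Suc n)" by simp
  show "moll n x = 0" if "1 / real (Suc n) \<le> norm x" for x :: 'a
    using bump_eq_0[OF d, of x] that by (simp add: m d_def)
  show "(LINT x|lebesgue. moll n (x :: 'a)) = 1" using I by (simp add: m) (simp add: I_def)
qed

text \<open>
  The mollifications are contractions, which reduces the claim to continuous functions with compact support, for
  which the convergence is uniform with supports in a fixed ball.
\<close>

theorem mollify_tendsto:
  fixes f :: "'a::euclidean_space \<Rightarrow> complex"
  assumes f: "sqint f" "csupp f"
  shows "(\<lambda>n. L2_class (conv (moll n) f)) \<longlonglongrightarrow> L2_class f"
proof (rule LIMSEQ_I)
  fix e :: real assume e: "0 < e"
  then have e3: "0 < e / 3" by simp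
  obtain g where g: "continuous_on UNIV g" "csupp g" "norm (L2_class f - L2_class g) < e / 3"
    using cc_dense[OF f e3] by blast
  have sg: "sqint g" by (rule sqint_cc[OF g(1,2)])
  have gi: "integrable lebesgue g" by (rule integrable_csupp[OF g(1,2)])
  have fi: "integrable lebesgue f" by (rule sqint_csupp_integrable[OF f])
  obtain r where r: "0 < r" "\<And>x. r < norm x \<Longrightarrow> g x = 0" using csuppE[OF g(2)] by blast
  define w where "w x = complex_of_real (indicator (cball 0 (r + 1)) x)" for x :: 'a
  have w: "sqint w" unfolding w_def by (rule sqint_indicator_cball)
  define \<delta> where "\<delta> = e / (3 * (norm (L2_class w) + 1))"
  have nw: "0 < norm (L2_class w) + 1" by (simp add: add_nonneg_pos)
  have \<delta>: "0 < \<delta>" unfolding \<delta>_def using e nw by (intro divide_pos_pos mult_pos_pos) auto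
  have \<delta>w: "\<delta> * norm (L2_class w) < e / 3"
  proof -
    have "\<delta> * norm (L2_class w) < \<delta> * (norm (L2_class w) + 1)" using \<delta> by simp
    also have "\<dots> = e / 3" unfolding \<delta>_def using nw by (simp add: field_simps)
    finally show ?thesis .
  qed
  obtain d where d: "0 < d" "\<And>x y. dist x y < d \<Longrightarrow> dist (g x) (g y) < \<delta>"
    using csupp_uniformly_continuous[OF g(1,2) \<delta>] by blast
  obtain N where N: "1 / real (Suc N) < d" using nat_approx_posE[OF d(1)] by blast
  have "norm (L2_class (conv (moll n) f) - L2_class f) < e" if n: "n \<ge> N" for n
  proof -
    interpret mollifier "moll n :: 'a \<Rightarrow> real" "1 / real (Suc n)" by (rule mollifier_moll)
    have nd: "1 / real (Suc n) < d" "1 / real (Suc n) \<le> 1"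
    proof -
      have "1 / real (Suc n) \<le> 1 / real (Suc N)" using n by (intro divide_left_mono) auto
      then show "1 / real (Suc n) < d" using N by linarith
    qed simp
    have cf: "sqint (conv (moll n) f)" and cg: "sqint (conv (moll n) g)"
      using conv_contraction[OF f] conv_contraction[OF sg g(2)] by blast+
    have diff: "conv (moll n) (\<lambda>x. f x - g x) = (\<lambda>z. conv (moll n) f z - conv (moll n) g z)"
    proof
      fix z :: 'a
      obtain B where B: "0 < B" "\<And>x. norm (moll n (x :: 'a)) \<le> B" using csupp_bounded[OF cont compact_support] by blast
      have ic: "integrable lebesgue (\<lambda>y. h y * complex_of_real (moll n (z - y)))" if "integrable lebesgue h" for h
        by (rule integrable_conv[OF that cont, of B]) (use B in auto)
      show "conv (moll n) (\<lambda>x. f x - g x) z = conv (moll n) f z - conv (moll n) g z"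
        unfolding conv_def left_diff_distrib by (intro Bochner_Integration.integral_diff ic fi gi)
    qed
    have sfg: "csupp (\<lambda>x. f x - g x)"
      using csupp_add[OF f(2), of "\<lambda>x. - g x"] csupp_subset[OF g(2), of "\<lambda>x. - g x"] by simp
    have 1: "norm (L2_class (conv (moll n) f) - L2_class (conv (moll n) g)) < e / 3"
      using conv_contraction[OF sqint_diff[OF f(1) sg] sfg] g(3)
      by (simp add: diff L2_class_diff cf cg f(1) sg)
    have "norm (L2_class (conv (moll n) g) - L2_class g) \<le> \<delta> * norm (L2_class w)"
    proof -
      have pw: "cmod (conv (moll n) g z - g z) \<le> cmod (\<delta> *\<^sub>R w z)" for z
      proof (cases "norm z \<le> r + 1")
        case True
        have "cmod (conv (moll n) g z - g z) \<le> \<delta>"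
          by (rule conv_close[OF g(1,2)]) (use d(2) nd(1) in \<open>meson less_imp_le order.strict_trans\<close>)
        then show ?thesis using True \<delta> by (simp add: w_def)
      next
        case False
        have "g y * complex_of_real (moll n (z - y)) = 0" for y
        proof (cases "r < norm y")
          case False
          have "1 / real (Suc n) \<le> norm (z - y)"
            using norm_triangle_ineq2[of z y] \<open>\<not> norm z \<le> r + 1\<close> False nd(2) by linarith
          then show ?thesis using support(2)[of "z - y"] by simp
        qed (simp add: r(2))
        then have "conv (moll n) g z = 0" by (simp only: conv_def Bochner_Integration.integral_zero)
        moreover have "g z = 0" using r(2)[of z] False by simp
        ultimately show ?thesis by simp
      qed
      have sw: "sqint (\<lambda>x. \<delta> *\<^sub>R w x)" by (rule sqint_scaleR[OF w])
      have "(norm (L2_class (conv (moll n) g) - L2_class g))\<^sup>2 \<le> (norm (\<delta> *\<^sub>R L2_class w))\<^sup>2"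
        unfolding L2_class_diff[OF cg sg] L2_class_scaleR[OF w] L2_class_norm[OF sqint_diff[OF cg sg]] L2_class_norm[OF sw]
      proof (rule integral_mono)
        show "integrable lebesgue (\<lambda>x. (cmod (conv (moll n) g x - g x))\<^sup>2)" using sqint_diff[OF cg sg] by (simp add: sqint_def)
        show "integrable lebesgue (\<lambda>x. (cmod (\<delta> *\<^sub>R w x))\<^sup>2)" using sw by (simp add: sqint_def del: norm_scaleR)
        show "(cmod (conv (moll n) g x - g x))\<^sup>2 \<le> (cmod (\<delta> *\<^sub>R w x))\<^sup>2" for x by (rule power_mono[OF pw]) simp
      qed
      then have "norm (L2_class (conv (moll n) g) - L2_class g) \<le> norm (\<delta> *\<^sub>R L2_class w)"
        by (rule power2_le_imp_le) simp
      then show ?thesis using \<delta> by simp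
    qed
    then have 2: "norm (L2_class (conv (moll n) g) - L2_class g) < e / 3" using \<delta>w by linarith
    have "norm (L2_class (conv (moll n) f) - L2_class f) \<le>
        norm (L2_class (conv (moll n) f) - L2_class (conv (moll n) g)) + norm (L2_class (conv (moll n) g) - L2_class g)
        + norm (L2_class g - L2_class f)"
      using norm_triangle_ineq[of "L2_class (conv (moll n) f) - L2_class (conv (moll n) g)" "L2_class (conv (moll n) g) - L2_class g"]
        norm_triangle_ineq[of "L2_class (conv (moll n) f) - L2_class g" "L2_class g - L2_class f"] by simp
    then show ?thesis using 1 2 g(3) by (simp add: norm_minus_commute)
  qed
  then show "\<exists>N. \<forall>n\<ge>N. norm (L2_class (conv (moll n) f) - L2_class f) < e" by blast
qed

section \<open>Weighted square-integrable functions\<close>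

text \<open>
  This factor identifies the weighted space with the unweighted one.
\<close>

definition wm :: "(complex ^ 'n::finite \<Rightarrow> real) \<Rightarrow> (complex ^ 'n \<Rightarrow> complex) \<Rightarrow> complex ^ 'n \<Rightarrow> complex" where
  "wm \<phi> f z = f z * complex_of_real (exp (- \<phi> z / 2))"

definition wclass :: "(complex ^ 'n::finite \<Rightarrow> real) \<Rightarrow> (complex ^ 'n \<Rightarrow> complex) \<Rightarrow> (complex ^ 'n) L2" where
  "wclass \<phi> f = L2_class (wm \<phi> f)"

lemma cmod_wm: "(cmod (wm \<phi> f z))\<^sup>2 = (cmod (f z))\<^sup>2 * exp (- \<phi> z)"
proof -
  have "(exp (- \<phi> z / 2))\<^sup>2 = exp (- \<phi> z)" by (simp add: power2_eq_square flip: exp_add)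
  then show ?thesis by (simp add: wm_def norm_mult power_mult_distrib)
qed

lemma continuous_measurable_lebesgue:
  fixes f :: "'a::euclidean_space \<Rightarrow> 'b::real_normed_vector"
  shows "continuous_on UNIV f \<Longrightarrow> f \<in> borel_measurable lebesgue"
  using borel_measurable_continuous_onI[of f] by (simp add: measurable_completion)

lemma measurable_continuous_mult:
  fixes f h :: "'a::euclidean_space \<Rightarrow> complex"
  assumes "continuous_on UNIV h" "f \<in> borel_measurable lebesgue"
  shows "(\<lambda>z. h z * f z) \<in> borel_measurable lebesgue"
  using continuous_measurable_lebesgue[OF assms(1)] assms(2) by (rule borel_measurable_times)

lemma continuous_exp_half:
  "continuous_on UNIV \<phi> \<Longrightarrow> continuous_on UNIV (\<lambda>z. complex_of_real (exp (c * \<phi> z / 2)))"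
  by (intro continuous_intros) auto

lemma L2_weight_iff:
  assumes c: "continuous_on UNIV \<phi>"
  shows "f \<in> L2_weight \<phi> \<longleftrightarrow> sqint (wm \<phi> f)"
proof -
  have "f \<in> borel_measurable lebesgue \<longleftrightarrow> wm \<phi> f \<in> borel_measurable lebesgue"
  proof
    assume "f \<in> borel_measurable lebesgue"
    from measurable_continuous_mult[OF continuous_exp_half[OF c, of "- 1"] this]
    show "wm \<phi> f \<in> borel_measurable lebesgue" by (simp add: wm_def[abs_def] mult.commute)
  next
    assume "wm \<phi> f \<in> borel_measurable lebesgue"
    from measurable_continuous_mult[OF continuous_exp_half[OF c, of 1] this]
    have "(\<lambda>z. complex_of_real (exp (1 * \<phi> z / 2)) * wm \<phi> f z) \<in> borel_measurable lebesgue" .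
    moreover have "complex_of_real (exp (1 * \<phi> z / 2)) * wm \<phi> f z = f z" for z
    proof -
      have "complex_of_real (exp (1 * \<phi> z / 2)) * wm \<phi> f z = complex_of_real (exp (\<phi> z / 2) * exp (- \<phi> z / 2)) * f z"
        by (simp add: wm_def)
      also have "exp (\<phi> z / 2) * exp (- \<phi> z / 2) = 1" by (simp flip: exp_add)
      finally show ?thesis by simp
    qed
    ultimately show "f \<in> borel_measurable lebesgue" by simp
  qed
  then show ?thesis by (simp add: L2_weight_def sqint_def cmod_wm)
qed

lemma wm_add: "wm \<phi> (\<lambda>z. f z + g z) = (\<lambda>z. wm \<phi> f z + wm \<phi> g z)"
  and wm_diff: "wm \<phi> (\<lambda>z. f z - g z) = (\<lambda>z. wm \<phi> f z - wm \<phi> g z)"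
  and wm_mult: "wm \<phi> (\<lambda>z. h z * f z) = (\<lambda>z. h z * wm \<phi> f z)"
  and wm_zero: "wm \<phi> (\<lambda>z. 0) = (\<lambda>z. 0)"
  by (simp_all add: wm_def[abs_def] algebra_simps)

text \<open>
  Local square integrability in the form of its use.  Weighted square-integrable functions have it because the weight is
  bounded on compact sets.
\<close>

definition loc2 :: "('a::euclidean_space \<Rightarrow> complex) \<Rightarrow> bool" where
  "loc2 f \<longleftrightarrow> f \<in> borel_measurable lebesgue \<and> (\<forall>h. continuous_on UNIV h \<longrightarrow> csupp h \<longrightarrow> sqint (\<lambda>z. h z * f z))"

lemma loc2D: "loc2 f \<Longrightarrow> continuous_on UNIV h \<Longrightarrow> csupp h \<Longrightarrow> sqint (\<lambda>z. h z * f z)"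
  by (simp add: loc2_def)

lemma loc2_integrable: "loc2 f \<Longrightarrow> continuous_on UNIV h \<Longrightarrow> csupp h \<Longrightarrow> integrable lebesgue (\<lambda>z. h z * f z)"
  by (rule sqint_csupp_integrable[OF loc2D csupp_mult1])

lemma sqint_cc_mult:
  assumes f: "sqint f" and h: "continuous_on UNIV h" "csupp h"
  shows "sqint (\<lambda>z. h z * f z)"
proof -
  obtain B where B: "0 < B" "\<And>x. norm (h x) \<le> B" using csupp_bounded[OF h] by blast
  show ?thesis
    by (rule sqint_bound[OF f measurable_continuous_mult[OF h(1) sqint_measurable[OF f]], of B])
      (simp add: norm_mult mult_right_mono B)
qed

lemma loc2_mult:
  assumes "loc2 f" "continuous_on UNIV k"
  shows "loc2 (\<lambda>z. k z * f z)"
  unfolding loc2_def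
proof (intro conjI allI impI)
  show "(\<lambda>z. k z * f z) \<in> borel_measurable lebesgue"
    using assms by (auto simp: loc2_def intro: measurable_continuous_mult)
  fix h :: "'a \<Rightarrow> complex" assume h: "continuous_on UNIV h" "csupp h"
  have "sqint (\<lambda>z. (h z * k z) * f z)"
    by (rule loc2D[OF assms(1)]) (intro continuous_intros h assms(2) csupp_mult1)+
  then show "sqint (\<lambda>z. h z * (k z * f z))" by (simp add: mult.assoc)
qed

lemma loc2_zero: "loc2 (\<lambda>z. 0)"
  by (simp add: loc2_def)

lemma loc2_add: "loc2 f \<Longrightarrow> loc2 g \<Longrightarrow> loc2 (\<lambda>z. f z + g z)"
  by (auto simp: loc2_def distrib_left intro: sqint_add borel_measurable_add)

lemma loc2_scale: "loc2 f \<Longrightarrow> loc2 (\<lambda>z. c * f z)"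
  by (rule loc2_mult) (auto intro: continuous_intros)

lemma loc2_uminus: "loc2 f \<Longrightarrow> loc2 (\<lambda>z. - f z)"
  using loc2_scale[of f "- 1"] by simp

lemma loc2_diff: "loc2 f \<Longrightarrow> loc2 g \<Longrightarrow> loc2 (\<lambda>z. f z - g z)"
  using loc2_add[of f "\<lambda>z. - g z"] loc2_uminus[of g] by simp

lemma loc2_sum: "(\<And>i. i \<in> I \<Longrightarrow> loc2 (f i)) \<Longrightarrow> loc2 (\<lambda>z. \<Sum>i\<in>I. f i z)"
  by (induction I rule: infinite_finite_induct) (auto intro: loc2_zero loc2_add)

lemma loc2_annih: "(\<And>J. loc2 (F J)) \<Longrightarrow> loc2 (\<lambda>z. annih k (\<lambda>J. F J z) L)"
  by (cases "k \<in> L") (simp_all add: annih_def loc2_zero loc2_scale)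

lemma loc2_creat: "(\<And>J. loc2 (F J)) \<Longrightarrow> loc2 (\<lambda>z. creat k (\<lambda>J. F J z) L)"
  by (cases "k \<in> L") (simp_all add: creat_def loc2_zero loc2_scale)

lemma L2_weight_loc2:
  assumes c: "continuous_on UNIV \<phi>" and f: "sqint (wm \<phi> f)"
  shows "loc2 f"
  unfolding loc2_def
proof (intro conjI allI impI)
  show "f \<in> borel_measurable lebesgue" using f L2_weight_iff[OF c, of f] by (simp add: L2_weight_def)
  fix h :: "complex ^ 'a \<Rightarrow> complex" assume h: "continuous_on UNIV h" "csupp h"
  have "sqint (\<lambda>z. (h z * complex_of_real (exp (1 * \<phi> z / 2))) * wm \<phi> f z)"
    by (intro sqint_cc_mult f continuous_intros h continuous_exp_half c csupp_mult1)
  moreover have "(h z * complex_of_real (exp (1 * \<phi> z / 2))) * wm \<phi> f z = h z * f z" for z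
  proof -
    have "(h z * complex_of_real (exp (1 * \<phi> z / 2))) * wm \<phi> f z = h z * f z * complex_of_real (exp (\<phi> z / 2) * exp (- \<phi> z / 2))"
      by (simp add: wm_def)
    also have "exp (\<phi> z / 2) * exp (- \<phi> z / 2) = 1" by (simp flip: exp_add)
    finally show ?thesis by simp
  qed
  ultimately show "sqint (\<lambda>z. h z * f z)" by (simp only:)
qed

section \<open>Weak derivatives and convolution\<close>

lemma dird_reflect:
  assumes "f differentiable (at (z - y))"
  shows "dird b (\<lambda>y. f (z - y)) y = - dird b f (z - y)" "(\<lambda>y. f (z - y)) differentiable (at y)"
proof -
  have f: "(f has_derivative frechet_derivative f (at (z - y))) (at (z - y))"
    using assms frechet_derivative_works by blast
  have m: "((\<lambda>y. z - y) has_derivative (\<lambda>h. - h)) (at y)" by (auto intro!: derivative_eq_intros)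
  have d: "((\<lambda>y. f (z - y)) has_derivative (\<lambda>h. frechet_derivative f (at (z - y)) (- h))) (at y)"
    by (rule has_derivative_compose[OF m f])
  show "(\<lambda>y. f (z - y)) differentiable (at y)" using d unfolding differentiable_def by blast
  have "linear (frechet_derivative f (at (z - y)))" using assms by (rule linear_frechet_derivative)
  then show "dird b (\<lambda>y. f (z - y)) y = - dird b f (z - y)"
    using dird_eqI[OF d] by (simp add: dird_def linear_neg)
qed

lemma Ck_reflect: "Ck k f \<Longrightarrow> Ck k (\<lambda>y. f (z - y))"
proof (induction k arbitrary: f)
  case 0
  then show ?case by (auto intro!: continuous_on_compose2[of UNIV f] continuous_intros)
next
  case (Suc k)
  have d: "f differentiable (at x)" for x using Suc.prems by (rule Ck_differentiable)
  have "dird b (\<lambda>y. f (z - y)) = (\<lambda>y. - dird b f (z - y))" for b using dird_reflect(1)[OF d] by auto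
  then show ?case unfolding Ck_Suc_iff
    using dird_reflect(2)[OF d] Suc.IH[OF Ck_dird[OF Suc.prems]] by (simp add: Ck_uminus)
qed

lemma test_funI:
  fixes f :: "complex ^ 'n::finite \<Rightarrow> complex"
  assumes "\<And>k. Ck k f" "csupp f"
  shows "test_fun f"
proof -
  obtain r where r: "0 < r" "\<And>x. r < norm x \<Longrightarrow> f x = 0" using csuppE[OF assms(2)] by blast
  have "{z. f z \<noteq> 0} \<subseteq> cball 0 r" using r(2) by (auto simp: not_less[symmetric])
  then have "bounded {z. f z \<noteq> 0}" by (rule bounded_subset[OF bounded_cball])
  then show ?thesis using assms(1) by (simp add: test_fun_def)
qed

lemma test_funD:
  assumes "test_fun f"
  shows "Ck k f" "csupp f"
proof -
  show "Ck k f" using assms by (simp add: test_fun_def)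
  have "bounded {z. f z \<noteq> 0}"
    using assms compact_imp_bounded bounded_subset[OF _ closure_subset] by (auto simp: test_fun_def)
  then obtain r where "\<And>z. f z \<noteq> 0 \<Longrightarrow> norm z \<le> r" unfolding bounded_iff by blast
  then show "csupp f" unfolding csupp_def by (intro exI[of _ r]) (auto simp: not_less[symmetric])
qed

lemma wirt_conv:
  fixes \<rho> :: "complex ^ 'n::finite \<Rightarrow> real"
  assumes f: "integrable lebesgue f" and \<rho>: "Ck 1 \<rho>" "csupp \<rho>"
  shows "wirt s j (conv \<rho> f) z = (LINT y|lebesgue. f y * wirt s j (\<lambda>x. complex_of_real (\<rho> x)) (z - y))"
proof -
  have \<rho>1: "Ck (Suc 0) \<rho>" using \<rho>(1) by simp
  have d0: "\<rho> differentiable (at x)" for x by (rule Ck_differentiable[OF \<rho>1])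
  have i: "integrable lebesgue (\<lambda>y. f y * complex_of_real (dird b \<rho> (z - y)))" if "b \<in> Basis" for b
  proof -
    have c: "continuous_on UNIV (dird b \<rho>)" by (rule Ck_continuous[OF Ck_dird[OF \<rho>1 that]])
    obtain B where "0 < B" "\<And>x. norm (dird b \<rho> x) \<le> B" using csupp_bounded[OF c csupp_dird[OF \<rho>(2)]] by blast
    then show ?thesis by (intro integrable_conv[OF f c]) auto
  qed
  have "wirt s j (conv \<rho> f) z = ((LINT y|lebesgue. f y * complex_of_real (dird (axis j 1) \<rho> (z - y)))
      + s * (LINT y|lebesgue. f y * complex_of_real (dird (axis j \<i>) \<rho> (z - y)))) / 2"
    by (simp add: wirt_def dird_conv[OF f \<rho> axis_Basis(1)] dird_conv[OF f \<rho> axis_Basis(2)] conv_def)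
  also have "\<dots> = (LINT y|lebesgue. (f y * complex_of_real (dird (axis j 1) \<rho> (z - y))
      + s * (f y * complex_of_real (dird (axis j \<i>) \<rho> (z - y)))) / 2)"
    using i[OF axis_Basis(1)[of j]] i[OF axis_Basis(2)[of j]] by simp
  also have "\<dots> = (LINT y|lebesgue. f y * wirt s j (\<lambda>x. complex_of_real (\<rho> x)) (z - y))"
    by (rule Bochner_Integration.integral_cong[OF refl])
      (simp add: wirt_def dird_bounded_linear[OF bounded_linear_of_real d0] algebra_simps)
  finally show ?thesis .
qed

text \<open>
  The value at \<open>z\<close> of a convolution with \<open>\<rho>\<close> is a pairing with \<open>y \<mapsto> \<rho> (z - y)\<close>.  Testing the weak equation with the
  product of this function and \<open>\<kappa>\<close> therefore shows that the regularised localised functions solve the localised equation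
  in the classical sense.
\<close>

lemma weak_equation_conv:
  fixes f :: "'n::finite \<Rightarrow> complex ^ 'n \<Rightarrow> complex" and \<rho> :: "complex ^ 'n \<Rightarrow> real"
  assumes f: "\<And>j. loc2 (f j)" and g: "loc2 g"
    and weak: "\<And>\<eta>. test_fun \<eta> \<Longrightarrow> (LINT y|lebesgue. g y * \<eta> y) = - (\<Sum>j\<in>UNIV. (LINT y|lebesgue. f j y * wirt s j \<eta> y))"
    and \<kappa>: "\<And>k. Ck k \<kappa>" "csupp \<kappa>" and \<rho>: "\<And>k. Ck k \<rho>" "csupp \<rho>"
  shows "(\<Sum>j\<in>UNIV. wirt s j (conv \<rho> (\<lambda>y. \<kappa> y * f j y)) z) =
    conv \<rho> (\<lambda>y. \<kappa> y * g y + (\<Sum>j\<in>UNIV. wirt s j \<kappa> y * f j y)) z"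
proof -
  define r where "r y = complex_of_real (\<rho> (z - y))" for y
  define \<sigma> where "\<sigma> j y = wirt s j (\<lambda>x. complex_of_real (\<rho> x)) (z - y)" for j y
  have Cr: "Ck k r" for k unfolding r_def by (intro Ck_of_real Ck_reflect \<rho>)
  have cr: "continuous_on UNIV r" by (rule Ck_continuous[OF Cr])
  have C\<rho>: "Ck k (\<lambda>x. complex_of_real (\<rho> x))" for k by (rule Ck_of_real[OF \<rho>(1)])
  have wr: "wirt s j r y = - \<sigma> j y" for j y
    unfolding r_def \<sigma>_def wirt_def
    by (simp add: dird_reflect(1)[of "\<lambda>x. complex_of_real (\<rho> x)", OF Ck_differentiable[OF C\<rho>]] field_simps)
  have c\<sigma>: "continuous_on UNIV (\<sigma> j)" for j
    unfolding \<sigma>_def by (rule Ck_continuous[OF Ck_reflect[OF Ck_wirt[OF C\<rho>[of "Suc 0"]]]])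
  have c\<kappa>: "continuous_on UNIV \<kappa>" "continuous_on UNIV (wirt s j \<kappa>)" for j
    by (rule Ck_continuous[OF \<kappa>(1)], rule Ck_continuous[OF Ck_wirt[OF \<kappa>(1)[of "Suc 0"]]])
  define \<eta> where "\<eta> y = \<kappa> y * r y" for y
  have test: "test_fun \<eta>" unfolding \<eta>_def by (intro test_funI Ck_mult \<kappa> Cr csupp_mult1)
  have w\<eta>: "wirt s j \<eta> y = - (\<kappa> y * \<sigma> j y) + wirt s j \<kappa> y * r y" for j y
    unfolding \<eta>_def using wirt_mult[OF Ck_differentiable[OF \<kappa>(1)[of "Suc 0"]] Ck_differentiable[OF Cr[of "Suc 0"]], of s j y]
    by (simp add: wr)
  have i1: "integrable lebesgue (\<lambda>y. (\<kappa> y * \<sigma> j y) * f j y)" for j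
    by (intro loc2_integrable f continuous_intros c\<kappa> c\<sigma> csupp_mult1 \<kappa>)
  have i2: "integrable lebesgue (\<lambda>y. (wirt s j \<kappa> y * r y) * f j y)" for j
    by (intro loc2_integrable f continuous_intros c\<kappa> cr csupp_mult1 csupp_wirt \<kappa>)
  have i3: "integrable lebesgue (\<lambda>y. (\<kappa> y * r y) * g y)"
    by (intro loc2_integrable g continuous_intros c\<kappa> cr csupp_mult1 \<kappa>)
  have "(LINT y|lebesgue. (\<kappa> y * r y) * g y) = (LINT y|lebesgue. g y * \<eta> y)"
    by (simp add: \<eta>_def mult.commute)
  also have "\<dots> = - (\<Sum>j\<in>UNIV. (LINT y|lebesgue. f j y * wirt s j \<eta> y))" by (rule weak[OF test])
  also have "(\<lambda>j. (LINT y|lebesgue. f j y * wirt s j \<eta> y)) =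
      (\<lambda>j. (LINT y|lebesgue. (wirt s j \<kappa> y * r y) * f j y) - (LINT y|lebesgue. (\<kappa> y * \<sigma> j y) * f j y))"
  proof
    fix j
    have "(\<lambda>y. f j y * wirt s j \<eta> y) = (\<lambda>y. (wirt s j \<kappa> y * r y) * f j y - (\<kappa> y * \<sigma> j y) * f j y)"
      by (rule ext) (simp add: w\<eta> algebra_simps)
    then show "(LINT y|lebesgue. f j y * wirt s j \<eta> y) =
        (LINT y|lebesgue. (wirt s j \<kappa> y * r y) * f j y) - (LINT y|lebesgue. (\<kappa> y * \<sigma> j y) * f j y)"
      by (simp only: Bochner_Integration.integral_diff[OF i2 i1])
  qed
  finally have eq: "(\<Sum>j\<in>UNIV. (LINT y|lebesgue. (\<kappa> y * \<sigma> j y) * f j y)) =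
      (LINT y|lebesgue. (\<kappa> y * r y) * g y) + (\<Sum>j\<in>UNIV. (LINT y|lebesgue. (wirt s j \<kappa> y * r y) * f j y))"
    by (simp add: sum_subtractf)
  have "wirt s j (conv \<rho> (\<lambda>y. \<kappa> y * f j y)) z = (LINT y|lebesgue. (\<kappa> y * \<sigma> j y) * f j y)" for j
    unfolding \<sigma>_def by (subst wirt_conv[OF loc2_integrable[OF f c\<kappa>(1) \<kappa>(2)] \<rho>]) (simp add: mult_ac)
  moreover have "conv \<rho> (\<lambda>y. \<kappa> y * g y + (\<Sum>j\<in>UNIV. wirt s j \<kappa> y * f j y)) z =
      (LINT y|lebesgue. (\<kappa> y * r y) * g y) + (\<Sum>j\<in>UNIV. (LINT y|lebesgue. (wirt s j \<kappa> y * r y) * f j y))"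
  proof -
    have "(\<lambda>y. (\<kappa> y * g y + (\<Sum>j\<in>UNIV. wirt s j \<kappa> y * f j y)) * complex_of_real (\<rho> (z - y))) =
        (\<lambda>y. (\<kappa> y * r y) * g y + (\<Sum>j\<in>UNIV. (wirt s j \<kappa> y * r y) * f j y))"
      unfolding distrib_right sum_distrib_right r_def by (simp only: mult_ac)
    then have "conv \<rho> (\<lambda>y. \<kappa> y * g y + (\<Sum>j\<in>UNIV. wirt s j \<kappa> y * f j y)) z =
        (LINT y|lebesgue. (\<kappa> y * r y) * g y + (\<Sum>j\<in>UNIV. (wirt s j \<kappa> y * r y) * f j y))"
      unfolding conv_def by (simp only:)
    also have "\<dots> = (LINT y|lebesgue. (\<kappa> y * r y) * g y) + (LINT y|lebesgue. (\<Sum>j\<in>UNIV. (wirt s j \<kappa> y * r y) * f j y))"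
      by (rule Bochner_Integration.integral_add[OF i3 Bochner_Integration.integrable_sum]) (rule i2)
    finally show ?thesis by (simp only: Bochner_Integration.integral_sum[OF i2])
  qed
  ultimately show ?thesis using eq by simp
qed

section \<open>Limits in the weighted norm\<close>

lemma wclass_mult_tendsto:
  assumes f: "sqint (wm \<phi> f)" and m: "\<And>n. continuous_on UNIV (m n)" "\<And>n z. cmod (m n z) \<le> B"
    and k: "\<And>z. (\<lambda>n. m n z) \<longlonglongrightarrow> k"
  shows "(\<lambda>n. wclass \<phi> (\<lambda>z. m n z * f z)) \<longlonglongrightarrow> wclass \<phi> (\<lambda>z. k * f z)"
proof -
  have W: "sqint (\<lambda>z. complex_of_real B * wm \<phi> f z)" by (rule sqint_scale[OF f])
  have B: "0 \<le> B" using m(2) norm_ge_zero order_trans by blast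
  show ?thesis
    unfolding wclass_def wm_mult
  proof (rule L2_dominated_convergence(3)[OF W])
    show "(\<lambda>z. m n z * wm \<phi> f z) \<in> borel_measurable lebesgue" for n
      by (rule measurable_continuous_mult[OF m(1) sqint_measurable[OF f]])
    show "(\<lambda>z. k * wm \<phi> f z) \<in> borel_measurable lebesgue"
      by (rule sqint_measurable[OF sqint_scale[OF f]])
    show "cmod (m n z * wm \<phi> f z) \<le> cmod (complex_of_real B * wm \<phi> f z)" for n z
      using m(2)[of n z] B by (simp add: norm_mult mult_right_mono)
    show "AE z in lebesgue. (\<lambda>n. m n z * wm \<phi> f z) \<longlonglongrightarrow> k * wm \<phi> f z"
      by (intro AE_I2 tendsto_intros k)
  qed
qed

lemma sqint_wm:
  assumes c: "continuous_on UNIV \<phi>" "\<And>z. 0 \<le> \<phi> z" and f: "sqint f"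
  shows "sqint (wm \<phi> f)"
proof (rule sqint_bound[OF f, of _ 1])
  show "wm \<phi> f \<in> borel_measurable lebesgue"
    using measurable_continuous_mult[OF continuous_exp_half[OF c(1), of "- 1"] sqint_measurable[OF f]]
    by (simp add: wm_def[abs_def] mult.commute)
  show "AE x in lebesgue. cmod (wm \<phi> f x) \<le> 1 * cmod (f x)"
    by (rule AE_I2) (simp add: wm_def norm_mult mult_left_le c(2))
qed

lemma wclass_contraction:
  assumes c: "continuous_on UNIV \<phi>" "\<And>z. 0 \<le> \<phi> z" and f: "sqint f"
  shows "norm (wclass \<phi> f) \<le> norm (L2_class f)"
proof -
  have s: "sqint (wm \<phi> f)" by (rule sqint_wm[OF assms])
  have "(norm (wclass \<phi> f))\<^sup>2 \<le> (norm (L2_class f))\<^sup>2"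
    unfolding wclass_def L2_class_norm[OF s] L2_class_norm[OF f]
  proof (rule integral_mono)
    show "(cmod (wm \<phi> f x))\<^sup>2 \<le> (cmod (f x))\<^sup>2" for x
      unfolding cmod_wm using c(2)[of x] by (simp add: mult_left_le)
  qed (use s f in \<open>simp_all add: sqint_def\<close>)
  then show ?thesis by (rule power2_le_imp_le) simp
qed

lemma wclass_diff: "sqint (wm \<phi> f) \<Longrightarrow> sqint (wm \<phi> g) \<Longrightarrow> wclass \<phi> f - wclass \<phi> g = wclass \<phi> (\<lambda>z. f z - g z)"
  by (simp add: wclass_def wm_diff L2_class_diff)

lemma wclass_add: "sqint (wm \<phi> f) \<Longrightarrow> sqint (wm \<phi> g) \<Longrightarrow> wclass \<phi> f + wclass \<phi> g = wclass \<phi> (\<lambda>z. f z + g z)"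
  by (simp add: wclass_def wm_add L2_class_add)

lemma wclass_sum:
  assumes "\<And>i. i \<in> I \<Longrightarrow> sqint (wm \<phi> (f i))"
  shows "(\<Sum>i\<in>I. wclass \<phi> (f i)) = wclass \<phi> (\<lambda>z. \<Sum>i\<in>I. f i z) \<and> sqint (wm \<phi> (\<lambda>z. \<Sum>i\<in>I. f i z))"
  using assms
proof (induction I rule: infinite_finite_induct)
  case (insert i F)
  then have a: "sqint (wm \<phi> (f i))" "sqint (wm \<phi> (\<lambda>z. \<Sum>i\<in>F. f i z))"
    "(\<Sum>i\<in>F. wclass \<phi> (f i)) = wclass \<phi> (\<lambda>z. \<Sum>i\<in>F. f i z)" by auto
  show ?case using insert.hyps by (simp add: a wclass_add wm_add sqint_add)
qed (simp_all add: wclass_def wm_zero L2_class_zero)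

lemma conv_moll_support:
  assumes f: "\<And>z. R < norm z \<Longrightarrow> f z = 0" and z: "R + 1 < norm z"
  shows "conv (moll n) f z = 0"
proof -
  interpret mollifier "moll n :: 'a \<Rightarrow> real" "1 / real (Suc n)" by (rule mollifier_moll)
  have "f y * complex_of_real (moll n (z - y)) = 0" for y
  proof (cases "R < norm y")
    case False
    have "1 / real (Suc n) \<le> 1" by simp
    moreover have "norm z - norm y \<le> norm (z - y)" by (rule norm_triangle_ineq2)
    ultimately have "1 / real (Suc n) \<le> norm (z - y)" using False z by linarith
    then show ?thesis using support(2)[of "z - y"] by simp
  qed (simp add: f)
  then show ?thesis by (simp only: conv_def Bochner_Integration.integral_zero)
qed

text \<open>
  The regularisations have a common compact support, on which the continuous factor \<open>b\<close> is bounded.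
\<close>

lemma wclass_mollify_tendsto:
  assumes c: "continuous_on UNIV \<phi>" "\<And>z. 0 \<le> \<phi> z" and f: "sqint f" "csupp f" and b: "continuous_on UNIV b"
  shows "(\<lambda>n. wclass \<phi> (\<lambda>z. b z * conv (moll n) f z)) \<longlonglongrightarrow> wclass \<phi> (\<lambda>z. b z * f z)"
    "\<And>n. sqint (\<lambda>z. b z * conv (moll n) f z)"
proof -
  obtain r where r: "0 < r" "\<And>x. r < norm x \<Longrightarrow> f x = 0" using csuppE[OF f(2)] by blast
  define k where "k z = b z * complex_of_real (cutoff (r + 1) z)" for z
  have kc: "continuous_on UNIV k"
    unfolding k_def by (intro continuous_intros b Ck_continuous[OF Ck_of_real[OF cutoff_Ck[of 0]]])
  have ks: "csupp k"
    unfolding k_def by (rule csupp_mult2) (rule csupp_subset[OF csupp_cutoff[of "r + 1"]], use r(1) in auto)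
  obtain B where B: "0 < B" "\<And>x. norm (k x) \<le> B" using csupp_bounded[OF kc ks] by blast
  have kb: "b z * h z = k z * h z" if "\<And>z. r + 1 < norm z \<Longrightarrow> h z = 0" for h z
  proof (cases "norm z \<le> r + 1")
    case True
    then show ?thesis using cutoff_eq_1[of "r + 1" z] r(1) by (simp add: k_def)
  qed (use that in auto)
  have f0: "f z = 0" if "r + 1 < norm z" for z using r(2)[of z] that by simp
  have sc: "sqint (conv (moll n) f)" for n
    using mollifier.conv_contraction[OF mollifier_moll f] by blast
  have bc: "(\<lambda>z. b z * conv (moll n) f z) = (\<lambda>z. k z * conv (moll n) f z)" for n
    using kb[of "conv (moll n) f", OF conv_moll_support[of r f, OF r(2)]] by blast
  have bf: "(\<lambda>z. b z * f z) = (\<lambda>z. k z * f z)" using kb[of f, OF f0] by blast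
  show s: "sqint (\<lambda>z. b z * conv (moll n) f z)" for n unfolding bc by (rule sqint_cc_mult[OF sc kc ks])
  have sf: "sqint (\<lambda>z. b z * f z)" unfolding bf by (rule sqint_cc_mult[OF f(1) kc ks])
  have bound: "norm (wclass \<phi> (\<lambda>z. b z * conv (moll n) f z) - wclass \<phi> (\<lambda>z. b z * f z)) \<le>
      B * norm (L2_class (conv (moll n) f) - L2_class f)" for n
  proof -
    have d: "sqint (\<lambda>z. conv (moll n) f z - f z)" by (rule sqint_diff[OF sc f(1)])
    have e: "sqint (\<lambda>z. k z * (conv (moll n) f z - f z))" by (rule sqint_cc_mult[OF d kc ks])
    have "wclass \<phi> (\<lambda>z. b z * conv (moll n) f z) - wclass \<phi> (\<lambda>z. b z * f z) =
        wclass \<phi> (\<lambda>z. k z * (conv (moll n) f z - f z))"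
      by (simp add: wclass_diff sqint_wm[OF c s] sqint_wm[OF c sf]) (simp add: bc bf fun_cong[OF bc] fun_cong[OF bf] right_diff_distrib)
    also have "norm \<dots> \<le> norm (L2_class (\<lambda>z. k z * (conv (moll n) f z - f z)))" by (rule wclass_contraction[OF c e])
    also have "\<dots> \<le> norm (B *\<^sub>R L2_class (\<lambda>z. conv (moll n) f z - f z))"
    proof (rule power2_le_imp_le)
      show "(norm (L2_class (\<lambda>z. k z * (conv (moll n) f z - f z))))\<^sup>2 \<le> (norm (B *\<^sub>R L2_class (\<lambda>z. conv (moll n) f z - f z)))\<^sup>2"
        unfolding L2_class_scaleR[OF d] L2_class_norm[OF e] L2_class_norm[OF sqint_scaleR[OF d]]
      proof (rule integral_mono)
        show "integrable lebesgue (\<lambda>x. (cmod (k x * (conv (moll n) f x - f x)))\<^sup>2)" using e by (simp add: sqint_def)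
        show "integrable lebesgue (\<lambda>x. (cmod (B *\<^sub>R (conv (moll n) f x - f x)))\<^sup>2)"
          using sqint_scaleR[OF d, of B] unfolding sqint_def by blast
        show "(cmod (k x * (conv (moll n) f x - f x)))\<^sup>2 \<le> (cmod (B *\<^sub>R (conv (moll n) f x - f x)))\<^sup>2" for x
          using B by (intro power_mono) (simp_all add: norm_mult mult_right_mono)
      qed
    qed simp
    also have "\<dots> = B * norm (L2_class (conv (moll n) f) - L2_class f)" using B(1) by (simp add: L2_class_diff[OF sc f(1)])
    finally show ?thesis .
  qed
  have "(\<lambda>n. L2_class (conv (moll n) f) - L2_class f) \<longlonglongrightarrow> 0" by (rule LIM_zero[OF mollify_tendsto[OF f]])
  then have "(\<lambda>n. B * norm (L2_class (conv (moll n) f) - L2_class f)) \<longlonglongrightarrow> B * 0"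
    by (intro tendsto_intros tendsto_norm_zero)
  then have lim: "(\<lambda>n. B * norm (L2_class (conv (moll n) f) - L2_class f)) \<longlonglongrightarrow> 0" by simp
  show "(\<lambda>n. wclass \<phi> (\<lambda>z. b z * conv (moll n) f z)) \<longlonglongrightarrow> wclass \<phi> (\<lambda>z. b z * f z)"
    by (rule LIM_zero_cancel) (rule Lim_null_comparison[OF always_eventually[OF allI[OF bound]] lim])
qed

section \<open>The estimate on the domains of the weak operators\<close>

text \<open>
  A \<open>(0,q)\<close>-form leaves its components at index sets of other cardinalities unspecified; here they become zero.
\<close>

definition trunc :: "nat \<Rightarrow> 'n form \<Rightarrow> 'n form" where
  "trunc q x J z = (if card J = q then x J z else 0)"

lemma trunc_L2_forms:
  assumes "continuous_on UNIV \<phi>" "x \<in> L2_forms \<phi> q"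
  shows "sqint (wm \<phi> (trunc q x J))"
proof (cases "card J = q")
  case True
  then have "x J \<in> L2_weight \<phi>" using assms(2) by (simp add: L2_forms_def)
  moreover have "trunc q x J = x J" using True by (simp add: trunc_def fun_eq_iff)
  ultimately show ?thesis by (simp add: L2_weight_iff[OF assms(1)])
next
  case False
  then have "trunc q x J = (\<lambda>z. 0)" by (simp add: trunc_def fun_eq_iff)
  then show ?thesis by (simp add: wm_zero)
qed

lemma loc2_cnj:
  assumes "loc2 f"
  shows "loc2 (\<lambda>z. cnj (f z))"
  unfolding loc2_def
proof (intro conjI allI impI)
  have fm: "f \<in> borel_measurable lebesgue" using assms by (simp add: loc2_def)
  show "(\<lambda>z. cnj (f z)) \<in> borel_measurable lebesgue"
    by (rule measurable_compose[OF fm]) (intro borel_measurable_continuous_onI continuous_intros)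
  fix h :: "'a \<Rightarrow> complex" assume h: "continuous_on UNIV h" "csupp h"
  have "sqint (\<lambda>z. cnj (cnj (h z) * f z))"
  proof (intro sqint_cnj loc2D[OF assms])
    show "continuous_on UNIV (\<lambda>z. cnj (h z))" by (intro continuous_intros h)
    show "csupp (\<lambda>z. cnj (h z))" by (rule csupp_subset[OF h(2)]) simp
  qed
  then show "sqint (\<lambda>z. h z * cnj (f z))" by simp
qed

text \<open>
  For forms with vanishing components in the other degrees the distributional equation holds at every index set \<open>K\<close>,
  and the sum over \<open>K\<close> becomes a sum over all indices.
\<close>

lemma weak_dbar_identity:
  fixes \<eta> :: "complex ^ 'n::{finite,linorder} \<Rightarrow> complex"
  assumes x: "is_dbar \<phi> q x v" and \<eta>: "test_fun \<eta>"
  shows "(LINT y|lebesgue. trunc (Suc q) v K y * \<eta> y) =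
    - (\<Sum>j\<in>UNIV. (LINT y|lebesgue. creat j (\<lambda>J. trunc q x J y) K * wirt \<i> j \<eta> y))"
proof (cases "card K = Suc q")
  case True
  have "(LINT y|lebesgue. v K y * \<eta> y) =
      - (\<Sum>j\<in>K. wedge_sign j (K - {j}) * (LINT y|lebesgue. x (K - {j}) y * d_zbar j \<eta> y))"
    using x \<eta> True unfolding is_dbar_def by blast
  also have "(\<Sum>j\<in>K. wedge_sign j (K - {j}) * (LINT y|lebesgue. x (K - {j}) y * d_zbar j \<eta> y)) =
      (\<Sum>j\<in>UNIV. (LINT y|lebesgue. creat j (\<lambda>J. trunc q x J y) K * wirt \<i> j \<eta> y))"
  proof (rule sum.mono_neutral_cong_left)
    show "\<forall>j\<in>UNIV - K. (LINT y|lebesgue. creat j (\<lambda>J. trunc q x J y) K * wirt \<i> j \<eta> y) = 0"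
      by (simp add: creat_def)
    fix j assume j: "j \<in> K"
    then have "card (K - {j}) = q" using True by simp
    then have "creat j (\<lambda>J. trunc q x J y) K * wirt \<i> j \<eta> y = wedge_sign j (K - {j}) * (x (K - {j}) y * d_zbar j \<eta> y)" for y
      using j by (simp add: creat_def trunc_def d_zbar_wirt)
    then show "wedge_sign j (K - {j}) * (LINT y|lebesgue. x (K - {j}) y * d_zbar j \<eta> y) =
        (LINT y|lebesgue. creat j (\<lambda>J. trunc q x J y) K * wirt \<i> j \<eta> y)"
      by (simp only: integral_mult_right_zero)
  qed auto
  finally show ?thesis using True by (simp add: trunc_def)
next
  case False
  have "creat j (\<lambda>J. trunc q x J y) K = 0" for j y
  proof (cases "j \<in> K")
    case True
    then have "card (K - {j}) \<noteq> q" using False card_Suc_Diff1[of K j] by auto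
    then have "trunc q x (K - {j}) y = 0" unfolding trunc_def by (rule if_not_P)
    then show ?thesis by (simp add: creat_def)
  qed (simp add: creat_def)
  then show ?thesis using False by (simp add: trunc_def)
qed

text \<open>
  Integration by parts.  One derivative suffices, so that forms involving the weight \<open>e\<^sup>\<phi>\<close> can be used to test the
  adjoint.
\<close>

lemma smooth_is_dbar:
  fixes u :: "'n::{finite,linorder} form"
  assumes \<phi>: "continuous_on UNIV \<phi>" and u: "\<And>J. Ck 1 (u J)" "\<And>J. csupp (u J)"
  shows "is_dbar \<phi> p u (dbar_form u)"
  unfolding is_dbar_def
proof (intro conjI allI impI)
  have u1: "Ck (Suc 0) (u J)" for J using u(1) by simp
  have uc: "cc0 (u J)" for J using Ck_continuous[OF u1] u(2) by (simp add: cc0_def)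
  have wc: "cc0 (wirt s j (u J))" for s j J
    using Ck_continuous[OF Ck_wirt[OF u1]] csupp_wirt[OF u(2)] by (simp add: cc0_def)
  then have dc: "cc0 (dbar_form u K)" for K
    unfolding dbar_form_def[abs_def] d_zbar_wirt by (intro cc0_sum cc0_creat)
  have mem: "f \<in> L2_weight \<phi>" if "cc0 f" for f
    unfolding L2_weight_iff[OF \<phi>] wm_def[abs_def]
    using that continuous_exp_half[OF \<phi>, of "- 1"]
    by (intro sqint_cc continuous_on_mult csupp_mult1) (auto simp: cc0_def)
  show "u \<in> L2_forms \<phi> p" "dbar_form u \<in> L2_forms \<phi> (Suc p)"
    using mem uc dc by (simp_all add: L2_forms_def)
  fix K :: "'n set" and \<eta> :: "(complex, 'n) vec \<Rightarrow> complex"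
  assume "card K = Suc p \<and> test_fun \<eta>"
  then have \<eta>: "test_fun \<eta>" by simp
  have \<eta>1: "Ck 1 \<eta>" by (rule test_funD[OF \<eta>])
  have parts: "(LINT z|lebesgue. wirt \<i> j (u J) z * \<eta> z) = - (LINT z|lebesgue. u J z * wirt \<i> j \<eta> z)" for j J
    using integral_wirt_parts[OF u(1)[of J] \<eta>1 disjI1[OF u(2)], of \<i> j] by simp
  have i: "integrable lebesgue (\<lambda>z. creat j (\<lambda>J. d_zbar j (u J) z) K * \<eta> z)" for j
    unfolding d_zbar_wirt by (intro cc0_integrable cc0_mult1 cc0_creat wc Ck_continuous[OF \<eta>1])
  have "(LINT z|lebesgue. dbar_form u K z * \<eta> z) = (\<Sum>j\<in>UNIV. (LINT z|lebesgue. creat j (\<lambda>J. d_zbar j (u J) z) K * \<eta> z))"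
    unfolding dbar_form_def sum_distrib_right by (rule Bochner_Integration.integral_sum) (rule i)
  also have "\<dots> = (\<Sum>j\<in>K. - (wedge_sign j (K - {j}) * (LINT z|lebesgue. u (K - {j}) z * d_zbar j \<eta> z)))"
  proof (rule sum.mono_neutral_cong_right)
    show "\<forall>j\<in>UNIV - K. (LINT z|lebesgue. creat j (\<lambda>J. d_zbar j (u J) z) K * \<eta> z) = 0"
      by (simp add: creat_def)
    fix j assume j: "j \<in> K"
    then have "creat j (\<lambda>J. d_zbar j (u J) z) K * \<eta> z = wedge_sign j (K - {j}) * (wirt \<i> j (u (K - {j})) z * \<eta> z)" for z
      by (simp add: creat_def d_zbar_wirt)
    then have "(LINT z|lebesgue. creat j (\<lambda>J. d_zbar j (u J) z) K * \<eta> z) =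
        wedge_sign j (K - {j}) * (LINT z|lebesgue. wirt \<i> j (u (K - {j})) z * \<eta> z)"
      by (simp only: integral_mult_right_zero)
    then show "(LINT z|lebesgue. creat j (\<lambda>J. d_zbar j (u J) z) K * \<eta> z) =
        - (wedge_sign j (K - {j}) * (LINT z|lebesgue. u (K - {j}) z * d_zbar j \<eta> z))"
      by (simp add: parts d_zbar_wirt)
  qed auto
  finally show "(LINT z|lebesgue. dbar_form u K z * \<eta> z) =
      - (\<Sum>j\<in>K. wedge_sign j (K - {j}) * (LINT z|lebesgue. u (K - {j}) z * d_zbar j \<eta> z))"
    by (simp add: sum_negf)
qed

lemma is_dbar_adjD:
  "is_dbar_adj \<phi> p x w \<Longrightarrow> is_dbar \<phi> p u u' \<Longrightarrow> form_inner \<phi> (Suc p) u' x = form_inner \<phi> p u w"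
  by (simp add: is_dbar_adj_def)

text \<open>
  The adjoint is tested with the form \<open>cnj \<eta> e\<^sup>\<phi> d\<zeta>\<^sub>L\<close>, in which the weight cancels; this turns the adjoint equation
  into a weak equation with constant coefficients and a term of order zero.
\<close>

lemma weak_dbar_adj_identity:
  fixes \<phi> :: "complex ^ 'n::{finite,linorder} \<Rightarrow> real"
  assumes \<phi>: "Ck 2 \<phi>" and x: "is_dbar_adj \<phi> p x w" and \<eta>: "test_fun \<eta>"
  defines "X \<equiv> trunc (Suc p) x"
  shows "(LINT y|lebesgue. ((\<Sum>k\<in>UNIV. d_z k (\<lambda>z. complex_of_real (\<phi> z)) y * annih k (\<lambda>J. X J y) L) - trunc p w L y) * \<eta> y) =
    - (\<Sum>k\<in>UNIV. (LINT y|lebesgue. annih k (\<lambda>J. X J y) L * wirt (- \<i>) k \<eta> y))"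
proof (cases "card L = p")
  case False
  have "annih k (\<lambda>J. X J y) L = 0" for k y
  proof (cases "k \<in> L")
    case no: False
    then have "card (insert k L) \<noteq> Suc p" using False by simp
    then have "X (insert k L) y = 0" unfolding X_def trunc_def by (rule if_not_P)
    then show ?thesis by (simp add: annih_def)
  qed (simp add: annih_def)
  then show ?thesis using False by (simp add: trunc_def)
next
  case True
  have \<phi>2: "Ck (Suc (Suc 0)) \<phi>" using \<phi> by (simp only: numeral_2_eq_2)
  have c\<phi>: "continuous_on UNIV \<phi>" by (rule Ck_continuous[OF \<phi>])
  have p\<phi>: "continuous_on UNIV (wirt s k (\<lambda>z. complex_of_real (\<phi> z)))" for s k
    by (rule Ck_continuous[OF Ck_wirt[OF Ck_of_real[OF \<phi>2]]])
  have \<eta>C: "Ck k \<eta>" "csupp \<eta>" for k by (rule test_funD[OF \<eta>])+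
  have c\<eta>: "continuous_on UNIV \<eta>" "continuous_on UNIV (wirt s k \<eta>)" for s k
    by (rule Ck_continuous[OF \<eta>C(1)], rule Ck_continuous[OF Ck_wirt[OF \<eta>C(1)[of "Suc 0"]]])
  have xs: "x \<in> L2_forms \<phi> (Suc p)" and ws: "w \<in> L2_forms \<phi> p" using x by (auto simp: is_dbar_adj_def)
  have Xl: "loc2 (X J)" for J unfolding X_def by (rule L2_weight_loc2[OF c\<phi> trunc_L2_forms[OF c\<phi> xs]])
  have wL: "trunc p w L = w L" using True by (simp add: trunc_def fun_eq_iff)
  have wl: "loc2 (w L)" using L2_weight_loc2[OF c\<phi> trunc_L2_forms[OF c\<phi> ws, of L]] by (simp add: wL)
  have Al: "loc2 (\<lambda>y. annih k (\<lambda>J. X J y) L)" for k by (intro loc2_annih Xl)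
  \<comment> \<open>the reciprocal of the weight\<close>
  define E where "E z = complex_of_real (exp (\<phi> z))" for z
  have EC: "Ck 2 E" unfolding E_def[abs_def] by (intro Ck_of_real Ck_exp \<phi>)
  have E2: "Ck (Suc (Suc 0)) E" using EC by (simp only: numeral_2_eq_2)
  have Ewt: "E z * wt \<phi> z = 1" for z
  proof -
    have "E z * wt \<phi> z = complex_of_real (exp (\<phi> z) * exp (- \<phi> z))" by (simp add: E_def wt_def)
    also have "exp (\<phi> z) * exp (- \<phi> z) = 1" by (simp flip: exp_add)
    finally show ?thesis by simp
  qed
  have dE: "wirt s k E z = wirt s k (\<lambda>z. complex_of_real (\<phi> z)) z * E z" for s k z
  proof -
    have "E = wt (\<lambda>z. - \<phi> z)" by (simp add: E_def wt_def fun_eq_iff)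
    moreover have "(\<lambda>z. - \<phi> z) differentiable (at z)" using Ck_differentiable[OF \<phi>2] by simp
    moreover have "wirt s k (\<lambda>z. complex_of_real (- \<phi> z)) z = - wirt s k (\<lambda>z. complex_of_real (\<phi> z)) z"
      using wirt_uminus[OF Ck_differentiable[OF Ck_of_real[OF \<phi>2]], of s k z] by simp
    ultimately show ?thesis using wirt_wt[of "\<lambda>z. - \<phi> z" z s k] by simp
  qed
  define g where "g z = cnj (\<eta> z * E z)" for z
  have \<eta>E: "Ck 2 (\<lambda>z. \<eta> z * E z)" by (intro Ck_mult \<eta>C EC)
  have \<eta>E2: "Ck (Suc (Suc 0)) (\<lambda>z. \<eta> z * E z)" using \<eta>E by (simp only: numeral_2_eq_2)
  have g1: "Ck 1 g" unfolding g_def[abs_def] using Ck_bounded_linear[OF bounded_linear_cnj Ck_SucD[OF \<eta>E2]] by simp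
  have gs: "csupp g" by (rule csupp_subset[OF \<eta>C(2)]) (simp add: g_def)
  have dg: "d_zbar k g z * wt \<phi> z = cnj (wirt (- \<i>) k \<eta> z + d_z k (\<lambda>z. complex_of_real (\<phi> z)) z * \<eta> z)" for k z
  proof -
    have "d_zbar k g z = cnj (wirt (- \<i>) k (\<lambda>z. \<eta> z * E z) z)"
      unfolding g_def[abs_def] d_zbar_wirt using wirt_cnj[OF Ck_differentiable[OF \<eta>E2], of \<i> k z] by simp
    also have "wirt (- \<i>) k (\<lambda>z. \<eta> z * E z) z = (wirt (- \<i>) k \<eta> z + d_z k (\<lambda>z. complex_of_real (\<phi> z)) z * \<eta> z) * E z"
      unfolding wirt_mult[OF Ck_differentiable[OF \<eta>C(1)[of "Suc 0"]] Ck_differentiable[OF E2]] dE d_z_wirt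
      by (simp add: algebra_simps)
    finally have "d_zbar k g z * wt \<phi> z =
        cnj (wirt (- \<i>) k \<eta> z + d_z k (\<lambda>z. complex_of_real (\<phi> z)) z * \<eta> z) * cnj (E z * wt \<phi> z)"
      by (simp add: wt_def)
    then show ?thesis by (simp add: Ewt)
  qed
  define u :: "'n form" where "u J = (if J = L then g else (\<lambda>z. 0))" for J
  have uC: "Ck 1 (u J)" "csupp (u J)" for J
    using g1 gs by (auto simp: u_def Ck_const csupp_def)
  have u1: "Ck (Suc 0) (u J)" for J using uC by simp
  have du: "d_zbar k (u J) z = (if J = L then d_zbar k g z else 0)" for k J z
    by (simp add: u_def d_zbar_wirt)
  have dbc: "cc0 (dbar_form u K)" for K
    unfolding dbar_form_def[abs_def] d_zbar_wirt
    using Ck_continuous[OF Ck_wirt[OF u1]] csupp_wirt[OF uC(2)] by (intro cc0_sum cc0_creat) (simp add: cc0_def)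
  have cwt: "continuous_on UNIV (wt \<phi>)" by (rule Ck_continuous[OF Ck_wt[OF \<phi>]])
  have iK: "integrable lebesgue (\<lambda>z. dbar_form u K z * cnj (X K z) * wt \<phi> z)" for K
  proof -
    have "cc0 (\<lambda>z. dbar_form u K z * wt \<phi> z)" by (rule cc0_mult1[OF dbc cwt])
    then have "integrable lebesgue (\<lambda>z. (dbar_form u K z * wt \<phi> z) * cnj (X K z))"
      by (intro loc2_integrable loc2_cnj Xl) (auto simp: cc0_def)
    then show ?thesis by (simp add: mult_ac)
  qed
  have eqn: "form_inner \<phi> (Suc p) (dbar_form u) x = form_inner \<phi> p u w"
    by (rule is_dbar_adjD[OF x smooth_is_dbar[OF c\<phi> uC]])
  have eqr: "form_inner \<phi> p u w = cnj (LINT z|lebesgue. trunc p w L z * \<eta> z)"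
  proof -
    have "form_inner \<phi> p u w = (\<Sum>J\<in>{L}. (LINT z|lebesgue. u J z * cnj (w J z) * complex_of_real (exp (- \<phi> z))))"
      unfolding form_inner_def by (rule sum.mono_neutral_right) (auto simp: u_def True)
    also have "\<dots> = (LINT z|lebesgue. cnj (trunc p w L z * \<eta> z))"
    proof -
      have "g z * cnj (w L z) * complex_of_real (exp (- \<phi> z)) = cnj (trunc p w L z * \<eta> z) * cnj (E z * wt \<phi> z)" for z
        by (simp add: g_def wt_def wL)
      then show ?thesis by (simp add: u_def Ewt)
    qed
    finally show ?thesis by (simp only: Bochner_Integration.integral_cnj)
  qed
  have eql: "form_inner \<phi> (Suc p) (dbar_form u) x =
      cnj (\<Sum>k\<in>UNIV. (LINT z|lebesgue. annih k (\<lambda>J. X J z) L * wirt (- \<i>) k \<eta> z)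
        + (LINT z|lebesgue. d_z k (\<lambda>z. complex_of_real (\<phi> z)) z * annih k (\<lambda>J. X J z) L * \<eta> z))"
  proof -
    have i1: "integrable lebesgue (\<lambda>z. annih k (\<lambda>J. X J z) L * wirt (- \<i>) k \<eta> z)" for k
      using loc2_integrable[OF Al c\<eta>(2) csupp_wirt[OF \<eta>C(2)]] by (simp add: mult.commute)
    have i2: "integrable lebesgue (\<lambda>z. d_z k (\<lambda>z. complex_of_real (\<phi> z)) z * annih k (\<lambda>J. X J z) L * \<eta> z)" for k
    proof -
      have "integrable lebesgue (\<lambda>z. (wirt (- \<i>) k (\<lambda>z. complex_of_real (\<phi> z)) z * \<eta> z) * annih k (\<lambda>J. X J z) L)"
        by (intro loc2_integrable[OF Al] continuous_intros p\<phi> c\<eta> csupp_mult2 \<eta>C)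
      then show ?thesis by (simp add: d_z_wirt mult_ac)
    qed
    have "form_inner \<phi> (Suc p) (dbar_form u) x = (\<Sum>K\<in>UNIV. (LINT z|lebesgue. dbar_form u K z * cnj (X K z) * wt \<phi> z))"
      unfolding form_inner_def by (rule sum.mono_neutral_cong_left) (auto simp: X_def trunc_def wt_def)
    also have "\<dots> = (LINT z|lebesgue. (\<Sum>K\<in>UNIV. dbar_form u K z * cnj (X K z) * wt \<phi> z))"
      by (rule Bochner_Integration.integral_sum[symmetric]) (rule iK)
    also have "\<dots> = (LINT z|lebesgue. cnj (\<Sum>k\<in>UNIV. annih k (\<lambda>J. X J z) L * wirt (- \<i>) k \<eta> z
        + d_z k (\<lambda>z. complex_of_real (\<phi> z)) z * annih k (\<lambda>J. X J z) L * \<eta> z))"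
    proof (rule Bochner_Integration.integral_cong[OF refl])
      fix z
      have "(\<Sum>K\<in>UNIV. dbar_form u K z * cnj (X K z) * wt \<phi> z) =
          ext_inner (\<lambda>K. \<Sum>k\<in>UNIV. creat k (\<lambda>J. d_zbar k (u J) z) K) (\<lambda>J. X J z) * wt \<phi> z"
        by (simp add: dbar_form_def ext_inner_def sum_distrib_right)
      also have "\<dots> = (\<Sum>k\<in>UNIV. d_zbar k g z * cnj (annih k (\<lambda>J. X J z) L)) * wt \<phi> z"
        unfolding ext_inner_sum_left ext_inner_creat
        by (simp add: ext_inner_def du if_distrib[of "\<lambda>x. x * _"] cong: if_cong)
      also have "\<dots> = (\<Sum>k\<in>UNIV. (d_zbar k g z * wt \<phi> z) * cnj (annih k (\<lambda>J. X J z) L))"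
        unfolding sum_distrib_right by (intro sum.cong refl) (simp only: mult_ac)
      also have "\<dots> = cnj (\<Sum>k\<in>UNIV. annih k (\<lambda>J. X J z) L * wirt (- \<i>) k \<eta> z
        + d_z k (\<lambda>z. complex_of_real (\<phi> z)) z * annih k (\<lambda>J. X J z) L * \<eta> z)"
        unfolding dg cnj_sum by (intro sum.cong refl) (simp add: algebra_simps)
      finally show "(\<Sum>K\<in>UNIV. dbar_form u K z * cnj (X K z) * wt \<phi> z) = \<dots>" .
    qed
    also have "\<dots> = cnj (LINT z|lebesgue. (\<Sum>k\<in>UNIV. annih k (\<lambda>J. X J z) L * wirt (- \<i>) k \<eta> z
        + d_z k (\<lambda>z. complex_of_real (\<phi> z)) z * annih k (\<lambda>J. X J z) L * \<eta> z))"
      by (rule Bochner_Integration.integral_cnj)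
    finally show ?thesis by (simp add: i1 i2)
  qed
  have W: "(LINT z|lebesgue. trunc p w L z * \<eta> z) =
      (\<Sum>k\<in>UNIV. (LINT z|lebesgue. annih k (\<lambda>J. X J z) L * wirt (- \<i>) k \<eta> z)
        + (LINT z|lebesgue. d_z k (\<lambda>z. complex_of_real (\<phi> z)) z * annih k (\<lambda>J. X J z) L * \<eta> z))"
    using trans[OF eqr[symmetric] trans[OF eqn[symmetric] eql]] by (rule complex_cnj_cancel_iff[THEN iffD1])
  have G: "(LINT y|lebesgue. ((\<Sum>k\<in>UNIV. d_z k (\<lambda>z. complex_of_real (\<phi> z)) y * annih k (\<lambda>J. X J y) L) - trunc p w L y) * \<eta> y) =
      (\<Sum>k\<in>UNIV. (LINT z|lebesgue. d_z k (\<lambda>z. complex_of_real (\<phi> z)) z * annih k (\<lambda>J. X J z) L * \<eta> z))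
      - (LINT z|lebesgue. trunc p w L z * \<eta> z)"
  proof -
    have i2: "integrable lebesgue (\<lambda>z. d_z k (\<lambda>z. complex_of_real (\<phi> z)) z * annih k (\<lambda>J. X J z) L * \<eta> z)" for k
    proof -
      have "integrable lebesgue (\<lambda>z. (wirt (- \<i>) k (\<lambda>z. complex_of_real (\<phi> z)) z * \<eta> z) * annih k (\<lambda>J. X J z) L)"
        by (intro loc2_integrable[OF Al] continuous_intros p\<phi> c\<eta> csupp_mult2 \<eta>C)
      then show ?thesis by (simp add: d_z_wirt mult_ac)
    qed
    have i3: "integrable lebesgue (\<lambda>z. trunc p w L z * \<eta> z)"
      using loc2_integrable[OF wl c\<eta>(1) \<eta>C(2)] by (simp add: wL mult.commute)
    show ?thesis
      unfolding left_diff_distrib sum_distrib_right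
      by (subst Bochner_Integration.integral_diff[OF Bochner_Integration.integrable_sum[OF i2] i3])
        (simp only: Bochner_Integration.integral_sum[OF i2])
  qed
  show ?thesis unfolding G W sum.distrib by (simp only: add_diff_cancel_right' diff_add_eq_diff_diff_swap diff_self diff_0)
qed

lemma cutoff_scale: "cutoff R z = cutoff 1 ((1 / R) *\<^sub>R z)"
  by (simp add: cutoff_def power2_eq_square)

text \<open>
  By scaling, the derivative for radius \<open>R\<close> is \<open>1 / R\<close> times a value of the derivative for radius 1.
\<close>

lemma dird_cutoff_bound:
  fixes b :: "'a::euclidean_space"
  assumes b: "b \<in> Basis"
  shows "\<exists>B\<ge>0. \<forall>R\<ge>1. \<forall>z. \<bar>dird b (cutoff R) z\<bar> \<le> B"
proof -
  have c1: "csupp (cutoff 1 :: 'a \<Rightarrow> real)" by (rule csupp_cutoff) simp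
  have c: "continuous_on UNIV (dird b (cutoff 1))" by (rule Ck_continuous[OF Ck_dird[OF cutoff_Ck[of "Suc 0"] b]])
  obtain B where B: "0 < B" "\<And>x. norm (dird b (cutoff 1) x) \<le> B" using csupp_bounded[OF c csupp_dird[OF c1]] by blast
  have "\<bar>dird b (cutoff R) z\<bar> \<le> B" if R: "R \<ge> 1" for R z
  proof -
    have d: "cutoff 1 differentiable (at x)" for x :: 'a by (rule Ck_differentiable[OF cutoff_Ck])
    have m: "((\<lambda>z. (1 / R) *\<^sub>R z) has_derivative (\<lambda>h. (1 / R) *\<^sub>R h)) (at z)" by (auto intro!: derivative_eq_intros)
    have "((\<lambda>z. cutoff 1 ((1 / R) *\<^sub>R z)) has_derivative
        (\<lambda>h. frechet_derivative (cutoff 1) (at ((1 / R) *\<^sub>R z)) ((1 / R) *\<^sub>R h))) (at z)"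
      by (rule has_derivative_compose[OF m d[unfolded frechet_derivative_works]])
    moreover have "(\<lambda>z. cutoff 1 ((1 / R) *\<^sub>R z)) = (cutoff R :: 'a \<Rightarrow> real)" by (simp only: cutoff_scale[symmetric])
    ultimately have "(cutoff R has_derivative (\<lambda>h. frechet_derivative (cutoff 1) (at ((1 / R) *\<^sub>R z)) ((1 / R) *\<^sub>R h))) (at z)"
      by simp
    from dird_eqI[OF this, of b]
    have "dird b (cutoff R) z = (1 / R) * dird b (cutoff 1) ((1 / R) *\<^sub>R z)"
      using linear_cmul[OF linear_frechet_derivative[OF d[of "(1 / R) *\<^sub>R z"]], of "1 / R" b] by (simp add: dird_def)
    then have "\<bar>dird b (cutoff R) z\<bar> = (1 / R) * \<bar>dird b (cutoff 1) ((1 / R) *\<^sub>R z)\<bar>" using R by (simp add: abs_mult)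
    also have "\<dots> \<le> 1 * B" using R B by (intro mult_mono) auto
    finally show ?thesis by simp
  qed
  then show ?thesis using B(1) by (intro exI[of _ B]) auto
qed

lemma wirt_cutoff_bound:
  "\<exists>B\<ge>0. \<forall>R\<ge>1. \<forall>z. cmod (wirt s j (\<lambda>z. complex_of_real (cutoff R z)) (z :: complex ^ 'n::finite)) \<le> B"
proof -
  obtain A where A: "0 \<le> A" "\<And>R z. R \<ge> 1 \<Longrightarrow> \<bar>dird (axis j 1) (cutoff R) (z :: (complex, 'n) vec)\<bar> \<le> A"
    using dird_cutoff_bound[OF axis_Basis(1)[of j]] by blast
  obtain B where B: "0 \<le> B" "\<And>R z. R \<ge> 1 \<Longrightarrow> \<bar>dird (axis j \<i>) (cutoff R) (z :: (complex, 'n) vec)\<bar> \<le> B"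
    using dird_cutoff_bound[OF axis_Basis(2)[of j]] by blast
  have "cmod (wirt s j (\<lambda>z. complex_of_real (cutoff R z)) z) \<le> A + cmod s * B" if R: "R \<ge> 1" for R and z :: "(complex, 'n) vec"
  proof -
    have d: "cutoff R differentiable (at z)" by (rule Ck_differentiable[OF cutoff_Ck])
    have e: "dird b (\<lambda>z. complex_of_real (cutoff R z)) z = complex_of_real (dird b (cutoff R) z)" for b
      by (rule dird_bounded_linear[OF bounded_linear_of_real d])
    have "2 * cmod (wirt s j (\<lambda>z. complex_of_real (cutoff R z)) z) \<le>
        \<bar>dird (axis j 1) (cutoff R) z\<bar> + cmod s * \<bar>dird (axis j \<i>) (cutoff R) z\<bar>"
      using norm_triangle_ineq[of "complex_of_real (dird (axis j 1) (cutoff R) z)" "s * complex_of_real (dird (axis j \<i>) (cutoff R) z)"]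
      by (simp add: wirt_def e norm_divide norm_mult)
    also have "\<dots> \<le> A + cmod s * B" by (intro add_mono mult_left_mono A B R) simp
    finally have "2 * cmod (wirt s j (\<lambda>z. complex_of_real (cutoff R z)) z) \<le> A + cmod s * B" .
    moreover have "0 \<le> cmod (wirt s j (\<lambda>z. complex_of_real (cutoff R z)) z)" by simp
    ultimately show ?thesis by linarith
  qed
  moreover have "0 \<le> A + cmod s * B" using A(1) B(1) by simp
  ultimately show ?thesis by blast
qed

lemma wnorm2_wclass:
  fixes u :: "'n::finite form"
  assumes "\<And>J. sqint (wm \<phi> (u J))"
  shows "wnorm2 \<phi> u = (\<Sum>J\<in>UNIV. (norm (wclass \<phi> (u J)))\<^sup>2)"
proof -
  have "wnorm2 \<phi> u = (LINT z|lebesgue. (\<Sum>J\<in>UNIV. (cmod (wm \<phi> (u J) z))\<^sup>2))"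
    unfolding wnorm2_def by (simp add: ext_inner_self cmod_wm sum_distrib_right)
  also have "\<dots> = (\<Sum>J\<in>UNIV. (LINT z|lebesgue. (cmod (wm \<phi> (u J) z))\<^sup>2))"
    by (rule Bochner_Integration.integral_sum) (use assms in \<open>simp add: sqint_def\<close>)
  finally show ?thesis by (simp add: wclass_def L2_class_norm assms)
qed

lemma conv_scale: "conv \<rho> (\<lambda>y. c * f y) = (\<lambda>z. c * conv \<rho> f z)"
  by (rule ext) (simp add: conv_def mult.assoc)

lemma conv_zero: "conv \<rho> (\<lambda>y. 0) = (\<lambda>z. 0)"
  by (rule ext) (simp add: conv_def)

lemma wirt_scale: "f differentiable (at z) \<Longrightarrow> wirt s j (\<lambda>z. c * f z) z = c * wirt s j f z"
  using wirt_mult[of "\<lambda>z. c" z f s j] by simp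

lemma sqint_wm_mult:
  assumes f: "sqint (wm \<phi> f)" and m: "continuous_on UNIV m" "\<And>z. cmod (m z) \<le> B"
  shows "sqint (wm \<phi> (\<lambda>z. m z * f z))"
  unfolding wm_mult
  by (rule sqint_bound[OF f measurable_continuous_mult[OF m(1) sqint_measurable[OF f]], of B])
    (simp add: norm_mult mult_right_mono m(2))

text \<open>
  The form \<open>\<kappa> x\<close> is regularised by convolution.  The regularised forms are smooth with compact support and satisfy the
  assumed estimate, and all three terms converge.  In the adjoint the variable coefficients occur only in the term of
  order zero, where \<open>wclass_mollify_tendsto\<close> applies.
\<close>

lemma localized_estimate:
  fixes \<phi> :: "complex ^ 'n::{finite,linorder} \<Rightarrow> real"
  assumes nonneg: "\<And>z. 0 \<le> \<phi> z" and \<phi>: "Ck 2 \<phi>"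
    and est: "\<And>u. (\<And>J. Ck 2 (u J)) \<Longrightarrow> (\<And>J. csupp (u J)) \<Longrightarrow> (\<And>J z. card J \<noteq> Suc p \<Longrightarrow> u J z = 0) \<Longrightarrow>
      wnorm2 \<phi> u \<le> C * (wnorm2 \<phi> (dbar_form u) + wnorm2 \<phi> (dbar_adj_form \<phi> u))"
    and x: "is_dbar \<phi> (Suc p) x v" "is_dbar_adj \<phi> p x w"
    and \<kappa>: "\<And>k. Ck k \<kappa>" "csupp \<kappa>"
  defines "X \<equiv> trunc (Suc p) x" and "V \<equiv> trunc (Suc (Suc p)) v" and "W \<equiv> trunc p w"
  shows "(\<Sum>J\<in>UNIV. (norm (wclass \<phi> (\<lambda>y. \<kappa> y * X J y)))\<^sup>2) \<le>
    C * ((\<Sum>K\<in>UNIV. (norm (wclass \<phi> (\<lambda>y. \<kappa> y * V K y + (\<Sum>j\<in>UNIV. wirt \<i> j \<kappa> y * creat j (\<lambda>J. X J y) K))))\<^sup>2)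
      + (\<Sum>L\<in>UNIV. (norm (wclass \<phi> (\<lambda>y. \<kappa> y * W L y - (\<Sum>k\<in>UNIV. wirt (- \<i>) k \<kappa> y * annih k (\<lambda>J. X J y) L))))\<^sup>2))"
proof -
  have \<phi>2: "Ck (Suc (Suc 0)) \<phi>" using \<phi> by (simp only: numeral_2_eq_2)
  have c\<phi>: "continuous_on UNIV \<phi>" by (rule Ck_continuous[OF \<phi>])
  define p\<phi> where "p\<phi> k = d_z k (\<lambda>z. complex_of_real (\<phi> z))" for k
  have cp: "continuous_on UNIV (p\<phi> k)" for k
    unfolding p\<phi>_def d_z_wirt by (rule Ck_continuous[OF Ck_wirt[OF Ck_of_real[OF \<phi>2]]])
  have xs: "x \<in> L2_forms \<phi> (Suc p)" and vs: "v \<in> L2_forms \<phi> (Suc (Suc p))" and ws: "w \<in> L2_forms \<phi> p"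
    using x by (auto simp: is_dbar_adj_def is_dbar_def)
  have Xl: "loc2 (X J)" for J unfolding X_def by (rule L2_weight_loc2[OF c\<phi> trunc_L2_forms[OF c\<phi> xs]])
  have Vl: "loc2 (V J)" for J unfolding V_def by (rule L2_weight_loc2[OF c\<phi> trunc_L2_forms[OF c\<phi> vs]])
  have Wl: "loc2 (W J)" for J unfolding W_def by (rule L2_weight_loc2[OF c\<phi> trunc_L2_forms[OF c\<phi> ws]])
  have cX: "loc2 (\<lambda>y. creat j (\<lambda>J. X J y) K)" and aX: "loc2 (\<lambda>y. annih j (\<lambda>J. X J y) K)" for j K
    by (intro loc2_creat loc2_annih Xl)+
  have c\<kappa>: "continuous_on UNIV \<kappa>" "continuous_on UNIV (wirt s j \<kappa>)" for s j
    by (rule Ck_continuous[OF \<kappa>(1)], rule Ck_continuous[OF Ck_wirt[OF \<kappa>(1)[of "Suc 0"]]])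
  define f where "f J = (\<lambda>y. \<kappa> y * X J y)" for J
  define G where "G K = (\<lambda>y. \<kappa> y * V K y + (\<Sum>j\<in>UNIV. wirt \<i> j \<kappa> y * creat j (\<lambda>J. X J y) K))" for K
  define g where "g L = (\<lambda>y. (\<Sum>k\<in>UNIV. p\<phi> k y * annih k (\<lambda>J. X J y) L) - W L y)" for L
  define H where "H L = (\<lambda>y. \<kappa> y * g L y + (\<Sum>k\<in>UNIV. wirt (- \<i>) k \<kappa> y * annih k (\<lambda>J. X J y) L))" for L
  define A where "A k L = (\<lambda>y. \<kappa> y * annih k (\<lambda>J. X J y) L)" for k L
  have gl: "loc2 (g L)" for L
    unfolding g_def by (intro loc2_diff loc2_sum loc2_mult[OF _ cp] aX Wl)
  have fs: "sqint (f J)" "csupp (f J)" for J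
    unfolding f_def by (rule loc2D[OF Xl c\<kappa>(1) \<kappa>(2)], rule csupp_mult1[OF \<kappa>(2)])
  have As: "sqint (A k L)" "csupp (A k L)" for k L
    unfolding A_def by (rule loc2D[OF aX c\<kappa>(1) \<kappa>(2)], rule csupp_mult1[OF \<kappa>(2)])
  have Gs: "sqint (G K)" for K
    unfolding G_def
    by (intro sqint_add sqint_sum loc2D[OF Vl] loc2D[OF cX] c\<kappa> \<kappa> csupp_wirt)
  have Hs: "sqint (H L)" for L
    unfolding H_def
    by (intro sqint_add sqint_sum loc2D[OF gl] loc2D[OF aX] c\<kappa> \<kappa> csupp_wirt)
  have csum: "csupp (\<lambda>y. \<Sum>j\<in>I. F j y)" if "\<And>j. csupp (F j)" for I :: "'n set" and F :: "'n \<Rightarrow> (complex, 'n) vec \<Rightarrow> complex"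
    by (induction I rule: infinite_finite_induct) (auto simp: csupp_def[of "\<lambda>y. 0"] intro: csupp_add that)
  have Gc: "csupp (G K)" and Hc: "csupp (H K)" for K
    unfolding G_def H_def by (intro csupp_add csum csupp_mult1 csupp_wirt \<kappa>)+
  note m = mollifier_moll[where ?'a = "(complex, 'n) vec"]
  note ms = mollifier.smooth[OF m] and mc = mollifier.compact_support[OF m]
  define u where "u n J = conv (moll n) (f J)" for n J
  have uC: "Ck k (u n J)" "csupp (u n J)" for k n J
    unfolding u_def by (rule Ck_conv[OF sqint_csupp_integrable[OF fs] ms mc], rule csupp_conv[OF fs(2) mc])
  have u0: "u n J z = 0" if "card J \<noteq> Suc p" for n J z
  proof -
    have "f J = (\<lambda>y. 0)" using that by (simp add: f_def X_def trunc_def fun_eq_iff)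
    then show ?thesis by (simp add: u_def conv_zero)
  qed
  have creat_conv: "creat j (\<lambda>J. wirt s j (u n J) z) K = wirt s j (conv (moll n) (\<lambda>y. \<kappa> y * creat j (\<lambda>J. X J y) K)) z"
    for j s n z K
  proof (cases "j \<in> K")
    case True
    have "(\<lambda>y. \<kappa> y * creat j (\<lambda>J. X J y) K) = (\<lambda>y. wedge_sign j (K - {j}) * f (K - {j}) y)"
      using True by (simp add: creat_def f_def fun_eq_iff)
    then show ?thesis using True
      by (simp add: creat_def conv_scale u_def[symmetric] wirt_scale Ck_differentiable[OF uC(1)[of "Suc 0"]])
  qed (simp add: creat_def conv_zero)
  have annih_conv: "annih k (\<lambda>J. h * wirt s k (u n J) z) L = h * wirt s k (conv (moll n) (A k L)) z"
    "annih k (\<lambda>J. h * u n J z) L = h * conv (moll n) (A k L) z"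
    for k s n z L h
  proof -
    have "annih k (\<lambda>J. h * wirt s k (u n J) z) L = h * wirt s k (conv (moll n) (A k L)) z \<and>
        annih k (\<lambda>J. h * u n J z) L = h * conv (moll n) (A k L) z"
    proof (cases "k \<in> L")
      case False
      have "A k L = (\<lambda>y. wedge_sign k L * f (insert k L) y)"
        using False by (simp add: annih_def A_def f_def fun_eq_iff)
      then show ?thesis using False
        by (simp add: annih_def conv_scale u_def[symmetric] wirt_scale Ck_differentiable[OF uC(1)[of "Suc 0"]])
    next
      case True
      then have "A k L = (\<lambda>y. 0)" by (simp add: A_def annih_def)
      then show ?thesis using True by (simp add: annih_def conv_zero)
    qed
    then show "annih k (\<lambda>J. h * wirt s k (u n J) z) L = h * wirt s k (conv (moll n) (A k L)) z"
      "annih k (\<lambda>J. h * u n J z) L = h * conv (moll n) (A k L) z" by blast+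
  qed
  have dbar_u: "dbar_form (u n) K = conv (moll n) (G K)" for n K
  proof
    fix z
    have "dbar_form (u n) K z = (\<Sum>j\<in>UNIV. wirt \<i> j (conv (moll n) (\<lambda>y. \<kappa> y * creat j (\<lambda>J. X J y) K)) z)"
      by (simp only: dbar_form_def d_zbar_wirt creat_conv)
    also have "\<dots> = conv (moll n) (G K) z"
      unfolding G_def
      by (rule weak_equation_conv[OF cX Vl _ \<kappa> ms mc])
        (unfold V_def X_def, rule weak_dbar_identity[OF x(1)])
    finally show "dbar_form (u n) K z = conv (moll n) (G K) z" .
  qed
  have adj_u: "dbar_adj_form \<phi> (u n) L = (\<lambda>z. - (1 * conv (moll n) (H L) z) + (\<Sum>k\<in>UNIV. p\<phi> k z * conv (moll n) (A k L) z))" for n L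
  proof
    fix z
    have split: "annih k (\<lambda>J. dstar \<phi> k (u n J) z) L = wirt (- \<i>) k (conv (moll n) (A k L)) z - p\<phi> k z * conv (moll n) (A k L) z" for k
    proof -
      have "annih k (\<lambda>J. dstar \<phi> k (u n J) z) L =
          annih k (\<lambda>J. 1 * wirt (- \<i>) k (u n J) z) L - annih k (\<lambda>J. p\<phi> k z * u n J z) L"
        by (simp add: annih_def dstar_def d_z_wirt p\<phi>_def right_diff_distrib)
      then show ?thesis unfolding annih_conv by simp
    qed
    have "(\<Sum>k\<in>UNIV. wirt (- \<i>) k (conv (moll n) (A k L)) z) = conv (moll n) (H L) z"
      unfolding A_def H_def
      by (rule weak_equation_conv[OF aX gl _ \<kappa> ms mc])
        (unfold g_def p\<phi>_def W_def X_def, rule weak_dbar_adj_identity[OF \<phi> x(2)])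
    then show "dbar_adj_form \<phi> (u n) L z = - (1 * conv (moll n) (H L) z) + (\<Sum>k\<in>UNIV. p\<phi> k z * conv (moll n) (A k L) z)"
      unfolding dbar_adj_form_def split sum_subtractf by simp
  qed
  have sw: "sqint (wm \<phi> h)" if "sqint h" for h by (rule sqint_wm[OF c\<phi> nonneg that])
  have one: "continuous_on UNIV (\<lambda>z :: (complex, 'n) vec. 1 :: complex)" by (intro continuous_intros)
  have lim_u: "(\<lambda>n. wclass \<phi> (u n J)) \<longlonglongrightarrow> wclass \<phi> (f J)" "sqint (u n J)" for J n
    using wclass_mollify_tendsto(1)[OF c\<phi> nonneg fs(1)[of J] fs(2)[of J] one]
      wclass_mollify_tendsto(2)[OF c\<phi> nonneg fs(1)[of J] fs(2)[of J] one] by (simp_all add: u_def)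
  have lim_G: "(\<lambda>n. wclass \<phi> (conv (moll n) (G K))) \<longlonglongrightarrow> wclass \<phi> (G K)" "sqint (conv (moll n) (G K))" for K n
    using wclass_mollify_tendsto(1)[OF c\<phi> nonneg Gs[of K] Gc[of K] one]
      wclass_mollify_tendsto(2)[OF c\<phi> nonneg Gs[of K] Gc[of K] one] by simp_all
  have mone: "continuous_on UNIV (\<lambda>z :: (complex, 'n) vec. - 1 :: complex)" by (intro continuous_intros)
  define WR where "WR L = (\<lambda>z. - 1 * H L z + (\<Sum>k\<in>UNIV. p\<phi> k z * A k L z))" for L
  have adj_u': "dbar_adj_form \<phi> (u n) L = (\<lambda>z. - 1 * conv (moll n) (H L) z + (\<Sum>k\<in>UNIV. p\<phi> k z * conv (moll n) (A k L) z))" for n L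
    unfolding adj_u by simp
  have sH: "sqint (\<lambda>z. - 1 * conv (moll n) (H L) z)" for n L
    by (rule wclass_mollify_tendsto(2)[OF c\<phi> nonneg Hs Hc mone])
  have sA: "sqint (\<lambda>z. p\<phi> k z * conv (moll n) (A k L) z)" for n k L
    by (rule wclass_mollify_tendsto(2)[OF c\<phi> nonneg As cp])
  have sA': "sqint (\<lambda>z. p\<phi> k z * A k L z)" for k L
    unfolding A_def
  proof -
    have "sqint (\<lambda>y. (p\<phi> k y * \<kappa> y) * annih k (\<lambda>J. X J y) L)"
      by (intro loc2D[OF aX] continuous_intros cp c\<kappa> csupp_mult2 \<kappa>)
    then show "sqint (\<lambda>z. p\<phi> k z * (\<kappa> z * annih k (\<lambda>J. X J z) L))" by (simp add: mult.assoc)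
  qed
  have sH': "sqint (\<lambda>z. - 1 * H L z)" for L by (rule sqint_scale[OF Hs])
  have lim_W: "(\<lambda>n. wclass \<phi> (dbar_adj_form \<phi> (u n) L)) \<longlonglongrightarrow> wclass \<phi> (WR L)" for L
  proof -
    have e1: "wclass \<phi> (dbar_adj_form \<phi> (u n) L) = wclass \<phi> (\<lambda>z. - 1 * conv (moll n) (H L) z)
        + (\<Sum>k\<in>UNIV. wclass \<phi> (\<lambda>z. p\<phi> k z * conv (moll n) (A k L) z))" for n
      unfolding adj_u' conjunct1[OF wclass_sum[of UNIV \<phi> "\<lambda>k z. p\<phi> k z * conv (moll n) (A k L) z", OF sw[OF sA]]]
      by (rule wclass_add[OF sw[OF sH] sw[OF sqint_sum[OF sA]], symmetric])
    have e2: "wclass \<phi> (WR L) = wclass \<phi> (\<lambda>z. - 1 * H L z) + (\<Sum>k\<in>UNIV. wclass \<phi> (\<lambda>z. p\<phi> k z * A k L z))"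
      unfolding WR_def conjunct1[OF wclass_sum[of UNIV \<phi> "\<lambda>k z. p\<phi> k z * A k L z", OF sw[OF sA']]]
      by (rule wclass_add[OF sw[OF sH'] sw[OF sqint_sum[OF sA']], symmetric])
    show ?thesis
      unfolding e1 e2
      by (intro tendsto_add tendsto_sum wclass_mollify_tendsto(1)[OF c\<phi> nonneg Hs Hc mone]
          wclass_mollify_tendsto(1)[OF c\<phi> nonneg As cp])
  qed
  have sWn: "sqint (dbar_adj_form \<phi> (u n) L)" for n L
    unfolding adj_u' by (intro sqint_add sH sqint_sum sA)
  have ineq: "(\<Sum>J\<in>UNIV. (norm (wclass \<phi> (u n J)))\<^sup>2) \<le>
      C * ((\<Sum>K\<in>UNIV. (norm (wclass \<phi> (conv (moll n) (G K))))\<^sup>2) + (\<Sum>L\<in>UNIV. (norm (wclass \<phi> (dbar_adj_form \<phi> (u n) L)))\<^sup>2))" for n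
  proof -
    have "wnorm2 \<phi> (u n) \<le> C * (wnorm2 \<phi> (dbar_form (u n)) + wnorm2 \<phi> (dbar_adj_form \<phi> (u n)))"
      by (rule est[OF uC u0])
    moreover have "wnorm2 \<phi> (u n) = (\<Sum>J\<in>UNIV. (norm (wclass \<phi> (u n J)))\<^sup>2)"
      by (rule wnorm2_wclass[OF sw[OF lim_u(2)]])
    moreover have "wnorm2 \<phi> (dbar_form (u n)) = (\<Sum>K\<in>UNIV. (norm (wclass \<phi> (conv (moll n) (G K))))\<^sup>2)"
      by (subst wnorm2_wclass) (simp_all add: dbar_u sw lim_G(2))
    moreover have "wnorm2 \<phi> (dbar_adj_form \<phi> (u n)) = (\<Sum>L\<in>UNIV. (norm (wclass \<phi> (dbar_adj_form \<phi> (u n) L)))\<^sup>2)"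
      by (rule wnorm2_wclass[OF sw[OF sWn]])
    ultimately show ?thesis by (simp only:)
  qed
  have "(\<Sum>J\<in>UNIV. (norm (wclass \<phi> (f J)))\<^sup>2) \<le>
      C * ((\<Sum>K\<in>UNIV. (norm (wclass \<phi> (G K)))\<^sup>2) + (\<Sum>L\<in>UNIV. (norm (wclass \<phi> (WR L)))\<^sup>2))"
  proof (rule LIMSEQ_le)
    show "(\<lambda>n. \<Sum>J\<in>UNIV. (norm (wclass \<phi> (u n J)))\<^sup>2) \<longlonglongrightarrow> (\<Sum>J\<in>UNIV. (norm (wclass \<phi> (f J)))\<^sup>2)"
      by (intro tendsto_intros lim_u)
    show "(\<lambda>n. C * ((\<Sum>K\<in>UNIV. (norm (wclass \<phi> (conv (moll n) (G K))))\<^sup>2) + (\<Sum>L\<in>UNIV. (norm (wclass \<phi> (dbar_adj_form \<phi> (u n) L)))\<^sup>2)))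
        \<longlonglongrightarrow> C * ((\<Sum>K\<in>UNIV. (norm (wclass \<phi> (G K)))\<^sup>2) + (\<Sum>L\<in>UNIV. (norm (wclass \<phi> (WR L)))\<^sup>2))"
      by (intro tendsto_intros lim_G lim_W)
  qed (use ineq in blast)
  moreover have "WR L = (\<lambda>y. \<kappa> y * W L y - (\<Sum>k\<in>UNIV. wirt (- \<i>) k \<kappa> y * annih k (\<lambda>J. X J y) L))" for L
  proof
    fix y
    have "(\<Sum>k\<in>UNIV. p\<phi> k y * A k L y) = \<kappa> y * (\<Sum>k\<in>UNIV. p\<phi> k y * annih k (\<lambda>J. X J y) L)"
      unfolding A_def sum_distrib_left by (simp only: mult.left_commute)
    then show "WR L y = \<kappa> y * W L y - (\<Sum>k\<in>UNIV. wirt (- \<i>) k \<kappa> y * annih k (\<lambda>J. X J y) L)"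
      unfolding WR_def H_def g_def by (simp add: right_diff_distrib)
  qed
  ultimately show ?thesis by (simp only: f_def G_def)
qed

text \<open>
  The cut-off functions in \<open>localized_estimate\<close> are now equal to one on balls that grow to the whole space.  Their
  derivatives are uniformly bounded and tend to zero pointwise, so the error terms disappear by dominated convergence.
\<close>

theorem weak_estimate:
  fixes \<phi> :: "complex ^ 'n::{finite,linorder} \<Rightarrow> real"
  assumes nonneg: "\<And>z. 0 \<le> \<phi> z" and \<phi>: "Ck 2 \<phi>"
    and est: "\<And>u. (\<And>J. Ck 2 (u J)) \<Longrightarrow> (\<And>J. csupp (u J)) \<Longrightarrow> (\<And>J z. card J \<noteq> Suc p \<Longrightarrow> u J z = 0) \<Longrightarrow>
      wnorm2 \<phi> u \<le> C * (wnorm2 \<phi> (dbar_form u) + wnorm2 \<phi> (dbar_adj_form \<phi> u))"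
    and x: "is_dbar \<phi> (Suc p) x v" "is_dbar_adj \<phi> p x w"
  shows "(\<Sum>J\<in>UNIV. (norm (wclass \<phi> (trunc (Suc p) x J)))\<^sup>2) \<le>
    C * ((\<Sum>K\<in>UNIV. (norm (wclass \<phi> (trunc (Suc (Suc p)) v K)))\<^sup>2) + (\<Sum>L\<in>UNIV. (norm (wclass \<phi> (trunc p w L)))\<^sup>2))"
proof -
  have c\<phi>: "continuous_on UNIV \<phi>" by (rule Ck_continuous[OF \<phi>])
  define X where "X = trunc (Suc p) x"
  define V where "V = trunc (Suc (Suc p)) v"
  define W where "W = trunc p w"
  have xs: "x \<in> L2_forms \<phi> (Suc p)" and vs: "v \<in> L2_forms \<phi> (Suc (Suc p))" and ws: "w \<in> L2_forms \<phi> p"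
    using x by (auto simp: is_dbar_adj_def is_dbar_def)
  have sX: "sqint (wm \<phi> (X J))" and sV: "sqint (wm \<phi> (V J))" and sW: "sqint (wm \<phi> (W J))" for J
    unfolding X_def V_def W_def by (rule trunc_L2_forms[OF c\<phi> xs], rule trunc_L2_forms[OF c\<phi> vs], rule trunc_L2_forms[OF c\<phi> ws])
  have wz: "sqint (wm \<phi> (\<lambda>z. 0))" by (simp add: wm_zero)
  have scale: "sqint (wm \<phi> (\<lambda>z. c * f z))" if "sqint (wm \<phi> f)" for c f
    unfolding wm_mult by (rule sqint_scale[OF that])
  have sc: "sqint (wm \<phi> (\<lambda>y. creat j (\<lambda>J. X J y) K))" for j K
    by (cases "j \<in> K") (simp_all add: creat_def wz scale sX)
  have sa: "sqint (wm \<phi> (\<lambda>y. annih j (\<lambda>J. X J y) K))" for j K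
    by (cases "j \<in> K") (simp_all add: annih_def wz scale sX)
  define \<kappa> where "\<kappa> n = (\<lambda>z :: (complex, 'n) vec. complex_of_real (cutoff (real (Suc n)) z))" for n
  have \<kappa>C: "Ck k (\<kappa> n)" for k n unfolding \<kappa>_def by (rule Ck_of_real[OF cutoff_Ck])
  have \<kappa>s: "csupp (\<kappa> n)" for n
    unfolding \<kappa>_def by (rule csupp_subset[OF csupp_cutoff[of "real (Suc n)"]]) auto
  have \<kappa>c: "continuous_on UNIV (\<kappa> n)" "continuous_on UNIV (wirt s j (\<kappa> n))" for n s j
    by (rule Ck_continuous[OF \<kappa>C], rule Ck_continuous[OF Ck_wirt[OF \<kappa>C[of "Suc 0"]]])
  have \<kappa>1: "cmod (\<kappa> n z) \<le> 1" for n z using cutoff_bounds[of "real (Suc n)" z] by (simp add: \<kappa>_def)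
  have big: "\<forall>\<^sub>F n in sequentially. norm z < real (Suc n)" for z :: "(complex, 'n) vec"
  proof -
    obtain N where N: "norm z < real N" using reals_Archimedean2 by blast
    show ?thesis using eventually_ge_at_top[of N] by eventually_elim (use N in auto)
  qed
  have \<kappa>lim: "(\<lambda>n. \<kappa> n z) \<longlonglongrightarrow> 1" for z
  proof (rule tendsto_eventually)
    show "\<forall>\<^sub>F n in sequentially. \<kappa> n z = 1"
      using big[of z] by eventually_elim (simp add: \<kappa>_def cutoff_eq_1)
  qed
  have \<kappa>lim': "(\<lambda>n. wirt s j (\<kappa> n) z) \<longlonglongrightarrow> 0" for s j z
  proof (rule tendsto_eventually)
    show "\<forall>\<^sub>F n in sequentially. wirt s j (\<kappa> n) z = 0"
      using big[of z]
    proof eventually_elim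
      case (elim n)
      have "wirt s j (\<kappa> n) z = wirt s j (\<lambda>z. 1) z"
        by (rule wirt_local[of "ball 0 (real (Suc n))"]) (use elim in \<open>auto simp: \<kappa>_def cutoff_eq_1\<close>)
      then show ?case by simp
    qed
  qed
  have bound: "\<exists>B. \<forall>n z. cmod (wirt s j (\<kappa> n) z) \<le> B" for s j
  proof -
    obtain B where "\<And>R z. R \<ge> 1 \<Longrightarrow> cmod (wirt s j (\<lambda>z. complex_of_real (cutoff R z)) (z :: (complex, 'n) vec)) \<le> B"
      using wirt_cutoff_bound[of s j] by blast
    then have "cmod (wirt s j (\<kappa> n) z) \<le> B" for n z unfolding \<kappa>_def by simp
    then show ?thesis by blast
  qed
  have term0: "(\<lambda>n. wclass \<phi> (\<lambda>y. wirt s j (\<kappa> n) y * h y)) \<longlonglongrightarrow> 0"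
    and sterm: "sqint (wm \<phi> (\<lambda>y. wirt s j (\<kappa> n) y * h y))" if h: "sqint (wm \<phi> h)" for s j h n
  proof -
    obtain B where B: "\<And>n z. cmod (wirt s j (\<kappa> n) z) \<le> B" using bound by blast
    have "(\<lambda>n. wclass \<phi> (\<lambda>y. wirt s j (\<kappa> n) y * h y)) \<longlonglongrightarrow> wclass \<phi> (\<lambda>y. 0 * h y)"
      by (rule wclass_mult_tendsto[OF h \<kappa>c(2) B \<kappa>lim'])
    then show "(\<lambda>n. wclass \<phi> (\<lambda>y. wirt s j (\<kappa> n) y * h y)) \<longlonglongrightarrow> 0"
      by (simp add: wclass_def wm_zero L2_class_zero)
    show "sqint (wm \<phi> (\<lambda>y. wirt s j (\<kappa> n) y * h y))" by (rule sqint_wm_mult[OF h \<kappa>c(2) B])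
  qed
  have main: "(\<lambda>n. wclass \<phi> (\<lambda>y. \<kappa> n y * h y)) \<longlonglongrightarrow> wclass \<phi> h"
    and smain: "sqint (wm \<phi> (\<lambda>y. \<kappa> n y * h y))" if h: "sqint (wm \<phi> h)" for h n
    using wclass_mult_tendsto[OF h \<kappa>c(1) \<kappa>1 \<kappa>lim] sqint_wm_mult[OF h \<kappa>c(1) \<kappa>1] by simp_all
  have sum0: "(\<lambda>n. wclass \<phi> (\<lambda>y. \<Sum>j\<in>UNIV. wirt s j (\<kappa> n) y * h j y)) \<longlonglongrightarrow> 0"
    and ssum: "sqint (wm \<phi> (\<lambda>y. \<Sum>j\<in>UNIV. wirt s j (\<kappa> n) y * h j y))"
    if h: "\<And>j. sqint (wm \<phi> (h j))" for s and h :: "'n \<Rightarrow> (complex, 'n) vec \<Rightarrow> complex" and n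
  proof -
    have e: "wclass \<phi> (\<lambda>y. \<Sum>j\<in>UNIV. wirt s j (\<kappa> n) y * h j y) = (\<Sum>j\<in>UNIV. wclass \<phi> (\<lambda>y. wirt s j (\<kappa> n) y * h j y))"
      and s: "sqint (wm \<phi> (\<lambda>y. \<Sum>j\<in>UNIV. wirt s j (\<kappa> n) y * h j y))" for n
      using wclass_sum[of UNIV \<phi> "\<lambda>j y. wirt s j (\<kappa> n) y * h j y", OF sterm[OF h]] by auto
    have "(\<lambda>n. \<Sum>j\<in>UNIV. wclass \<phi> (\<lambda>y. wirt s j (\<kappa> n) y * h j y)) \<longlonglongrightarrow> (\<Sum>j\<in>(UNIV :: 'n set). 0)"
      by (intro tendsto_sum term0 h)
    then show "(\<lambda>n. wclass \<phi> (\<lambda>y. \<Sum>j\<in>UNIV. wirt s j (\<kappa> n) y * h j y)) \<longlonglongrightarrow> 0" unfolding e by simp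
    show "sqint (wm \<phi> (\<lambda>y. \<Sum>j\<in>UNIV. wirt s j (\<kappa> n) y * h j y))" by (rule s)
  qed
  have limV: "(\<lambda>n. wclass \<phi> (\<lambda>y. \<kappa> n y * V K y + (\<Sum>j\<in>UNIV. wirt \<i> j (\<kappa> n) y * creat j (\<lambda>J. X J y) K))) \<longlonglongrightarrow> wclass \<phi> (V K)" for K
  proof -
    have "(\<lambda>n. wclass \<phi> (\<lambda>y. \<kappa> n y * V K y) + wclass \<phi> (\<lambda>y. \<Sum>j\<in>UNIV. wirt \<i> j (\<kappa> n) y * creat j (\<lambda>J. X J y) K))
        \<longlonglongrightarrow> wclass \<phi> (V K) + 0"
      by (intro tendsto_add main sV sum0 sc)
    then show ?thesis by (simp add: wclass_add smain[OF sV] ssum[OF sc])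
  qed
  have limW: "(\<lambda>n. wclass \<phi> (\<lambda>y. \<kappa> n y * W L y - (\<Sum>k\<in>UNIV. wirt (- \<i>) k (\<kappa> n) y * annih k (\<lambda>J. X J y) L))) \<longlonglongrightarrow> wclass \<phi> (W L)" for L
  proof -
    have "(\<lambda>n. wclass \<phi> (\<lambda>y. \<kappa> n y * W L y) - wclass \<phi> (\<lambda>y. \<Sum>k\<in>UNIV. wirt (- \<i>) k (\<kappa> n) y * annih k (\<lambda>J. X J y) L))
        \<longlonglongrightarrow> wclass \<phi> (W L) - 0"
      by (intro tendsto_diff main sW sum0 sa)
    then show ?thesis by (simp add: wclass_diff smain[OF sW] ssum[OF sa])
  qed
  have "(\<Sum>J\<in>UNIV. (norm (wclass \<phi> (X J)))\<^sup>2) \<le>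
    C * ((\<Sum>K\<in>UNIV. (norm (wclass \<phi> (V K)))\<^sup>2) + (\<Sum>L\<in>UNIV. (norm (wclass \<phi> (W L)))\<^sup>2))"
  proof (rule LIMSEQ_le)
    show "(\<lambda>n. \<Sum>J\<in>UNIV. (norm (wclass \<phi> (\<lambda>y. \<kappa> n y * X J y)))\<^sup>2) \<longlonglongrightarrow> (\<Sum>J\<in>UNIV. (norm (wclass \<phi> (X J)))\<^sup>2)"
      by (intro tendsto_intros main sX)
    show "(\<lambda>n. C * ((\<Sum>K\<in>UNIV. (norm (wclass \<phi> (\<lambda>y. \<kappa> n y * V K y + (\<Sum>j\<in>UNIV. wirt \<i> j (\<kappa> n) y * creat j (\<lambda>J. X J y) K))))\<^sup>2)
      + (\<Sum>L\<in>UNIV. (norm (wclass \<phi> (\<lambda>y. \<kappa> n y * W L y - (\<Sum>k\<in>UNIV. wirt (- \<i>) k (\<kappa> n) y * annih k (\<lambda>J. X J y) L))))\<^sup>2)))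
      \<longlonglongrightarrow> C * ((\<Sum>K\<in>UNIV. (norm (wclass \<phi> (V K)))\<^sup>2) + (\<Sum>L\<in>UNIV. (norm (wclass \<phi> (W L)))\<^sup>2))"
      by (intro tendsto_mult tendsto_const tendsto_add tendsto_sum tendsto_power tendsto_norm limV limW)
    have "(\<Sum>J\<in>UNIV. (norm (wclass \<phi> (\<lambda>y. \<kappa> n y * X J y)))\<^sup>2) \<le>
      C * ((\<Sum>K\<in>UNIV. (norm (wclass \<phi> (\<lambda>y. \<kappa> n y * V K y + (\<Sum>j\<in>UNIV. wirt \<i> j (\<kappa> n) y * creat j (\<lambda>J. X J y) K))))\<^sup>2)
      + (\<Sum>L\<in>UNIV. (norm (wclass \<phi> (\<lambda>y. \<kappa> n y * W L y - (\<Sum>k\<in>UNIV. wirt (- \<i>) k (\<kappa> n) y * annih k (\<lambda>J. X J y) L))))\<^sup>2))" for n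
      unfolding X_def V_def W_def by (rule localized_estimate[OF nonneg \<phi> est x \<kappa>C \<kappa>s])
    then show "\<exists>N. \<forall>n\<ge>N. (\<Sum>J\<in>UNIV. (norm (wclass \<phi> (\<lambda>y. \<kappa> n y * X J y)))\<^sup>2) \<le>
      C * ((\<Sum>K\<in>UNIV. (norm (wclass \<phi> (\<lambda>y. \<kappa> n y * V K y + (\<Sum>j\<in>UNIV. wirt \<i> j (\<kappa> n) y * creat j (\<lambda>J. X J y) K))))\<^sup>2)
      + (\<Sum>L\<in>UNIV. (norm (wclass \<phi> (\<lambda>y. \<kappa> n y * W L y - (\<Sum>k\<in>UNIV. wirt (- \<i>) k (\<kappa> n) y * annih k (\<lambda>J. X J y) L))))\<^sup>2))"
      by (intro exI[of _ 0] allI impI)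
  qed
  then show ?thesis by (simp only: X_def V_def W_def)
qed

section \<open>The complex as a pair of closed relations\<close>

lemma L2_forms_add:
  assumes "x \<in> L2_forms \<phi> q" "y \<in> L2_forms \<phi> q" "continuous_on UNIV \<phi>"
  shows "form_add x y \<in> L2_forms \<phi> q"
  using assms by (auto simp: L2_forms_def form_add_def L2_weight_iff wm_add sqint_add)

lemma L2_forms_scale:
  assumes "x \<in> L2_forms \<phi> q" "continuous_on UNIV \<phi>"
  shows "form_scale c x \<in> L2_forms \<phi> q"
  using assms by (auto simp: L2_forms_def form_scale_def L2_weight_iff wm_mult sqint_scale)

text \<open>
  The element of the Hilbert space represented by a form, with zero components in the other degrees.
\<close>

definition form_class ::
  "(complex ^ 'n::finite \<Rightarrow> real) \<Rightarrow> nat \<Rightarrow> 'n form \<Rightarrow> (complex ^ 'n) L2 ^ ('n set)" where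
  "form_class \<phi> q x = (\<chi> J. wclass \<phi> (trunc q x J))"

lemma trunc_zero: "card J \<noteq> q \<Longrightarrow> trunc q x J = (\<lambda>z. 0)"
  by (simp add: trunc_def fun_eq_iff)

lemma trunc_eq: "card J = q \<Longrightarrow> trunc q x J = x J"
  by (simp add: trunc_def fun_eq_iff)

lemma form_class_nth: "form_class \<phi> q x $ J = (if card J = q then wclass \<phi> (x J) else 0)"
  by (simp add: form_class_def trunc_zero trunc_eq wclass_def wm_zero L2_class_zero)

lemma L2_forms_sqint: "continuous_on UNIV \<phi> \<Longrightarrow> x \<in> L2_forms \<phi> q \<Longrightarrow> card J = q \<Longrightarrow> sqint (wm \<phi> (x J))"
  by (simp add: L2_forms_def L2_weight_iff)

lemma wm_inner: "wm \<phi> f z \<bullet> wm \<phi> g z = Re (f z * cnj (g z) * complex_of_real (exp (- \<phi> z)))"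
proof -
  have e: "exp (- \<phi> z / 2) * exp (- \<phi> z / 2) = exp (- \<phi> z)" by (simp flip: exp_add)
  have "wm \<phi> f z \<bullet> wm \<phi> g z = (f z \<bullet> g z) * (exp (- \<phi> z / 2) * exp (- \<phi> z / 2))"
    by (simp add: wm_def inner_complex_def algebra_simps)
  also have "\<dots> = Re (f z * cnj (g z) * complex_of_real (exp (- \<phi> z)))"
    unfolding e by (simp add: inner_complex_def)
  finally show ?thesis .
qed

lemma integrable_weighted_product:
  assumes "sqint (wm \<phi> f)" "sqint (wm \<phi> g)"
  shows "integrable lebesgue (\<lambda>z. f z * cnj (g z) * complex_of_real (exp (- \<phi> z)))"
proof -
  have e: "complex_of_real (exp (- \<phi> z)) = complex_of_real (exp (- \<phi> z / 2)) * complex_of_real (exp (- \<phi> z / 2))" for z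
    by (simp flip: exp_add of_real_mult)
  have "f z * cnj (g z) * complex_of_real (exp (- \<phi> z)) = wm \<phi> f z * cnj (wm \<phi> g z)" for z
    unfolding e by (simp add: wm_def)
  then show ?thesis using integrable_sqint_mult[OF assms(1) sqint_cnj[OF assms(2)]] by simp
qed

lemma form_class_inner:
  fixes x :: "'n::finite form"
  assumes c: "continuous_on UNIV \<phi>" and x: "x \<in> L2_forms \<phi> q" and y: "y \<in> L2_forms \<phi> q"
  shows "form_class \<phi> q x \<bullet> form_class \<phi> q y = Re (form_inner \<phi> q x y)"
proof -
  have "form_class \<phi> q x \<bullet> form_class \<phi> q y = (\<Sum>J\<in>UNIV. form_class \<phi> q x $ J \<bullet> form_class \<phi> q y $ J)"
    by (simp add: inner_vec_def)
  also have "\<dots> = (\<Sum>J | card J = q. form_class \<phi> q x $ J \<bullet> form_class \<phi> q y $ J)"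
    by (rule sum.mono_neutral_right) (auto simp: form_class_nth)
  also have "\<dots> = (\<Sum>J | card J = q. Re (LINT z|lebesgue. x J z * cnj (y J z) * complex_of_real (exp (- \<phi> z))))"
  proof (rule sum.cong[OF refl])
    fix J :: "'n set" assume "J \<in> {J. card J = q}"
    then have J: "card J = q" by simp
    note s = L2_forms_sqint[OF c x J] L2_forms_sqint[OF c y J]
    have "form_class \<phi> q x $ J \<bullet> form_class \<phi> q y $ J = (LINT z|lebesgue. wm \<phi> (x J) z \<bullet> wm \<phi> (y J) z)"
      using J by (simp add: form_class_nth wclass_def L2_class_inner[OF s])
    also have "\<dots> = Re (LINT z|lebesgue. x J z * cnj (y J z) * complex_of_real (exp (- \<phi> z)))"
      unfolding wm_inner by (rule integral_Re[OF integrable_weighted_product[OF s]])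
    finally show "form_class \<phi> q x $ J \<bullet> form_class \<phi> q y $ J =
      Re (LINT z|lebesgue. x J z * cnj (y J z) * complex_of_real (exp (- \<phi> z)))" .
  qed
  finally show ?thesis by (simp add: form_inner_def)
qed

lemma form_class_norm:
  assumes "continuous_on UNIV \<phi>" "x \<in> L2_forms \<phi> q"
  shows "norm (form_class \<phi> q x) = form_norm \<phi> q x"
  unfolding form_norm_def norm_eq_sqrt_inner form_class_inner[OF assms(1) assms(2) assms(2)] ..

lemma form_class_eq_iff:
  assumes c: "continuous_on UNIV \<phi>" and x: "x \<in> L2_forms \<phi> q" and y: "y \<in> L2_forms \<phi> q"
  shows "form_class \<phi> q x = form_class \<phi> q y \<longleftrightarrow> form_eq q x y"
proof -
  have "wclass \<phi> (x J) = wclass \<phi> (y J) \<longleftrightarrow> (AE z in lebesgue. x J z = y J z)" if J: "card J = q" for J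
    unfolding wclass_def L2_class_eq_iff[OF L2_forms_sqint[OF c x J] L2_forms_sqint[OF c y J]]
    by (simp add: wm_def)
  then show ?thesis unfolding form_eq_def vec_eq_iff form_class_nth by simp
qed

lemma form_class_add:
  assumes c: "continuous_on UNIV \<phi>" and x: "x \<in> L2_forms \<phi> q" and y: "y \<in> L2_forms \<phi> q"
  shows "form_class \<phi> q (form_add x y) = form_class \<phi> q x + form_class \<phi> q y"
  unfolding vec_eq_iff
proof
  fix J
  show "form_class \<phi> q (form_add x y) $ J = (form_class \<phi> q x + form_class \<phi> q y) $ J"
  proof (cases "card J = q")
    case True
    then show ?thesis
      by (simp add: form_class_nth form_add_def wclass_add[OF L2_forms_sqint[OF c x] L2_forms_sqint[OF c y]])
  qed (simp add: form_class_nth)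
qed

text \<open>
  Each component has a representative, and it can be divided by the weight, which has no zeros.
\<close>

lemma form_class_surj:
  assumes c: "continuous_on UNIV \<phi>" and a: "\<And>J. card J \<noteq> q \<Longrightarrow> a $ J = 0"
  obtains x where "x \<in> L2_forms \<phi> q" "form_class \<phi> q x = a"
proof -
  have "\<exists>f. sqint (wm \<phi> f) \<and> wclass \<phi> f = a $ J" for J
  proof -
    obtain g where g: "sqint g" "a $ J = L2_class g" by (rule L2_class_cases)
    have "wm \<phi> (\<lambda>z. g z * complex_of_real (exp (\<phi> z / 2))) = g"
      by (rule ext) (simp add: wm_def mult.assoc flip: of_real_mult exp_add)
    then show ?thesis using g by (intro exI[of _ "\<lambda>z. g z * complex_of_real (exp (\<phi> z / 2))"]) (simp add: wclass_def)
  qed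
  then have "\<exists>x. \<forall>J. sqint (wm \<phi> (x J)) \<and> wclass \<phi> (x J) = a $ J" by (intro choice) blast
  then obtain x where x: "\<And>J. sqint (wm \<phi> (x J))" "\<And>J. wclass \<phi> (x J) = a $ J" by blast
  show ?thesis
  proof (rule that[of x])
    show "x \<in> L2_forms \<phi> q" by (simp add: L2_forms_def L2_weight_iff[OF c] x)
    show "form_class \<phi> q x = a" unfolding vec_eq_iff form_class_nth by (simp add: x a)
  qed
qed

text \<open>
  The integral of \<open>f \<eta>\<close> as a function of the weighted class of \<open>f\<close>.  In a real Hilbert space its real and imaginary parts
  are two inner products, with \<open>cnj \<eta> e\<^bsup>\<phi>/2\<^esup>\<close> and with \<open>\<i>\<close> times this function.
\<close>

definition pairing :: "(complex ^ 'n::finite \<Rightarrow> real) \<Rightarrow> (complex ^ 'n \<Rightarrow> complex) \<Rightarrow> (complex ^ 'n) L2 \<Rightarrow> complex" where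
  "pairing \<phi> \<eta> a =
     complex_of_real (a \<bullet> L2_class (\<lambda>z. cnj (\<eta> z) * complex_of_real (exp (\<phi> z / 2))))
     + \<i> * complex_of_real (a \<bullet> L2_class (\<lambda>z. \<i> * (cnj (\<eta> z) * complex_of_real (exp (\<phi> z / 2)))))"

lemma pairing_add: "pairing \<phi> \<eta> (a + b) = pairing \<phi> \<eta> a + pairing \<phi> \<eta> b"
  and pairing_scaleR: "pairing \<phi> \<eta> (r *\<^sub>R a) = complex_of_real r * pairing \<phi> \<eta> a"
  and pairing_zero: "pairing \<phi> \<eta> 0 = 0"
  by (simp_all add: pairing_def inner_add_left algebra_simps)

lemma continuous_on_pairing [continuous_intros]:
  "continuous_on A f \<Longrightarrow> continuous_on A (\<lambda>x. pairing \<phi> \<eta> (f x))"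
  unfolding pairing_def by (intro continuous_intros)

lemma pairing_wclass:
  fixes \<eta> :: "complex ^ 'n::finite \<Rightarrow> complex"
  assumes c: "continuous_on UNIV \<phi>" and f: "sqint (wm \<phi> f)" and \<eta>: "continuous_on UNIV \<eta>" "csupp \<eta>"
  shows "pairing \<phi> \<eta> (wclass \<phi> f) = (LINT z|lebesgue. f z * \<eta> z)"
proof -
  define g where "g z = cnj (\<eta> z) * complex_of_real (exp (\<phi> z / 2))" for z
  have gs: "sqint g"
  proof (rule sqint_cc)
    show "continuous_on UNIV g" unfolding g_def by (intro continuous_intros \<eta> c) auto
    show "csupp g" by (rule csupp_subset[OF \<eta>(2)]) (simp add: g_def)
  qed
  have e: "wm \<phi> f z * cnj (g z) = f z * \<eta> z" for z
  proof -
    have "complex_of_real (exp (- \<phi> z / 2)) * complex_of_real (exp (\<phi> z / 2)) = 1"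
      by (simp flip: of_real_mult exp_add)
    then show ?thesis by (simp add: wm_def g_def mult.assoc mult.left_commute)
  qed
  have i: "integrable lebesgue (\<lambda>z. f z * \<eta> z)"
    using integrable_sqint_mult[OF f sqint_cnj[OF gs]] by (simp add: e)
  have 1: "wclass \<phi> f \<bullet> L2_class g = Re (LINT z|lebesgue. f z * \<eta> z)"
  proof -
    have "wm \<phi> f z \<bullet> g z = Re (f z * \<eta> z)" for z unfolding e[symmetric] by (simp add: inner_complex_def)
    then show ?thesis by (simp add: wclass_def L2_class_inner[OF f gs] integral_Re[OF i] del: times_complex.sel)
  qed
  have 2: "wclass \<phi> f \<bullet> L2_class (\<lambda>z. \<i> * g z) = Im (LINT z|lebesgue. f z * \<eta> z)"
  proof -
    have "wm \<phi> f z \<bullet> (\<i> * g z) = Im (f z * \<eta> z)" for z unfolding e[symmetric] by (simp add: inner_complex_def)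
    then show ?thesis by (simp add: wclass_def L2_class_inner[OF f sqint_scale[OF gs]] integral_Im[OF i] del: times_complex.sel)
  qed
  have "pairing \<phi> \<eta> (wclass \<phi> f) = complex_of_real (wclass \<phi> f \<bullet> L2_class g) + \<i> * complex_of_real (wclass \<phi> f \<bullet> L2_class (\<lambda>z. \<i> * g z))"
    unfolding pairing_def g_def ..
  then show ?thesis unfolding 1 2 by (simp only: complex_eq[symmetric])
qed

type_synonym 'n L2_form = "((complex, 'n) vec L2, 'n set) vec"

text \<open>
  The graph of dbar between the Hilbert spaces of classes.
\<close>

definition dbar_rel ::
  "(complex ^ 'n::{finite,linorder} \<Rightarrow> real) \<Rightarrow> nat \<Rightarrow> ('n::{finite,linorder} L2_form \<times> 'n L2_form) set" where
  "dbar_rel \<phi> q = {(form_class \<phi> q x, form_class \<phi> (Suc q) v) | x v. is_dbar \<phi> q x v}"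

lemma is_dbarD:
  "is_dbar \<phi> q x v \<Longrightarrow> x \<in> L2_forms \<phi> q"
  "is_dbar \<phi> q x v \<Longrightarrow> v \<in> L2_forms \<phi> (Suc q)"
  by (simp_all add: is_dbar_def)

lemma test_fun_d_zbar:
  fixes \<eta> :: "complex ^ 'n::finite \<Rightarrow> complex"
  shows "test_fun \<eta> \<Longrightarrow> test_fun (d_zbar j \<eta>)"
  unfolding d_zbar_wirt by (rule test_funI[OF Ck_wirt[OF test_funD(1)] csupp_wirt[OF test_funD(2)]])

lemma test_fun_continuous: "test_fun \<eta> \<Longrightarrow> continuous_on UNIV \<eta>"
  using test_funD(1)[of \<eta> 0] by simp

text \<open>
  The distributional equation depends only on the classes and is expressed by continuous functionals of them.
\<close>

lemma dbar_equation_iff: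
  fixes \<phi> :: "complex ^ 'n::{finite,linorder} \<Rightarrow> real"
  assumes c: "continuous_on UNIV \<phi>" and x: "x \<in> L2_forms \<phi> q" and v: "v \<in> L2_forms \<phi> (Suc q)"
    and K: "card K = Suc q" and \<eta>: "test_fun \<eta>"
  shows "(LINT z|lebesgue. v K z * \<eta> z) =
        - (\<Sum>j\<in>K. wedge_sign j (K - {j}) * (LINT z|lebesgue. x (K - {j}) z * d_zbar j \<eta> z))
    \<longleftrightarrow> pairing \<phi> \<eta> (form_class \<phi> (Suc q) v $ K) =
        - (\<Sum>j\<in>K. wedge_sign j (K - {j}) * pairing \<phi> (d_zbar j \<eta>) (form_class \<phi> q x $ (K - {j})))"
proof -
  have 1: "pairing \<phi> \<eta> (form_class \<phi> (Suc q) v $ K) = (LINT z|lebesgue. v K z * \<eta> z)"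
    using K by (simp add: form_class_nth pairing_wclass[OF c L2_forms_sqint[OF c v] test_fun_continuous[OF \<eta>] test_funD(2)[OF \<eta>]])
  have 2: "pairing \<phi> (d_zbar j \<eta>) (form_class \<phi> q x $ (K - {j})) = (LINT z|lebesgue. x (K - {j}) z * d_zbar j \<eta> z)"
    if j: "j \<in> K" for j
  proof -
    have "card (K - {j}) = q" using K j by simp
    then show ?thesis
      by (simp add: form_class_nth pairing_wclass[OF c L2_forms_sqint[OF c x]
            test_fun_continuous[OF test_fun_d_zbar[OF \<eta>]] test_funD(2)[OF test_fun_d_zbar[OF \<eta>]]])
  qed
  show ?thesis unfolding 1 by (simp add: 2)
qed

text \<open>
  A system of continuous linear conditions, from which linearity and closedness of the graph are read off.
\<close>

lemma dbar_rel_iff: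
  fixes \<phi> :: "complex ^ 'n::{finite,linorder} \<Rightarrow> real"
  assumes c: "continuous_on UNIV \<phi>"
  shows "p \<in> dbar_rel \<phi> q \<longleftrightarrow>
     (\<forall>J. card J \<noteq> q \<longrightarrow> fst p $ J = 0) \<and> (\<forall>K. card K \<noteq> Suc q \<longrightarrow> snd p $ K = 0) \<and>
     (\<forall>K \<eta>. card K = Suc q \<and> test_fun \<eta> \<longrightarrow> pairing \<phi> \<eta> (snd p $ K) =
        - (\<Sum>j\<in>K. wedge_sign j (K - {j}) * pairing \<phi> (d_zbar j \<eta>) (fst p $ (K - {j}))))" (is "?L \<longleftrightarrow> ?R")
proof
  assume ?L
  then obtain x v where p: "p = (form_class \<phi> q x, form_class \<phi> (Suc q) v)" and xv: "is_dbar \<phi> q x v"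
    unfolding dbar_rel_def by blast
  note l = is_dbarD[OF xv]
  show ?R
  proof (intro conjI allI impI)
    fix K :: "'n set" and \<eta> assume h: "card K = Suc q \<and> test_fun (\<eta> :: (complex, 'n) vec \<Rightarrow> complex)"
    then show "pairing \<phi> \<eta> (snd p $ K) =
        - (\<Sum>j\<in>K. wedge_sign j (K - {j}) * pairing \<phi> (d_zbar j \<eta>) (fst p $ (K - {j})))"
      unfolding p fst_conv snd_conv dbar_equation_iff[OF c l conjunct1[OF h] conjunct2[OF h], symmetric]
      using xv by (simp add: is_dbar_def)
  qed (simp_all add: p form_class_nth)
next
  assume r: ?R
  obtain x where x: "x \<in> L2_forms \<phi> q" "form_class \<phi> q x = fst p"
    by (rule form_class_surj[OF c, of q "fst p"]) (use r in auto)
  obtain v where v: "v \<in> L2_forms \<phi> (Suc q)" "form_class \<phi> (Suc q) v = snd p"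
    by (rule form_class_surj[OF c, of "Suc q" "snd p"]) (use r in auto)
  have "is_dbar \<phi> q x v"
    unfolding is_dbar_def
  proof (intro conjI allI impI x v)
    fix K :: "'n set" and \<eta> assume h: "card K = Suc q \<and> test_fun (\<eta> :: (complex, 'n) vec \<Rightarrow> complex)"
    then show "(LINT z|lebesgue. v K z * \<eta> z) =
        - (\<Sum>j\<in>K. wedge_sign j (K - {j}) * (LINT z|lebesgue. x (K - {j}) z * d_zbar j \<eta> z))"
      unfolding dbar_equation_iff[OF c x(1) v(1) conjunct1[OF h] conjunct2[OF h]] x v
      using r by blast
  qed
  then show ?L unfolding dbar_rel_def using x v by (cases p) auto
qed

lemma dbar_rel_is_dbar:
  fixes x :: "'n::{finite,linorder} form"
  assumes c: "continuous_on UNIV \<phi>" and x: "x \<in> L2_forms \<phi> q" and v: "v \<in> L2_forms \<phi> (Suc q)"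
    and r: "(form_class \<phi> q x, form_class \<phi> (Suc q) v) \<in> dbar_rel \<phi> q"
  shows "is_dbar \<phi> q x v"
  unfolding is_dbar_def
proof (intro conjI allI impI x v)
  fix K :: "'n set" and \<eta> assume h: "card K = Suc q \<and> test_fun (\<eta> :: (complex, 'n) vec \<Rightarrow> complex)"
  show "(LINT z|lebesgue. v K z * \<eta> z) =
      - (\<Sum>j\<in>K. wedge_sign j (K - {j}) * (LINT z|lebesgue. x (K - {j}) z * d_zbar j \<eta> z))"
    unfolding dbar_equation_iff[OF c x v conjunct1[OF h] conjunct2[OF h]]
    using r h unfolding dbar_rel_iff[OF c] fst_conv snd_conv by blast
qed

lemma subspace_dbar_rel:
  assumes c: "continuous_on UNIV \<phi>"
  shows "subspace (dbar_rel \<phi> q)"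
proof (rule subspaceI)
  show "0 \<in> dbar_rel \<phi> q" by (simp add: dbar_rel_iff[OF c] pairing_zero)
next
  fix a b assume "a \<in> dbar_rel \<phi> q" "b \<in> dbar_rel \<phi> q"
  then show "a + b \<in> dbar_rel \<phi> q"
    unfolding dbar_rel_iff[OF c] by (simp add: pairing_add distrib_left sum.distrib)
next
  fix a and r :: real assume "a \<in> dbar_rel \<phi> q"
  then show "r *\<^sub>R a \<in> dbar_rel \<phi> q"
    unfolding dbar_rel_iff[OF c] by (simp add: pairing_scaleR sum_distrib_left mult.left_commute)
qed

lemma closed_dbar_rel:
  fixes \<phi> :: "complex ^ 'n::{finite,linorder} \<Rightarrow> real"
  assumes c: "continuous_on UNIV \<phi>"
  shows "closed (dbar_rel \<phi> q)"
proof -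
  have "closed {p. (\<forall>J. card J \<noteq> q \<longrightarrow> fst p $ J = 0) \<and> (\<forall>K. card K \<noteq> Suc q \<longrightarrow> snd p $ K = 0) \<and>
     (\<forall>K \<eta>. card K = Suc q \<and> test_fun \<eta> \<longrightarrow> pairing \<phi> \<eta> (snd p $ K) =
        - (\<Sum>j\<in>K. wedge_sign j (K - {j}) * pairing \<phi> (d_zbar j \<eta>) (fst p $ (K - {j}))))}"
    by (intro closed_Collect_conj closed_Collect_all closed_Collect_imp open_Collect_const closed_Collect_eq
        continuous_intros)
  moreover have "dbar_rel \<phi> q = {p. (\<forall>J. card J \<noteq> q \<longrightarrow> fst p $ J = 0) \<and> (\<forall>K. card K \<noteq> Suc q \<longrightarrow> snd p $ K = 0) \<and>
     (\<forall>K \<eta>. card K = Suc q \<and> test_fun \<eta> \<longrightarrow> pairing \<phi> \<eta> (snd p $ K) =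
        - (\<Sum>j\<in>K. wedge_sign j (K - {j}) * pairing \<phi> (d_zbar j \<eta>) (fst p $ (K - {j}))))}"
    by (rule set_eqI) (simp only: dbar_rel_iff[OF c] mem_Collect_eq)
  ultimately show ?thesis by simp
qed

lemma is_dbar_scale:
  fixes x :: "'n::{finite,linorder} form"
  assumes c: "continuous_on UNIV \<phi>" and x: "is_dbar \<phi> q x v"
  shows "is_dbar \<phi> q (form_scale a x) (form_scale a v)"
  unfolding is_dbar_def
proof (intro conjI allI impI L2_forms_scale[OF is_dbarD(1)[OF x] c] L2_forms_scale[OF is_dbarD(2)[OF x] c])
  fix K :: "'n set" and \<eta> assume h: "card K = Suc q \<and> test_fun (\<eta> :: (complex, 'n) vec \<Rightarrow> complex)"
  then have "(LINT z|lebesgue. v K z * \<eta> z) =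
      - (\<Sum>j\<in>K. wedge_sign j (K - {j}) * (LINT z|lebesgue. x (K - {j}) z * d_zbar j \<eta> z))"
    using x by (simp add: is_dbar_def)
  then have "a * (LINT z|lebesgue. v K z * \<eta> z) =
      - (\<Sum>j\<in>K. wedge_sign j (K - {j}) * (a * (LINT z|lebesgue. x (K - {j}) z * d_zbar j \<eta> z)))"
    by (simp add: sum_distrib_left mult.left_commute)
  then show "(LINT z|lebesgue. form_scale a v K z * \<eta> z) =
      - (\<Sum>j\<in>K. wedge_sign j (K - {j}) * (LINT z|lebesgue. form_scale a x (K - {j}) z * d_zbar j \<eta> z))"
    by (simp add: form_scale_def mult.assoc)
qed

lemma form_inner_scale: "form_inner \<phi> q (form_scale a x) y = a * form_inner \<phi> q x y"
  by (simp add: form_inner_def form_scale_def mult.assoc sum_distrib_left)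

text \<open>
  The real parts of the inner products determine the complex ones, because the domain of dbar is invariant under
  multiplication by \<open>\<i>\<close>; so the adjoint in the real Hilbert space is the adjoint in the complex one.
\<close>

lemma adjoint_dbar_rel_iff:
  fixes x :: "'n::{finite,linorder} form"
  assumes c: "continuous_on UNIV \<phi>" and x: "x \<in> L2_forms \<phi> (Suc p)" and w: "w \<in> L2_forms \<phi> p"
  shows "(form_class \<phi> (Suc p) x, form_class \<phi> p w) \<in> adjoint_rel (dbar_rel \<phi> p) \<longleftrightarrow> is_dbar_adj \<phi> p x w"
proof
  assume a: "(form_class \<phi> (Suc p) x, form_class \<phi> p w) \<in> adjoint_rel (dbar_rel \<phi> p)"
  have re: "Re (form_inner \<phi> (Suc p) u' x) = Re (form_inner \<phi> p u w)" if u: "is_dbar \<phi> p u u'" for u u'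
  proof -
    have "(form_class \<phi> p u, form_class \<phi> (Suc p) u') \<in> dbar_rel \<phi> p" unfolding dbar_rel_def using u by blast
    from adjoint_relD[OF a this] show ?thesis
      by (simp add: form_class_inner[OF c is_dbarD(2)[OF u] x] form_class_inner[OF c is_dbarD(1)[OF u] w])
  qed
  show "is_dbar_adj \<phi> p x w"
    unfolding is_dbar_adj_def
  proof (intro conjI allI impI x w)
    fix u u' assume u: "is_dbar \<phi> p u u'"
    have "Re (\<i> * form_inner \<phi> (Suc p) u' x) = Re (\<i> * form_inner \<phi> p u w)"
      using re[OF is_dbar_scale[OF c u, of \<i>]] by (simp only: form_inner_scale)
    then show "form_inner \<phi> (Suc p) u' x = form_inner \<phi> p u w"
      using re[OF u] by (simp add: complex_eq_iff)
  qed
next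
  assume a: "is_dbar_adj \<phi> p x w"
  have "form_class \<phi> (Suc p) u' \<bullet> form_class \<phi> (Suc p) x = form_class \<phi> p u \<bullet> form_class \<phi> p w"
    if u: "is_dbar \<phi> p u u'" for u u'
    unfolding form_class_inner[OF c is_dbarD(2)[OF u] x] form_class_inner[OF c is_dbarD(1)[OF u] w]
      is_dbar_adjD[OF a u] ..
  then show "(form_class \<phi> (Suc p) x, form_class \<phi> p w) \<in> adjoint_rel (dbar_rel \<phi> p)"
    unfolding adjoint_rel_def dbar_rel_def by fastforce
qed

text \<open>
  The equation for \<open>v\<close> is evaluated with \<open>d_zbar j \<eta>\<close> as test function.  In the resulting double sum over pairs of
  indices the second derivatives of \<open>\<eta>\<close> are symmetric, and the product of the two signs is antisymmetric.
\<close>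

lemma is_dbar_dbar:
  fixes x :: "'n::{finite,linorder} form"
  assumes x: "is_dbar \<phi> p x v"
  shows "is_dbar \<phi> (Suc p) v (\<lambda>K z. 0)"
  unfolding is_dbar_def
proof (intro conjI allI impI is_dbarD(2)[OF x])
  show "(\<lambda>K z. 0) \<in> L2_forms \<phi> (Suc (Suc p))" by (simp add: L2_forms_def L2_weight_def)
  fix K :: "'n set" and \<eta> assume h: "card K = Suc (Suc p) \<and> test_fun (\<eta> :: (complex, 'n) vec \<Rightarrow> complex)"
  define F where "F i j = wedge_sign j (K - {j}) * (wedge_sign i (K - {j} - {i}) *
    (LINT z|lebesgue. x (K - {j} - {i}) z * d_zbar i (d_zbar j \<eta>) z))" for i j
  have e: "wedge_sign j (K - {j}) * (LINT z|lebesgue. v (K - {j}) z * d_zbar j \<eta> z) = - (\<Sum>i\<in>K - {j}. F i j)"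
    if j: "j \<in> K" for j
  proof -
    have "card (K - {j}) = Suc p" using h j by simp
    then have "(LINT z|lebesgue. v (K - {j}) z * d_zbar j \<eta> z) =
        - (\<Sum>i\<in>K - {j}. wedge_sign i (K - {j} - {i}) * (LINT z|lebesgue. x (K - {j} - {i}) z * d_zbar i (d_zbar j \<eta>) z))"
      using x h by (simp add: is_dbar_def test_fun_d_zbar)
    then show ?thesis by (simp add: F_def sum_distrib_left)
  qed
  have anti: "F i j = - F j i" if ij: "i \<in> K" "j \<in> K" "i \<noteq> j" for i j
  proof -
    define L where "L = K - {j} - {i}"
    have L: "K - {j} = insert i L" "K - {i} = insert j L" "insert i L - {i} = L" "insert j L - {j} = L" "i \<notin> L" "j \<notin> L"
      unfolding L_def using ij by auto
    have d: "d_zbar i (d_zbar j \<eta>) = d_zbar j (d_zbar i \<eta>)"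
      unfolding d_zbar_wirt by (rule ext) (rule wirt_commute[OF test_funD(1)[OF conjunct2[OF h]]])
    have 1: "F i j = (if i < j then - 1 else 1) * wedge_sign j L * (wedge_sign i L * (LINT z|lebesgue. x L z * d_zbar i (d_zbar j \<eta>) z))"
      by (simp only: F_def L(1,3) wedge_sign_insert[OF L(5)])
    have 2: "F j i = (if j < i then - 1 else 1) * wedge_sign i L * (wedge_sign j L * (LINT z|lebesgue. x L z * d_zbar i (d_zbar j \<eta>) z))"
      by (simp only: F_def L(2,4) wedge_sign_insert[OF L(6)] d)
    show ?thesis
      unfolding 1 2 by (cases i j rule: linorder_cases) (use ij(3) in simp_all)
  qed
  define S where "S = (\<Sum>j\<in>K. \<Sum>i\<in>K - {j}. F i j)"
  have S1: "S = (\<Sum>j\<in>K. \<Sum>i\<in>K. if i = j then 0 else F i j)"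
    unfolding S_def by (intro sum.cong refl sum.mono_neutral_cong_left) auto
  also have "\<dots> = (\<Sum>i\<in>K. \<Sum>j\<in>K. if i = j then 0 else F i j)"
    by (rule sum.swap)
  also have "\<dots> = (\<Sum>i\<in>K. \<Sum>j\<in>K. - (if j = i then 0 else F j i))"
  proof (intro sum.cong refl)
    fix i j assume ij: "i \<in> K" "j \<in> K"
    show "(if i = j then 0 else F i j) = - (if j = i then 0 else F j i)"
    proof (cases "i = j")
      case False
      then show ?thesis unfolding if_not_P[OF False] if_not_P[OF not_sym[OF False]] by (intro anti ij)
    qed simp
  qed
  also have "\<dots> = - S" unfolding S1 by (simp only: sum_negf)
  finally have "S + S = 0" by (rule eq_neg_iff_add_eq_0[THEN iffD1])
  then have "2 * S = 0" by (simp only: mult_2)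
  then have S0: "S = 0" by simp
  have "(\<Sum>j\<in>K. wedge_sign j (K - {j}) * (LINT z|lebesgue. v (K - {j}) z * d_zbar j \<eta> z)) = (\<Sum>j\<in>K. - (\<Sum>i\<in>K - {j}. F i j))"
    by (rule sum.cong[OF refl e])
  also have "\<dots> = - S" unfolding S_def by (rule sum_negf)
  finally have "(\<Sum>j\<in>K. wedge_sign j (K - {j}) * (LINT z|lebesgue. v (K - {j}) z * d_zbar j \<eta> z)) = 0"
    by (simp only: S0 minus_zero)
  then show "(LINT z|lebesgue. 0 * \<eta> z) =
      - (\<Sum>j\<in>K. wedge_sign j (K - {j}) * (LINT z|lebesgue. v (K - {j}) z * d_zbar j \<eta> z))"
    by (simp only: mult_zero_left Bochner_Integration.integral_zero minus_zero)
qed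

text \<open>
  The classes of \<open>(0,p)\<close>-forms span only the components with \<open>card J = p\<close>, so the image
  under the adjoint is determined only there; its other components may be removed.
\<close>

lemma adjoint_dbar_rel_truncate:
  fixes a b :: "'n::{finite,linorder} L2_form"
  assumes "(a, b) \<in> adjoint_rel (dbar_rel \<phi> p)"
  shows "(a, vec_lambda (\<lambda>J. if card J = p then b $ J else 0)) \<in> adjoint_rel (dbar_rel \<phi> p)"
    "norm (vec_lambda (\<lambda>J. if card J = p then b $ J else 0) :: 'n L2_form) \<le> norm b"
proof -
  let ?b = "vec_lambda (\<lambda>J. if card J = p then b $ J else 0) :: 'n L2_form"
  have "form_class \<phi> p u \<bullet> ?b = form_class \<phi> p u \<bullet> b" for u
    unfolding inner_vec_def by (rule sum.cong[OF refl]) (simp add: form_class_nth)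
  then show "(a, ?b) \<in> adjoint_rel (dbar_rel \<phi> p)"
    using assms unfolding adjoint_rel_def dbar_rel_def by fastforce
  show "norm ?b \<le> norm b" unfolding norm_vec_def by (rule L2_set_mono) simp_all
qed

lemma norm_form_class_square: "(norm (form_class \<phi> q x))\<^sup>2 = (\<Sum>J\<in>UNIV. (norm (wclass \<phi> (trunc q x J)))\<^sup>2)"
  by (simp add: power2_norm_eq_inner inner_vec_def form_class_def)

lemma dbar_rel_estimate:
  fixes \<phi> :: "complex ^ 'n::{finite,linorder} \<Rightarrow> real"
  assumes nonneg: "\<And>z. 0 \<le> \<phi> z" and \<phi>: "Ck 2 \<phi>" and C: "0 \<le> C"
    and est: "\<And>u. (\<And>J. Ck 2 (u J)) \<Longrightarrow> (\<And>J. csupp (u J)) \<Longrightarrow> (\<And>J z. card J \<noteq> Suc p \<Longrightarrow> u J z = 0) \<Longrightarrow>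
      wnorm2 \<phi> u \<le> C * (wnorm2 \<phi> (dbar_form u) + wnorm2 \<phi> (dbar_adj_form \<phi> u))"
    and S: "(x, v) \<in> dbar_rel \<phi> (Suc p)" and T: "(x, w) \<in> adjoint_rel (dbar_rel \<phi> p)"
  shows "(norm x)\<^sup>2 \<le> C * ((norm v)\<^sup>2 + (norm w)\<^sup>2)"
proof -
  have c: "continuous_on UNIV \<phi>" by (rule Ck_continuous[OF \<phi>])
  obtain f g where fg: "x = form_class \<phi> (Suc p) f" "v = form_class \<phi> (Suc (Suc p)) g" "is_dbar \<phi> (Suc p) f g"
    using S unfolding dbar_rel_def by blast
  obtain h where h: "h \<in> L2_forms \<phi> p" "form_class \<phi> p h = vec_lambda (\<lambda>J. if card J = p then w $ J else 0)"
    by (rule form_class_surj[OF c, of p "vec_lambda (\<lambda>J. if card J = p then w $ J else 0)"]) simp_all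
  have "is_dbar_adj \<phi> p f h"
    using adjoint_dbar_rel_truncate(1)[OF T]
    unfolding fg(1) h(2)[symmetric] adjoint_dbar_rel_iff[OF c is_dbarD(1)[OF fg(3)] h(1)] .
  from weak_estimate[OF nonneg \<phi> est fg(3) this]
  have "(norm x)\<^sup>2 \<le> C * ((norm v)\<^sup>2 + (norm (form_class \<phi> p h))\<^sup>2)"
    unfolding fg(1,2) norm_form_class_square .
  also have "\<dots> \<le> C * ((norm v)\<^sup>2 + (norm w)\<^sup>2)"
    using adjoint_dbar_rel_truncate(2)[OF T] C by (intro mult_left_mono add_left_mono power_mono) (simp_all add: h(2))
  finally show ?thesis .
qed

lemma dbar_rel_complex:
  fixes \<phi> :: "complex ^ 'n::{finite,linorder} \<Rightarrow> real"
  assumes "(w, a) \<in> dbar_rel \<phi> p"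
  shows "(a, 0) \<in> dbar_rel \<phi> (Suc p)"
proof -
  obtain f g where fg: "w = form_class \<phi> p f" "a = form_class \<phi> (Suc p) g" "is_dbar \<phi> p f g"
    using assms unfolding dbar_rel_def by blast
  have "form_class \<phi> (Suc (Suc p)) (\<lambda>K z. 0) = 0"
    unfolding vec_eq_iff by (simp add: form_class_nth wclass_def wm_zero L2_class_zero)
  then show ?thesis using is_dbar_dbar[OF fg(3)] unfolding dbar_rel_def fg(2) by force
qed

section \<open>The inverse of the complex Laplacian\<close>

lemma laplace_rel_add:
  assumes T: "subspace T" and S: "subspace S" and xy: "laplace_rel T S x u" "laplace_rel T S y v"
  shows "laplace_rel T S (x + y) (u + v)"
proof -
  obtain v1 w1 a1 b1 where 1: "(x, w1) \<in> adjoint_rel T" "(w1, a1) \<in> T" "(x, v1) \<in> S" "(v1, b1) \<in> adjoint_rel S" "u = a1 + b1"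
    using xy(1) unfolding laplace_rel_def by blast
  obtain v2 w2 a2 b2 where 2: "(y, w2) \<in> adjoint_rel T" "(w2, a2) \<in> T" "(y, v2) \<in> S" "(v2, b2) \<in> adjoint_rel S" "v = a2 + b2"
    using xy(2) unfolding laplace_rel_def by blast
  have "u + v = (a1 + a2) + (b1 + b2)" by (simp add: 1 2)
  then show ?thesis
    unfolding laplace_rel_def
    using subspace_add[OF subspace_adjoint_rel 1(1) 2(1)] subspace_add[OF T 1(2) 2(2)]
      subspace_add[OF S 1(3) 2(3)] subspace_add[OF subspace_adjoint_rel 1(4) 2(4)]
    unfolding add_Pair by blast
qed

lemma laplace_rel_uminus:
  assumes T: "subspace T" and S: "subspace S" and x: "laplace_rel T S x u"
  shows "laplace_rel T S (- x) (- u)"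
proof -
  obtain v1 w1 a1 b1 where 1: "(x, w1) \<in> adjoint_rel T" "(w1, a1) \<in> T" "(x, v1) \<in> S" "(v1, b1) \<in> adjoint_rel S" "u = a1 + b1"
    using x unfolding laplace_rel_def by blast
  have "- u = - a1 + - b1" by (simp add: 1)
  then show ?thesis
    unfolding laplace_rel_def
    using subspace_neg[OF subspace_adjoint_rel 1(1)] subspace_neg[OF T 1(2)]
      subspace_neg[OF S 1(3)] subspace_neg[OF subspace_adjoint_rel 1(4)]
    unfolding uminus_Pair by blast
qed

text \<open>
  Representatives exist for all intermediate elements: \<open>w\<close>, \<open>a\<close> and \<open>v\<close> occur in graphs of dbar, and \<open>b\<close> is the
  difference of two classes of forms.
\<close>

lemma is_laplacian_iff:
  fixes y u :: "'n::{finite,linorder} form"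
  assumes c: "continuous_on UNIV \<phi>" and y: "y \<in> L2_forms \<phi> (Suc p)" and u: "u \<in> L2_forms \<phi> (Suc p)"
  shows "is_laplacian \<phi> (Suc p) y u \<longleftrightarrow>
    laplace_rel (dbar_rel \<phi> p) (dbar_rel \<phi> (Suc p)) (form_class \<phi> (Suc p) y) (form_class \<phi> (Suc p) u)"
proof
  assume "is_laplacian \<phi> (Suc p) y u"
  then obtain v w a b where h: "is_dbar_adj \<phi> p y w" "is_dbar \<phi> p w a" "is_dbar \<phi> (Suc p) y v"
    "is_dbar_adj \<phi> (Suc p) v b" "form_eq (Suc p) u (form_add a b)"
    unfolding is_laplacian_def by auto
  have l: "w \<in> L2_forms \<phi> p" "a \<in> L2_forms \<phi> (Suc p)" "v \<in> L2_forms \<phi> (Suc (Suc p))" "b \<in> L2_forms \<phi> (Suc p)"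
    using h by (auto simp: is_dbar_def is_dbar_adj_def)
  have "form_class \<phi> (Suc p) u = form_class \<phi> (Suc p) a + form_class \<phi> (Suc p) b"
    using h(5) form_class_eq_iff[OF c u L2_forms_add[OF l(2,4) c]] by (simp add: form_class_add[OF c l(2,4)])
  moreover have "(form_class \<phi> (Suc p) y, form_class \<phi> p w) \<in> adjoint_rel (dbar_rel \<phi> p)"
    by (simp only: adjoint_dbar_rel_iff[OF c y l(1)] h(1))
  moreover have "(form_class \<phi> (Suc (Suc p)) v, form_class \<phi> (Suc p) b) \<in> adjoint_rel (dbar_rel \<phi> (Suc p))"
    by (simp only: adjoint_dbar_rel_iff[OF c l(3) l(4)] h(4))
  moreover have "(form_class \<phi> p w, form_class \<phi> (Suc p) a) \<in> dbar_rel \<phi> p"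
    "(form_class \<phi> (Suc p) y, form_class \<phi> (Suc (Suc p)) v) \<in> dbar_rel \<phi> (Suc p)"
    using h(2,3) unfolding dbar_rel_def by blast+
  ultimately show "laplace_rel (dbar_rel \<phi> p) (dbar_rel \<phi> (Suc p)) (form_class \<phi> (Suc p) y) (form_class \<phi> (Suc p) u)"
    unfolding laplace_rel_def by blast
next
  assume "laplace_rel (dbar_rel \<phi> p) (dbar_rel \<phi> (Suc p)) (form_class \<phi> (Suc p) y) (form_class \<phi> (Suc p) u)"
  then obtain V W A B where h: "(form_class \<phi> (Suc p) y, W) \<in> adjoint_rel (dbar_rel \<phi> p)" "(W, A) \<in> dbar_rel \<phi> p"
    "(form_class \<phi> (Suc p) y, V) \<in> dbar_rel \<phi> (Suc p)" "(V, B) \<in> adjoint_rel (dbar_rel \<phi> (Suc p))"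
    "form_class \<phi> (Suc p) u = A + B"
    unfolding laplace_rel_def by blast
  obtain w a where wa: "W = form_class \<phi> p w" "A = form_class \<phi> (Suc p) a" "is_dbar \<phi> p w a"
    using h(2) unfolding dbar_rel_def by blast
  obtain v where v: "V = form_class \<phi> (Suc (Suc p)) v" "v \<in> L2_forms \<phi> (Suc (Suc p))"
    using h(3) is_dbarD(2) unfolding dbar_rel_def by blast
  have yv: "is_dbar \<phi> (Suc p) y v" by (rule dbar_rel_is_dbar[OF c y v(2) h(3)[unfolded v(1)]])
  note l = is_dbarD[OF wa(3)]
  have "B = form_class \<phi> (Suc p) u - A" using h(5) by simp
  then have "B $ J = 0" if "card J \<noteq> Suc p" for J using that by (simp add: wa(2) form_class_nth)
  then obtain b where b: "b \<in> L2_forms \<phi> (Suc p)" "form_class \<phi> (Suc p) b = B"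
    using form_class_surj[OF c, of "Suc p" B] by blast
  have 1: "is_dbar_adj \<phi> p y w" using h(1) unfolding wa(1) adjoint_dbar_rel_iff[OF c y l(1)] .
  have 2: "is_dbar_adj \<phi> (Suc p) v b"
    using h(4) unfolding v(1) b(2)[symmetric] adjoint_dbar_rel_iff[OF c v(2) b(1)] .
  have 3: "form_eq (Suc p) u (form_add a b)"
    using h(5) unfolding form_class_eq_iff[OF c u L2_forms_add[OF l(2) b(1) c], symmetric]
      form_class_add[OF c l(2) b(1)] by (simp add: wa(2) b(2))
  show "is_laplacian \<phi> (Suc p) y u"
    unfolding is_laplacian_def diff_Suc_1 using 1 wa(3) yv 2 3 by blast
qed

lemma is_dbar_adj_scale:
  fixes x :: "'n::{finite,linorder} form"
  assumes c: "continuous_on UNIV \<phi>" and x: "is_dbar_adj \<phi> p x w"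
  shows "is_dbar_adj \<phi> p (form_scale a x) (form_scale a w)"
proof -
  have e: "form_inner \<phi> q f (form_scale a g) = cnj a * form_inner \<phi> q f g" for q and f g :: "'n form"
  proof -
    have "f J z * cnj (a * g J z) * complex_of_real (exp (- \<phi> z)) = cnj a * (f J z * cnj (g J z) * complex_of_real (exp (- \<phi> z)))" for J z
      by simp
    then show ?thesis by (simp only: form_inner_def form_scale_def integral_mult_right_zero sum_distrib_left)
  qed
  have "x \<in> L2_forms \<phi> (Suc p)" "w \<in> L2_forms \<phi> p" using x by (simp_all add: is_dbar_adj_def)
  then show ?thesis
    unfolding is_dbar_adj_def e using L2_forms_scale[OF _ c] is_dbar_adjD[OF x] by simp
qed

text \<open>
  Complex multiples are taken of the representatives, because the space of classes is a real Hilbert space.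
\<close>

lemma is_laplacian_scale:
  fixes y u :: "'n::{finite,linorder} form"
  assumes c: "continuous_on UNIV \<phi>" and y: "is_laplacian \<phi> q y u"
  shows "is_laplacian \<phi> q (form_scale s y) (form_scale s u)"
proof -
  obtain v w a b where h: "is_dbar_adj \<phi> (q - 1) y w" "is_dbar \<phi> (q - 1) w a" "is_dbar \<phi> q y v"
    "is_dbar_adj \<phi> q v b" "form_eq q u (form_add a b)"
    using y unfolding is_laplacian_def by blast
  have "form_eq q (form_scale s u) (form_add (form_scale s a) (form_scale s b))"
    using h(5) unfolding form_eq_def
  proof (intro allI impI)
    fix J :: "'n set"
    assume "\<forall>J. card J = q \<longrightarrow> (AE z in lebesgue. u J z = form_add a b J z)" "card J = q"
    then have "AE z in lebesgue. u J z = form_add a b J z" by blast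
    then show "AE z in lebesgue. form_scale s u J z = form_add (form_scale s a) (form_scale s b) J z"
      by (rule AE_mp) (simp add: form_scale_def form_add_def distrib_left)
  qed
  then show ?thesis
    unfolding is_laplacian_def
    using is_dbar_adj_scale[OF c h(1)] is_dbar_scale[OF c h(2)] is_dbar_scale[OF c h(3)] is_dbar_adj_scale[OF c h(4)]
    by blast
qed

theorem proposition2p1:
  fixes \<phi> :: "complex ^ 'n::{finite,linorder} \<Rightarrow> real" and q :: nat
  assumes "\<And>z. 0 \<le> \<phi> z"
    and "Ck 2 \<phi>"
    and "plurisubharmonic \<phi>"
    and "1 \<le> q" and "q \<le> CARD('n)"
    and "Liminf at_infinity (\<lambda>z. ereal (sum_smallest_eigenvalues q (levi_matrix \<phi> z))) > 0"
  shows "\<exists>N. bounded_operator \<phi> q N \<and>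
             (\<forall>u\<in>L2_forms \<phi> q. is_laplacian \<phi> q (N u) u) \<and>
             (\<forall>N'. bounded_operator \<phi> q N' \<and> (\<forall>u\<in>L2_forms \<phi> q. is_laplacian \<phi> q (N' u) u)
                   \<longrightarrow> (\<forall>u\<in>L2_forms \<phi> q. form_eq q (N' u) (N u)))"
proof -
  have c: "continuous_on UNIV \<phi>" by (rule Ck_continuous[OF assms(2)])
  obtain p where q: "q = Suc p" using \<open>1 \<le> q\<close> by (cases q) auto
  obtain C where C: "0 \<le> C" "\<And>u. (\<forall>J. Ck 2 (u J) \<and> csupp (u J)) \<longrightarrow> (\<forall>J z. card J \<noteq> q \<longrightarrow> u J z = 0) \<longrightarrow>
      wnorm2 \<phi> u \<le> C * (wnorm2 \<phi> (dbar_form u) + wnorm2 \<phi> (dbar_adj_form \<phi> u))"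
    using basic_estimate[OF assms(1-3,5,6)] by blast
  define T where "T = dbar_rel \<phi> p"
  define S where "S = dbar_rel \<phi> q"
  have T: "subspace T" "closed T" unfolding T_def by (rule subspace_dbar_rel[OF c], rule closed_dbar_rel[OF c])
  have S: "subspace S" "closed S" unfolding S_def by (rule subspace_dbar_rel[OF c], rule closed_dbar_rel[OF c])
  have est: "(norm x)\<^sup>2 \<le> C * ((norm v)\<^sup>2 + (norm w)\<^sup>2)" if "(x, v) \<in> S" "(x, w) \<in> adjoint_rel T" for x v w
  proof (rule dbar_rel_estimate[OF assms(1,2) C(1) _ that[unfolded S_def T_def q]])
    fix u :: "'n form"
    assume "\<And>J. Ck 2 (u J)" "\<And>J. csupp (u J)" "\<And>J z. card J \<noteq> Suc p \<Longrightarrow> u J z = 0"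
    then show "wnorm2 \<phi> u \<le> C * (wnorm2 \<phi> (dbar_form u) + wnorm2 \<phi> (dbar_adj_form \<phi> u))"
      using C(2)[rule_format, of u] unfolding q by blast
  qed
  have compl: "(a, 0) \<in> S" if "(w, a) \<in> T" for w a
    using dbar_rel_complex that unfolding S_def T_def q by blast
  have iff: "is_laplacian \<phi> q y u \<longleftrightarrow> laplace_rel T S (form_class \<phi> q y) (form_class \<phi> q u)"
    if "y \<in> L2_forms \<phi> q" "u \<in> L2_forms \<phi> q" for y u
    using is_laplacian_iff[OF c] that unfolding T_def S_def q by blast
  have dom: "y \<in> L2_forms \<phi> q" if "is_laplacian \<phi> q y u" for y u
    using that is_dbarD(1) unfolding is_laplacian_def by blast
  have bound: "form_norm \<phi> q y \<le> C * form_norm \<phi> q u" if y: "is_laplacian \<phi> q y u" and u: "u \<in> L2_forms \<phi> q" for y u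
    using laplace_rel_bound[OF est C(1) iff[OF dom[OF y] u, THEN iffD1, OF y]]
    by (simp only: form_class_norm[OF c dom[OF y]] form_class_norm[OF c u])
  have unique_rel: "x = y" if "laplace_rel T S x u" "laplace_rel T S y u" for x y u
  proof -
    have "laplace_rel T S (x + - y) (u + - u)"
      by (intro laplace_rel_add[OF T(1) S(1)] laplace_rel_uminus[OF T(1) S(1)] that)
    from laplace_rel_bound[OF est C(1) this] show ?thesis by simp
  qed
  have unique: "form_eq q y y'"
    if "is_laplacian \<phi> q y u" "is_laplacian \<phi> q y' u'" "form_eq q u u'" "u \<in> L2_forms \<phi> q" "u' \<in> L2_forms \<phi> q" for y y' u u'
  proof -
    note d = dom[OF that(1)] dom[OF that(2)]
    have "form_class \<phi> q u = form_class \<phi> q u'" using that(3) form_class_eq_iff[OF c that(4,5)] by blast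
    then have "laplace_rel T S (form_class \<phi> q y) (form_class \<phi> q u)" "laplace_rel T S (form_class \<phi> q y') (form_class \<phi> q u)"
      using iff[OF d(1) that(4)] iff[OF d(2) that(5)] that(1,2) by auto
    then show ?thesis using unique_rel form_class_eq_iff[OF c d] by blast
  qed
  have exists: "\<exists>y. is_laplacian \<phi> q y u" if u: "u \<in> L2_forms \<phi> q" for u
  proof -
    have "\<exists>X. laplace_rel T S X (form_class \<phi> q u)"
      by (rule laplace_rel_solvable[OF T S _ _ C(1)]) (erule compl, erule (1) est)
    then obtain X where X: "laplace_rel T S X (form_class \<phi> q u)" ..
    then obtain V where "(X, V) \<in> S" unfolding laplace_rel_def by blast
    then obtain y where "X = form_class \<phi> q y" "y \<in> L2_forms \<phi> q"
      using is_dbarD(1) unfolding S_def dbar_rel_def by blast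
    then show ?thesis using X iff u by blast
  qed
  \<comment> \<open>the choice does not matter up to null sets, which makes \<open>N\<close> linear on classes\<close>
  define N where "N u = (SOME y. is_laplacian \<phi> q y u)" for u
  have N: "is_laplacian \<phi> q (N u) u" if "u \<in> L2_forms \<phi> q" for u
    unfolding N_def by (rule someI_ex[OF exists[OF that]])
  have refl: "form_eq q u u" for u by (simp add: form_eq_def)
  have bounded: "bounded_operator \<phi> q N"
    unfolding bounded_operator_def
  proof (intro conjI ballI allI impI)
    fix u assume u: "u \<in> L2_forms \<phi> q"
    show "N u \<in> L2_forms \<phi> q" by (rule dom[OF N[OF u]])
    show "form_eq q (N (form_scale s u)) (form_scale s (N u))" for s
      by (rule unique[OF N[OF L2_forms_scale[OF u c]] is_laplacian_scale[OF c N[OF u]] refl L2_forms_scale[OF u c] L2_forms_scale[OF u c]])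
    fix v assume v: "v \<in> L2_forms \<phi> q"
    show "form_eq q (N u) (N v)" if "form_eq q u v" by (rule unique[OF N[OF u] N[OF v] that u v])
    note d = dom[OF N[OF u]] dom[OF N[OF v]]
    have "laplace_rel T S (form_class \<phi> q (N u) + form_class \<phi> q (N v)) (form_class \<phi> q u + form_class \<phi> q v)"
      using N u v d iff by (intro laplace_rel_add[OF T(1) S(1)]) blast+
    then have "is_laplacian \<phi> q (form_add (N u) (N v)) (form_add u v)"
      unfolding iff[OF L2_forms_add[OF d c] L2_forms_add[OF u v c]] form_class_add[OF c d] form_class_add[OF c u v] .
    then show "form_eq q (N (form_add u v)) (form_add (N u) (N v))"
      by (rule unique[OF N[OF L2_forms_add[OF u v c]] _ refl L2_forms_add[OF u v c] L2_forms_add[OF u v c]])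
  next
    show "\<exists>C. \<forall>u\<in>L2_forms \<phi> q. form_norm \<phi> q (N u) \<le> C * form_norm \<phi> q u"
      using bound N by blast
  qed
  have "form_eq q (N' u) (N u)"
    if "\<forall>u\<in>L2_forms \<phi> q. is_laplacian \<phi> q (N' u) u" "u \<in> L2_forms \<phi> q" for N' u
    using unique[OF _ N refl] that by blast
  then show ?thesis using bounded N by blast
qed

end
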